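(* For the universal unfolding $(\mathscr X_k\to\mathscr S_k,F)$ of the log LG model mirror to a projective toric manifold $Y$, the hypercohomology $\mathcal H^F_k:=H(\Omega^\bullet_{\mathscr X_k^\dagger/\mathscr S_k^\dagger}[[u]],dF\wedge+u\partial)$ is a graded free $\mathscr R_k[[u]]$-module for each $k$.
   Context: **Toric setup.** $N\cong\mathbb Z^n$, $M=\mathrm{Hom}(N,\mathbb Z)$; $\Sigma\subset N\otimes\mathbb R$ is a smooth complete fan whose toric variety $Y$ is projective; $\rho_1,\dots,\rho_d\in N$ are the primitive ray generators, with $\rho_1,\dots,\rho_n$ a basis of $N$ spanning a maximal cone; $e^1,\dots,e^n\in M$ is the dual basis. $X\subset\mathbb C^d$ is the analytic space defined by the Stanley-Reisner ideal of $\Sigma$; $f=z_1+\dots+z_d$. **Basis.** Fix an ordering $\sigma_1,\dots,\sigma_\mu$ of the maximal cones such that, with $\tau_i$ the intersection of $\sigma_i$ with all $\sigma_j$, $j>i$, $\dim(\sigma_i\cap\sigma_j)=n-1$, one has $\tau_i\subset\sigma_j\Rightarrow i\le j$. For a cone $\tau$ generated by $\rho_{i_1},\dots,\rho_{i_k}$ put $P(\tau)=z_{i_1}\cdots z_{i_k}$. $\varphi_1,\dots,\varphi_\mu$ are the monomials $P(\tau_i)$ reindexed so that $\varphi_1=1$, $\varphi_2,\dots,\varphi_\nu$ have degree one and the others higher degree; $s=\mu-\nu+1$. **Unfolding.** $P=\overline{NE}(Y)$ is the monoid of effective curve classes, $P^{gp}=A_1(Y,\mathbb Z)=\ker(\mathbb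 Z^{d}\to N,\ t_{\rho_i}\mapsto\rho_i)$. Choose a splitting $\pi:\mathbb Z^d\to A_1(Y,\mathbb Z)$ and let $\varphi_\Sigma:N\to P^{gp}$ be the composition of $\pi$ with the $\Sigma$-piecewise linear map sending $\rho_i$ to $t_{\rho_i}$. $P_{\varphi_\Sigma}=\{(m,\varphi_\Sigma(m)+p):m\in N,p\in P\}$ is a monoid; $p\mapsto(0,p)$ gives a flat family $\mathrm{Spec}\,\mathbb C[P_{\varphi_\Sigma}]\to\mathrm{Spec}\,\mathbb C[P]$ with central fibre $X$; $z_i:=z^{(\rho_i,\varphi_\Sigma(\rho_i))}$. $\mathscr R=\mathbb C[P]\otimes\mathbb C[t_1,\dots,t_s]$, $\mathcal I$ its maximal ideal generated by $z^p$ ($p\in P\setminus0$) and the $t_i$, $\mathscr R_k=\mathscr R/\mathcal I^{k+1}$; $\mathscr X_k$ is the base change of the family to $\mathscr S_k=\mathrm{Spec}\,\mathscr R_k$ (an analytic thickening of $X$), with log structures given by $P_{\varphi_\Sigma}$ and $P$; $F=f+t_1+\sum_{i=2}^st_i\varphi_{\nu+i-1}$. The relative log forms $\Omega^1_{\mathscr X_k^\dagger/\mathscr S_k^\dagger}$ are free over $\mathcal O_{\mathscr X_k}$ with frame $d\log z_1,\dots,d\log z_n$, with $d\,z^{(m,p)}=z^{(m,p)}\sum_k\langle m,e^k\rangle d\log z_k$; $\partial$ is the relative holomorphic de Rham differential, $\Omega^\bullet=\wedge^\bullet\Omega^1$, and $dF=\partial F$. $u$ is a formal variable; hypercohomology is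 cohomology of global sections since $X$ is Stein. **Grading.** $z_i$ and $u$ have weight 2, $z^p$ ($p\in P$) has weight $2\sum_iD_i\cdot p$ ($D_i$ the toric divisors), the $t_i$ have the weights making $F$ homogeneous of weight 2, and a product of $j$ of the forms $d\log z_1,\dots,d\log z_n$ has weight $2(n-j)$; the differential $dF\wedge+u\partial$ preserves weights. "Graded free" means free with a basis of homogeneous elements. *)

theory Defs
  imports "HOL-Analysis.Analysis" "HOL-Library.Poly_Mapping"
    "HOL-Algebra.Module" "HOL-Algebra.QuotRing" "HOL-Algebra.Ideal_Product"
begin

section \<open>Toric data\<close>

text \<open>
  The lattice is \<open>N = int^'n\<close>, so \<open>n = CARD('n)\<close>, and \<open>N \<otimes> R = real^'n\<close>. Rays are numbered
  \<open>1, \<dots>, d\<close>; \<open>Z^d\<close> is realised as the finitely supported functions with support in \<open>{1..d}\<close>.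
\<close>

record ('n::finite) lg_data =
  fan :: "(real^'n) set set"
  nrays :: nat  \<comment> \<open>\<open>d\<close>\<close>
  ray :: "nat \<Rightarrow> int^'n"  \<comment> \<open>\<open>\<rho>\<^sub>1, \<dots>, \<rho>\<^sub>d\<close>\<close>
  dualvec :: "nat \<Rightarrow> int^'n \<Rightarrow> int"  \<comment> \<open>\<open>e\<^sup>1, \<dots>, e\<^sup>n\<close> in \<open>M = Hom(N, Z)\<close>\<close>
  cone_seq :: "nat \<Rightarrow> (real^'n) set"  \<comment> \<open>\<open>\<sigma>\<^sub>1, \<dots>, \<sigma>\<^sub>\<mu>\<close>\<close>
  reindex :: "nat \<Rightarrow> nat"  \<comment> \<open>\<open>\<phi>\<^sub>i = P(\<tau>\<^sub>j)\<close> for \<open>j = reindex i\<close>\<close>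
  nu :: nat
  splitting :: "(nat \<Rightarrow>\<^sub>0 int) \<Rightarrow> (nat \<Rightarrow>\<^sub>0 int)"  \<comment> \<open>\<open>\<pi>\<close>\<close>

definition rvec :: "int^'n \<Rightarrow> real^'n" where
  "rvec m = (\<chi> i. of_int (m $ i))"

definition gen_cone :: "(int^'n) set \<Rightarrow> (real^'n) set" where
  "gen_cone A = convex_cone hull (rvec ` A)"

definition lattice_basis :: "(int^'n) set \<Rightarrow> bool" where
  "lattice_basis B \<longleftrightarrow> finite B \<and>
     (\<forall>m. \<exists>!c. (\<forall>v. v \<notin> B \<longrightarrow> c v = 0) \<and> m = (\<Sum>v\<in>B. c v *s v))"

definition is_fan :: "(real^'n) set set \<Rightarrow> bool" where
  "is_fan \<Sigma> \<longleftrightarrow> finite \<Sigma> \<and> \<Sigma> \<noteq> {} \<and>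
     (\<forall>\<sigma>\<in>\<Sigma>. (\<exists>A. finite A \<and> \<sigma> = gen_cone A) \<and> \<sigma> \<inter> uminus ` \<sigma> = {0}) \<and>
     (\<forall>\<sigma>\<in>\<Sigma>. \<forall>\<tau>. \<tau> face_of \<sigma> \<and> \<tau> \<noteq> {} \<longrightarrow> \<tau> \<in> \<Sigma>) \<and>
     (\<forall>\<sigma>\<in>\<Sigma>. \<forall>\<sigma>'\<in>\<Sigma>. (\<sigma> \<inter> \<sigma>') face_of \<sigma> \<and> (\<sigma> \<inter> \<sigma>') face_of \<sigma>')"

definition smooth_fan :: "(real^'n) set set \<Rightarrow> bool" where
  "smooth_fan \<Sigma> \<longleftrightarrow> is_fan \<Sigma> \<and>
     (\<forall>\<sigma>\<in>\<Sigma>. \<exists>B A. lattice_basis B \<and> A \<subseteq> B \<and> \<sigma> = gen_cone A)"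

definition complete_fan :: "(real^'n) set set \<Rightarrow> bool" where
  "complete_fan \<Sigma> \<longleftrightarrow> \<Union>\<Sigma> = UNIV"

definition max_cones :: "(real^'n) set set \<Rightarrow> (real^'n) set set" where
  "max_cones \<Sigma> = {\<sigma>\<in>\<Sigma>. \<forall>\<sigma>'\<in>\<Sigma>. \<sigma> \<subseteq> \<sigma>' \<longrightarrow> \<sigma>' = \<sigma>}"

definition primitive :: "int^'n \<Rightarrow> bool" where
  "primitive v \<longleftrightarrow> (\<forall>c m. v = c *s m \<longrightarrow> \<bar>c\<bar> = 1)"

definition ray_generators :: "('n::finite) lg_data \<Rightarrow> bool" where
  "ray_generators G \<longleftrightarrow> inj_on (ray G) {1..nrays G} \<and>
     (\<forall>i\<in>{1..nrays G}. primitive (ray G i)) \<and>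
     (\<lambda>i. gen_cone {ray G i}) ` {1..nrays G} = {\<sigma>\<in>fan G. dim \<sigma> = 1}"

definition gens :: "('n::finite) lg_data \<Rightarrow> (real^'n) set \<Rightarrow> nat set" where
  "gens G \<sigma> = {i\<in>{1..nrays G}. rvec (ray G i) \<in> \<sigma>}"

definition first_rays_basis :: "('n::finite) lg_data \<Rightarrow> bool" where
  "first_rays_basis G \<longleftrightarrow> CARD('n) \<le> nrays G \<and> lattice_basis (ray G ` {1..CARD('n)}) \<and>
     gen_cone (ray G ` {1..CARD('n)}) \<in> max_cones (fan G)"

definition dual_basis :: "('n::finite) lg_data \<Rightarrow> bool" where
  "dual_basis G \<longleftrightarrow> (\<forall>k\<in>{1..CARD('n)}. Modules.additive (dualvec G k) \<and>
     (\<forall>l\<in>{1..CARD('n)}. dualvec G k (ray G l) = (if k = l then 1 else 0)))"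

text \<open>
  \<open>Y\<close> is projective iff it carries an ample divisor, which may be taken torus invariant. The divisor
  \<open>\<Sum> a\<^sub>i D\<^sub>i\<close> is ample iff its support function, given on the maximal cone \<open>\<sigma>\<close> by a linear form
  \<open>h\<close> with \<open>h(\<rho>\<^sub>i) = - a\<^sub>i\<close> for \<open>\<rho>\<^sub>i\<close> in \<open>\<sigma>\<close>, is strictly convex, i.e. \<open>h(\<rho>\<^sub>i) > - a\<^sub>i\<close> for the other rays.
\<close>

definition ample :: "('n::finite) lg_data \<Rightarrow> (nat \<Rightarrow> int) \<Rightarrow> bool" where
  "ample G a \<longleftrightarrow> (\<forall>\<sigma>\<in>max_cones (fan G). \<exists>h. Modules.additive h \<and>
     (\<forall>i\<in>gens G \<sigma>. h (ray G i) = - a i) \<and>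
     (\<forall>i\<in>{1..nrays G} - gens G \<sigma>. h (ray G i) > - a i))"

definition projective_fan :: "('n::finite) lg_data \<Rightarrow> bool" where
  "projective_fan G \<longleftrightarrow> (\<exists>a. ample G a)"


section \<open>The monomial basis\<close>

definition mu :: "('n::finite) lg_data \<Rightarrow> nat" where
  "mu G = card (max_cones (fan G))"

definition tau :: "('n::finite) lg_data \<Rightarrow> nat \<Rightarrow> (real^'n) set" where
  "tau G i = cone_seq G i \<inter>
     \<Inter>{cone_seq G j | j. i < j \<and> j \<le> mu G \<and> dim (cone_seq G i \<inter> cone_seq G j) = CARD('n) - 1}"

definition cone_ordering :: "('n::finite) lg_data \<Rightarrow> bool" where
  "cone_ordering G \<longleftrightarrow> bij_betw (cone_seq G) {1..mu G} (max_cones (fan G)) \<and>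
     (\<forall>i\<in>{1..mu G}. \<forall>j\<in>{1..mu G}. tau G i \<subseteq> cone_seq G j \<longrightarrow> i \<le> j)"

text \<open>\<open>\<phi>\<^sub>i\<close> is the product of the \<open>z\<^sub>l\<close> with \<open>l \<in> phi_gens G i\<close>.\<close>

definition phi_gens :: "('n::finite) lg_data \<Rightarrow> nat \<Rightarrow> nat set" where
  "phi_gens G i = gens G (tau G (reindex G i))"

definition monomial_numbering :: "('n::finite) lg_data \<Rightarrow> bool" where
  "monomial_numbering G \<longleftrightarrow> bij_betw (reindex G) {1..mu G} {1..mu G} \<and>
     1 \<le> nu G \<and> nu G \<le> mu G \<and> phi_gens G 1 = {} \<and>
     (\<forall>i\<in>{2..nu G}. card (phi_gens G i) = 1) \<and>
     (\<forall>i\<in>{nu G<..mu G}. card (phi_gens G i) > 1)"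

definition sdim :: "('n::finite) lg_data \<Rightarrow> nat" where
  "sdim G = mu G - nu G + 1"


section \<open>Curve classes and the monoid of the family\<close>

definition Zd :: "('n::finite) lg_data \<Rightarrow> (nat \<Rightarrow>\<^sub>0 int) set" where
  "Zd G = {a. Poly_Mapping.keys a \<subseteq> {1..nrays G}}"

definition ray_map :: "('n::finite) lg_data \<Rightarrow> (nat \<Rightarrow>\<^sub>0 int) \<Rightarrow> int^'n" where
  "ray_map G a = (\<Sum>i\<in>{1..nrays G}. Poly_Mapping.lookup a i *s ray G i)"

definition A1 :: "('n::finite) lg_data \<Rightarrow> (nat \<Rightarrow>\<^sub>0 int) set" where
  "A1 G = {a\<in>Zd G. ray_map G a = 0}"

text \<open>
  Classes of the torus invariant curves \<open>C\<close>, one for each wall \<open>\<sigma> \<inter> \<sigma>'\<close>. The \<open>i\<close>-th coordinate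
  of a class is \<open>D\<^sub>i \<cdot> C\<close>; this is 1 for the two rays off the wall, 0 for rays outside
  \<open>\<sigma> \<union> \<sigma>'\<close>, and the other values are determined by the relation defining \<open>A\<^sub>1\<close>.
\<close>

definition invariant_curves :: "('n::finite) lg_data \<Rightarrow> (nat \<Rightarrow>\<^sub>0 int) set" where
  "invariant_curves G = {a\<in>A1 G. \<exists>\<sigma>\<in>max_cones (fan G). \<exists>\<sigma>'\<in>max_cones (fan G).
     \<sigma> \<noteq> \<sigma>' \<and> dim (\<sigma> \<inter> \<sigma>') = CARD('n) - 1 \<and> Poly_Mapping.keys a \<subseteq> gens G \<sigma> \<union> gens G \<sigma>' \<and>
     (\<forall>i\<in>(gens G \<sigma> - gens G \<sigma>') \<union> (gens G \<sigma>' - gens G \<sigma>). Poly_Mapping.lookup a i = 1)}"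

text \<open>
  The monoid \<open>P\<close>: integral classes in the Mori cone, which for a complete toric variety is spanned by
  the torus invariant curves. For smooth projective \<open>Y\<close> every such class is the class of an effective
  cycle with integral coefficients (Casagrande, Contractible classes in toric varieties).
\<close>

definition NE :: "('n::finite) lg_data \<Rightarrow> (nat \<Rightarrow>\<^sub>0 int) set" where
  "NE G = {a\<in>A1 G. \<exists>c. (\<forall>C\<in>invariant_curves G. 0 \<le> c C) \<and>
     (\<forall>i. real_of_int (Poly_Mapping.lookup a i) = (\<Sum>C\<in>invariant_curves G. c C * real_of_int (Poly_Mapping.lookup C i)))}"

definition is_splitting :: "('n::finite) lg_data \<Rightarrow> bool" where
  "is_splitting G \<longleftrightarrow>
     (\<forall>a\<in>Zd G. splitting G a \<in> A1 G) \<and>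
     (\<forall>a\<in>Zd G. \<forall>b\<in>Zd G. splitting G (a + b) = splitting G a + splitting G b) \<and>
     (\<forall>a\<in>A1 G. splitting G a = a)"

text \<open>The piecewise linear map \<open>N \<rightarrow> Z^d\<close> with \<open>\<rho>\<^sub>i \<mapsto> t\<^bsub>\<rho>\<^sub>i\<^esub>\<close>.\<close>

definition pl_lift :: "('n::finite) lg_data \<Rightarrow> int^'n \<Rightarrow> (nat \<Rightarrow>\<^sub>0 int)" where
  "pl_lift G m = (THE a. (\<exists>\<sigma>\<in>fan G. Poly_Mapping.keys a \<subseteq> gens G \<sigma>) \<and> (\<forall>i. 0 \<le> Poly_Mapping.lookup a i) \<and> ray_map G a = m)"

definition phi_fan :: "('n::finite) lg_data \<Rightarrow> int^'n \<Rightarrow> (nat \<Rightarrow>\<^sub>0 int)" where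
  "phi_fan G m = splitting G (pl_lift G m)"

text \<open>\<open>(m, p, a)\<close> stands for the monomial \<open>z\<^bsup>(m,p)\<^esup> t\<^bsup>a\<^esup>\<close>.\<close>

type_synonym 'n expo = "(int^'n) \<times> (nat \<Rightarrow>\<^sub>0 int) \<times> (nat \<Rightarrow>\<^sub>0 nat)"

definition P_phi :: "('n::finite) lg_data \<Rightarrow> ((int^'n) \<times> (nat \<Rightarrow>\<^sub>0 int)) set" where
  "P_phi G = {(m, phi_fan G m + p) | m p. p \<in> NE G}"

definition t_expos :: "('n::finite) lg_data \<Rightarrow> (nat \<Rightarrow>\<^sub>0 nat) set" where
  "t_expos G = {a. Poly_Mapping.keys a \<subseteq> {1..sdim G}}"

definition family_monoid :: "('n::finite) lg_data \<Rightarrow> 'n expo set" where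
  "family_monoid G = {(m, q, a). (m, q) \<in> P_phi G \<and> a \<in> t_expos G}"

definition base_monoid :: "('n::finite) lg_data \<Rightarrow> 'n expo set" where
  "base_monoid G = {(0, p, a) | p a. p \<in> NE G \<and> a \<in> t_expos G}"


section \<open>The family and its base change\<close>

definition zmon :: "'n expo \<Rightarrow> 'n expo \<Rightarrow> complex" where
  "zmon x = (\<lambda>y. if y = x then 1 else 0)"

text \<open>The points of the analytic space of \<open>Spec C[Q]\<close> are the monoid homomorphisms \<open>Q \<rightarrow> (C, \<cdot>)\<close>.\<close>

definition points :: "'n expo set \<Rightarrow> ('n::finite expo \<Rightarrow> complex) set" where
  "points Q = {\<xi>. \<xi> 0 = 1 \<and> (\<forall>x\<in>Q. \<forall>y\<in>Q. \<xi> (x + y) = \<xi> x * \<xi> y)}"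

text \<open>
  Global analytic functions on \<open>(Spec C[P\<^sub>\<phi>])\<^bsup>an\<^esup> \<times> C^s\<close>: series in the monomials of \<open>family_monoid\<close> that
  converge absolutely at every point. The sum in \<open>mult\<close> is finite, since that monoid is finitely
  generated and has no invertible elements besides 0.
\<close>

definition total_ring :: "('n::finite) lg_data \<Rightarrow> ('n expo \<Rightarrow> complex) ring" where
  "total_ring G =
     \<lparr>carrier = {c. (\<forall>x. x \<notin> family_monoid G \<longrightarrow> c x = 0) \<and>
                   (\<forall>\<xi>\<in>points (family_monoid G). (\<lambda>x. norm (c x * \<xi> x)) summable_on family_monoid G)},
      mult = (\<lambda>c d x. \<Sum>(y, z)\<in>{(y, z). y \<in> family_monoid G \<and> z \<in> family_monoid G \<and> y + z = x}. c y * d z),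
      one = zmon 0,
      zero = (\<lambda>x. 0),
      add = (\<lambda>c d x. c x + d x)\<rparr>"

text \<open>\<open>C[P] \<otimes> C[t\<^sub>1, \<dots>, t\<^sub>s]\<close>, as a subring of \<open>total_ring\<close>.\<close>

definition base_ring :: "('n::finite) lg_data \<Rightarrow> ('n expo \<Rightarrow> complex) ring" where
  "base_ring G = (total_ring G)
     \<lparr>carrier := {c. finite {x. c x \<noteq> 0} \<and> {x. c x \<noteq> 0} \<subseteq> base_monoid G}\<rparr>"

definition texp :: "nat \<Rightarrow> 'n::finite expo" where
  "texp i = (0, 0, Poly_Mapping.single i 1)"

definition max_ideal :: "('n::finite) lg_data \<Rightarrow> ('n expo \<Rightarrow> complex) set" where
  "max_ideal G = Idl\<^bsub>base_ring G\<^esub>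
     ({zmon (0, p, 0) | p. p \<in> NE G - {0}} \<union> {zmon (texp i) | i. i \<in> {1..sdim G}})"

definition ideal_k :: "('n::finite) lg_data \<Rightarrow> nat \<Rightarrow> ('n expo \<Rightarrow> complex) set" where
  "ideal_k G k = max_ideal G [^]\<^bsub>ideals_set (base_ring G)\<^esub> Suc k"

definition base_k :: "('n::finite) lg_data \<Rightarrow> nat \<Rightarrow> ('n expo \<Rightarrow> complex) set ring" where
  "base_k G k = base_ring G Quot ideal_k G k"

text \<open>
  \<open>\<X>\<^sub>k\<close> is the closed analytic subspace of the total space defined by \<open>\<I>\<^bsup>k+1\<^esup>\<close>; as the total
  space is Stein, the global sections of its structure sheaf form the following quotient.
\<close>

definition extended_ideal_k :: "('n::finite) lg_data \<Rightarrow> nat \<Rightarrow> ('n expo \<Rightarrow> complex) set" where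
  "extended_ideal_k G k = Idl\<^bsub>total_ring G\<^esub> (ideal_k G k)"

definition fun_k :: "('n::finite) lg_data \<Rightarrow> nat \<Rightarrow> ('n expo \<Rightarrow> complex) set ring" where
  "fun_k G k = total_ring G Quot extended_ideal_k G k"

definition base_to_fun ::
    "('n::finite) lg_data \<Rightarrow> nat \<Rightarrow> ('n expo \<Rightarrow> complex) set \<Rightarrow> ('n expo \<Rightarrow> complex) set" where
  "base_to_fun G k A = (\<Union>a\<in>A. extended_ideal_k G k +>\<^bsub>total_ring G\<^esub> a)"

text \<open>The derivation \<open>\<partial>\<^sub>i\<close> with \<open>\<partial>g = \<Sum>\<^sub>i \<partial>\<^sub>i g d log z\<^sub>i\<close>, on \<open>total_ring\<close> and induced on the quotient.\<close>

definition log_deriv ::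
    "('n::finite) lg_data \<Rightarrow> nat \<Rightarrow> ('n expo \<Rightarrow> complex) \<Rightarrow> ('n expo \<Rightarrow> complex)" where
  "log_deriv G i c = (\<lambda>(m, q, a). of_int (dualvec G i m) * c (m, q, a))"

definition log_deriv_k ::
    "('n::finite) lg_data \<Rightarrow> nat \<Rightarrow> nat \<Rightarrow> ('n expo \<Rightarrow> complex) set \<Rightarrow> ('n expo \<Rightarrow> complex) set" where
  "log_deriv_k G k i A = (\<Union>c\<in>A. extended_ideal_k G k +>\<^bsub>total_ring G\<^esub> log_deriv G i c)"


section \<open>The unfolding\<close>

definition zexp :: "('n::finite) lg_data \<Rightarrow> nat \<Rightarrow> 'n expo" where
  "zexp G i = (ray G i, phi_fan G (ray G i), 0)"

definition phi_exp :: "('n::finite) lg_data \<Rightarrow> nat \<Rightarrow> 'n expo" where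
  "phi_exp G i = (\<Sum>l\<in>phi_gens G i. zexp G l)"

definition unfolding_F :: "('n::finite) lg_data \<Rightarrow> 'n expo \<Rightarrow> complex" where
  "unfolding_F G = (\<lambda>x. (\<Sum>i\<in>{1..nrays G}. zmon (zexp G i) x) + zmon (texp 1) x +
     (\<Sum>i\<in>{2..sdim G}. zmon (texp i + phi_exp G (nu G + i - 1)) x))"

definition F_k :: "('n::finite) lg_data \<Rightarrow> nat \<Rightarrow> ('n expo \<Rightarrow> complex) set" where
  "F_k G k = extended_ideal_k G k +>\<^bsub>total_ring G\<^esub> unfolding_F G"


section \<open>The twisted de Rham complex\<close>

definition power_series_ring :: "('a, 'm) ring_scheme \<Rightarrow> (nat \<Rightarrow> 'a) ring" where
  "power_series_ring R =
     \<lparr>carrier = UNIV \<rightarrow> carrier R,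
      mult = (\<lambda>f g j. \<Oplus>\<^bsub>R\<^esub>i\<in>{..j}. f i \<otimes>\<^bsub>R\<^esub> g (j - i)),
      one = (\<lambda>j. if j = 0 then \<one>\<^bsub>R\<^esub> else \<zero>\<^bsub>R\<^esub>),
      zero = (\<lambda>j. \<zero>\<^bsub>R\<^esub>),
      add = (\<lambda>f g j. f j \<oplus>\<^bsub>R\<^esub> g j)\<rparr>"

abbreviation base_k_u :: "('n::finite) lg_data \<Rightarrow> nat \<Rightarrow> (nat \<Rightarrow> ('n expo \<Rightarrow> complex) set) ring" where
  "base_k_u G k \<equiv> power_series_ring (base_k G k)"

text \<open>
  An element \<open>\<omega>\<close> of the total complex \<open>\<Omega>\<^sup>\<bullet>[[u]]\<close> (sum over all form degrees) is given by its
  coefficients: \<open>\<omega> j K\<close> is the coefficient of \<open>u\<^bsup>j\<^esup> d log z\<^sub>K\<close>, where for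
  \<open>K = {k\<^sub>1 < \<dots> < k\<^sub>p} \<subseteq> {1..n}\<close> we put \<open>d log z\<^sub>K = d log z\<^bsub>k\<^sub>1\<^esub> \<and> \<dots> \<and> d log z\<^bsub>k\<^sub>p\<^esub>\<close>.
  The fields \<open>mult\<close> and \<open>one\<close> of a module record are irrelevant.
\<close>

type_synonym 'n form = "nat \<Rightarrow> nat set \<Rightarrow> ('n expo \<Rightarrow> complex) set"

definition forms ::
    "('n::finite) lg_data \<Rightarrow> nat \<Rightarrow> (nat \<Rightarrow> ('n expo \<Rightarrow> complex) set, 'n form) module" where
  "forms G k =
     \<lparr>carrier = UNIV \<rightarrow> (Pow {1..CARD('n)} \<rightarrow>\<^sub>E carrier (fun_k G k)),
      mult = undefined,
      one = undefined,
      zero = (\<lambda>j. \<lambda>K\<in>Pow {1..CARD('n)}. \<zero>\<^bsub>fun_k G k\<^esub>),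
      add = (\<lambda>\<omega> \<eta> j. \<lambda>K\<in>Pow {1..CARD('n)}. \<omega> j K \<oplus>\<^bsub>fun_k G k\<^esub> \<eta> j K),
      smult = (\<lambda>c \<omega> j. \<lambda>K\<in>Pow {1..CARD('n)}.
        \<Oplus>\<^bsub>fun_k G k\<^esub>i\<in>{..j}. base_to_fun G k (c i) \<otimes>\<^bsub>fun_k G k\<^esub> \<omega> (j - i) K)\<rparr>"

text \<open>
  \<open>dF\<and> + u\<partial>\<close>. The sign comes from
  \<open>d log z\<^sub>i \<and> d log z\<^bsub>K-{i}\<^esub> = (-1)\<^bsup>card {l \<in> K. l < i}\<^esup> d log z\<^sub>K\<close> for \<open>i\<close> in \<open>K\<close>.
\<close>

definition twisted_d :: "('n::finite) lg_data \<Rightarrow> nat \<Rightarrow> 'n form \<Rightarrow> 'n form" where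
  "twisted_d G k \<omega> = (\<lambda>j. \<lambda>K\<in>Pow {1..CARD('n)}. \<Oplus>\<^bsub>fun_k G k\<^esub>i\<in>K.
     (let b = (log_deriv_k G k i (F_k G k) \<otimes>\<^bsub>fun_k G k\<^esub> \<omega> j (K - {i})) \<oplus>\<^bsub>fun_k G k\<^esub>
              (if j = 0 then \<zero>\<^bsub>fun_k G k\<^esub> else log_deriv_k G k i (\<omega> (j - 1) (K - {i})))
      in if even (card {l\<in>K. l < i}) then b else \<ominus>\<^bsub>fun_k G k\<^esub> b))"

definition cohomology :: "('r, 'a, 'm) module_scheme \<Rightarrow> ('a \<Rightarrow> 'a) \<Rightarrow> ('r, 'a set) module" where
  "cohomology M D = (let Z = {x\<in>carrier M. D x = \<zero>\<^bsub>M\<^esub>}; B = D ` carrier M in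
     \<lparr>carrier = {B +>\<^bsub>M\<^esub> x | x. x \<in> Z},
      mult = undefined,
      one = undefined,
      zero = B,
      add = set_add M,
      smult = (\<lambda>c A. \<Union>x\<in>A. B +>\<^bsub>M\<^esub> (c \<odot>\<^bsub>M\<^esub> x))\<rparr>)"

definition hypercohomology ::
    "('n::finite) lg_data \<Rightarrow> nat \<Rightarrow> (nat \<Rightarrow> ('n expo \<Rightarrow> complex) set, 'n form set) module" where
  "hypercohomology G k = cohomology (forms G k) (twisted_d G k)"


section \<open>The grading\<close>

definition t_weight :: "('n::finite) lg_data \<Rightarrow> nat \<Rightarrow> int" where
  "t_weight G i = (if i = 1 then 2 else 2 - 2 * int (card (phi_gens G (nu G + i - 1))))"

text \<open>
  For \<open>(m, q)\<close> in \<open>P\<^sub>\<phi>\<close> with \<open>q = \<phi>(m) + p\<close> the monomial \<open>z\<^bsup>(m,q)\<^esup>\<close> is \<open>z\<^bsup>p\<^esup>\<close> times the product of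
  the \<open>z\<^sub>i\<close> to the power \<open>pl_lift G m\<close>.
\<close>

definition expo_weight :: "('n::finite) lg_data \<Rightarrow> 'n expo \<Rightarrow> int" where
  "expo_weight G = (\<lambda>(m, q, a).
     2 * (\<Sum>i\<in>{1..nrays G}. Poly_Mapping.lookup (pl_lift G m) i) +
     2 * (\<Sum>i\<in>{1..nrays G}. Poly_Mapping.lookup (q - phi_fan G m) i) +
     (\<Sum>i\<in>{1..sdim G}. int (Poly_Mapping.lookup a i) * t_weight G i))"

definition homogeneous_form :: "('n::finite) lg_data \<Rightarrow> int \<Rightarrow> 'n form \<Rightarrow> bool" where
  "homogeneous_form G w \<omega> \<longleftrightarrow> (\<forall>j. \<forall>K\<subseteq>{1..CARD('n)}. \<exists>c\<in>\<omega> j K. \<forall>x. c x \<noteq> 0 \<longrightarrow>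
     expo_weight G x + 2 * int j + 2 * (int CARD('n) - int (card K)) = w)"

definition homogeneous_classes :: "('n::finite) lg_data \<Rightarrow> nat \<Rightarrow> 'n form set set" where
  "homogeneous_classes G k =
     {A\<in>carrier (hypercohomology G k). \<exists>w. \<exists>\<omega>\<in>A. homogeneous_form G w \<omega>}"


section \<open>Graded free modules\<close>

definition module_basis :: "('r, 'q) ring_scheme \<Rightarrow> ('r, 'a, 'm) module_scheme \<Rightarrow> 'a set \<Rightarrow> bool" where
  "module_basis R M B \<longleftrightarrow> B \<subseteq> carrier M \<and>
     (\<forall>x\<in>carrier M. \<exists>!c. c \<in> B \<rightarrow>\<^sub>E carrier R \<and> finite {b\<in>B. c b \<noteq> \<zero>\<^bsub>R\<^esub>} \<and>
        x = (\<Oplus>\<^bsub>M\<^esub>b\<in>{b\<in>B. c b \<noteq> \<zero>\<^bsub>R\<^esub>}. c b \<odot>\<^bsub>M\<^esub> b))"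

definition graded_free ::
    "('r, 'q) ring_scheme \<Rightarrow> ('r, 'a, 'm) module_scheme \<Rightarrow> 'a set \<Rightarrow> bool" where
  "graded_free R M Hom \<longleftrightarrow> Module.module R M \<and> (\<exists>B\<subseteq>Hom. module_basis R M B)"

end

theory Submission
  imports Defs "HOL-Algebra.Subrings"
begin

text \<open>
  Work in the monomials \<open>x = (m, q, a)\<close> of the family. Each \<open>m\<close> is assigned to the least \<open>i\<close> such that
  the piecewise linear lift of \<open>m\<close> is supported on \<open>\<sigma>\<^sub>i\<close>; by the shelling condition the monomials over a
  fixed base exponent with index \<open>i\<close> are \<open>P(\<tau>\<^sub>i)\<close> times the monomials in the \<open>n\<close> variables of \<open>\<sigma>\<^sub>i\<close>.
  Multiplying such a block by a variable outside \<open>\<sigma>\<^sub>i\<close> either raises \<open>i\<close> or produces a nonzero effective curve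
  class (a wall crossing changes the lift by a positive multiple of an invariant curve), hence raises the
  ample degree of the base part. So for the order by base degree and then index, the leading part of
  \<open>dF \<and>\<close> on each block is the Koszul differential of \<open>n\<close> independent linear forms, whose homology is
  spanned by \<open>P(\<tau>\<^sub>i)\<close> in top degree; an explicit contracting homotopy preserves convergence. Modulo
  \<open>\<I>\<^bsup>k+1\<^esup>\<close> the order takes finitely many values, so filtering by the power of \<open>u\<close> and this order shows that
  the classes of \<open>P(\<tau>\<^sub>i) dlog z\<^sub>1 \<and> \<dots> \<and> dlog z\<^sub>n\<close> form a basis.
\<close>

section \<open>Smooth cones and piecewise linear lifts\<close>

text \<open>The obstacle is convergence: a single level contains infinitely many monomials, and a
  primitive found on it must again be a convergent series. Convergence is therefore recorded by
  bounds on |c x| R^(H x) for every R, which survive convolution, restriction of supports and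
  division by a monomial. The homotopy multiplies by \<alpha> + 1, as a derivative does, but the
  Euler eigenvalue by which it is divided is at least as large. Only finitely many base exponents
  survive modulo the ideal, so the levels met by a fixed power of u are bounded, and the infinitely
  many corrections are a finite sum in each coefficient. Independence comes from the same
  filtration: a primitive can be pushed to any level without changing its differential, whereas the
  leading part of a differential vanishes at exponents without excess. Projectivity enters through
  one ample weight that is positive on every ray and on every invariant curve.\<close>

lemma rvec_add [simp]: "rvec (a + b) = rvec a + rvec b"
  by (simp add: rvec_def vec_eq_iff)

lemma rvec_0 [simp]: "rvec 0 = 0"
  by (simp add: rvec_def vec_eq_iff)

lemma rvec_smult [simp]: "rvec (c *s v) = of_int c *\<^sub>R rvec v"
  by (simp add: rvec_def vec_eq_iff)

lemma rvec_sum: "rvec (\<Sum>i\<in>I. f i) = (\<Sum>i\<in>I. rvec (f i))"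
  by (induction I rule: infinite_finite_induct) auto

lemma rvec_inject [simp]: "rvec a = rvec b \<longleftrightarrow> a = b"
  by (simp add: rvec_def vec_eq_iff)

lemma inj_rvec: "inj_on rvec A"
  by (simp add: inj_on_def)

lemma rvec_axis: "rvec (axis i 1) = axis i 1"
  by (simp add: rvec_def vec_eq_iff axis_def)

section \<open>Coordinates in a lattice basis and the cones they describe\<close>

definition icoord :: "(int^'n) set \<Rightarrow> int^'n \<Rightarrow> int^'n \<Rightarrow> int" where
  "icoord B m = (THE c. (\<forall>v. v \<notin> B \<longrightarrow> c v = 0) \<and> m = (\<Sum>v\<in>B. c v *s v))"

text \<open>Extended linearly from the standard axes, so that linearity is immediate;
  \<open>rcoord_rvec\<close> then shows agreement with \<open>icoord\<close> on lattice
  vectors.\<close>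

definition rcoord :: "(int^'n) set \<Rightarrow> int^'n \<Rightarrow> real^'n \<Rightarrow> real" where
  "rcoord B w x = (\<Sum>i\<in>UNIV. x $ i * of_int (icoord B (axis i 1) w))"

context
  fixes B :: "(int^'n) set"
  assumes B: "lattice_basis B"
begin

lemma icoord_prop: "(\<forall>v. v \<notin> B \<longrightarrow> icoord B m v = 0) \<and> m = (\<Sum>v\<in>B. icoord B m v *s v)"
proof -
  have "\<exists>!c. (\<forall>v. v \<notin> B \<longrightarrow> c v = 0) \<and> m = (\<Sum>v\<in>B. c v *s v)"
    using B unfolding lattice_basis_def by blast
  from theI'[OF this] show ?thesis unfolding icoord_def by blast
qed

lemma icoord_sum: "(\<Sum>v\<in>B. icoord B m v *s v) = m"
  using icoord_prop by metis

lemma icoord_out: "v \<notin> B \<Longrightarrow> icoord B m v = 0"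
  using icoord_prop by metis

lemma icoord_unique:
  assumes "\<And>v. v \<notin> B \<Longrightarrow> c v = 0" "m = (\<Sum>v\<in>B. c v *s v)"
  shows "icoord B m = c"
proof -
  have "\<exists>!c. (\<forall>v. v \<notin> B \<longrightarrow> c v = 0) \<and> m = (\<Sum>v\<in>B. c v *s v)"
    using B by (auto simp: lattice_basis_def)
  then show ?thesis using icoord_prop[of m] assms by blast
qed

lemma finite_basis: "finite B"
  using B by (simp add: lattice_basis_def)

lemma icoord_add: "icoord B (a + b) v = icoord B a v + icoord B b v"
proof -
  have "icoord B (a + b) = (\<lambda>v. icoord B a v + icoord B b v)"
    by (rule icoord_unique)
      (auto simp: icoord_out vector_sadd_rdistrib sum.distrib icoord_sum)
  then show ?thesis by simp
qed

lemma icoord_smult: "icoord B (k *s b) v = k * icoord B b v"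
proof -
  have "icoord B (k *s b) = (\<lambda>v. k * icoord B b v)"
  proof (rule icoord_unique)
    have "(\<Sum>v\<in>B. (k * icoord B b v) *s v) = (\<Sum>v\<in>B. k *s (icoord B b v *s v))"
      by (intro sum.cong) (auto simp: vec_eq_iff)
    also have "\<dots> = k *s (\<Sum>v\<in>B. icoord B b v *s v)"
      by (simp add: vec_eq_iff sum_distrib_left mult.assoc)
    finally show "k *s b = (\<Sum>v\<in>B. (k * icoord B b v) *s v)" by (simp add: icoord_sum)
  qed (simp add: icoord_out)
  then show ?thesis by simp
qed

lemma icoord_zero [simp]: "icoord B 0 v = 0"
  using icoord_add[of 0 0 v] by simp

lemma icoord_sum_arg: "icoord B (\<Sum>i\<in>I. f i) v = (\<Sum>i\<in>I. icoord B (f i) v)"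
  by (induction I rule: infinite_finite_induct) (auto simp: icoord_add)

lemma icoord_basis: "w \<in> B \<Longrightarrow> icoord B w v = (if v = w then 1 else 0)"
proof -
  assume w: "w \<in> B"
  have "icoord B w = (\<lambda>v. if v = w then 1 else 0)"
  proof (rule icoord_unique)
    have "(\<Sum>v\<in>B. (if v = w then 1 else 0) *s v) = (\<Sum>v\<in>B. if v = w then w else 0)"
      by (rule sum.cong) auto
    then show "w = (\<Sum>v\<in>B. (if v = w then 1 else 0) *s v)" using w finite_basis by simp
  qed (use w in auto)
  then show ?thesis by simp
qed

lemma linear_rcoord: "linear (rcoord B w)"
  by (rule linearI) (auto simp: rcoord_def algebra_simps sum.distrib sum_distrib_left)

lemma vec_axis_sum: "(\<Sum>i\<in>UNIV. (m $ i) *s axis i 1) = (m :: int^'n)"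
  by (simp add: vec_eq_iff axis_def if_distrib cong: if_cong)

lemma rcoord_rvec: "rcoord B w (rvec m) = of_int (icoord B m w)"
proof -
  have "icoord B m w = icoord B (\<Sum>i\<in>UNIV. (m $ i) *s axis i 1) w" by (simp add: vec_axis_sum)
  also have "\<dots> = (\<Sum>i\<in>UNIV. m $ i * icoord B (axis i 1) w)"
    by (simp add: icoord_sum_arg icoord_smult)
  finally show ?thesis by (simp add: rcoord_def rvec_def)
qed

lemma rcoord_sum: "(\<Sum>w\<in>B. rcoord B w x *\<^sub>R rvec w) = x"
proof -
  have e: "rvec (\<Sum>w\<in>B. icoord B (axis i 1) w *s w) = axis i 1" for i
    by (simp add: icoord_sum rvec_axis)
  have "(\<Sum>w\<in>B. rcoord B w x *\<^sub>R rvec w) =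
      (\<Sum>w\<in>B. \<Sum>i\<in>UNIV. (x $ i) *\<^sub>R (of_int (icoord B (axis i 1) w) *\<^sub>R rvec w))"
    by (simp add: rcoord_def scaleR_left.sum)
  also have "\<dots> = (\<Sum>i\<in>UNIV. (x $ i) *\<^sub>R (\<Sum>w\<in>B. (of_int (icoord B (axis i 1) w) *\<^sub>R rvec w)))"
    by (subst sum.swap) (simp add: scaleR_right.sum)
  also have "\<dots> = (\<Sum>i\<in>UNIV. (x $ i) *\<^sub>R axis i 1)"
    using e by (simp add: rvec_sum)
  also have "\<dots> = x" by (simp add: vec_eq_iff axis_def if_distrib cong: if_cong)
  finally show ?thesis .
qed

lemma rcoord_basis: "v \<in> B \<Longrightarrow> rcoord B w (rvec v) = (if w = v then 1 else 0)"
  by (simp add: rcoord_rvec icoord_basis)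

lemma independent_rvec_basis: "independent (rvec ` B)"
proof (rule independent_if_scalars_zero)
  show "finite (rvec ` B)" using finite_basis by simp
  fix f x assume s: "(\<Sum>x\<in>rvec ` B. f x *\<^sub>R x) = 0" and x: "x \<in> rvec ` B"
  then obtain w where w: "w \<in> B" "x = rvec w" by auto
  have "0 = rcoord B w (\<Sum>v\<in>B. f (rvec v) *\<^sub>R rvec v)"
    using s by (simp add: sum.reindex[OF inj_rvec] linear_0[OF linear_rcoord])
  also have "\<dots> = (\<Sum>v\<in>B. f (rvec v) * rcoord B w (rvec v))"
    by (simp add: linear_sum[OF linear_rcoord] linear_cmul[OF linear_rcoord])
  also have "\<dots> = (\<Sum>v\<in>B. if v = w then f (rvec v) else 0)"
    by (rule sum.cong) (auto simp: rcoord_basis)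
  also have "\<dots> = f x" using w finite_basis by simp
  finally show "f x = 0" by simp
qed

lemma card_basis: "card B = CARD('n)"
proof -
  have "span (rvec ` B) = UNIV"
  proof -
    have "x \<in> span (rvec ` B)" for x
    proof -
      have "(\<Sum>w\<in>B. rcoord B w x *\<^sub>R rvec w) \<in> span (rvec ` B)"
        by (intro span_sum span_scale span_base) auto
      then show ?thesis by (simp add: rcoord_sum)
    qed
    then show ?thesis by auto
  qed
  then have "dim (UNIV :: (real^'n) set) = card (rvec ` B)"
    using independent_rvec_basis dim_eq_card by (metis span_UNIV)
  then show ?thesis by (simp add: card_image[OF inj_rvec])
qed

text \<open>The sign conditions cut out a convex cone containing the generators, and conversely the
  basis expansion of a point satisfying them is a nonnegative combination of \<open>A\<close>. All
  later questions about membership in a smooth cone become conditions on coordinates.\<close>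

lemma gen_cone_eq:
  assumes "A \<subseteq> B"
  shows "gen_cone A = {x. \<forall>w\<in>B. 0 \<le> rcoord B w x \<and> (w \<notin> A \<longrightarrow> rcoord B w x = 0)}" (is "_ = ?C")
proof
  have "convex_cone ?C"
    unfolding convex_cone_iff
    by (auto simp: linear_0[OF linear_rcoord] linear_add[OF linear_rcoord] linear_cmul[OF linear_rcoord])
  moreover have "rvec ` A \<subseteq> ?C" using assms by (auto simp: rcoord_basis)
  ultimately show "gen_cone A \<subseteq> ?C" unfolding gen_cone_def by (intro hull_minimal) auto
  show "?C \<subseteq> gen_cone A"
  proof
    fix x assume x: "x \<in> ?C"
    have "x = (\<Sum>w\<in>B. rcoord B w x *\<^sub>R rvec w)" by (simp add: rcoord_sum)
    also have "\<dots> = (\<Sum>w\<in>A. rcoord B w x *\<^sub>R rvec w)"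
      using x assms finite_basis by (intro sum.mono_neutral_right) auto
    also have "\<dots> \<in> gen_cone A"
    proof -
      have "finite A'' \<Longrightarrow> A'' \<subseteq> A \<Longrightarrow> (\<Sum>w\<in>A''. rcoord B w x *\<^sub>R rvec w) \<in> gen_cone A" for A''
      proof (induction A'' rule: finite_induct)
        case (insert a F)
        have "rvec a \<in> gen_cone A" unfolding gen_cone_def
          using insert by (intro hull_inc) auto
        then show ?case using insert x assms unfolding gen_cone_def
          by (auto intro!: convex_cone_hull_add convex_cone_hull_mul)
      qed (simp add: gen_cone_def convex_cone_hull_contains_0)
      then show ?thesis using finite_subset[OF assms finite_basis] by blast
    qed
    finally show "x \<in> gen_cone A" .
  qed
qed

lemma dim_gen_cone:
  assumes "A \<subseteq> B"
  shows "dim (gen_cone A) = card A"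
proof -
  have fin: "finite A" using assms finite_basis finite_subset by blast
  have "gen_cone A \<subseteq> span (rvec ` A)"
    unfolding gen_cone_def
    by (rule hull_minimal)
      (auto simp: span_base convex_cone_iff span_0 intro: span_add span_scale)
  moreover have "rvec ` A \<subseteq> gen_cone A" unfolding gen_cone_def by (rule hull_subset)
  ultimately have "span (gen_cone A) = span (rvec ` A)"
    by (metis span_mono span_span subset_antisym)
  moreover have "independent (rvec ` A)"
    using independent_rvec_basis assms by (meson image_mono independent_mono)
  ultimately show ?thesis
    by (metis dim_span dim_eq_card_independent card_image inj_rvec)
qed

text \<open>A nonnegative coordinate that vanishes at an interior point of a segment vanishes at
  both ends.\<close>

lemma gen_cone_face:
  assumes "A' \<subseteq> A" "A \<subseteq> B"
  shows "gen_cone A' face_of gen_cone A"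
  unfolding face_of_def
proof (intro conjI ballI impI)
  have A'B: "A' \<subseteq> B" using assms by auto
  show "gen_cone A' \<subseteq> gen_cone A" using assms(1) unfolding gen_cone_def by (intro hull_mono) auto
  show "convex (gen_cone A')" unfolding gen_cone_def by (rule convex_convex_cone_hull)
  fix a b x assume a: "a \<in> gen_cone A" and b: "b \<in> gen_cone A" and x: "x \<in> gen_cone A'"
    and s: "x \<in> open_segment a b"
  obtain u where u: "0 < u" "u < 1" "x = (1 - u) *\<^sub>R a + u *\<^sub>R b"
    using s by (auto simp: in_segment)
  have pos: "0 \<le> rcoord B w a" "0 \<le> rcoord B w b" if "w \<in> B" for w
    using a b that by (auto simp: gen_cone_eq[OF assms(2)])
  have z: "rcoord B w a = 0 \<and> rcoord B w b = 0" if "w \<in> B" "w \<notin> A'" for w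
  proof -
    have "(1 - u) * rcoord B w a + u * rcoord B w b = 0"
      using x that u by (auto simp: gen_cone_eq[OF A'B] linear_add[OF linear_rcoord] linear_cmul[OF linear_rcoord])
    then show ?thesis using pos[OF that(1)] u
      by (smt (verit) mult_nonneg_nonneg mult_pos_pos)
  qed
  show "a \<in> gen_cone A'" "b \<in> gen_cone A'"
    using pos z by (auto simp: gen_cone_eq[OF A'B])
qed

end

lemma gen_cone_single: "gen_cone {v} = {t *\<^sub>R rvec v | t. 0 \<le> t}"
proof
  have "convex_cone {t *\<^sub>R rvec v | t. 0 \<le> t}"
    unfolding convex_cone_iff
  proof (intro conjI ballI allI impI)
    show "0 \<in> {t *\<^sub>R rvec v |t. 0 \<le> t}" by (auto intro: exI[of _ 0])
  next
    fix x y assume "x \<in> {t *\<^sub>R rvec v |t. 0 \<le> t}" "y \<in> {t *\<^sub>R rvec v |t. 0 \<le> t}"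
    then show "x + y \<in> {t *\<^sub>R rvec v |t. 0 \<le> t}"
      by (auto simp: scaleR_add_left[symmetric] intro!: add_nonneg_nonneg)
  next
    fix x c assume "x \<in> {t *\<^sub>R rvec v |t. 0 \<le> t}" "0 \<le> (c::real)"
    then show "c *\<^sub>R x \<in> {t *\<^sub>R rvec v |t. 0 \<le> t}" by auto
  qed
  moreover have "rvec v \<in> {t *\<^sub>R rvec v | t. 0 \<le> t}"
    by (metis (mono_tags, lifting) mem_Collect_eq scaleR_one zero_le_one)
  then have "rvec ` {v} \<subseteq> {t *\<^sub>R rvec v | t. 0 \<le> t}" by (simp only: image_insert image_empty insert_subset empty_subsetI)
  ultimately show "gen_cone {v} \<subseteq> {t *\<^sub>R rvec v | t. 0 \<le> t}"
    unfolding gen_cone_def by (intro hull_minimal)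
  show "{t *\<^sub>R rvec v | t. 0 \<le> t} \<subseteq> gen_cone {v}"
    unfolding gen_cone_def by (auto intro!: convex_cone_hull_mul[OF hull_inc])
qed

text \<open>The factor \<open>t\<close> is the coordinate of \<open>w\<close> along
  \<open>v\<close>, hence an integer, and primitivity leaves only 1.\<close>

lemma primitive_eq_basis_vector:
  assumes B: "lattice_basis B" and v: "v \<in> B" and w: "primitive w" and t: "rvec w = t *\<^sub>R rvec v" "0 \<le> t"
  shows "w = v"
proof -
  have "of_int (icoord B w v) = t"
    using t v by (simp flip: rcoord_rvec[OF B] add: rcoord_basis[OF B] linear_cmul[OF linear_rcoord[OF B]])
  then have e: "rvec w = rvec (icoord B w v *s v)" using t by simp
  then have "w = icoord B w v *s v" by (simp only: rvec_inject)
  then have "\<bar>icoord B w v\<bar> = 1" using w by (auto simp: primitive_def)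
  moreover have "icoord B w v \<ge> 0" using \<open>_ = t\<close> t(2) by linarith
  ultimately show ?thesis using \<open>w = icoord B w v *s v\<close> by simp
qed

text \<open>Faces are defined through open segments, and \<open>a + b\<close> is the midpoint of
  \<open>2 a\<close> and \<open>2 b\<close>. The segment degenerates when \<open>a = b\<close>, so
  this case is separate.\<close>

lemma face_of_cone_add:
  assumes F: "F face_of S" and cS: "convex_cone S" and cF: "convex_cone F"
    and a: "a \<in> S" and b: "b \<in> S" and ab: "a + b \<in> F"
  shows "a \<in> F"
proof (cases "a = b")
  case True
  have "(1/2) *\<^sub>R (a + b) \<in> F" by (rule convex_cone_scaleR[OF cF _ ab]) simp
  then show ?thesis using True by (simp add: scaleR_2[symmetric])
next
  case False
  have "a + b \<in> open_segment (2 *\<^sub>R a) (2 *\<^sub>R b)"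
    unfolding in_segment
  proof (intro conjI exI[of _ "1/2"])
    show "2 *\<^sub>R a \<noteq> 2 *\<^sub>R b" using False by simp
    show "a + b = (1 - 1/2) *\<^sub>R (2 *\<^sub>R a) + (1/2) *\<^sub>R (2 *\<^sub>R b)" by simp
  qed auto
  moreover have "2 *\<^sub>R a \<in> S" "2 *\<^sub>R b \<in> S" using a b cS by (auto intro: convex_cone_scaleR)
  ultimately have "2 *\<^sub>R a \<in> F" using F ab unfolding face_of_def by blast
  then have "(1/2) *\<^sub>R (2 *\<^sub>R a) \<in> F" by (intro convex_cone_scaleR[OF cF, of "1/2" "2 *\<^sub>R a"]) simp_all
  then show ?thesis by (simp only: scaleR_scaleR) simp
qed

lemma convex_cone_gen_cone: "convex_cone (gen_cone A)"
  by (simp add: gen_cone_def convex_cone_convex_cone_hull)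

lemma rvec_in_gen_cone: "v \<in> A \<Longrightarrow> rvec v \<in> gen_cone A"
  by (simp add: gen_cone_def hull_inc)

lemma gen_cone_mono: "A \<subseteq> B \<Longrightarrow> gen_cone A \<subseteq> gen_cone B"
  unfolding gen_cone_def by (intro hull_mono image_mono)

lemma primitive_nonzero: "primitive v \<Longrightarrow> v \<noteq> 0"
proof
  assume "primitive v" "v = 0"
  then have "v = 0 *s v" by simp
  with \<open>primitive v\<close> have "\<bar>0::int\<bar> = 1" unfolding primitive_def by blast
  then show False by simp
qed

text \<open>Replaces a closedness argument for cones: a coordinate is followed along points
  approaching a limit, for infinitely many but possibly not all indices.\<close>

lemma nonneg_limit:
  fixes p q :: real
  assumes "infinite M" "\<And>m. m \<in> M \<Longrightarrow> 0 \<le> p + q / real (Suc m)"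
  shows "0 \<le> p"
proof (rule ccontr)
  assume "\<not> 0 \<le> p"
  obtain N where N: "\<bar>q\<bar> / (- p) < real N" using reals_Archimedean2 by blast
  obtain m where m: "m \<in> M" "m > N" using assms(1) by (meson infinite_nat_iff_unbounded)
  have "\<bar>q\<bar> < real (Suc m) * (- p)"
  proof -
    have "\<bar>q\<bar> / (- p) < real (Suc m)" using N m by linarith
    moreover have "0 < - p" using \<open>\<not> 0 \<le> p\<close> by simp
    ultimately show ?thesis using pos_divide_less_eq[of "- p" "\<bar>q\<bar>" "real (Suc m)"] by blast
  qed
  then have "q / real (Suc m) < - p"
    by (simp add: divide_less_eq mult.commute abs_less_iff)
  then show False using assms(2)[OF m(1)] by linarith
qed

section \<open>Generators and maximal cones of a smooth complete fan\<close>

locale toric =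
  fixes G :: "('n::finite) lg_data"
  assumes smooth: "smooth_fan (fan G)" and complete: "complete_fan (fan G)"
    and rays: "ray_generators G" and projective: "projective_fan G"
    and first_rays: "first_rays_basis G" and dual: "dual_basis G"
    and ordering: "cone_ordering G"
    and splitting: "is_splitting G"
begin

lemma fan_is_fan: "is_fan (fan G)" using smooth by (simp add: smooth_fan_def)

lemma finite_fan: "finite (fan G)" using fan_is_fan by (simp add: is_fan_def)

lemma face_in_fan: "\<sigma> \<in> fan G \<Longrightarrow> \<tau> face_of \<sigma> \<Longrightarrow> \<tau> \<noteq> {} \<Longrightarrow> \<tau> \<in> fan G"
  using fan_is_fan unfolding is_fan_def by blast

lemma inter_face: "\<sigma> \<in> fan G \<Longrightarrow> \<sigma>' \<in> fan G \<Longrightarrow> (\<sigma> \<inter> \<sigma>') face_of \<sigma>"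
  using fan_is_fan unfolding is_fan_def by blast

lemma fan_gen: "\<sigma> \<in> fan G \<Longrightarrow> \<exists>B A. lattice_basis B \<and> A \<subseteq> B \<and> \<sigma> = gen_cone A"
  using smooth unfolding smooth_fan_def by blast

lemma zero_in_fan: "\<sigma> \<in> fan G \<Longrightarrow> 0 \<in> \<sigma>"
  using fan_gen convex_cone_contains_0 convex_cone_gen_cone by metis

lemma inter_in_fan: "\<sigma> \<in> fan G \<Longrightarrow> \<sigma>' \<in> fan G \<Longrightarrow> \<sigma> \<inter> \<sigma>' \<in> fan G"
  using face_in_fan[OF _ inter_face] zero_in_fan by blast

lemma ray_inj: "inj_on (ray G) {1..nrays G}"
  using rays by (simp add: ray_generators_def)

lemma ray_primitive: "i \<in> {1..nrays G} \<Longrightarrow> primitive (ray G i)"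
  using rays by (simp add: ray_generators_def)

lemma ray_in_fan: "i \<in> {1..nrays G} \<Longrightarrow> gen_cone {ray G i} \<in> fan G"
  using rays unfolding ray_generators_def by blast

lemma dim1_ray: "\<sigma> \<in> fan G \<Longrightarrow> dim \<sigma> = 1 \<Longrightarrow> \<exists>i\<in>{1..nrays G}. \<sigma> = gen_cone {ray G i}"
  using rays unfolding ray_generators_def by blast

lemma gens_subset: "gens G \<sigma> \<subseteq> {1..nrays G}"
  by (auto simp: gens_def)

lemma finite_gens: "finite (gens G \<sigma>)"
  using gens_subset finite_subset by blast

lemma gens_inter: "gens G (\<sigma> \<inter> \<sigma>') = gens G \<sigma> \<inter> gens G \<sigma>'"
  by (auto simp: gens_def)

text \<open>Each basis vector in \<open>A\<close> spans a one-dimensional face, hence a listed ray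
  with the same primitive generator. Conversely a listed ray inside \<sigma> is a face of \<sigma>,
  and a face containing a nonnegative combination of \<open>A\<close> contains the summands.\<close>

lemma gens_unique:
  assumes f: "\<sigma> \<in> fan G" and B: "lattice_basis B" and A: "A \<subseteq> B" and s: "\<sigma> = gen_cone A"
  shows "ray G ` gens G \<sigma> = A"
proof
  show "A \<subseteq> ray G ` gens G \<sigma>"
  proof
    fix v assume v: "v \<in> A"
    have sub: "{v} \<subseteq> A" and subB: "{v} \<subseteq> B" using v A by auto
    have "gen_cone {v} \<in> fan G"
      using face_in_fan[OF f] gen_cone_face[OF B sub A] s rvec_in_gen_cone[of v "{v}"] by auto
    moreover have "dim (gen_cone {v}) = 1" using dim_gen_cone[OF B subB] by simp
    ultimately obtain i where i: "i \<in> {1..nrays G}" "gen_cone {v} = gen_cone {ray G i}"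
      using dim1_ray by blast
    have "rvec (ray G i) \<in> gen_cone {v}" using i(2) rvec_in_gen_cone[of "ray G i" "{ray G i}"] by simp
    then obtain t where t: "rvec (ray G i) = t *\<^sub>R rvec v" "0 \<le> t" by (auto simp: gen_cone_single)
    have "ray G i = v" using primitive_eq_basis_vector[OF B _ ray_primitive[OF i(1)] t] v A by auto
    moreover have "rvec v \<in> \<sigma>" using s v rvec_in_gen_cone by auto
    ultimately show "v \<in> ray G ` gens G \<sigma>" using i(1) by (auto simp: gens_def)
  qed
next
  show "ray G ` gens G \<sigma> \<subseteq> A"
  proof
    fix w assume "w \<in> ray G ` gens G \<sigma>"
    then obtain i where i: "i \<in> {1..nrays G}" "w = ray G i" "rvec w \<in> \<sigma>" by (auto simp: gens_def)
    let ?F = "gen_cone {w}"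
    have sub: "?F \<subseteq> \<sigma>"
      using i(3) s convex_cone_scaleR[OF convex_cone_gen_cone] by (auto simp: gen_cone_single)
    have F: "?F face_of \<sigma>"
      using inter_face[OF f ray_in_fan[OF i(1)]] sub i(2) by (simp add: Int_absorb1)
    have co: "0 \<le> rcoord B v (rvec w)" "v \<notin> A \<Longrightarrow> rcoord B v (rvec w) = 0" if "v \<in> B" for v
      using i(3) s that by (auto simp: gen_cone_eq[OF B A])
    have "rvec w \<noteq> 0" using ray_primitive[OF i(1)] primitive_nonzero i(2) by (metis rvec_0 rvec_inject)
    then obtain v where v: "v \<in> B" "rcoord B v (rvec w) \<noteq> 0"
      using rcoord_sum[OF B, of "rvec w"] by (metis (no_types, lifting) scaleR_zero_left sum.neutral)
    have vA: "v \<in> A" using v co by blast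
    let ?c = "rcoord B v (rvec w)"
    have c: "?c > 0" using v co[OF v(1)] by linarith
    let ?r = "\<Sum>u\<in>B - {v}. rcoord B u (rvec w) *\<^sub>R rvec u"
    have split: "rvec w = ?c *\<^sub>R rvec v + ?r"
      using rcoord_sum[OF B, of "rvec w"] v(1) finite_basis[OF B] by (simp add: sum.remove)
    have a: "?c *\<^sub>R rvec v \<in> \<sigma>"
      using c vA s convex_cone_scaleR[OF convex_cone_gen_cone] rvec_in_gen_cone by (metis less_imp_le)
    have "?r = (\<Sum>u\<in>A - {v}. rcoord B u (rvec w) *\<^sub>R rvec u)"
      using co A finite_basis[OF B] by (intro sum.mono_neutral_right) auto
    also have "\<dots> \<in> \<sigma>"
    proof -
      have "finite X \<Longrightarrow> X \<subseteq> A \<Longrightarrow> (\<Sum>u\<in>X. rcoord B u (rvec w) *\<^sub>R rvec u) \<in> gen_cone A" for X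
      proof (induction X rule: finite_induct)
        case empty
        then show ?case using convex_cone_contains_0[OF convex_cone_gen_cone] by simp
      next
        case (insert x F)
        then show ?case using co A
          by (auto intro!: convex_cone_add[OF convex_cone_gen_cone] convex_cone_scaleR[OF convex_cone_gen_cone] rvec_in_gen_cone)
      qed
      then show ?thesis using s finite_subset[OF A finite_basis[OF B]] by (metis Diff_subset finite_Diff)
    qed
    finally have b: "?r \<in> \<sigma>" .
    \<comment> \<open>The two parts of the expansion lie in \<sigma> and their sum in the face, so
      the part along \<open>v\<close> lies on the ray of \<open>w\<close>.\<close>
    have "?c *\<^sub>R rvec v \<in> ?F"
      by (rule face_of_cone_add[OF F _ _ a b])
        (use s split rvec_in_gen_cone[of w "{w}"] in \<open>auto simp: convex_cone_gen_cone\<close>)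
    then obtain t where t: "?c *\<^sub>R rvec v = t *\<^sub>R rvec w" "0 \<le> t" by (auto simp: gen_cone_single)
    have "t \<noteq> 0" using t(1) c v(1)
      using rcoord_basis[OF B v(1), of v] linear_0[OF linear_rcoord[OF B, of v]] by auto
    then have "rvec w = (?c / t) *\<^sub>R rvec v"
      using t(1) by (metis (no_types, lifting) divide_inverse_commute scaleR_left_imp_eq scaleR_scaleR right_inverse scaleR_one)
    moreover have "?c / t \<ge> 0" using c t(2) by simp
    ultimately have "w = v"
      using primitive_eq_basis_vector[OF B v(1)] ray_primitive[OF i(1)] i(2) by blast
    then show "w \<in> A" using vA by simp
  qed
qed

lemma cone_gens:
  assumes "\<sigma> \<in> fan G"
  shows "\<sigma> = gen_cone (ray G ` gens G \<sigma>)" "\<exists>B. lattice_basis B \<and> ray G ` gens G \<sigma> \<subseteq> B"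
proof -
  obtain B A where BA: "lattice_basis B" "A \<subseteq> B" "\<sigma> = gen_cone A" using fan_gen[OF assms] by blast
  have e: "ray G ` gens G \<sigma> = A" by (rule gens_unique[OF assms BA])
  show "\<sigma> = gen_cone (ray G ` gens G \<sigma>)" unfolding e by (rule BA(3))
  show "\<exists>B. lattice_basis B \<and> ray G ` gens G \<sigma> \<subseteq> B" unfolding e using BA by blast
qed

lemma gens_mono_iff:
  assumes "\<sigma> \<in> fan G" "\<sigma>' \<in> fan G"
  shows "gens G \<sigma> \<subseteq> gens G \<sigma>' \<longleftrightarrow> \<sigma> \<subseteq> \<sigma>'"
proof
  assume "gens G \<sigma> \<subseteq> gens G \<sigma>'"
  then have "gen_cone (ray G ` gens G \<sigma>) \<subseteq> gen_cone (ray G ` gens G \<sigma>')"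
    by (intro gen_cone_mono image_mono)
  then show "\<sigma> \<subseteq> \<sigma>'"
    by (simp only: cone_gens(1)[OF assms(1), symmetric] cone_gens(1)[OF assms(2), symmetric])
qed (auto simp: gens_def)

lemma max_in_fan: "\<sigma> \<in> max_cones (fan G) \<Longrightarrow> \<sigma> \<in> fan G"
  by (simp add: max_cones_def)

lemma finite_max: "finite (max_cones (fan G))"
  using finite_fan by (simp add: max_cones_def)

lemma in_max: "\<sigma> \<in> fan G \<Longrightarrow> \<exists>\<sigma>'\<in>max_cones (fan G). \<sigma> \<subseteq> \<sigma>'"
proof -
  assume s: "\<sigma> \<in> fan G"
  obtain m where m: "m \<in> fan G" "\<sigma> \<subseteq> m" "\<forall>b\<in>fan G. m \<subseteq> b \<longrightarrow> b = m"
    using finite_has_maximal2[OF finite_fan s] by blast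
  then show ?thesis unfolding max_cones_def by blast
qed

lemma cover: "\<exists>\<sigma>\<in>max_cones (fan G). x \<in> \<sigma>"
  using complete in_max unfolding complete_fan_def by blast

text \<open>Pigeonhole over the finitely many maximal cones: one of them contains infinitely many
  points on the way from \<open>x + y\<close> to \<open>x\<close>, and then \<open>x\<close> as
  well. It produces the cone met on leaving \<open>x\<close> in the direction
  \<open>y\<close>.\<close>

lemma limit_cone:
  obtains \<sigma>' M where "\<sigma>' \<in> max_cones (fan G)" "x \<in> \<sigma>'" "infinite M"
    "\<And>m. m \<in> M \<Longrightarrow> x + (1 / real (Suc m)) *\<^sub>R y \<in> \<sigma>'"
proof -
  define f where "f m = (SOME \<sigma>. \<sigma> \<in> max_cones (fan G) \<and> x + (1 / real (Suc m)) *\<^sub>R y \<in> \<sigma>)" for m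
  have f: "f m \<in> max_cones (fan G)" "x + (1 / real (Suc m)) *\<^sub>R y \<in> f m" for m
    using someI_ex[of "\<lambda>\<sigma>. \<sigma> \<in> max_cones (fan G) \<and> x + (1 / real (Suc m)) *\<^sub>R y \<in> \<sigma>"] cover
    unfolding f_def by blast+
  have "finite (range f)" using f(1) finite_max by (meson finite_subset image_subsetI)
  then obtain \<sigma>' where s: "\<sigma>' \<in> range f" "infinite (f -` {\<sigma>'})"
    using inf_img_fin_dom[of f UNIV] by auto
  have sm: "\<sigma>' \<in> max_cones (fan G)" using s f by auto
  have mem: "x + (1 / real (Suc m)) *\<^sub>R y \<in> \<sigma>'" if "m \<in> f -` {\<sigma>'}" for m
    using that f(2)[of m] by auto
  obtain B A where B: "lattice_basis B" "A \<subseteq> B" "\<sigma>' = gen_cone A" using fan_gen[OF max_in_fan[OF sm]] by blast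
  have lin: "rcoord B w (x + (1 / real (Suc m)) *\<^sub>R y) = rcoord B w x + rcoord B w y / real (Suc m)" for w m
    by (simp only: linear_add[OF linear_rcoord[OF B(1)]] linear_cmul[OF linear_rcoord[OF B(1)]]) simp
  have "0 \<le> rcoord B w x" if w: "w \<in> B" for w
  proof (rule nonneg_limit[OF s(2)])
    fix m assume "m \<in> f -` {\<sigma>'}"
    from mem[OF this] show "0 \<le> rcoord B w x + rcoord B w y / real (Suc m)"
      using w B(3) unfolding lin[symmetric] by (auto simp: gen_cone_eq[OF B(1,2)])
  qed
  moreover have "rcoord B w x = 0" if w: "w \<in> B" "w \<notin> A" for w
  proof -
    have "0 \<le> - rcoord B w x"
    proof (rule nonneg_limit[OF s(2)])
      fix m assume "m \<in> f -` {\<sigma>'}"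
      from mem[OF this] have "rcoord B w x + rcoord B w y / real (Suc m) = 0"
        using w B(3) unfolding lin[symmetric] by (auto simp: gen_cone_eq[OF B(1,2)])
      then show "0 \<le> - rcoord B w x + (- rcoord B w y) / real (Suc m)" by simp
    qed
    then show ?thesis using \<open>\<And>w. w \<in> B \<Longrightarrow> 0 \<le> rcoord B w x\<close>[OF w(1)] by linarith
  qed
  ultimately have "x \<in> \<sigma>'" using B by (auto simp: gen_cone_eq[OF B(1,2)])
  then show thesis using that sm s(2) mem by blast
qed

text \<open>If a basis vector \<open>w\<close> were not a generator, leaving an interior point of
  \<sigma> in the direction \<open>w\<close> would lead into a cone containing \<sigma>. By
  maximality that cone is \<sigma>, although the points on the way have positive
  \<open>w\<close>-coordinate.\<close>

lemma max_basis:
  assumes m: "\<sigma> \<in> max_cones (fan G)"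
  shows "lattice_basis (ray G ` gens G \<sigma>)"
proof -
  let ?A = "ray G ` gens G \<sigma>"
  have f: "\<sigma> \<in> fan G" using m by (rule max_in_fan)
  obtain B where B: "lattice_basis B" "?A \<subseteq> B" using cone_gens(2)[OF f] by blast
  have s: "\<sigma> = gen_cone ?A" using cone_gens(1)[OF f] .
  have "B \<subseteq> ?A"
  proof (rule ccontr)
    assume "\<not> B \<subseteq> ?A"
    then obtain w where w: "w \<in> B" "w \<notin> ?A" by blast
    \<comment> \<open>The sum of the generators has all coordinates 1, so a face of \<sigma>
      containing it is \<sigma> itself.\<close>
    define x where "x = rvec (\<Sum>v\<in>?A. v)"
    obtain \<sigma>' M where l: "\<sigma>' \<in> max_cones (fan G)" "x \<in> \<sigma>'" "infinite M"
      "\<And>m. m \<in> M \<Longrightarrow> x + (1 / real (Suc m)) *\<^sub>R rvec w \<in> \<sigma>'"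
      by (rule limit_cone[of x "rvec w"]) blast
    have f': "\<sigma>' \<in> fan G" using l(1) by (rule max_in_fan)
    have fA: "finite ?A" using finite_gens by blast
    have xc: "rcoord B v x = (if v \<in> ?A then 1 else 0)" if "v \<in> B" for v
    proof -
      have "rcoord B v x = (\<Sum>u\<in>?A. if v = u then 1 else 0)"
        using B(2) by (auto simp: x_def rvec_sum linear_sum[OF linear_rcoord[OF B(1)]] rcoord_basis[OF B(1)] subset_iff intro!: sum.cong)
      then show ?thesis using fA by simp
    qed
    have xs: "x \<in> \<sigma>" by (subst s) (use xc in \<open>auto simp: gen_cone_eq[OF B]\<close>)
    let ?D = "ray G ` gens G (\<sigma> \<inter> \<sigma>')"
    have D: "\<sigma> \<inter> \<sigma>' = gen_cone ?D" using cone_gens(1)[OF inter_in_fan[OF f f']] .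
    have DA: "?D \<subseteq> ?A" by (auto simp: gens_inter)
    have "x \<in> gen_cone ?D" using D xs l(2) by blast
    then have "?A \<subseteq> ?D"
    proof (intro subsetI)
      fix v assume v: "v \<in> ?A"
      show "v \<in> ?D"
      proof (rule ccontr)
        assume "v \<notin> ?D"
        then have "rcoord B v x = 0"
          using \<open>x \<in> gen_cone ?D\<close> v B(2) unfolding gen_cone_eq[OF B(1) subset_trans[OF DA B(2)]] by blast
        moreover have "rcoord B v x = 1" using xc v B(2) by (simp add: subset_iff)
        ultimately show False by simp
      qed
    qed
    then have "gen_cone ?A \<subseteq> gen_cone ?D" by (rule gen_cone_mono)
    then have "\<sigma> \<subseteq> \<sigma> \<inter> \<sigma>'" by (simp only: D[symmetric] s[symmetric])
    then have "\<sigma> \<subseteq> \<sigma>'" by blast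
    then have "\<sigma>' = \<sigma>" using m f' by (auto simp: max_cones_def)
    obtain k where k: "k \<in> M" using l(3) by fastforce
    have "rcoord B w (x + (1 / real (Suc k)) *\<^sub>R rvec w) = 0"
    proof -
      have "x + (1 / real (Suc k)) *\<^sub>R rvec w \<in> gen_cone ?A"
        using l(4)[OF k] unfolding \<open>\<sigma>' = \<sigma>\<close> by (simp only: s[symmetric])
      then show ?thesis using w unfolding gen_cone_eq[OF B] by blast
    qed
    moreover have "rcoord B w (x + (1 / real (Suc k)) *\<^sub>R rvec w) = 1 / real (Suc k)"
      by (simp only: linear_add[OF linear_rcoord[OF B(1)]] linear_cmul[OF linear_rcoord[OF B(1)]])
        (use w xc[OF w(1)] in \<open>simp add: rcoord_basis[OF B(1)]\<close>)
    ultimately show False by simp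
  qed
  then show ?thesis using B by (metis subset_antisym)
qed

end

section \<open>Linear and piecewise linear lifts to Z^d, and wall crossing\<close>

abbreviation lk where "lk \<equiv> Poly_Mapping.lookup"

definition scal :: "int \<Rightarrow> (nat \<Rightarrow>\<^sub>0 int) \<Rightarrow> (nat \<Rightarrow>\<^sub>0 int)" where
  "scal t a = Poly_Mapping.map (\<lambda>x. t * x) a"

lemma lookup_scal [simp]: "lk (scal t a) i = t * lk a i"
  by (simp add: scal_def Poly_Mapping.map.rep_eq when_def)

lemma lookup_minus' [simp]: "lk (a - b :: nat \<Rightarrow>\<^sub>0 int) i = lk a i - lk b i"
  by (simp add: lookup_minus)

lemma keys_sub_iff: "Poly_Mapping.keys a \<subseteq> S \<longleftrightarrow> (\<forall>i. i \<notin> S \<longrightarrow> lk a i = 0)"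
  by (auto simp: in_keys_iff)

context toric begin

abbreviation maxc where "maxc \<equiv> max_cones (fan G)"

lemma Zd_iff: "a \<in> Zd G \<longleftrightarrow> (\<forall>i. i \<notin> {1..nrays G} \<longrightarrow> lk a i = 0)"
  by (simp only: Zd_def mem_Collect_eq keys_sub_iff)

lemma ray_map_add: "ray_map G (a + b) = ray_map G a + ray_map G b"
  by (simp add: ray_map_def lookup_add vector_sadd_rdistrib sum.distrib)

lemma ray_map_diff: "ray_map G (a - b) = ray_map G a - ray_map G b"
  using ray_map_add[of "a - b" b] by simp

lemma ray_map_zero [simp]: "ray_map G 0 = 0"
  by (simp add: ray_map_def)

lemma ray_map_scal: "ray_map G (scal t a) = t *s ray_map G a"
  by (simp add: ray_map_def vec_eq_iff sum_distrib_left mult.assoc)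

lemma ray_map_single:
  assumes "l \<in> {1..nrays G}" shows "ray_map G (Poly_Mapping.single l c) = c *s ray G l"
proof -
  have "ray_map G (Poly_Mapping.single l c) = (\<Sum>i\<in>{1..nrays G}. if i = l then c *s ray G l else 0)"
    unfolding ray_map_def by (rule sum.cong) (auto simp: lookup_single when_def)
  then show ?thesis using assms by simp
qed

lemma ray_map_restrict:
  assumes "Poly_Mapping.keys a \<subseteq> S" "S \<subseteq> {1..nrays G}"
  shows "ray_map G a = (\<Sum>i\<in>S. lk a i *s ray G i)"
  unfolding ray_map_def using assms
  by (intro sum.mono_neutral_right) (auto simp: in_keys_iff)

text \<open>The linear extension of the lift from \<sigma> to all of N: the coordinates of
  \<open>m\<close> in the rays of \<sigma>, negative ones included. It agrees with
  \<open>pl_lift\<close> only for \<open>m\<close> in \<sigma>.\<close>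

definition lift :: "(real^'n) set \<Rightarrow> int^'n \<Rightarrow> (nat \<Rightarrow>\<^sub>0 int)" where
  "lift \<sigma> m = (\<Sum>l\<in>gens G \<sigma>. Poly_Mapping.single l (icoord (ray G ` gens G \<sigma>) m (ray G l)))"

lemma lookup_lift: "lk (lift \<sigma> m) l = (if l \<in> gens G \<sigma> then icoord (ray G ` gens G \<sigma>) m (ray G l) else 0)"
  by (simp add: lift_def lookup_sum lookup_single when_def finite_gens)

lemma keys_lift: "Poly_Mapping.keys (lift \<sigma> m) \<subseteq> gens G \<sigma>"
  by (simp add: keys_sub_iff lookup_lift)

lemma inj_gens: "inj_on (ray G) (gens G \<sigma>)"
  using ray_inj gens_subset inj_on_subset by blast

context
  fixes \<sigma> assumes s: "\<sigma> \<in> maxc"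
begin

lemma card_gens_max: "card (gens G \<sigma>) = CARD('n)"
  using card_basis[OF max_basis[OF s]] by (simp add: card_image[OF inj_gens])

lemma ray_map_lift: "ray_map G (lift \<sigma> m) = m"
proof -
  have "ray_map G (lift \<sigma> m) = (\<Sum>l\<in>gens G \<sigma>. icoord (ray G ` gens G \<sigma>) m (ray G l) *s ray G l)"
    by (simp add: ray_map_restrict[OF keys_lift gens_subset] lookup_lift)
  also have "\<dots> = (\<Sum>v\<in>ray G ` gens G \<sigma>. icoord (ray G ` gens G \<sigma>) m v *s v)"
    by (simp add: sum.reindex[OF inj_gens])
  finally show ?thesis by (simp add: icoord_sum[OF max_basis[OF s]])
qed

lemma lift_unique:
  assumes "Poly_Mapping.keys a \<subseteq> gens G \<sigma>"
  shows "a = lift \<sigma> (ray_map G a)"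
proof (rule poly_mapping_eqI)
  fix l
  let ?B = "ray G ` gens G \<sigma>"
  let ?c = "\<lambda>v. if v \<in> ?B then lk a (the_inv_into (gens G \<sigma>) (ray G) v) else 0"
  have c: "?c (ray G i) = lk a i" if "i \<in> gens G \<sigma>" for i
    using that by (simp add: the_inv_into_f_f[OF inj_gens])
  have "icoord ?B (ray_map G a) = ?c"
  proof (rule icoord_unique[OF max_basis[OF s]])
    have "(\<Sum>v\<in>?B. ?c v *s v) = (\<Sum>i\<in>gens G \<sigma>. ?c (ray G i) *s ray G i)"
      by (simp only: sum.reindex[OF inj_gens] o_def)
    also have "\<dots> = (\<Sum>i\<in>gens G \<sigma>. lk a i *s ray G i)"
      by (rule sum.cong[OF refl]) (simp only: c)
    finally show "ray_map G a = (\<Sum>v\<in>?B. ?c v *s v)"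
      by (simp add: ray_map_restrict[OF assms gens_subset])
  qed simp
  then show "lk a l = lk (lift \<sigma> (ray_map G a)) l"
    using assms c by (auto simp: lookup_lift keys_sub_iff)
qed

lemma lift_eqI: "Poly_Mapping.keys a \<subseteq> gens G \<sigma> \<Longrightarrow> ray_map G a = m \<Longrightarrow> lift \<sigma> m = a"
  using lift_unique by metis

lemma lift_add: "lift \<sigma> (m + m') = lift \<sigma> m + lift \<sigma> m'"
  by (rule lift_eqI) (use keys_lift in \<open>auto simp: ray_map_add ray_map_lift keys_sub_iff lookup_add lookup_lift\<close>)

lemma lift_zero [simp]: "lift \<sigma> 0 = 0"
  by (rule lift_eqI) auto

lemma mem_max_iff: "rvec m \<in> \<sigma> \<longleftrightarrow> (\<forall>l. 0 \<le> lk (lift \<sigma> m) l)"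
proof -
  have "rvec m \<in> gen_cone (ray G ` gens G \<sigma>) \<longleftrightarrow> (\<forall>l\<in>gens G \<sigma>. 0 \<le> lk (lift \<sigma> m) l)"
    by (simp add: gen_cone_eq[OF max_basis[OF s] order_refl] rcoord_rvec[OF max_basis[OF s]] lookup_lift)
  then show ?thesis by (auto simp: cone_gens(1)[OF max_in_fan[OF s], symmetric] lookup_lift)
qed

end

text \<open>The point lies in the common face of the two cones, so its coordinates in \<sigma>
  vanish off the rays of \<sigma>', and uniqueness of coordinates in \<sigma>' applies.\<close>

lemma pl_lift_unique_aux:
  assumes s: "\<sigma> \<in> maxc" and s': "\<sigma>' \<in> maxc" and m: "rvec m \<in> \<sigma>" "rvec m \<in> \<sigma>'"
  shows "lift \<sigma> m = lift \<sigma>' m"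
proof -
  let ?D = "gens G (\<sigma> \<inter> \<sigma>')"
  note B = max_basis[OF s]
  have f: "\<sigma> \<inter> \<sigma>' \<in> fan G" using inter_in_fan max_in_fan s s' by blast
  have D: "ray G ` ?D \<subseteq> ray G ` gens G \<sigma>" by (auto simp: gens_inter)
  have mem: "rvec m \<in> gen_cone (ray G ` ?D)" using m cone_gens(1)[OF f] by blast
  have "lk (lift \<sigma> m) l = 0" if "l \<notin> gens G \<sigma>'" for l
  proof (cases "l \<in> gens G \<sigma>")
    case True
    have "ray G l \<notin> ray G ` ?D"
    proof
      assume "ray G l \<in> ray G ` ?D"
      then obtain i where "i \<in> ?D" "ray G l = ray G i" by auto
      then have "l = i" using True inj_onD[OF inj_gens[of \<sigma>]] by (auto simp: gens_inter)
      then show False using \<open>i \<in> ?D\<close> that by (auto simp: gens_inter)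
    qed
    then have "rcoord (ray G ` gens G \<sigma>) (ray G l) (rvec m) = 0"
      using mem True unfolding gen_cone_eq[OF B D] by blast
    then show ?thesis using True by (simp add: lookup_lift rcoord_rvec[OF B])
  qed (simp add: lookup_lift)
  then have "lift \<sigma>' m = lift \<sigma> m"
    by (intro lift_eqI[OF s']) (auto simp: keys_sub_iff ray_map_lift[OF s])
  then show ?thesis by simp
qed

lemma pl_lift_eqI:
  assumes s: "\<sigma> \<in> maxc" and k: "Poly_Mapping.keys a \<subseteq> gens G \<sigma>" and n: "\<And>i. 0 \<le> lk a i" and r: "ray_map G a = m"
  shows "pl_lift G m = a"
  unfolding pl_lift_def
proof (rule the_equality)
  show "(\<exists>\<sigma>\<in>fan G. Poly_Mapping.keys a \<subseteq> gens G \<sigma>) \<and> (\<forall>i. 0 \<le> lk a i) \<and> ray_map G a = m"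
    using assms max_in_fan by blast
  fix b assume b: "(\<exists>\<sigma>\<in>fan G. Poly_Mapping.keys b \<subseteq> gens G \<sigma>) \<and> (\<forall>i. 0 \<le> lk b i) \<and> ray_map G b = m"
  then obtain \<sigma>0 where s0: "\<sigma>0 \<in> fan G" "Poly_Mapping.keys b \<subseteq> gens G \<sigma>0" by blast
  then obtain \<sigma>' where s': "\<sigma>' \<in> maxc" "\<sigma>0 \<subseteq> \<sigma>'" using in_max by blast
  then have kb: "Poly_Mapping.keys b \<subseteq> gens G \<sigma>'" using s0 gens_mono_iff[OF s0(1) max_in_fan[OF s'(1)]] by blast
  have la: "lift \<sigma> m = a" using lift_eqI[OF s k r] .
  have lb: "lift \<sigma>' m = b" using lift_eqI[OF s'(1) kb] b by blast
  have "rvec m \<in> \<sigma>" using mem_max_iff[OF s] la n by simp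
  moreover have "rvec m \<in> \<sigma>'" using mem_max_iff[OF s'(1)] lb b by simp
  ultimately show "b = a" using pl_lift_unique_aux[OF s s'(1)] la lb by simp
qed

lemma pl_lift_eq_lift: "\<sigma> \<in> maxc \<Longrightarrow> rvec m \<in> \<sigma> \<Longrightarrow> pl_lift G m = lift \<sigma> m"
  using pl_lift_eqI[OF _ keys_lift] mem_max_iff ray_map_lift by blast

lemma pl_lift_cone: "\<exists>\<sigma>\<in>maxc. rvec m \<in> \<sigma> \<and> Poly_Mapping.keys (pl_lift G m) \<subseteq> gens G \<sigma>"
  using cover pl_lift_eq_lift keys_lift by metis

lemma pl_lift_nonneg: "0 \<le> lk (pl_lift G m) i"
  using cover pl_lift_eq_lift mem_max_iff by metis

lemma ray_map_pl_lift: "ray_map G (pl_lift G m) = m"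
  using cover pl_lift_eq_lift ray_map_lift by metis

lemma pl_lift_Zd: "pl_lift G m \<in> Zd G"
  using pl_lift_cone[of m] gens_subset unfolding Zd_def by blast

lemma pl_lift_zero [simp]: "pl_lift G 0 = 0"
  using cover[of 0] by (auto intro: pl_lift_eqI)

lemma pl_lift_add:
  assumes "\<sigma> \<in> maxc" "Poly_Mapping.keys (pl_lift G m) \<subseteq> gens G \<sigma>" "Poly_Mapping.keys (pl_lift G m') \<subseteq> gens G \<sigma>"
  shows "pl_lift G (m + m') = pl_lift G m + pl_lift G m'"
  using assms by (intro pl_lift_eqI) (auto simp: keys_sub_iff lookup_add pl_lift_nonneg ray_map_add ray_map_pl_lift)

text \<open>Leave the sum of the rays other than \<open>j\<close> in the direction opposite to
  \<open>j\<close>. The cone reached contains the wall, because the starting point is interior to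
  it, but not \<open>j\<close>, whose coordinate would be negative; counting rays leaves exactly one
  new ray. Smoothness on both sides forces its \<open>j\<close>-coordinate to be -1.\<close>

lemma wall_crossing:
  assumes s: "\<sigma> \<in> maxc" and j: "j \<in> gens G \<sigma>"
  obtains \<sigma>' l where "\<sigma>' \<in> maxc" "l \<notin> gens G \<sigma>" "l \<in> {1..nrays G}" "gens G \<sigma>' = insert l (gens G \<sigma> - {j})"
    "dim (\<sigma> \<inter> \<sigma>') = CARD('n) - 1" "lk (lift \<sigma> (ray G l)) j = -1"
proof -
  define R where "R = gens G \<sigma> - {j}"
  define x where "x = rvec (\<Sum>i\<in>R. ray G i)"
  have finR: "finite R" using finite_gens by (simp add: R_def)
  obtain \<sigma>' M where l: "\<sigma>' \<in> maxc" "x \<in> \<sigma>'" "infinite M"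
    "\<And>m. m \<in> M \<Longrightarrow> x + (1 / real (Suc m)) *\<^sub>R rvec ((-1) *s ray G j) \<in> \<sigma>'"
    by (rule limit_cone[of x "rvec ((-1) *s ray G j)"]) blast
  note B = max_basis[OF s] and B' = max_basis[OF l(1)]
  let ?B = "ray G ` gens G \<sigma>" and ?B' = "ray G ` gens G \<sigma>'"
  obtain k where k: "k \<in> M" using l(3) by fastforce
  let ?e = "1 / real (Suc k)"
  have f: "\<sigma> \<inter> \<sigma>' \<in> fan G" using inter_in_fan max_in_fan s l(1) by blast
  let ?D = "gens G (\<sigma> \<inter> \<sigma>')"
  have DB: "ray G ` ?D \<subseteq> ?B" by (auto simp: gens_inter)
  have xc: "rcoord C (ray G i) x = (if i \<in> R then 1 else 0)"
    if C: "lattice_basis C" "ray G ` R \<subseteq> C" "i \<in> {1..nrays G}" for C i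
  proof -
    have "rcoord C (ray G i) x = (\<Sum>u\<in>R. if i = u then 1 else 0)"
      unfolding x_def rvec_sum linear_sum[OF linear_rcoord[OF C(1)]]
    proof (rule sum.cong[OF refl])
      fix u assume u: "u \<in> R"
      then have "u \<in> {1..nrays G}" using gens_subset[of \<sigma>] by (auto simp: R_def)
      then show "rcoord C (ray G i) (rvec (ray G u)) = (if i = u then 1 else 0)"
        using u C inj_onD[OF ray_inj, of i u] by (auto simp: rcoord_basis[OF C(1)] subset_iff)
    qed
    then show ?thesis using finR by simp
  qed
  have RB: "ray G ` R \<subseteq> ?B" by (auto simp: R_def)
  have "x \<in> gen_cone ?B"
    unfolding gen_cone_eq[OF B order_refl] using xc[OF B RB] gens_subset[of \<sigma>] by (auto simp: subset_iff)
  then have "x \<in> \<sigma>" by (simp only: cone_gens(1)[OF max_in_fan[OF s], symmetric])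
  then have xD: "x \<in> gen_cone (ray G ` ?D)" using l(2) cone_gens(1)[OF f] by blast
  have RD: "R \<subseteq> ?D"
  proof (rule subsetI, rule ccontr)
    fix i assume i: "i \<in> R" "i \<notin> ?D"
    have ib: "i \<in> {1..nrays G}" using i gens_subset[of \<sigma>] by (auto simp: R_def)
    have "ray G i \<notin> ray G ` ?D"
    proof
      assume "ray G i \<in> ray G ` ?D"
      then obtain i' where i': "i' \<in> ?D" "ray G i = ray G i'" by auto
      then have "i' \<in> {1..nrays G}" using gens_subset by blast
      then have "i = i'" using inj_onD[OF ray_inj i'(2) ib] by simp
      then show False using i' i by simp
    qed
    then have "rcoord ?B (ray G i) x = 0"
      using xD RB i(1) unfolding gen_cone_eq[OF B DB] by blast
    then show False using xc[OF B RB ib] i by simp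
  qed
  then have Rs': "R \<subseteq> gens G \<sigma>'" by (auto simp: gens_inter)
  then have RB': "ray G ` R \<subseteq> ?B'" by auto
  have jb: "j \<in> {1..nrays G}" using j gens_subset by blast
  have lin: "rcoord ?B' w (x + ?e *\<^sub>R rvec ((-1) *s ray G j)) = rcoord ?B' w x - ?e * rcoord ?B' w (rvec (ray G j))" for w
    by (simp only: linear_add[OF linear_rcoord[OF B']] linear_cmul[OF linear_rcoord[OF B']] rvec_smult) simp
  have mem: "x + ?e *\<^sub>R rvec ((-1) *s ray G j) \<in> gen_cone ?B'"
    using l(4)[OF k] by (simp only: cone_gens(1)[OF max_in_fan[OF l(1)], symmetric])
  have pos: "0 \<le> rcoord ?B' w x - ?e * rcoord ?B' w (rvec (ray G j))" if "w \<in> ?B'" for w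
    using mem that unfolding gen_cone_eq[OF B' order_refl] lin[symmetric] by blast
  have js': "j \<notin> gens G \<sigma>'"
  proof
    assume "j \<in> gens G \<sigma>'"
    then have jB': "ray G j \<in> ?B'" by blast
    have "rcoord ?B' (ray G j) x = 0" using xc[OF B' RB' jb] by (simp add: R_def)
    moreover have "rcoord ?B' (ray G j) (rvec (ray G j)) = 1" using rcoord_basis[OF B' jB'] by simp
    ultimately show False using pos[OF jB'] by simp
  qed
  have cR: "card R = CARD('n) - 1" using card_gens_max[OF s] j finite_gens by (simp add: R_def)
  have "card (gens G \<sigma>' - R) = 1"
    using card_gens_max[OF l(1)] cR Rs' finR by (simp add: card_Diff_subset)
  then obtain l' where l': "gens G \<sigma>' - R = {l'}" by (auto simp: card_1_singleton_iff)
  then have g': "gens G \<sigma>' = insert l' R" using Rs' by blast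
  have l's: "l' \<notin> gens G \<sigma>" using l' js' by (auto simp: R_def)
  have l'b: "l' \<in> {1..nrays G}" using g' gens_subset by blast
  have Deq: "?D = R" using RD g' l's by (auto simp: gens_inter R_def)
  have dim: "dim (\<sigma> \<inter> \<sigma>') = CARD('n) - 1"
  proof -
    have "dim (gen_cone (ray G ` ?D)) = card (ray G ` ?D)" by (rule dim_gen_cone[OF B DB])
    also have "\<dots> = card R" using Deq card_image[OF inj_gens[of "\<sigma> \<inter> \<sigma>'"]] by simp
    finally show ?thesis using cR by (simp only: cone_gens(1)[OF f, symmetric])
  qed
  define c where "c = icoord ?B (ray G l') (ray G j)"
  define c' where "c' = icoord ?B' (ray G j) (ray G l')"
  \<comment> \<open>Expand the ray \<open>j\<close> in the basis of the new cone and read off its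
    coordinate at \<open>j\<close> in the old one: only the new ray contributes, so
    \<open>c'\<close> and \<open>c\<close> are mutually inverse integers.\<close>
  have "1 = icoord ?B (\<Sum>v\<in>?B'. icoord ?B' (ray G j) v *s v) (ray G j)"
    using icoord_basis[OF B, of "ray G j"] j by (simp add: icoord_sum[OF B'])
  also have "\<dots> = (\<Sum>v\<in>?B'. icoord ?B' (ray G j) v * icoord ?B v (ray G j))"
    by (simp add: icoord_sum_arg[OF B] icoord_smult[OF B])
  also have "\<dots> = (\<Sum>i\<in>insert l' R. icoord ?B' (ray G j) (ray G i) * icoord ?B (ray G i) (ray G j))"
    by (simp only: sum.reindex[OF inj_gens] o_def) (simp only: g')
  also have "\<dots> = c' * c + (\<Sum>i\<in>R. icoord ?B' (ray G j) (ray G i) * icoord ?B (ray G i) (ray G j))"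
    using finR l's by (subst sum.insert) (auto simp: R_def c_def c'_def)
  also have "(\<Sum>i\<in>R. icoord ?B' (ray G j) (ray G i) * icoord ?B (ray G i) (ray G j)) = 0"
  proof (rule sum.neutral, rule ballI)
    fix i assume i: "i \<in> R"
    then have "ray G j \<noteq> ray G i" using j inj_onD[OF inj_gens[of \<sigma>], of j i] by (auto simp: R_def)
    then show "icoord ?B' (ray G j) (ray G i) * icoord ?B (ray G i) (ray G j) = 0"
      using icoord_basis[OF B, of "ray G i" "ray G j"] i by (auto simp: R_def)
  qed
  finally have cc: "c' * c = 1" by simp
  \<comment> \<open>The starting point has coordinate 0 along the new ray, so staying in the new
    cone fixes the sign of \<open>c'\<close>.\<close>
  have "0 \<le> - (?e * of_int c')"
  proof -
    have lB: "ray G l' \<in> ?B'" using g' by blast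
    have "rcoord ?B' (ray G l') x = 0" using xc[OF B' RB' l'b] l's by (simp add: R_def)
    then show ?thesis using pos[OF lB] by (simp add: rcoord_rvec[OF B'] c'_def)
  qed
  then have "c' \<le> 0" by (simp add: divide_le_0_iff)
  then have "c = -1" using cc
    by (smt (verit) zmult_eq_1_iff)
  then have lj: "lk (lift \<sigma> (ray G l')) j = -1" using j by (simp add: lookup_lift c_def)
  show thesis by (rule that[OF l(1) l's l'b _ dim lj]) (simp add: g' R_def)
qed

end

section \<open>Invariant curves, ample weights and the Mori cone\<close>

context toric begin

abbreviation icurves :: "(nat \<Rightarrow>\<^sub>0 int) set" where "icurves \<equiv> invariant_curves G"

text \<open>For a curve class \<open>v\<close> this is the intersection number with the invariant
  divisor whose coefficients are \<open>w\<close>.\<close>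

definition pair :: "(nat \<Rightarrow> int) \<Rightarrow> (nat \<Rightarrow>\<^sub>0 int) \<Rightarrow> int" where
  "pair w v = (\<Sum>i\<in>{1..nrays G}. w i * lk v i)"

lemma pair_add: "pair w (a + b) = pair w a + pair w b"
  by (simp add: pair_def lookup_add algebra_simps sum.distrib)

lemma pair_zero [simp]: "pair w 0 = 0"
  by (simp add: pair_def)

lemma pair_scal: "pair w (scal t a) = t * pair w a"
  by (simp add: pair_def algebra_simps sum_distrib_left)

lemma inv_A1: "C \<in> icurves \<Longrightarrow> C \<in> A1 G"
  by (simp add: invariant_curves_def)

text \<open>The wall has n - 1 rays and each maximal cone n, so one ray lies off \<sigma>. The class
  is thus supported on the rays of one cone and a single further ray, where its coordinate is
  1.\<close>

lemma inv_cases: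
  assumes "C \<in> icurves"
  obtains \<sigma> \<sigma>' l where "\<sigma> \<in> maxc" "\<sigma>' \<in> maxc" "l \<in> {1..nrays G}" "l \<notin> gens G \<sigma>" "gens G \<sigma>' - gens G \<sigma> = {l}"
    "Poly_Mapping.keys C \<subseteq> insert l (gens G \<sigma>)" "lk C l = 1"
proof -
  obtain \<sigma> \<sigma>' where s: "\<sigma> \<in> maxc" "\<sigma>' \<in> maxc" "\<sigma> \<noteq> \<sigma>'" "dim (\<sigma> \<inter> \<sigma>') = CARD('n) - 1"
    and k: "Poly_Mapping.keys C \<subseteq> gens G \<sigma> \<union> gens G \<sigma>'"
    and o: "\<forall>i\<in>(gens G \<sigma> - gens G \<sigma>') \<union> (gens G \<sigma>' - gens G \<sigma>). lk C i = 1"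
    using assms unfolding invariant_curves_def by blast
  have f: "\<sigma> \<inter> \<sigma>' \<in> fan G" using inter_in_fan max_in_fan s by blast
  obtain B where B: "lattice_basis B" "ray G ` gens G (\<sigma> \<inter> \<sigma>') \<subseteq> B" using cone_gens(2)[OF f] by blast
  have "card (gens G \<sigma> \<inter> gens G \<sigma>') = CARD('n) - 1"
  proof -
    have "dim (\<sigma> \<inter> \<sigma>') = card (ray G ` gens G (\<sigma> \<inter> \<sigma>'))"
      using dim_gen_cone[OF B] by (simp only: cone_gens(1)[OF f, symmetric])
    also have "\<dots> = card (gens G (\<sigma> \<inter> \<sigma>'))" by (rule card_image[OF inj_gens])
    finally show ?thesis using s(4) by (simp only: gens_inter)
  qed
  then have "card (gens G \<sigma>' - gens G \<sigma>) = CARD('n) - (CARD('n) - 1)"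
    using card_gens_max[OF s(2)] card_Diff_subset_Int[of "gens G \<sigma>'" "gens G \<sigma>"] finite_gens
    by (simp add: Int_commute)
  then have "card (gens G \<sigma>' - gens G \<sigma>) = 1" using zero_less_card_finite[where 'a='n] by linarith
  then obtain l where l: "gens G \<sigma>' - gens G \<sigma> = {l}" by (auto simp: card_1_singleton_iff)
  show thesis
  proof (rule that[OF s(1,2) _ _ l])
    show "l \<in> {1..nrays G}" using l gens_subset[of \<sigma>'] by blast
    show "l \<notin> gens G \<sigma>" using l by blast
    show "Poly_Mapping.keys C \<subseteq> insert l (gens G \<sigma>)" using k l by blast
    show "lk C l = 1" using o l by blast
  qed
qed

text \<open>Two classes with the same cone and the same extra ray differ by a relation among the
  rays of that cone, which is zero because they form a basis.\<close>

lemma finite_inv: "finite icurves"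
proof -
  define X where "X \<sigma> l = {C \<in> A1 G. Poly_Mapping.keys C \<subseteq> insert l (gens G \<sigma>) \<and> lk C l = 1}" for \<sigma> l
  have "icurves \<subseteq> (\<Union>\<sigma>\<in>maxc. \<Union>l\<in>{1..nrays G} - gens G \<sigma>. X \<sigma> l)"
  proof
    fix C assume C: "C \<in> icurves"
    show "C \<in> (\<Union>\<sigma>\<in>maxc. \<Union>l\<in>{1..nrays G} - gens G \<sigma>. X \<sigma> l)"
    proof (rule inv_cases[OF C])
      fix \<sigma> l assume "\<sigma> \<in> maxc" "l \<in> {1..nrays G}" "l \<notin> gens G \<sigma>"
        "Poly_Mapping.keys C \<subseteq> insert l (gens G \<sigma>)" "lk C l = 1"
      then have "C \<in> X \<sigma> l" "l \<in> {1..nrays G} - gens G \<sigma>" using inv_A1[OF C] by (auto simp: X_def)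
      then show ?thesis using \<open>\<sigma> \<in> maxc\<close> by blast
    qed
  qed
  moreover have "finite (X \<sigma> l)" if s: "\<sigma> \<in> maxc" "l \<notin> gens G \<sigma>" for \<sigma> l
  proof -
    have "a = b" if "a \<in> X \<sigma> l" "b \<in> X \<sigma> l" for a b
    proof -
      have "Poly_Mapping.keys (a - b) \<subseteq> gens G \<sigma>"
        unfolding keys_sub_iff
      proof (intro allI impI)
        fix i assume "i \<notin> gens G \<sigma>"
        then show "lk (a - b) i = 0" using that by (cases "i = l") (auto simp: X_def keys_sub_iff)
      qed
      moreover have "ray_map G (a - b) = 0" using that by (auto simp: X_def A1_def ray_map_diff)
      ultimately have "a - b = 0" using lift_eqI[OF s(1)] lift_zero[OF s(1)] by metis
      then show ?thesis by simp
    qed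
    then have "X \<sigma> l \<subseteq> {SOME a. a \<in> X \<sigma> l}" by (metis singletonI someI subsetI)
    then show ?thesis using finite_subset by blast
  qed
  ultimately show ?thesis using finite_max by (elim finite_subset) auto
qed

lemma additive_sum: "Modules.additive h \<Longrightarrow> h (\<Sum>i\<in>I. c i *s v i) = (\<Sum>i\<in>I. (c i :: int) * h (v i :: int^'n) :: int)"
proof -
  assume h: "Modules.additive h"
  interpret h: Modules.additive h by fact
  have nat: "h (int k *s v) = int k * h v" for k v
  proof (induction k)
    case (Suc k)
    have "int (Suc k) *s v = v + int k *s v" by (simp add: vec_eq_iff algebra_simps)
    then show ?case using Suc by (simp add: h.add algebra_simps)
  qed (simp add: h.zero)
  have "h (k *s v) = k * h v" for k v
  proof (cases k)
    case (nonneg n)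
    then show ?thesis using nat by simp
  next
    case (neg n)
    have "k + int (Suc n) = 0" using neg by simp
    then have "k *s v + int (Suc n) *s v = 0"
      by (simp only: vector_sadd_rdistrib[symmetric] vector_smult_lzero)
    then have "h (k *s v) + h (int (Suc n) *s v) = 0"
      by (simp only: h.add[symmetric] h.zero)
    then have "h (k *s v) = - int (Suc n) * h v" using nat[of "Suc n" v] by linarith
    then show ?thesis by (simp only: neg)
  qed
  then show ?thesis by (simp add: h.sum)
qed

lemma pointed:
  assumes "\<sigma> \<in> fan G" shows "\<sigma> \<inter> uminus ` \<sigma> = {0}"
proof -
  have "\<forall>\<sigma>\<in>fan G. (\<exists>A. finite A \<and> \<sigma> = gen_cone A) \<and> \<sigma> \<inter> uminus ` \<sigma> = {0}"
    using fan_is_fan unfolding is_fan_def by (elim conjE)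
  from bspec[OF this assms] show ?thesis by (rule conjunct2)
qed

text \<open>Changing a divisor by a linear form does not affect its pairing with curve classes. Each
  maximal cone thus gives an equivalent divisor that is zero on its own rays and positive on the
  others, and the sum over all cones is positive on every ray.\<close>

lemma ample_weights: "\<exists>w. (\<forall>i\<in>{1..nrays G}. 0 < w i) \<and> (\<forall>C\<in>icurves. 0 < pair w C)"
proof -
  obtain a where "ample G a" using projective by (auto simp: projective_fan_def)
  then have "\<forall>\<sigma>\<in>maxc. \<exists>h. Modules.additive h \<and>
     (\<forall>i\<in>gens G \<sigma>. h (ray G i) = - a i) \<and> (\<forall>i\<in>{1..nrays G} - gens G \<sigma>. h (ray G i) > - a i)"
    unfolding ample_def .
  then obtain h where h: "\<And>\<sigma>. \<sigma> \<in> maxc \<Longrightarrow> Modules.additive (h \<sigma>)"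
     "\<And>\<sigma> i. \<sigma> \<in> maxc \<Longrightarrow> i \<in> gens G \<sigma> \<Longrightarrow> h \<sigma> (ray G i) = - a i"
     "\<And>\<sigma> i. \<sigma> \<in> maxc \<Longrightarrow> i \<in> {1..nrays G} - gens G \<sigma> \<Longrightarrow> h \<sigma> (ray G i) > - a i"
    by metis
  \<comment> \<open>The ample divisor normalised to vanish on \<sigma>. Its only contribution to a
    wall curve of \<sigma> comes from the ray off \<sigma>, which makes the pairing
    positive.\<close>
  define b where "b \<sigma> i = a i + h \<sigma> (ray G i)" for \<sigma> i
  have b0: "b \<sigma> i = 0" if "\<sigma> \<in> maxc" "i \<in> gens G \<sigma>" for \<sigma> i using h(2)[OF that] by (simp add: b_def)
  have b1: "b \<sigma> i > 0" if "\<sigma> \<in> maxc" "i \<in> {1..nrays G} - gens G \<sigma>" for \<sigma> i using h(3)[OF that] by (simp add: b_def)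
  have bn: "b \<sigma> i \<ge> 0" if "\<sigma> \<in> maxc" "i \<in> {1..nrays G}" for \<sigma> i
    using b0[OF that(1)] b1[OF that(1)] that by (metis DiffI less_eq_int_code(1) order_le_less)
  have pb: "pair (b \<sigma>) C = pair a C" if "\<sigma> \<in> maxc" "ray_map G C = 0" for \<sigma> C
  proof -
    have "h \<sigma> (ray_map G C) = (\<Sum>i\<in>{1..nrays G}. lk C i * h \<sigma> (ray G i))"
      unfolding ray_map_def by (rule additive_sum[OF h(1)[OF that(1)]])
    moreover have "h \<sigma> 0 = 0" using h(1)[OF that(1)] by (rule additive.zero)
    ultimately show ?thesis using that(2)
      by (simp add: pair_def b_def algebra_simps sum.distrib)
  qed
  have pC: "0 < pair a C" if C: "C \<in> icurves" for C
  proof (rule inv_cases[OF C])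
    fix \<sigma> \<sigma>' l assume s: "\<sigma> \<in> maxc" "l \<in> {1..nrays G}" "l \<notin> gens G \<sigma>"
      "Poly_Mapping.keys C \<subseteq> insert l (gens G \<sigma>)" "lk C l = 1"
    have "pair (b \<sigma>) C = (\<Sum>i\<in>{l}. b \<sigma> i * lk C i)"
      unfolding pair_def
    proof (rule sum.mono_neutral_right)
      show "\<forall>i\<in>{1..nrays G} - {l}. b \<sigma> i * lk C i = 0"
        using s b0[OF s(1)] by (auto simp: keys_sub_iff)
    qed (use s in auto)
    also have "\<dots> > 0" using s b1[OF s(1)] by simp
    finally show ?thesis using pb[OF s(1)] inv_A1[OF C] by (simp add: A1_def)
  qed
  \<comment> \<open>Every ray gets a positive contribution from some cone missing it: a cone
    containing the opposite vector, by completeness and pointedness.\<close>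
  define w where "w i = (\<Sum>\<sigma>\<in>maxc. b \<sigma> i)" for i
  have "0 < w i" if i: "i \<in> {1..nrays G}" for i
  proof -
    obtain \<sigma> where s: "\<sigma> \<in> maxc" "rvec ((-1) *s ray G i) \<in> \<sigma>" using cover by blast
    have "i \<notin> gens G \<sigma>"
    proof
      assume "i \<in> gens G \<sigma>"
      then have "rvec (ray G i) \<in> \<sigma>" by (simp add: gens_def)
      moreover have "rvec (ray G i) \<in> uminus ` \<sigma>" using imageI[OF s(2), of uminus] by simp
      ultimately have "rvec (ray G i) = 0"
        using pointed[OF max_in_fan[OF s(1)]] by blast
      then show False using primitive_nonzero[OF ray_primitive[OF i]] by (metis rvec_0 rvec_inject)
    qed
    then have "b \<sigma> i > 0" using b1 s i by blast
    then show ?thesis unfolding w_def using sum_pos2[OF finite_max s(1)] bn i by metis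
  qed
  moreover have "0 < pair w C" if C: "C \<in> icurves" for C
  proof -
    have "pair w C = (\<Sum>\<sigma>\<in>maxc. pair (b \<sigma>) C)"
      unfolding pair_def w_def sum_distrib_right by (rule sum.swap)
    also have "\<dots> = (\<Sum>\<sigma>\<in>maxc. pair a C)"
      using pb inv_A1[OF C] by (intro sum.cong) (auto simp: A1_def)
    also have "\<dots> = int (card maxc) * pair a C" by simp
    also have "\<dots> > 0"
    proof -
      have "0 < card maxc" using cover[of 0] finite_max by (auto simp: card_gt_0_iff)
      then show ?thesis using pC[OF C] by simp
    qed
    finally show ?thesis .
  qed
  ultimately show ?thesis by blast
qed

definition ample_wt :: "nat \<Rightarrow> int" where
  "ample_wt = (SOME w. (\<forall>i\<in>{1..nrays G}. 0 < w i) \<and> (\<forall>C\<in>icurves. 0 < pair w C))"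

lemma ample_wt_prop: "(\<forall>i\<in>{1..nrays G}. 0 < ample_wt i) \<and> (\<forall>C\<in>icurves. 0 < pair ample_wt C)"
  unfolding ample_wt_def by (rule someI_ex[OF ample_weights])

lemma ample_wt_pos: "i \<in> {1..nrays G} \<Longrightarrow> 0 < ample_wt i"
  using ample_wt_prop by blast

lemma ample_wt_inv: "C \<in> icurves \<Longrightarrow> 0 < pair ample_wt C"
  using ample_wt_prop by blast

lemma NE_A1: "p \<in> NE G \<Longrightarrow> p \<in> A1 G"
  by (simp add: NE_def)

lemma A1_add: "a \<in> A1 G \<Longrightarrow> b \<in> A1 G \<Longrightarrow> a + b \<in> A1 G"
  by (auto simp: A1_def Zd_iff lookup_add ray_map_add)

lemma A1_diff: "a \<in> A1 G \<Longrightarrow> b \<in> A1 G \<Longrightarrow> a - b \<in> A1 G"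
  by (auto simp: A1_def Zd_iff ray_map_diff)

lemma A1_scal: "a \<in> A1 G \<Longrightarrow> scal t a \<in> A1 G"
  by (auto simp: A1_def Zd_iff ray_map_scal)

lemma NE_zero [simp]: "0 \<in> NE G"
proof -
  have "0 \<in> A1 G" by (simp add: A1_def Zd_iff)
  then show ?thesis unfolding NE_def by (intro CollectI conjI exI[of _ "\<lambda>_. 0"]) simp_all
qed

lemma NE_add: 
  assumes "p \<in> NE G" "q \<in> NE G" shows "p + q \<in> NE G"
proof -
  obtain c e where "(\<forall>C\<in>icurves. 0 \<le> c C) \<and> (\<forall>i. real_of_int (lk p i) = (\<Sum>C\<in>icurves. c C * real_of_int (lk C i)))"
     "(\<forall>C\<in>icurves. 0 \<le> e C) \<and> (\<forall>i. real_of_int (lk q i) = (\<Sum>C\<in>icurves. e C * real_of_int (lk C i)))"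
    using assms unfolding NE_def by blast
  then show ?thesis using assms A1_add unfolding NE_def
    by (auto intro!: exI[of _ "\<lambda>C. c C + e C"] simp: lookup_add algebra_simps sum.distrib)
qed

lemma NE_scal_inv:
  assumes C: "C \<in> icurves" and t: "0 \<le> t" shows "scal t C \<in> NE G"
proof -
  have "(\<Sum>D\<in>icurves. (if D = C then of_int t else 0) * real_of_int (lk D i)) = (\<Sum>D\<in>icurves. if D = C then of_int t * real_of_int (lk C i) else 0)" for i
    by (rule sum.cong) auto
  then show ?thesis using C t finite_inv inv_A1 A1_scal unfolding NE_def
    by (auto intro!: exI[of _ "\<lambda>D. if D = C then of_int t else 0"])
qed

lemma NE_inv: "C \<in> icurves \<Longrightarrow> C \<in> NE G"
proof -
  have "scal 1 C = C" by (rule poly_mapping_eqI) simp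
  then show "C \<in> icurves \<Longrightarrow> C \<in> NE G" using NE_scal_inv[of C 1] by simp
qed

text \<open>Pointedness of the Mori cone: the pairing is a combination of positive numbers with
  nonnegative coefficients, so if it vanishes all coefficients do.\<close>

lemma pair_NE:
  assumes "p \<in> NE G" shows "0 \<le> pair ample_wt p" and "pair ample_wt p = 0 \<Longrightarrow> p = 0"
proof -
  obtain c where c: "\<forall>C\<in>icurves. 0 \<le> c C" "\<And>i. real_of_int (lk p i) = (\<Sum>C\<in>icurves. c C * real_of_int (lk C i))"
    using assms unfolding NE_def by blast
  have e: "real_of_int (pair ample_wt p) = (\<Sum>C\<in>icurves. c C * real_of_int (pair ample_wt C))"
  proof -
    have "real_of_int (pair ample_wt p) = (\<Sum>i\<in>{1..nrays G}. \<Sum>C\<in>icurves. of_int (ample_wt i) * (c C * real_of_int (lk C i)))"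
      by (simp add: pair_def c(2) sum_distrib_left)
    also have "\<dots> = (\<Sum>C\<in>icurves. \<Sum>i\<in>{1..nrays G}. c C * (of_int (ample_wt i) * real_of_int (lk C i)))"
      by (subst sum.swap) (simp add: algebra_simps)
    finally show ?thesis by (simp add: pair_def sum_distrib_left)
  qed
  have nn: "0 \<le> c C * real_of_int (pair ample_wt C)" if "C \<in> icurves" for C
    using c(1) ample_wt_inv[OF that] that by simp
  show "0 \<le> pair ample_wt p" using e nn by (metis (no_types, lifting) of_int_0_le_iff sum_nonneg)
  assume "pair ample_wt p = 0"
  then have "(\<Sum>C\<in>icurves. c C * real_of_int (pair ample_wt C)) = 0" using e by simp
  then have "\<forall>C\<in>icurves. c C * real_of_int (pair ample_wt C) = 0"
    using sum_nonneg_eq_0_iff[OF finite_inv, of "\<lambda>C. c C * real_of_int (pair ample_wt C)"] nn by simp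
  then have "\<forall>C\<in>icurves. c C = 0" using ample_wt_inv by fastforce
  then have "real_of_int (lk p i) = 0" for i by (simp add: c(2))
  then show "p = 0" by (intro poly_mapping_eqI) simp
qed

lemma finite_bounded: "finite {a \<in> Zd G. \<forall>i. \<bar>lk a i\<bar> \<le> N}"
proof (rule finite_imageD)
  let ?f = "\<lambda>a. \<lambda>i\<in>{1..nrays G}. lk a i"
  have "?f ` {a \<in> Zd G. \<forall>i. \<bar>lk a i\<bar> \<le> N} \<subseteq> {1..nrays G} \<rightarrow>\<^sub>E {-N..N}"
    by (auto simp: abs_le_iff) (metis minus_le_iff)+
  then show "finite (?f ` {a \<in> Zd G. \<forall>i. \<bar>lk a i\<bar> \<le> N})"
    by (rule finite_subset) (simp add: finite_PiE)
  show "inj_on ?f {a \<in> Zd G. \<forall>i. \<bar>lk a i\<bar> \<le> N}"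
  proof (rule inj_onI)
    fix a b assume ab: "a \<in> {a \<in> Zd G. \<forall>i. \<bar>lk a i\<bar> \<le> N}" "b \<in> {a \<in> Zd G. \<forall>i. \<bar>lk a i\<bar> \<le> N}" "?f a = ?f b"
    show "a = b"
    proof (rule poly_mapping_eqI)
      fix i show "lk a i = lk b i"
      proof (cases "i \<in> {1..nrays G}")
        case True
        then show ?thesis using fun_cong[OF ab(3), of i] by (simp only: restrict_apply if_True)
      qed (use ab in \<open>auto simp: Zd_iff\<close>)
    qed
  qed
qed

text \<open>Gordan's argument: subtract an invariant curve as long as some coefficient is at least
  1. What remains has coefficients below 1, hence bounded coordinates, and only finitely many
  lattice points are possible.\<close>

lemma NE_generators:
  "\<exists>\<Gamma>. finite \<Gamma> \<and> \<Gamma> \<subseteq> NE G - {0} \<and> (\<forall>p\<in>NE G - {0}. \<exists>g\<in>\<Gamma>. \<exists>p'\<in>NE G. p = g + p')"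
proof -
  define N where "N = (\<Sum>i\<in>{1..nrays G}. \<Sum>C\<in>icurves. \<bar>lk C i\<bar>)"
  define \<Gamma> where "\<Gamma> = icurves \<union> {p \<in> NE G - {0}. \<forall>i. \<bar>lk p i\<bar> \<le> N}"
  have "finite {p \<in> NE G - {0}. \<forall>i. \<bar>lk p i\<bar> \<le> N}"
    by (rule finite_subset[OF _ finite_bounded[of N]]) (auto simp: NE_def A1_def)
  then have "finite \<Gamma>" unfolding \<Gamma>_def using finite_inv by simp
  moreover have "0 \<notin> icurves" using ample_wt_inv[of 0] by auto
  then have "\<Gamma> \<subseteq> NE G - {0}" using NE_inv by (auto simp: \<Gamma>_def)
  moreover have "\<exists>g\<in>\<Gamma>. \<exists>p'\<in>NE G. p = g + p'" if p: "p \<in> NE G - {0}" for p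
  proof -
    obtain c where c: "\<forall>C\<in>icurves. 0 \<le> c C" "\<And>i. real_of_int (lk p i) = (\<Sum>C\<in>icurves. c C * real_of_int (lk C i))"
      using p unfolding NE_def by blast
    show ?thesis
    proof (cases "\<exists>C\<in>icurves. 1 \<le> c C")
      case True
      then obtain C where C: "C \<in> icurves" "1 \<le> c C" by blast
      have "p - C \<in> NE G" unfolding NE_def
      proof (intro CollectI conjI exI[of _ "\<lambda>D. if D = C then c D - 1 else c D"] ballI allI)
        show "p - C \<in> A1 G" using p NE_A1 inv_A1[OF C(1)] A1_diff by blast
        show "0 \<le> (if D = C then c D - 1 else c D)" if "D \<in> icurves" for D using C c(1) that by auto
        show "real_of_int (lk (p - C) i) = (\<Sum>D\<in>icurves. (if D = C then c D - 1 else c D) * real_of_int (lk D i))" for i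
          using sum.remove[OF finite_inv C(1), of "\<lambda>D. c D * real_of_int (lk D i)"]
            sum.remove[OF finite_inv C(1), of "\<lambda>D. (if D = C then c D - 1 else c D) * real_of_int (lk D i)"]
          by (simp add: c(2) algebra_simps)
      qed
      moreover have "C \<in> \<Gamma>" using C by (simp add: \<Gamma>_def)
      moreover have "p = C + (p - C)" by simp
      ultimately show ?thesis by blast
    next
      case False
      have "\<bar>lk p i\<bar> \<le> N" for i
      proof (cases "i \<in> {1..nrays G}")
        case True
        have "real_of_int \<bar>lk p i\<bar> \<le> (\<Sum>C\<in>icurves. \<bar>c C * real_of_int (lk C i)\<bar>)"
          by (simp add: c(2) sum_abs)
        also have "\<dots> \<le> (\<Sum>C\<in>icurves. \<bar>real_of_int (lk C i)\<bar>)"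
        proof (rule sum_mono)
          fix C assume "C \<in> icurves"
          then have "\<bar>c C\<bar> \<le> 1" using False c(1) by (auto simp: not_le intro: less_imp_le)
          then show "\<bar>c C * real_of_int (lk C i)\<bar> \<le> \<bar>real_of_int (lk C i)\<bar>"
            by (simp add: abs_mult mult_left_le_one_le)
        qed
        also have "\<dots> = real_of_int (\<Sum>C\<in>icurves. \<bar>lk C i\<bar>)" by simp
        finally have "\<bar>lk p i\<bar> \<le> (\<Sum>C\<in>icurves. \<bar>lk C i\<bar>)" by (simp only: of_int_le_iff)
        also have "\<dots> \<le> N" unfolding N_def
          by (rule member_le_sum[OF True]) (auto intro: sum_nonneg)
        finally show ?thesis .
      next
        case False
        then have "lk p i = 0" using p by (auto simp: NE_def A1_def Zd_iff)
        moreover have "0 \<le> N" unfolding N_def by (intro sum_nonneg) auto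
        ultimately show ?thesis by simp
      qed
      then have "p \<in> \<Gamma>" using p by (simp add: \<Gamma>_def)
      then show ?thesis using NE_zero by (metis add.right_neutral)
    qed
  qed
  ultimately show ?thesis by (intro exI[of _ \<Gamma>] conjI ballI) simp_all
qed

text \<open>
  Crossing the wall on which a coordinate of \<open>m\<close> is negative changes the lift by a positive
  multiple of an invariant curve, so it raises the ample height; the process stops at a cone containing \<open>m\<close>.
\<close>

lemma pl_lift_minus_lift:
  assumes "\<sigma> \<in> maxc" shows "pl_lift G m - lift \<sigma> m \<in> NE G"
proof (rule ccontr)
  define Bad where "Bad = {\<sigma>\<in>maxc. pl_lift G m - lift \<sigma> m \<notin> NE G}"
  assume "pl_lift G m - lift \<sigma> m \<notin> NE G"
  then have "Bad \<noteq> {}" "finite Bad" using assms finite_max by (auto simp: Bad_def)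
  then obtain \<tau> where t: "\<tau> \<in> Bad" "\<And>\<tau>'. \<tau>' \<in> Bad \<Longrightarrow> pair ample_wt (lift \<tau>' m) \<le> pair ample_wt (lift \<tau> m)"
    using Max_in[of "(\<lambda>\<tau>. pair ample_wt (lift \<tau> m)) ` Bad"] Max_ge[of "(\<lambda>\<tau>. pair ample_wt (lift \<tau> m)) ` Bad"] by fastforce
  have tm: "\<tau> \<in> maxc" using t by (simp add: Bad_def)
  have "rvec m \<notin> \<tau>" using t(1) pl_lift_eq_lift[OF tm] by (auto simp: Bad_def)
  then obtain j where j: "lk (lift \<tau> m) j < 0" using mem_max_iff[OF tm] by (auto simp: not_le)
  then have jg: "j \<in> gens G \<tau>" by (auto simp: lookup_lift split: if_splits)
  obtain \<tau>' l where w: "\<tau>' \<in> maxc" "l \<notin> gens G \<tau>" "l \<in> {1..nrays G}" "gens G \<tau>' = insert l (gens G \<tau> - {j})"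
    "dim (\<tau> \<inter> \<tau>') = CARD('n) - 1" "lk (lift \<tau> (ray G l)) j = -1"
    using wall_crossing[OF tm jg] by metis
  \<comment> \<open>The relation expressing the new ray through the rays of \<tau>. Because its
    coordinate at \<open>j\<close> is 1 as well, it is the class of the wall curve.\<close>
  define C where "C = Poly_Mapping.single l 1 - lift \<tau> (ray G l)"
  have lC: "lk C i = (if i = l then 1 else 0) - lk (lift \<tau> (ray G l)) i" for i
    by (simp add: C_def lookup_single when_def)
  have Cj: "lk C j = 1" using w jg by (auto simp: lC)
  have Cl: "lk C l = 1" using w by (simp add: lC lookup_lift)
  have kC: "Poly_Mapping.keys C \<subseteq> insert l (gens G \<tau>)"
    by (auto simp: keys_sub_iff lC lookup_lift)
  have rC: "ray_map G C = 0" using w(3) by (simp add: C_def ray_map_diff ray_map_single ray_map_lift[OF tm])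
  have "C \<in> icurves"
  proof -
    have "C \<in> A1 G" using kC rC w(3) gens_subset[of \<tau>] by (auto simp: A1_def Zd_def)
    moreover have "\<tau> \<noteq> \<tau>'" using w by auto
    moreover have "Poly_Mapping.keys C \<subseteq> gens G \<tau> \<union> gens G \<tau>'" using kC w(4) by blast
    moreover have "\<forall>i\<in>(gens G \<tau> - gens G \<tau>') \<union> (gens G \<tau>' - gens G \<tau>). lk C i = 1"
      using Cj Cl w by auto
    ultimately show ?thesis unfolding invariant_curves_def using tm w(1,5) by blast
  qed
  \<comment> \<open>Chosen to cancel the coordinate at \<open>j\<close>, the ray missing from
    \<tau>'.\<close>
  define t where "t = - lk (lift \<tau> m) j"
  have e: "lift \<tau>' m = lift \<tau> m + scal t C"
  proof (rule lift_eqI[OF w(1)])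
    show "ray_map G (lift \<tau> m + scal t C) = m"
      by (simp add: ray_map_add ray_map_scal rC ray_map_lift[OF tm])
    have "lk C i = 0" if "i \<notin> gens G \<tau>'" "i \<noteq> j" for i
      using kC that w(4) by (auto simp: keys_sub_iff)
    then show "Poly_Mapping.keys (lift \<tau> m + scal t C) \<subseteq> gens G \<tau>'"
      using Cj w(4) by (auto simp: keys_sub_iff lookup_add t_def lookup_lift)
  qed
  have t0: "0 < t" using j by (simp add: t_def)
  have "pair ample_wt (lift \<tau>' m) > pair ample_wt (lift \<tau> m)"
    using ample_wt_inv[OF \<open>C \<in> icurves\<close>] t0 by (simp add: e pair_add pair_scal)
  then have "\<tau>' \<notin> Bad" using t(2) by fastforce
  then have "pl_lift G m - lift \<tau>' m \<in> NE G" using w(1) by (simp add: Bad_def)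
  then have "pl_lift G m - lift \<tau>' m + scal t C \<in> NE G"
    using NE_add NE_scal_inv[OF \<open>C \<in> icurves\<close>] t0 by simp
  then show False using t(1) by (simp add: Bad_def e)
qed

text \<open>The bending of the piecewise linear lift: a product of monomials over \<open>m\<close>
  and \<open>m'\<close> acquires the base factor with this exponent.\<close>

definition cocyc :: "int^'n \<Rightarrow> int^'n \<Rightarrow> (nat \<Rightarrow>\<^sub>0 int)" where
  "cocyc m m' = pl_lift G m + pl_lift G m' - pl_lift G (m + m')"

text \<open>On a cone containing \<open>m + m'\<close> the lift of the sum is linear, so the bending
  is a sum of two differences between piecewise linear and linear lifts.\<close>

lemma cocyc_NE: "cocyc m m' \<in> NE G"
proof -
  obtain \<sigma> where s: "\<sigma> \<in> maxc" "rvec (m + m') \<in> \<sigma>" using cover by blast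
  have "cocyc m m' = (pl_lift G m - lift \<sigma> m) + (pl_lift G m' - lift \<sigma> m')"
    by (simp add: cocyc_def pl_lift_eq_lift[OF s] lift_add[OF s(1)])
  then show ?thesis using NE_add pl_lift_minus_lift[OF s(1)] by simp
qed

section \<open>Combinatorics of the ordering of maximal cones\<close>

abbreviation sigma_gens :: "nat \<Rightarrow> nat set" where "sigma_gens i \<equiv> gens G (cone_seq G i)"
abbreviation tau_gens :: "nat \<Rightarrow> nat set" where "tau_gens i \<equiv> gens G (tau G i)"

lemma cone_seq_bij: "bij_betw (cone_seq G) {1..mu G} maxc"
  using ordering unfolding cone_ordering_def by (rule conjunct1)

lemma cone_seq_max: "i \<in> {1..mu G} \<Longrightarrow> cone_seq G i \<in> maxc"
  using cone_seq_bij by (auto simp: bij_betw_def)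

lemma max_cone_seq: "\<sigma> \<in> maxc \<Longrightarrow> \<exists>i\<in>{1..mu G}. \<sigma> = cone_seq G i"
  using cone_seq_bij by (auto simp: bij_betw_def)

lemma tau_subset: "tau G i \<subseteq> cone_seq G i"
  by (auto simp: tau_def)

lemma tau_gens_subset: "tau_gens i \<subseteq> sigma_gens i"
  using tau_subset by (auto simp: gens_def)

lemma tau_in_fan: "i \<in> {1..mu G} \<Longrightarrow> tau G i \<in> fan G"
proof -
  assume i: "i \<in> {1..mu G}"
  have "finite F \<Longrightarrow> F \<subseteq> fan G \<Longrightarrow> cone_seq G i \<inter> \<Inter>F \<in> fan G" for F
  proof (induction F rule: finite_induct)
    case empty
    then show ?case using cone_seq_max[OF i] max_in_fan by simp
  next
    case (insert x F)
    have "cone_seq G i \<inter> \<Inter>(insert x F) = (cone_seq G i \<inter> \<Inter>F) \<inter> x" by blast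
    then show ?case using insert inter_in_fan by simp
  qed
  moreover have "{cone_seq G j | j. i < j \<and> j \<le> mu G \<and> dim (cone_seq G i \<inter> cone_seq G j) = CARD('n) - 1} \<subseteq> fan G"
    using cone_seq_max max_in_fan by auto
  ultimately show ?thesis unfolding tau_def using finite_subset[OF _ finite_fan] by blast
qed

lemma shelling: "i \<in> {1..mu G} \<Longrightarrow> j \<in> {1..mu G} \<Longrightarrow> tau_gens i \<subseteq> sigma_gens j \<Longrightarrow> i \<le> j"
proof -
  assume ij: "i \<in> {1..mu G}" "j \<in> {1..mu G}" "tau_gens i \<subseteq> sigma_gens j"
  then have "tau G i \<subseteq> cone_seq G j"
    using gens_mono_iff[OF tau_in_fan max_in_fan[OF cone_seq_max]] by blast
  then show "i \<le> j" using ordering ij unfolding cone_ordering_def by blast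
qed

text \<open>By definition \<tau>_i lies in every later neighbour of \<sigma>_i, while the neighbour
  across the wall opposite \<open>j\<close> does not contain \<open>j\<close>. So a ray of \<tau>_i
  is dropped only when stepping to an earlier cone.\<close>

lemma tau_gens_wall:
  assumes i: "i \<in> {1..mu G}" and j: "j \<in> sigma_gens i"
  obtains i' where "i' \<in> {1..mu G}" "i' \<noteq> i" "sigma_gens i - {j} \<subseteq> sigma_gens i'" "i < i' \<Longrightarrow> j \<notin> tau_gens i"
proof -
  obtain \<sigma>' l where w0: "\<sigma>' \<in> maxc" "l \<notin> sigma_gens i" "l \<in> {1..nrays G}" "gens G \<sigma>' = insert l (sigma_gens i - {j})"
    "dim (cone_seq G i \<inter> \<sigma>') = CARD('n) - 1" "lk (lift (cone_seq G i) (ray G l)) j = -1"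
    by (rule wall_crossing[OF cone_seq_max[OF i] j])
  note w = w0(1,2,4,5)
  obtain i' where i': "i' \<in> {1..mu G}" "\<sigma>' = cone_seq G i'" using max_cone_seq[OF w(1)] by blast
  have "j \<notin> tau_gens i" if "i < i'"
  proof -
    have "cone_seq G i' \<in> {cone_seq G j | j. i < j \<and> j \<le> mu G \<and> dim (cone_seq G i \<inter> cone_seq G j) = CARD('n) - 1}"
      using that w(4) i' by force
    then have "tau G i \<subseteq> cone_seq G i'" unfolding tau_def by (rule Int_lower2[THEN subset_trans, OF Inter_lower])
    then have "tau_gens i \<subseteq> sigma_gens i'" by (auto simp: gens_def)
    then show ?thesis using w(2,3) i'(2) j by auto
  qed
  then show thesis using that[OF i'(1)] w i'(2) by auto
qed

end

section \<open>Rings of convergent series over a graded monoid\<close>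

definition conv :: "'m::monoid_add set \<Rightarrow> ('m \<Rightarrow> complex) \<Rightarrow> ('m \<Rightarrow> complex) \<Rightarrow> 'm \<Rightarrow> complex" where
  "conv Q c d = (\<lambda>x. \<Sum>(y, z)\<in>{(y, z). y \<in> Q \<and> z \<in> Q \<and> y + z = x}. c y * d z)"

text \<open>
  For a finitely generated \<open>Q\<close> graded by \<open>H\<close> this is absolute convergence at every point of the
  analytic space of \<open>Q\<close>, in a form that is stable under convolution and restriction of supports.
\<close>

definition growth :: "'m set \<Rightarrow> ('m \<Rightarrow> nat) \<Rightarrow> ('m \<Rightarrow> complex) \<Rightarrow> bool" where
  "growth Q H c \<longleftrightarrow> (\<forall>x. x \<notin> Q \<longrightarrow> c x = 0) \<and> (\<forall>R::nat. \<exists>M::real. \<forall>x\<in>Q. norm (c x) * real R ^ H x \<le> M)"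

definition mono1 :: "'m \<Rightarrow> 'm \<Rightarrow> complex" where
  "mono1 x = (\<lambda>y. if y = x then 1 else 0)"

definition series_ring :: "'m::monoid_add set \<Rightarrow> ('m \<Rightarrow> nat) \<Rightarrow> ('m \<Rightarrow> complex) ring" where
  "series_ring Q H = \<lparr>carrier = {c. growth Q H c}, mult = conv Q, one = mono1 0, zero = (\<lambda>x. 0), add = (\<lambda>c d x. c x + d x)\<rparr>"

lemma growthI:
  assumes "\<And>x. x \<notin> Q \<Longrightarrow> c x = 0" "\<And>R::nat. \<exists>M::real. \<forall>x\<in>Q. norm (c x) * real R ^ H x \<le> M"
  shows "growth Q H c"
  using assms by (simp add: growth_def)

lemma growth_out: "growth Q H c \<Longrightarrow> x \<notin> Q \<Longrightarrow> c x = 0"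
  by (simp add: growth_def)

lemma growth_bound: "growth Q H c \<Longrightarrow> \<exists>M::real. M \<ge> 0 \<and> (\<forall>x\<in>Q. norm (c x) * real R ^ H x \<le> M)"
proof -
  assume "growth Q H c"
  then obtain M where "\<forall>x\<in>Q. norm (c x) * real R ^ H x \<le> M" unfolding growth_def by blast
  then have "\<forall>x\<in>Q. norm (c x) * real R ^ H x \<le> max 0 M" by fastforce
  then show ?thesis by (intro exI[of _ "max 0 M"]) simp
qed

lemma growth_zero: "growth Q H (\<lambda>x. 0)"
  by (auto intro!: growthI)

lemma growth_add: assumes "growth Q H c" "growth Q H d" shows "growth Q H (\<lambda>x. c x + d x)"
proof (rule growthI)
  fix R :: nat
  obtain M N where "\<forall>x\<in>Q. norm (c x) * real R ^ H x \<le> M" "\<forall>x\<in>Q. norm (d x) * real R ^ H x \<le> N"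
    using growth_bound[OF assms(1)] growth_bound[OF assms(2)] by metis
  moreover have "norm (c x + d x) * real R ^ H x \<le> norm (c x) * real R ^ H x + norm (d x) * real R ^ H x" for x
    unfolding distrib_right[symmetric] by (intro mult_right_mono norm_triangle_ineq) simp
  ultimately show "\<exists>M. \<forall>x\<in>Q. norm (c x + d x) * real R ^ H x \<le> M"
    by (intro exI[of _ "M + N"]) (meson add_mono order_trans)
qed (use assms in \<open>auto simp: growth_def\<close>)

lemma growth_dominated:
  assumes d: "growth Q H d" and 0: "\<And>x. x \<notin> Q \<Longrightarrow> c x = 0" and le: "\<And>x. x \<in> Q \<Longrightarrow> norm (c x) \<le> B * norm (d x)"
    and B: "0 \<le> B"
  shows "growth Q H c"
proof (rule growthI[OF 0])
  fix R :: nat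
  obtain M where M: "\<forall>x\<in>Q. norm (d x) * real R ^ H x \<le> M" using growth_bound[OF d] by metis
  have "norm (c x) * real R ^ H x \<le> B * M" if x: "x \<in> Q" for x
  proof -
    have "norm (c x) * real R ^ H x \<le> (B * norm (d x)) * real R ^ H x"
      by (intro mult_right_mono le x) simp
    also have "\<dots> = B * (norm (d x) * real R ^ H x)" by simp
    also have "\<dots> \<le> B * M" using M x B by (intro mult_left_mono) auto
    finally show ?thesis .
  qed
  then show "\<exists>M. \<forall>x\<in>Q. norm (c x) * real R ^ H x \<le> M" by blast
qed

lemma growth_restrict: "growth Q H d \<Longrightarrow> growth Q H (\<lambda>x. if P x then d x else 0)"
  by (rule growth_dominated[of Q H d _ 1]) (auto simp: growth_def)

lemma growth_scale: "growth Q H d \<Longrightarrow> growth Q H (\<lambda>x. a * d x)"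
  by (rule growth_dominated[of Q H d _ "norm a"]) (auto simp: growth_def norm_mult)

lemma growth_uminus: "growth Q H d \<Longrightarrow> growth Q H (\<lambda>x. - d x)"
  using growth_scale[of Q H d "-1"] by simp

lemma growth_sum: "(\<And>i. i \<in> I \<Longrightarrow> growth Q H (f i)) \<Longrightarrow> growth Q H (\<lambda>x. \<Sum>i\<in>I. f i x)"
  by (induction I rule: infinite_finite_induct) (auto intro: growth_zero growth_add)

lemma growth_finite_support:
  assumes "finite {x. c x \<noteq> 0}" "{x. c x \<noteq> 0} \<subseteq> Q"
  shows "growth Q H c"
proof (rule growthI)
  show "c x = 0" if "x \<notin> Q" for x using assms(2) that by blast
  fix R :: nat
  let ?f = "\<lambda>x. norm (c x) * real R ^ H x"
  have "?f x \<le> sum ?f {x. c x \<noteq> 0}" for x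
  proof (cases "c x = 0")
    case False
    then show ?thesis by (intro member_le_sum) (use assms in auto)
  qed (auto intro: sum_nonneg)
  then show "\<exists>M. \<forall>x\<in>Q. ?f x \<le> M" by blast
qed

text \<open>\<open>gen\<close> splits off one generator at a time; full decompositions follow by
  induction on the additive height, which is positive on generators.\<close>

locale height_monoid =
  fixes Q :: "'m::cancel_comm_monoid_add set" and H :: "'m \<Rightarrow> nat" and \<Gamma> :: "'m set"
  assumes zero_mem: "0 \<in> Q" and add_mem: "x \<in> Q \<Longrightarrow> y \<in> Q \<Longrightarrow> x + y \<in> Q"
    and H_add: "x \<in> Q \<Longrightarrow> y \<in> Q \<Longrightarrow> H (x + y) = H x + H y"
    and fin_gen: "finite \<Gamma>" and gen_sub: "\<Gamma> \<subseteq> Q" and H_gen: "g \<in> \<Gamma> \<Longrightarrow> 0 < H g"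
    and gen: "x \<in> Q \<Longrightarrow> x \<noteq> 0 \<Longrightarrow> \<exists>g\<in>\<Gamma>. \<exists>y\<in>Q. x = g + y"
begin

abbreviation R where "R \<equiv> series_ring Q H"
definition fib :: "'m \<Rightarrow> ('m \<times> 'm) set" where "fib x = {(y, z). y \<in> Q \<and> z \<in> Q \<and> y + z = x}"

lemma H_zero: "H 0 = 0"
  using H_add[OF zero_mem zero_mem] by simp

text \<open>Raising the height bound by one adds at most one generator to an element, so the number
  of elements grows at most exponentially. Exponential growth is what a change of radius can
  absorb.\<close>

lemma level: "finite {x\<in>Q. H x \<le> N} \<and> card {x\<in>Q. H x \<le> N} \<le> Suc (card \<Gamma>) ^ N"
proof (induction N)
  case 0
  have "{x\<in>Q. H x \<le> 0} \<subseteq> {0}"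
  proof
    fix x assume x: "x \<in> {x\<in>Q. H x \<le> 0}"
    show "x \<in> {0}"
    proof (rule ccontr)
      assume "x \<notin> {0}"
      then obtain g y where "g \<in> \<Gamma>" "y \<in> Q" "x = g + y" using gen x by blast
      then show False using x H_add[of g y] H_gen[of g] gen_sub by auto
    qed
  qed
  then show ?case using card_mono[of "{0}"] by (auto intro: finite_subset)
next
  case (Suc N)
  let ?A = "insert 0 \<Gamma> \<times> {x\<in>Q. H x \<le> N}"
  have sub: "{x\<in>Q. H x \<le> Suc N} \<subseteq> (\<lambda>(g, y). g + y) ` ?A"
  proof
    fix x assume x: "x \<in> {x\<in>Q. H x \<le> Suc N}"
    show "x \<in> (\<lambda>(g, y). g + y) ` ?A"
    proof (cases "x = 0")
      case True
      then show ?thesis using zero_mem H_zero by (auto intro!: image_eqI[of _ _ "(0, 0)"])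
    next
      case False
      then obtain g y where "g \<in> \<Gamma>" "y \<in> Q" "x = g + y" using gen x by blast
      then show ?thesis using x H_add[of g y] H_gen[of g] gen_sub
        by (auto intro!: image_eqI[of _ _ "(g, y)"])
    qed
  qed
  have fA: "finite ?A" using Suc fin_gen by simp
  have "card {x\<in>Q. H x \<le> Suc N} \<le> card ?A"
    using card_mono[OF finite_imageI[OF fA] sub] card_image_le[OF fA] by (rule order_trans)
  also have "\<dots> \<le> Suc (card \<Gamma>) * Suc (card \<Gamma>) ^ N"
    unfolding card_cartesian_product using Suc fin_gen
    by (intro mult_le_mono) (auto simp: card_insert_if)
  finally show ?case using finite_subset[OF sub finite_imageI[OF fA]] by simp
qed

lemma fib_sub: "fib x \<subseteq> {y\<in>Q. H y \<le> H x} \<times> {y\<in>Q. H y \<le> H x}"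
  by (auto simp: fib_def H_add)

lemma finite_fib: "finite (fib x)"
  using finite_subset[OF fib_sub] level by blast

lemma card_fib: "card (fib x) \<le> Suc (card \<Gamma>) ^ H x"
proof -
  have "inj_on fst (fib x)" by (auto simp: inj_on_def fib_def)
  then have "card (fib x) = card (fst ` fib x)" by (simp add: card_image)
  also have "\<dots> \<le> card {y\<in>Q. H y \<le> H x}"
  proof (rule card_mono)
    show "fst ` fib x \<subseteq> {y\<in>Q. H y \<le> H x}" using fib_sub[of x] by fastforce
  qed (use level in simp)
  finally show ?thesis using level[of "H x"] by linarith
qed

lemma conv_fib: "conv Q c d x = (\<Sum>(y, z)\<in>fib x. c y * d z)"
  by (simp add: conv_def fib_def)

lemma fib_empty: "x \<notin> Q \<Longrightarrow> fib x = {}"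
  by (auto simp: fib_def add_mem)

text \<open>The number of decompositions of \<open>x\<close> is at most \<open>K ^ H x\<close>, so
  the bounds of the two factors at radius \<open>K * R\<close> give a bound of the product at radius
  \<open>R\<close>.\<close>

lemma growth_conv:
  assumes c: "growth Q H c" and d: "growth Q H d"
  shows "growth Q H (conv Q c d)"
proof (rule growthI)
  show "conv Q c d x = 0" if "x \<notin> Q" for x using fib_empty[OF that] by (simp add: conv_fib)
  fix R :: nat
  define K where "K = Suc (card \<Gamma>)"
  obtain M N where M: "M \<ge> 0" "\<forall>x\<in>Q. norm (c x) * real (K * R) ^ H x \<le> M"
    and N: "N \<ge> 0" "\<forall>x\<in>Q. norm (d x) * real (K * R) ^ H x \<le> N"
    using growth_bound[OF c] growth_bound[OF d] by metis
  have "norm (conv Q c d x) * real R ^ H x \<le> M * N" if x: "x \<in> Q" for x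
  proof -
    have t: "norm (c y * d z) * real (K * R) ^ H x \<le> M * N" if "(y, z) \<in> fib x" for y z
    proof -
      have yz: "y \<in> Q" "z \<in> Q" "H x = H y + H z" using that H_add by (auto simp: fib_def)
      have "norm (c y * d z) * real (K * R) ^ H x = (norm (c y) * real (K * R) ^ H y) * (norm (d z) * real (K * R) ^ H z)"
        by (simp add: yz power_add norm_mult)
      also have "\<dots> \<le> M * N" using M N yz by (intro mult_mono) auto
      finally show ?thesis .
    qed
    have Kp: "real K ^ H x > 0" by (simp add: K_def)
    have "norm (conv Q c d x) * real (K * R) ^ H x \<le> (\<Sum>p\<in>fib x. norm (c (fst p) * d (snd p))) * real (K * R) ^ H x"
      unfolding conv_fib by (intro mult_right_mono) (auto simp: case_prod_unfold intro: norm_sum)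
    also have "\<dots> \<le> (\<Sum>p\<in>fib x. M * N)"
      unfolding sum_distrib_right using t by (intro sum_mono) auto
    also have "\<dots> \<le> real K ^ H x * (M * N)"
      using card_fib[of x] M(1) N(1) unfolding K_def
      by (simp del: of_nat_Suc power_Suc of_nat_power add: of_nat_power[symmetric] mult_right_mono)
    finally have "real K ^ H x * (norm (conv Q c d x) * real R ^ H x) \<le> real K ^ H x * (M * N)"
      by (simp add: power_mult_distrib algebra_simps)
    then show ?thesis using Kp by (simp only: mult_le_cancel_left_pos)
  qed
  then show "\<exists>M. \<forall>x\<in>Q. norm (conv Q c d x) * real R ^ H x \<le> M" by blast
qed

lemma conv_comm: "conv Q c d = conv Q d c"
proof
  fix x
  show "conv Q c d x = conv Q d c x" unfolding conv_fib
    by (rule sum.reindex_bij_witness[of _ "\<lambda>(a, b). (b, a)" "\<lambda>(a, b). (b, a)"])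
      (auto simp: fib_def add.commute)
qed

lemma conv_assoc: "conv Q (conv Q c d) e = conv Q c (conv Q d e)"
proof
  fix x
  have "conv Q (conv Q c d) e x = (\<Sum>p\<in>fib x. \<Sum>q\<in>fib (fst p). c (fst q) * d (snd q) * e (snd p))"
    by (simp add: conv_fib case_prod_unfold sum_distrib_right)
  also have "\<dots> = (\<Sum>(p, q)\<in>Sigma (fib x) (\<lambda>p. fib (fst p)). c (fst q) * d (snd q) * e (snd p))"
    by (rule sum.Sigma) (auto simp: finite_fib)
  also have "\<dots> = (\<Sum>(p, q)\<in>Sigma (fib x) (\<lambda>p. fib (snd p)). c (fst p) * (d (fst q) * e (snd q)))"
    by (rule sum.reindex_bij_witness[of _ "\<lambda>((a, b), (u, v)). ((a + u, v), (a, u))" "\<lambda>((a, b), (u, v)). ((u, v + b), (v, b))"])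
      (auto simp: fib_def add.assoc intro: add_mem)
  also have "\<dots> = (\<Sum>p\<in>fib x. \<Sum>q\<in>fib (snd p). c (fst p) * (d (fst q) * e (snd q)))"
    by (rule sum.Sigma[symmetric]) (auto simp: finite_fib)
  also have "\<dots> = conv Q c (conv Q d e) x"
    by (simp add: conv_fib case_prod_unfold sum_distrib_left)
  finally show "conv Q (conv Q c d) e x = conv Q c (conv Q d e) x" .
qed

lemma conv_add_left: "conv Q (\<lambda>x. c x + d x) e = (\<lambda>x. conv Q c e x + conv Q d e x)"
  by (simp add: conv_fib case_prod_unfold algebra_simps sum.distrib fun_eq_iff)

lemma conv_scale_left: "conv Q (\<lambda>x. a * c x) e = (\<lambda>x. a * conv Q c e x)"
  by (simp add: conv_fib case_prod_unfold sum_distrib_left mult.assoc fun_eq_iff)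

lemma conv_zero_left: "conv Q (\<lambda>x. 0) e = (\<lambda>x. 0)"
  by (simp add: conv_fib case_prod_unfold fun_eq_iff)

lemma conv_sum_left: "conv Q (\<lambda>x. \<Sum>i\<in>I. c i x) e = (\<lambda>x. \<Sum>i\<in>I. conv Q (c i) e x)"
  by (induction I rule: infinite_finite_induct) (simp_all add: conv_zero_left conv_add_left)

lemma conv_mono1:
  assumes y: "y \<in> Q" and z: "z \<in> Q"
  shows "conv Q (mono1 y) d (y + z) = d z"
proof -
  have "conv Q (mono1 y) d (y + z) = (\<Sum>(u, v)\<in>{(y, z)}. mono1 y u * d v)"
    unfolding conv_fib
    by (rule sum.mono_neutral_right) (use y z finite_fib in \<open>auto simp: fib_def mono1_def split: if_splits\<close>)
  then show ?thesis by (simp add: mono1_def)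
qed

lemma conv_mono1_out:
  assumes "\<nexists>z. z \<in> Q \<and> x = y + z"
  shows "conv Q (mono1 y) d x = 0"
  unfolding conv_fib by (rule sum.neutral) (use assms in \<open>auto simp: fib_def mono1_def\<close>)

lemma growth_mono1: "y \<in> Q \<Longrightarrow> growth Q H (mono1 y)"
  by (rule growth_finite_support) (auto simp: mono1_def)

lemma conv_one: "growth Q H d \<Longrightarrow> conv Q (mono1 0) d = d"
proof
  fix x assume d: "growth Q H d"
  show "conv Q (mono1 0) d x = d x"
    using conv_mono1[OF zero_mem, of x d] conv_mono1_out[of x 0 d] growth_out[OF d, of x] by (cases "x \<in> Q") auto
qed

lemma mono_mult: "x \<in> Q \<Longrightarrow> y \<in> Q \<Longrightarrow> conv Q (mono1 x) (mono1 y) = mono1 (x + y)"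
proof
  fix z assume xy: "x \<in> Q" "y \<in> Q"
  show "conv Q (mono1 x) (mono1 y) z = mono1 (x + y) z"
  proof (cases "\<exists>u. u \<in> Q \<and> z = x + u")
    case True
    then show ?thesis using xy conv_mono1 by (auto simp: mono1_def)
  next
    case False
    then show ?thesis using xy conv_mono1_out[OF False] by (auto simp: mono1_def)
  qed
qed

lemma growth_shift:
  assumes c: "growth Q H c" and w: "w \<in> Q"
  shows "growth Q H (\<lambda>y. if y \<in> Q then c (w + y) else 0)"
proof (rule growthI)
  fix R :: nat
  obtain M where M: "M \<ge> 0" "\<forall>x\<in>Q. norm (c x) * real R ^ H x \<le> M" using growth_bound[OF c] by metis
  obtain M' where M': "M' \<ge> 0" "\<forall>x\<in>Q. norm (c x) * real 1 ^ H x \<le> M'" using growth_bound[OF c] by metis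
  have "norm (c (w + y)) * real R ^ H y \<le> max M M'" if y: "y \<in> Q" for y
  proof (cases "R = 0")
    \<comment> \<open>At radius 0 only exponents of height 0 matter, and shifting by
      \<open>w\<close> may turn a positive height into 0; the bound at radius 1 is used
      instead.\<close>
    case True
    have "norm (c (w + y)) * real R ^ H y \<le> norm (c (w + y)) * 1"
      using True by (intro mult_left_mono) (auto simp: power_0_left)
    also have "\<dots> \<le> M'" using M'(2) add_mem[OF w y] by auto
    finally show ?thesis by simp
  next
    case False
    then have "1 \<le> real R ^ H w" by (intro one_le_power) simp
    then have "1 * real R ^ H y \<le> real R ^ H w * real R ^ H y" by (intro mult_right_mono) auto
    then have "norm (c (w + y)) * real R ^ H y \<le> norm (c (w + y)) * real R ^ H (w + y)"
      using y w by (auto simp: H_add power_add intro!: mult_left_mono)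
    also have "\<dots> \<le> M" using M add_mem[OF w y] by auto
    finally show ?thesis by simp
  qed
  then show "\<exists>M. \<forall>x\<in>Q. norm (if x \<in> Q then c (w + x) else 0) * real R ^ H x \<le> M"
    by (intro exI[of _ "max M M'"]) auto
qed simp

lemma cring_R: "cring R"
proof (rule cringI)
  show "abelian_group R"
  proof (rule abelian_groupI)
    fix c assume c: "c \<in> carrier R"
    then show "\<exists>y\<in>carrier R. y \<oplus>\<^bsub>R\<^esub> c = \<zero>\<^bsub>R\<^esub>"
      by (intro bexI[of _ "\<lambda>x. - c x"]) (auto simp: series_ring_def intro: growth_uminus)
  qed (auto simp: series_ring_def growth_zero growth_add algebra_simps)
  show "comm_monoid R"
    by (rule comm_monoidI)
      (auto simp: series_ring_def growth_conv growth_mono1 zero_mem conv_assoc conv_one intro: conv_comm)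
qed (auto simp: series_ring_def conv_add_left)

lemma a_inv_R: "c \<in> carrier R \<Longrightarrow> \<ominus>\<^bsub>R\<^esub> c = (\<lambda>x. - c x)"
proof -
  interpret R: cring R by (rule cring_R)
  assume c: "c \<in> carrier R"
  then show ?thesis
    by (intro R.minus_equality) (auto simp: series_ring_def intro: growth_uminus)
qed

end

section \<open>Monomial ideals of the base ring and their extensions\<close>

locale series_base = height_monoid Q H \<Gamma> for Q :: "'m::cancel_comm_monoid_add set" and H \<Gamma> +
  fixes Bs :: "'m set" and \<Delta> :: "'m set" and X :: "'m set"
  assumes Bs_sub: "Bs \<subseteq> Q" and Bs_zero: "0 \<in> Bs" and Bs_add: "x \<in> Bs \<Longrightarrow> y \<in> Bs \<Longrightarrow> x + y \<in> Bs"
    and fin_D: "finite \<Delta>" and D_sub: "\<Delta> \<subseteq> Bs - {0}"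
    and D_gen: "x \<in> Bs \<Longrightarrow> x \<noteq> 0 \<Longrightarrow> \<exists>g\<in>\<Delta>. \<exists>y\<in>Bs. x = g + y"
    and X_sub: "X \<subseteq> Bs - {0}" and X_gen: "x \<in> Bs \<Longrightarrow> x \<noteq> 0 \<Longrightarrow> \<exists>g\<in>X. \<exists>y\<in>Bs. x = g + y"
begin

definition base where "base = R\<lparr>carrier := {c. finite {x. c x \<noteq> 0} \<and> {x. c x \<noteq> 0} \<subseteq> Bs}\<rparr>"

text \<open>The exponents of the j-th power of the maximal ideal: an arbitrary base exponent plus j
  nonzero ones. The finite set \<open>gen_products j\<close>, built from \<Delta>, generates
  them.\<close>

fun power_expos :: "nat \<Rightarrow> 'm set" where
  "power_expos 0 = Bs"
| "power_expos (Suc j) = {x + y | x y. x \<in> power_expos j \<and> y \<in> Bs - {0}}"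

fun gen_products :: "nat \<Rightarrow> 'm set" where
  "gen_products 0 = {0}"
| "gen_products (Suc j) = (\<lambda>(x, y). x + y) ` (gen_products j \<times> \<Delta>)"

definition power_ideal :: "nat \<Rightarrow> ('m \<Rightarrow> complex) set" where
  "power_ideal j = {c. finite {x. c x \<noteq> 0} \<and> {x. c x \<noteq> 0} \<subseteq> power_expos j}"

definition ext :: "nat \<Rightarrow> 'm set" where "ext j = {x + y | x y. x \<in> power_expos j \<and> y \<in> Q}"

lemma add_zero_iff: "x \<in> Q \<Longrightarrow> y \<in> Q \<Longrightarrow> x + y = 0 \<longleftrightarrow> x = 0 \<and> y = 0"
proof -
  have "x = 0" if x: "x \<in> Q" "H x = 0" for x
  proof (rule ccontr)
    assume "x \<noteq> 0"
    then obtain g y where "g \<in> \<Gamma>" "y \<in> Q" "x = g + y" using gen x(1) by blast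
    then show False using x H_add[of g y] H_gen[of g] gen_sub by auto
  qed
  then show "x \<in> Q \<Longrightarrow> y \<in> Q \<Longrightarrow> x + y = 0 \<longleftrightarrow> x = 0 \<and> y = 0"
    using H_add[of x y] H_zero by force
qed

lemma power_expos_sub: "power_expos j \<subseteq> Bs"
  by (induction j) (auto intro: Bs_add)

lemma power_expos_add: "x \<in> power_expos j \<Longrightarrow> y \<in> Bs \<Longrightarrow> x + y \<in> power_expos j"
proof (induction j arbitrary: x)
  case (Suc j)
  then obtain u v where uv: "x = u + v" "u \<in> power_expos j" "v \<in> Bs - {0}" by auto
  then have "x + y = (u + y) + v" by (simp add: algebra_simps)
  then show ?case using uv Suc by auto
qed (auto intro: Bs_add)

lemma finite_gen_products: "finite (gen_products j)"
  by (induction j) (auto simp: fin_D)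

lemma gen_products_sub: "gen_products j \<subseteq> power_expos j"
proof (induction j)
  case (Suc j)
  show ?case
  proof
    fix x assume "x \<in> gen_products (Suc j)"
    then obtain u v where "x = u + v" "u \<in> gen_products j" "v \<in> \<Delta>" by auto
    then have "x = u + v" "u \<in> power_expos j" "v \<in> Bs - {0}" using Suc D_sub by auto
    then show "x \<in> power_expos (Suc j)" by auto
  qed
qed (simp add: Bs_zero)

lemma power_expos_gen_products: "x \<in> power_expos j \<Longrightarrow> \<exists>w\<in>gen_products j. \<exists>y\<in>Bs. x = w + y"
proof (induction j arbitrary: x)
  case (Suc j)
  then obtain u v where uv: "x = u + v" "u \<in> power_expos j" "v \<in> Bs - {0}" by auto
  obtain w y where w: "w \<in> gen_products j" "y \<in> Bs" "u = w + y" using Suc.IH[OF uv(2)] by blast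
  obtain g y' where g: "g \<in> \<Delta>" "y' \<in> Bs" "v = g + y'" using D_gen uv(3) by blast
  have "x = (w + g) + (y + y')" using uv w g by (simp add: algebra_simps)
  moreover have "w + g \<in> gen_products (Suc j)" using w g by auto
  ultimately show ?case using Bs_add w(2) g(2) by blast
qed auto

text \<open>Splitting a generator off an exponent outside stage j + 1 leaves one outside stage j, so
  each stage adds finitely many. This is the finite dimensionality of the truncated base
  ring.\<close>

lemma finite_power_expos_compl: "finite (Bs - power_expos j)"
proof (induction j)
  case (Suc j)
  have "Bs - power_expos (Suc j) \<subseteq> insert 0 ((\<lambda>(g, y). g + y) ` (\<Delta> \<times> (Bs - power_expos j)))"
  proof
    fix x assume x: "x \<in> Bs - power_expos (Suc j)"
    show "x \<in> insert 0 ((\<lambda>(g, y). g + y) ` (\<Delta> \<times> (Bs - power_expos j)))"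
    proof (cases "x = 0")
      case False
      then obtain g y where g: "g \<in> \<Delta>" "y \<in> Bs" "x = g + y" using D_gen x by blast
      have "y \<notin> power_expos j"
      proof
        assume "y \<in> power_expos j"
        then have "y + g \<in> power_expos (Suc j)" using g D_sub by auto
        then show False using x g by (simp add: add.commute)
      qed
      then show ?thesis using g by auto
    qed simp
  qed
  then show ?case using Suc fin_D by (elim finite_subset) auto
qed simp

lemma zero_notin_power_expos: "0 \<notin> power_expos (Suc j)"
proof
  assume "0 \<in> power_expos (Suc j)"
  then obtain x y where "0 = x + y" "x \<in> power_expos j" "y \<in> Bs - {0}" by auto
  then show False using add_zero_iff[of x y] power_expos_sub[of j] Bs_sub by auto
qed

lemma ext_sub: "ext j \<subseteq> Q"
  using power_expos_sub Bs_sub by (auto simp: ext_def intro: add_mem)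

lemma ext_add: "x \<in> ext j \<Longrightarrow> y \<in> Q \<Longrightarrow> x + y \<in> ext j"
proof -
  assume "x \<in> ext j" "y \<in> Q"
  then obtain u v where "x = u + v" "u \<in> power_expos j" "v \<in> Q" by (auto simp: ext_def)
  then have "x + y = u + (v + y)" "u \<in> power_expos j" "v + y \<in> Q"
    using \<open>y \<in> Q\<close> by (auto simp: add.assoc intro: add_mem)
  then show "x + y \<in> ext j" unfolding ext_def by blast
qed

lemma power_expos_ext: "power_expos j \<subseteq> ext j"
  using zero_mem by (force simp: ext_def)

lemma base_carrier: "carrier base = {c. finite {x. c x \<noteq> 0} \<and> {x. c x \<noteq> 0} \<subseteq> Bs}"
  by (simp add: base_def)

lemma base_sub_R: "carrier base \<subseteq> carrier R"
  using Bs_sub by (auto simp: base_carrier series_ring_def intro!: growth_finite_support)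

lemma conv_support: "{x. conv Q c d x \<noteq> 0} \<subseteq> (\<lambda>(x, y). x + y) ` ({x. c x \<noteq> 0} \<times> {x. d x \<noteq> 0})"
proof
  fix x assume "x \<in> {x. conv Q c d x \<noteq> 0}"
  then have "(\<Sum>(y, z)\<in>fib x. c y * d z) \<noteq> 0" by (simp add: conv_fib)
  then obtain p where "p \<in> fib x" "c (fst p) * d (snd p) \<noteq> 0"
    by (metis (no_types, lifting) case_prod_unfold sum.neutral)
  then show "x \<in> (\<lambda>(x, y). x + y) ` ({x. c x \<noteq> 0} \<times> {x. d x \<noteq> 0})"
    by (auto simp: fib_def intro!: image_eqI[of _ _ p])
qed

lemma base_ops: "mult base = conv Q" "add base = (\<lambda>c d x. c x + d x)" "\<zero>\<^bsub>base\<^esub> = (\<lambda>x. 0)" "\<one>\<^bsub>base\<^esub> = mono1 0"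
  by (simp_all add: base_def series_ring_def)

lemma R_ops: "mult R = conv Q" "add R = (\<lambda>c d x. c x + d x)" "\<zero>\<^bsub>R\<^esub> = (\<lambda>x. 0)" "\<one>\<^bsub>R\<^esub> = mono1 0"
  "carrier R = {c. growth Q H c}"
  by (simp_all add: series_ring_def)

lemma finite_support_add:
  assumes "finite {x. c x \<noteq> 0}" "finite {x. d x \<noteq> (0::complex)}" shows "finite {x. c x + d x \<noteq> 0}"
  by (rule finite_subset[of _ "{x. c x \<noteq> 0} \<union> {x. d x \<noteq> 0}"]) (use assms in auto)

lemma support_add:
  assumes "{x. c x \<noteq> 0} \<subseteq> A" "{x. d x \<noteq> (0::complex)} \<subseteq> A" shows "{x. c x + d x \<noteq> 0} \<subseteq> A"
proof
  fix x assume "x \<in> {x. c x + d x \<noteq> 0}"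
  then have "c x \<noteq> 0 \<or> d x \<noteq> 0" by auto
  then show "x \<in> A" using assms by blast
qed

lemma finite_support_conv:
  assumes "finite {x. c x \<noteq> 0}" "finite {x. d x \<noteq> 0}" shows "finite {x. conv Q c d x \<noteq> 0}"
  using assms by (intro finite_subset[OF conv_support]) auto

lemma subcring_base: "subcring (carrier base) R"
proof -
  interpret R: cring R by (rule cring_R)
  show ?thesis
  proof (rule R.subcringI'[OF R.subringI])
    show "carrier base \<subseteq> carrier R" by (rule base_sub_R)
    show "\<one>\<^bsub>R\<^esub> \<in> carrier base" using Bs_zero by (auto simp: R_ops base_carrier mono1_def)
    fix c assume c: "c \<in> carrier base"
    then show "\<ominus>\<^bsub>R\<^esub> c \<in> carrier base" using base_sub_R by (subst a_inv_R) (auto simp: base_carrier)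
    fix d assume d: "d \<in> carrier base"
    show "c \<otimes>\<^bsub>R\<^esub> d \<in> carrier base"
      using c d conv_support[of c d] by (auto simp: R_ops base_carrier finite_support_conv dest!: subsetD intro!: Bs_add)
    show "c \<oplus>\<^bsub>R\<^esub> d \<in> carrier base" 
      using c d support_add[of c Bs d] finite_support_add[of c d] unfolding R_ops base_carrier by blast
  qed
qed

lemma cring_base: "cring base"
proof -
  interpret R: cring R by (rule cring_R)
  have "cring (R\<lparr>carrier := carrier base\<rparr>)"
    using R.subcring_iff[OF base_sub_R] subcring_base by blast
  then show ?thesis by (simp add: base_def)
qed

lemma a_inv_base: "c \<in> carrier base \<Longrightarrow> \<ominus>\<^bsub>base\<^esub> c = (\<lambda>x. - c x)"
proof -
  interpret B: cring base by (rule cring_base)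
  assume c: "c \<in> carrier base"
  then show ?thesis by (intro B.minus_equality) (auto simp: base_carrier base_ops)
qed

lemma power_ideal_sub: "power_ideal j \<subseteq> carrier base"
  using power_expos_sub by (auto simp: power_ideal_def base_carrier)

lemma power_ideal_0: "power_ideal 0 = carrier base"
  by (simp add: power_ideal_def base_carrier)

lemma ideal_power_ideal: "ideal (power_ideal j) base"
proof -
  interpret B: cring base by (rule cring_base)
  have mult: "conv Q d c \<in> power_ideal j" if c: "c \<in> power_ideal j" and d: "d \<in> carrier base" for c d
  proof -
    have "{x. conv Q d c x \<noteq> 0} \<subseteq> power_expos j"
    proof
      fix x assume "x \<in> {x. conv Q d c x \<noteq> 0}"
      then obtain u v where "d u \<noteq> 0" "c v \<noteq> 0" "x = u + v" using conv_support[of d c] by auto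
      then show "x \<in> power_expos j" using power_expos_add[of v j u] c d by (auto simp: power_ideal_def base_carrier add.commute)
    qed
    then show ?thesis using c d finite_support_conv by (auto simp: power_ideal_def base_carrier)
  qed
  show ?thesis
  proof (rule idealI)
    show "ring base" by (rule B.ring_axioms)
    show "subgroup (power_ideal j) (add_monoid base)"
    proof (rule B.add.subgroupI)
      show "power_ideal j \<subseteq> carrier base" by (rule power_ideal_sub)
      have "(\<lambda>x. 0) \<in> power_ideal j" by (simp add: power_ideal_def)
      then show "power_ideal j \<noteq> {}" by blast
      fix c assume c: "c \<in> power_ideal j"
      then show "\<ominus>\<^bsub>base\<^esub> c \<in> power_ideal j" using power_ideal_sub by (subst a_inv_base) (auto simp: power_ideal_def)
      fix d assume d: "d \<in> power_ideal j"
      show "c \<oplus>\<^bsub>base\<^esub> d \<in> power_ideal j"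
        using c d support_add[of c "power_expos j" d] finite_support_add[of c d] unfolding power_ideal_def base_ops by blast
    qed
    fix c d assume "c \<in> power_ideal j" "d \<in> carrier base"
    then show "d \<otimes>\<^bsub>base\<^esub> c \<in> power_ideal j" "c \<otimes>\<^bsub>base\<^esub> d \<in> power_ideal j"
      using mult conv_comm[of c d] by (auto simp: base_ops)
  qed
qed

lemma scaled_mono_mult: "x \<in> Q \<Longrightarrow> y \<in> Q \<Longrightarrow> conv Q (\<lambda>u. a * mono1 x u) (mono1 y) = (\<lambda>u. a * mono1 (x + y) u)"
  by (simp add: conv_scale_left mono_mult)

lemma scaled_mono_base: "x \<in> Bs \<Longrightarrow> (\<lambda>u. a * mono1 x u) \<in> carrier base"
  by (auto simp: base_carrier mono1_def)

lemma scaled_mono_power_ideal: "x \<in> power_expos j \<Longrightarrow> (\<lambda>u. a * mono1 x u) \<in> power_ideal j"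
  by (auto simp: power_ideal_def mono1_def)

text \<open>Reduces membership of polynomials in an additively closed set to scaled
  monomials.\<close>

lemma finite_support_in_closed:
  assumes "finite {x. c x \<noteq> (0::complex)}" "{x. c x \<noteq> 0} \<subseteq> P"
    and "(\<lambda>x. 0) \<in> I" and "\<And>d e. d \<in> I \<Longrightarrow> e \<in> I \<Longrightarrow> (\<lambda>x. d x + e x) \<in> I"
    and "\<And>x a. x \<in> P \<Longrightarrow> (\<lambda>u. a * mono1 x u) \<in> I"
  shows "c \<in> I"
proof -
  have "finite F \<Longrightarrow> F \<subseteq> P \<Longrightarrow> (\<lambda>x. if x \<in> F then c x else 0) \<in> I" for F
  proof (induction F rule: finite_induct)
    case (insert y F)
    have "(\<lambda>x. if x \<in> insert y F then c x else 0) = (\<lambda>x. (if x \<in> F then c x else 0) + c y * mono1 y x)"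
      using insert(2) by (auto simp: mono1_def)
    then show ?case using insert assms(4)[OF insert.IH assms(5)] by auto
  qed (use assms(3) in simp)
  from this[OF assms(1,2)] have "(\<lambda>x. if x \<in> {x. c x \<noteq> 0} then c x else 0) \<in> I" .
  moreover have "(\<lambda>x. if x \<in> {x. c x \<noteq> 0} then c x else 0) = c" by auto
  ultimately show ?thesis by simp
qed

text \<open>Each nonzero base exponent splits off an element of \<open>X\<close>, so every monomial
  without constant part is a multiple of a generator. The set \<open>X\<close> may be infinite;
  finiteness arguments use \<Delta>.\<close>

lemma genideal_power_ideal: "Idl\<^bsub>base\<^esub> (mono1 ` X) = power_ideal 1"
proof -
  interpret B: cring base by (rule cring_base)
  have XB: "mono1 ` X \<subseteq> carrier base"
    using X_sub scaled_mono_base[of _ 1] by auto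
  have X1: "X \<subseteq> power_expos 1" using X_sub Bs_zero by force
  show ?thesis
  proof
    show "Idl\<^bsub>base\<^esub> (mono1 ` X) \<subseteq> power_ideal 1"
      by (rule B.genideal_minimal[OF ideal_power_ideal]) (use X1 scaled_mono_power_ideal[of _ 1 1] in auto)
    have I: "ideal (Idl\<^bsub>base\<^esub> (mono1 ` X)) base" by (rule B.genideal_ideal[OF XB])
    interpret I: ideal "Idl\<^bsub>base\<^esub> (mono1 ` X)" base by (rule I)
    show "power_ideal 1 \<subseteq> Idl\<^bsub>base\<^esub> (mono1 ` X)"
    proof
      fix c assume c: "c \<in> power_ideal 1"
      show "c \<in> Idl\<^bsub>base\<^esub> (mono1 ` X)"
      proof (rule finite_support_in_closed[of c "power_expos 1"])
        fix x a assume "x \<in> power_expos 1"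
        then have x: "x \<in> Bs" "x \<noteq> 0" using power_expos_sub[of 1] zero_notin_power_expos[of 0] by auto
        obtain g y where g: "g \<in> X" "y \<in> Bs" "x = g + y" using X_gen x by blast
        have "conv Q (\<lambda>u. a * mono1 y u) (mono1 g) \<in> Idl\<^bsub>base\<^esub> (mono1 ` X)"
          using I.I_l_closed[OF subsetD[OF B.genideal_self[OF XB]] scaled_mono_base[OF g(2)], of "mono1 g"] g
          by (auto simp: base_ops)
        moreover have "y \<in> Q" "g \<in> Q" using g X_sub Bs_sub by auto
        ultimately show "(\<lambda>u. a * mono1 x u) \<in> Idl\<^bsub>base\<^esub> (mono1 ` X)"
          using scaled_mono_mult[of y g a] g(3) by (simp add: add.commute)
      qed (use c I.zero_closed I.a_closed in \<open>auto simp: power_ideal_def base_ops\<close>)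
    qed
  qed
qed

lemma ideal_prod_power_ideal: "ideal_prod base (power_ideal j) (power_ideal 1) = power_ideal (Suc j)"
proof
  show "ideal_prod base (power_ideal j) (power_ideal 1) \<subseteq> power_ideal (Suc j)"
  proof
    fix s assume "s \<in> ideal_prod base (power_ideal j) (power_ideal 1)"
    then show "s \<in> power_ideal (Suc j)"
    proof induction
      case (prod c d)
      have "{x. conv Q c d x \<noteq> 0} \<subseteq> power_expos (Suc j)"
      proof
        fix x assume "x \<in> {x. conv Q c d x \<noteq> 0}"
        then obtain u v where uv: "c u \<noteq> 0" "d v \<noteq> 0" "x = u + v" using conv_support[of c d] by auto
        then have "u \<in> power_expos j" "v \<in> power_expos 1" using prod by (auto simp: power_ideal_def)
        moreover from this have "v \<in> Bs - {0}" using power_expos_sub[of 1] zero_notin_power_expos[of 0] by auto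
        ultimately show "x \<in> power_expos (Suc j)" using uv by auto
      qed
      then show ?case using prod finite_support_conv by (auto simp: power_ideal_def base_ops)
    next
      case (sum c d)
      then show ?case using additive_subgroup.a_closed[OF ideal.axioms(1)[OF ideal_power_ideal] sum(3,4)] by simp
    qed
  qed
  show "power_ideal (Suc j) \<subseteq> ideal_prod base (power_ideal j) (power_ideal 1)"
  proof
    fix c assume c: "c \<in> power_ideal (Suc j)"
    have z: "(\<lambda>x. 0) \<in> power_ideal i" for i by (simp add: power_ideal_def)
    show "c \<in> ideal_prod base (power_ideal j) (power_ideal 1)"
    proof (rule finite_support_in_closed[of c "power_expos (Suc j)"])
      show "(\<lambda>x. 0) \<in> ideal_prod base (power_ideal j) (power_ideal 1)"
        using ideal_prod.prod[OF z z, of base j 1] by (simp add: base_ops conv_zero_left)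
      show "(\<lambda>x. d x + e x) \<in> ideal_prod base (power_ideal j) (power_ideal 1)"
        if "d \<in> ideal_prod base (power_ideal j) (power_ideal 1)" "e \<in> ideal_prod base (power_ideal j) (power_ideal 1)" for d e
        using ideal_prod.sum[OF that] by (simp add: base_ops)
      fix x a assume "x \<in> power_expos (Suc j)"
      then obtain u v where uv: "x = u + v" "u \<in> power_expos j" "v \<in> Bs - {0}" by auto
      then have "v \<in> power_expos 1" using Bs_zero by force
      then have "conv Q (\<lambda>t. a * mono1 u t) (mono1 v) \<in> ideal_prod base (power_ideal j) (power_ideal 1)"
        using ideal_prod.prod[OF scaled_mono_power_ideal[OF uv(2)] scaled_mono_power_ideal[of v 1 1], of base a] by (simp add: base_ops)
      then show "(\<lambda>u. a * mono1 x u) \<in> ideal_prod base (power_ideal j) (power_ideal 1)"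
        using uv(1) scaled_mono_mult[of u v a] subsetD[OF power_expos_sub uv(2)] uv(3) subsetD[OF Bs_sub] by simp
    qed (use c in \<open>auto simp: power_ideal_def\<close>)
  qed
qed

lemma ideal_pow_power_ideal: "power_ideal 1 [^]\<^bsub>ideals_set base\<^esub> j = power_ideal j"
proof (induction j)
  case 0
  then show ?case by (simp add: nat_pow_def ideals_set_def power_ideal_0)
next
  case (Suc j)
  then show ?case using ideal_prod_power_ideal[of j] by (simp add: nat_pow_def ideals_set_def)
qed

definition ext_ideal :: "nat \<Rightarrow> ('m \<Rightarrow> complex) set" where
  "ext_ideal j = {c. growth Q H c \<and> {x. c x \<noteq> 0} \<subseteq> ext j}"

lemma ideal_ext_ideal: "ideal (ext_ideal j) R"
proof -
  interpret R: cring R by (rule cring_R)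
  have mult: "conv Q d c \<in> ext_ideal j" if c: "c \<in> ext_ideal j" and d: "growth Q H d" for c d
  proof -
    have "{x. conv Q d c x \<noteq> 0} \<subseteq> ext j"
    proof
      fix x assume "x \<in> {x. conv Q d c x \<noteq> 0}"
      then obtain u v where uv: "d u \<noteq> 0" "c v \<noteq> 0" "x = u + v" using conv_support[of d c] by auto
      then have "u \<in> Q" using growth_out[OF d] by blast
      then show "x \<in> ext j" using ext_add[of v j u] c uv by (auto simp: ext_ideal_def add.commute)
    qed
    then show ?thesis using c d growth_conv by (auto simp: ext_ideal_def)
  qed
  show ?thesis
  proof (rule idealI)
    show "ring R" by (rule R.ring_axioms)
    show "subgroup (ext_ideal j) (add_monoid R)"
    proof (rule R.add.subgroupI)
      show "ext_ideal j \<subseteq> carrier R" by (auto simp: ext_ideal_def R_ops)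
      have "(\<lambda>x. 0) \<in> ext_ideal j" by (simp add: ext_ideal_def growth_zero)
      then show "ext_ideal j \<noteq> {}" by blast
      fix c assume c: "c \<in> ext_ideal j"
      then show "\<ominus>\<^bsub>R\<^esub> c \<in> ext_ideal j" by (subst a_inv_R) (auto simp: ext_ideal_def R_ops growth_uminus)
      fix d assume d: "d \<in> ext_ideal j"
      show "c \<oplus>\<^bsub>R\<^esub> d \<in> ext_ideal j"
        using c d support_add[of c "ext j" d] growth_add[of Q H c d] unfolding ext_ideal_def R_ops by blast
    qed
    fix c d assume "c \<in> ext_ideal j" "d \<in> carrier R"
    then show "d \<otimes>\<^bsub>R\<^esub> c \<in> ext_ideal j" "c \<otimes>\<^bsub>R\<^esub> d \<in> ext_ideal j"
      using mult conv_comm[of c d] by (auto simp: R_ops)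
  qed
qed

text \<open>An element of the generated ideal is a finite combination, while a series has infinitely
  many terms. Finitely many exponents \<open>gen_products j\<close> divide all of them, so the
  series splits into finitely many parts, each a monomial times a series that still
  converges.\<close>

lemma genideal_ext_ideal: "Idl\<^bsub>R\<^esub> (power_ideal j) = ext_ideal j"
proof
  interpret R: cring R by (rule cring_R)
  have miR: "power_ideal j \<subseteq> carrier R" using power_ideal_sub base_sub_R by blast
  have "power_ideal j \<subseteq> ext_ideal j" using miR power_expos_ext[of j] by (auto simp: power_ideal_def ext_ideal_def R_ops)
  then show "Idl\<^bsub>R\<^esub> (power_ideal j) \<subseteq> ext_ideal j" by (rule R.genideal_minimal[OF ideal_ext_ideal])
  interpret I: ideal "Idl\<^bsub>R\<^esub> (power_ideal j)" R by (rule R.genideal_ideal[OF miR])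
  have main: "finite V \<Longrightarrow> V \<subseteq> power_expos j \<Longrightarrow> growth Q H c \<Longrightarrow> {x. c x \<noteq> 0} \<subseteq> (\<Union>w\<in>V. (\<lambda>y. w + y) ` Q) \<Longrightarrow> c \<in> Idl\<^bsub>R\<^esub> (power_ideal j)" for V c
  proof (induction V arbitrary: c rule: finite_induct)
    case empty
    then have "c = (\<lambda>x. 0)" by auto
    then show ?case using I.zero_closed by (simp add: R_ops)
  next
    case (insert w V)
    have wQ: "w \<in> Q" using insert power_expos_sub Bs_sub by blast
    \<comment> \<open>Quotient by the monomial \<open>w\<close> of all terms divisible by it;
      \<open>e\<close> keeps the others, which are covered by the remaining divisors.\<close>
    define d where "d y = (if y \<in> Q then c (w + y) else 0)" for y
    define e where "e x = (if x \<in> (\<lambda>y. w + y) ` Q then 0 else c x)" for x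
    have gd: "growth Q H d" unfolding d_def by (rule growth_shift[OF insert(5) wQ])
    have ge: "growth Q H e"
      by (rule growth_dominated[OF insert(5), of _ 1]) (use insert(5) in \<open>auto simp: e_def growth_def\<close>)
    have "{x. e x \<noteq> 0} \<subseteq> (\<Union>w\<in>V. (\<lambda>y. w + y) ` Q)" using insert(6) by (auto simp: e_def)
    then have eI: "e \<in> Idl\<^bsub>R\<^esub> (power_ideal j)" using insert ge by auto
    have "mono1 w \<in> power_ideal j" using insert scaled_mono_power_ideal[of w j 1] by simp
    then have "conv Q (mono1 w) d \<in> Idl\<^bsub>R\<^esub> (power_ideal j)"
      using I.I_r_closed[OF subsetD[OF R.genideal_self[OF miR]], of "mono1 w" d] gd by (simp add: R_ops)
    then have "(\<lambda>x. conv Q (mono1 w) d x + e x) \<in> Idl\<^bsub>R\<^esub> (power_ideal j)"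
      using I.a_closed[OF _ eI] by (simp add: R_ops)
    moreover have "(\<lambda>x. conv Q (mono1 w) d x + e x) = c"
    proof
      fix x
      show "conv Q (mono1 w) d x + e x = c x"
      proof (cases "x \<in> (\<lambda>y. w + y) ` Q")
        case True
        then show ?thesis using conv_mono1[OF wQ] by (auto simp: d_def e_def)
      next
        case False
        then have "conv Q (mono1 w) d x = 0" by (intro conv_mono1_out) auto
        then show ?thesis using False by (simp add: e_def)
      qed
    qed
    ultimately show ?case by simp
  qed
  show "ext_ideal j \<subseteq> Idl\<^bsub>R\<^esub> (power_ideal j)"
  proof
    fix c assume c: "c \<in> ext_ideal j"
    have "ext j \<subseteq> (\<Union>w\<in>gen_products j. (\<lambda>y. w + y) ` Q)"
    proof
      fix x assume "x \<in> ext j"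
      then obtain u v where uv: "x = u + v" "u \<in> power_expos j" "v \<in> Q" by (auto simp: ext_def)
      obtain w y where w: "w \<in> gen_products j" "y \<in> Bs" "u = w + y" using power_expos_gen_products[OF uv(2)] by blast
      have "x = w + (y + v)" using uv w by (simp add: add.assoc)
      moreover have "y + v \<in> Q" using add_mem w uv Bs_sub by blast
      ultimately show "x \<in> (\<Union>w\<in>gen_products j. (\<lambda>y. w + y) ` Q)" using w by blast
    qed
    then show "c \<in> Idl\<^bsub>R\<^esub> (power_ideal j)" using main[OF finite_gen_products gen_products_sub] c by (auto simp: ext_ideal_def)
  qed
qed

end

section \<open>Homology of the twisted differential\<close>

definition ksgn :: "nat \<Rightarrow> nat set \<Rightarrow> complex" where
  "ksgn k K = (if even (card {l\<in>K. l < k}) then 1 else -1)"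

lemma ksgn_square [simp]: "ksgn k K * ksgn k K = 1"
  by (simp add: ksgn_def)

lemma ksgn_remove [simp]: "ksgn k (K - {k}) = ksgn k K"
  unfolding ksgn_def by (rule arg_cong[where f = "\<lambda>S. if even (card S) then 1 else -1"]) auto

lemma ksgn_insert [simp]: "ksgn k (insert k K) = ksgn k K"
  unfolding ksgn_def by (rule arg_cong[where f = "\<lambda>S. if even (card S) then 1 else -1"]) auto

lemma ksgn_insert_other:
  assumes "finite K" "k' \<notin> K"
  shows "ksgn k (insert k' K) = (if k' < k then - ksgn k K else ksgn k K)"
proof -
  have "{l\<in>insert k' K. l < k} = (if k' < k then insert k' {l\<in>K. l < k} else {l\<in>K. l < k})" by auto
  then show ?thesis using assms by (auto simp: ksgn_def)
qed

lemma ksgn_anticommute: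
  assumes f: "finite K" and k: "k \<in> K" and k': "k' \<notin> K"
  shows "ksgn k K * ksgn k' (K - {k}) = - (ksgn k' K * ksgn k (insert k' K))"
proof -
  have "ksgn k' K = (if k < k' then - ksgn k' (K - {k}) else ksgn k' (K - {k}))"
    using ksgn_insert_other[of "K - {k}" k k'] f k by (simp add: insert_absorb)
  moreover have "ksgn k (insert k' K) = (if k' < k then - ksgn k K else ksgn k K)"
    by (rule ksgn_insert_other[OF f k'])
  moreover have "k \<noteq> k'" using k k' by auto
  ultimately show ?thesis by auto
qed

lemma ksgn_anticommute2:
  assumes f: "finite K" and k: "k \<in> K" and k': "k' \<in> K" and n: "k \<noteq> k'"
  shows "ksgn k K * ksgn k' (K - {k}) = - (ksgn k' K * ksgn k (K - {k'}))"
proof -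
  have "ksgn k' (insert k (K - {k})) = (if k < k' then - ksgn k' (K - {k}) else ksgn k' (K - {k}))"
    by (rule ksgn_insert_other) (use f in auto)
  moreover have "ksgn k (insert k' (K - {k'})) = (if k' < k then - ksgn k (K - {k'}) else ksgn k (K - {k'}))"
    by (rule ksgn_insert_other) (use f in auto)
  moreover have "insert k (K - {k}) = K" "insert k' (K - {k'}) = K" using k k' by auto
  ultimately show ?thesis using n by auto
qed

text \<open>\<open>A\<close> and \<open>B\<close> are mutually inverse frames for wedging and
  contracting, \<open>a l\<close> stands for the exponent of the variable \<open>l\<close> plus one,
  and \<open>Y l l'\<close> for the value at the exponent with \<open>l\<close> lowered and
  \<open>l'\<close> raised. Pairs k \<noteq> k' cancel by the sign rule. Pairs k = k' run over
  \<open>K\<close> in the first sum and over its complement in the second; together they form a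
  trace, which \<open>BA\<close> evaluates to the sum of the \<open>a l\<close>. The lowered
  exponent in the first sum costs, through \<open>AB\<close>, one for each element of
  \<open>K\<close>.\<close>

lemma koszul_identity:
  fixes A :: "nat \<Rightarrow> nat \<Rightarrow> complex" and B :: "nat \<Rightarrow> nat \<Rightarrow> complex" and a :: "nat \<Rightarrow> complex"
    and Y :: "nat \<Rightarrow> nat \<Rightarrow> nat set \<Rightarrow> complex" and V :: "nat set \<Rightarrow> complex"
  assumes fC: "finite C" and fN: "finite N" and K: "K \<subseteq> N"
    and AB: "\<And>k k'. k \<in> N \<Longrightarrow> k' \<in> N \<Longrightarrow> (\<Sum>l\<in>C. A k l * B l k') = (if k = k' then 1 else 0)"
    and BA: "\<And>l l'. l \<in> C \<Longrightarrow> l' \<in> C \<Longrightarrow> (\<Sum>k\<in>N. B l' k * A k l) = (if l' = l then 1 else 0)"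
    and Y: "\<And>l W. l \<in> C \<Longrightarrow> Y l l W = V W"
  shows "(\<Sum>k\<in>K. ksgn k K * (\<Sum>l\<in>C. A k l * (\<Sum>l'\<in>C. \<Sum>k'\<in>N - (K - {k}).
            ksgn k' (K - {k}) * B l' k' * (a l' - (if l = l' then 1 else 0)) * Y l l' (insert k' (K - {k}))))) +
         (\<Sum>l'\<in>C. \<Sum>k'\<in>N - K. ksgn k' K * B l' k' * a l' * (\<Sum>k\<in>insert k' K.
            ksgn k (insert k' K) * (\<Sum>l\<in>C. A k l * Y l l' (insert k' K - {k}))))
         = ((\<Sum>l\<in>C. a l) - of_nat (card K)) * V K"
    (is "?S + ?T = ?R")
proof -
  \<comment> \<open>The common content of both orders of composition: wedge with k along l, contract
    with k' along l'.\<close>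
  define M where "M k k' W = (\<Sum>l\<in>C. \<Sum>l'\<in>C. A k l * B l' k' * a l' * Y l l' W)" for k k' W
  have fK: "finite K" using K fN finite_subset by blast
  have S: "?S = (\<Sum>k\<in>K. \<Sum>k'\<in>N - (K - {k}). ksgn k K * ksgn k' (K - {k}) *
      (M k k' (insert k' (K - {k})) - (if k = k' then 1 else 0) * V (insert k' (K - {k}))))"
  proof (rule sum.cong[OF refl])
    fix k assume k: "k \<in> K"
    have "(\<Sum>l\<in>C. A k l * (\<Sum>l'\<in>C. \<Sum>k'\<in>N - (K - {k}).
            ksgn k' (K - {k}) * B l' k' * (a l' - (if l = l' then 1 else 0)) * Y l l' (insert k' (K - {k}))))
       = (\<Sum>l\<in>C. \<Sum>k'\<in>N - (K - {k}). \<Sum>l'\<in>C. A k l *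
            (ksgn k' (K - {k}) * B l' k' * (a l' - (if l = l' then 1 else 0)) * Y l l' (insert k' (K - {k}))))"
      by (subst sum.swap) (simp only: sum_distrib_left)
    also have "\<dots> = (\<Sum>k'\<in>N - (K - {k}). \<Sum>l\<in>C. \<Sum>l'\<in>C. A k l *
            (ksgn k' (K - {k}) * B l' k' * (a l' - (if l = l' then 1 else 0)) * Y l l' (insert k' (K - {k}))))"
      by (rule sum.swap)
    also have "\<dots> = (\<Sum>k'\<in>N - (K - {k}). ksgn k' (K - {k}) *
      (M k k' (insert k' (K - {k})) - (if k = k' then 1 else 0) * V (insert k' (K - {k}))))"
    proof (rule sum.cong[OF refl])
      fix k' assume k': "k' \<in> N - (K - {k})"
      let ?W = "insert k' (K - {k})"
      have "(\<Sum>l\<in>C. \<Sum>l'\<in>C. A k l * (ksgn k' (K - {k}) * B l' k' * (a l' - (if l = l' then 1 else 0)) * Y l l' ?W))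
        = (\<Sum>l\<in>C. \<Sum>l'\<in>C. ksgn k' (K - {k}) * (A k l * B l' k' * a l' * Y l l' ?W) - (if l' = l then ksgn k' (K - {k}) * (A k l * B l' k' * Y l l' ?W) else 0))"
        by (intro sum.cong refl) (simp add: algebra_simps)
      also have "\<dots> = ksgn k' (K - {k}) * M k k' ?W - (\<Sum>l\<in>C. ksgn k' (K - {k}) * (A k l * B l k' * Y l l ?W))"
        using fC by (simp add: M_def sum_subtractf sum_distrib_left)
      also have "(\<Sum>l\<in>C. ksgn k' (K - {k}) * (A k l * B l k' * Y l l ?W)) = ksgn k' (K - {k}) * ((\<Sum>l\<in>C. A k l * B l k') * V ?W)"
        by (simp add: sum_distrib_left sum_distrib_right Y)
      also have "(\<Sum>l\<in>C. A k l * B l k') = (if k = k' then 1 else 0)" using AB k k' K by auto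
      finally show "(\<Sum>l\<in>C. \<Sum>l'\<in>C. A k l * (ksgn k' (K - {k}) * B l' k' * (a l' - (if l = l' then 1 else 0)) * Y l l' ?W))
        = ksgn k' (K - {k}) * (M k k' ?W - (if k = k' then 1 else 0) * V ?W)"
        by (simp add: right_diff_distrib)
    qed
    finally show "ksgn k K * (\<Sum>l\<in>C. A k l * (\<Sum>l'\<in>C. \<Sum>k'\<in>N - (K - {k}).
            ksgn k' (K - {k}) * B l' k' * (a l' - (if l = l' then 1 else 0)) * Y l l' (insert k' (K - {k}))))
       = (\<Sum>k'\<in>N - (K - {k}). ksgn k K * ksgn k' (K - {k}) *
      (M k k' (insert k' (K - {k})) - (if k = k' then 1 else 0) * V (insert k' (K - {k}))))"
      by (simp add: sum_distrib_left mult.assoc)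
  qed
  have T: "?T = (\<Sum>k'\<in>N - K. \<Sum>k\<in>insert k' K. ksgn k' K * ksgn k (insert k' K) * M k k' (insert k' K - {k}))"
  proof -
    have "?T = (\<Sum>k'\<in>N - K. \<Sum>l'\<in>C. \<Sum>k\<in>insert k' K. \<Sum>l\<in>C.
        ksgn k' K * B l' k' * a l' * (ksgn k (insert k' K) * (A k l * Y l l' (insert k' K - {k}))))"
      by (subst sum.swap) (simp only: sum_distrib_left)
    also have "\<dots> = (\<Sum>k'\<in>N - K. \<Sum>k\<in>insert k' K. \<Sum>l'\<in>C. \<Sum>l\<in>C.
        ksgn k' K * B l' k' * a l' * (ksgn k (insert k' K) * (A k l * Y l l' (insert k' K - {k}))))"
      by (rule sum.cong[OF refl], rule sum.swap)
    also have "\<dots> = (\<Sum>k'\<in>N - K. \<Sum>k\<in>insert k' K. \<Sum>l\<in>C. \<Sum>l'\<in>C.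
        ksgn k' K * B l' k' * a l' * (ksgn k (insert k' K) * (A k l * Y l l' (insert k' K - {k}))))"
      by (rule sum.cong[OF refl], rule sum.cong[OF refl], rule sum.swap)
    also have "\<dots> = (\<Sum>k'\<in>N - K. \<Sum>k\<in>insert k' K. ksgn k' K * ksgn k (insert k' K) * M k k' (insert k' K - {k}))"
      unfolding M_def sum_distrib_left by (intro sum.cong refl) (simp only: mult_ac)
    finally show ?thesis .
  qed
  have S': "?S = (\<Sum>k\<in>K. (M k k K - V K) + (\<Sum>k'\<in>N - K. ksgn k K * ksgn k' (K - {k}) * M k k' (insert k' (K - {k}))))"
    unfolding S
  proof (rule sum.cong[OF refl])
    fix k assume k: "k \<in> K"
    \<comment> \<open>The value k' = k is isolated: it restores \<open>K\<close>, and the correction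
      term is nonzero only there.\<close>
    have e: "N - (K - {k}) = insert k (N - K)" using k K by auto
    have i: "insert k (K - {k}) = K" using k by auto
    have "(\<Sum>k'\<in>N - (K - {k}). ksgn k K * ksgn k' (K - {k}) *
      (M k k' (insert k' (K - {k})) - (if k = k' then 1 else 0) * V (insert k' (K - {k})))) =
      (M k k K - V K) + (\<Sum>k'\<in>N - K. ksgn k K * ksgn k' (K - {k}) *
      (M k k' (insert k' (K - {k})) - (if k = k' then 1 else 0) * V (insert k' (K - {k}))))"
      unfolding e using k fN by (subst sum.insert) (auto simp: i insert_absorb)
    also have "(\<Sum>k'\<in>N - K. ksgn k K * ksgn k' (K - {k}) *
      (M k k' (insert k' (K - {k})) - (if k = k' then 1 else 0) * V (insert k' (K - {k})))) =
      (\<Sum>k'\<in>N - K. ksgn k K * ksgn k' (K - {k}) * M k k' (insert k' (K - {k})))"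
      using k by (intro sum.cong refl) auto
    finally show "(\<Sum>k'\<in>N - (K - {k}). ksgn k K * ksgn k' (K - {k}) *
      (M k k' (insert k' (K - {k})) - (if k = k' then 1 else 0) * V (insert k' (K - {k})))) =
      (M k k K - V K) + (\<Sum>k'\<in>N - K. ksgn k K * ksgn k' (K - {k}) * M k k' (insert k' (K - {k})))" .
  qed
  have T': "?T = (\<Sum>k'\<in>N - K. M k' k' K + (\<Sum>k\<in>K. ksgn k' K * ksgn k (insert k' K) * M k k' (insert k' (K - {k}))))"
    unfolding T
  proof (rule sum.cong[OF refl])
    fix k' assume k': "k' \<in> N - K"
    have i: "insert k' K - {k'} = K" using k' by auto
    have "(\<Sum>k\<in>insert k' K. ksgn k' K * ksgn k (insert k' K) * M k k' (insert k' K - {k}))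
      = M k' k' K + (\<Sum>k\<in>K. ksgn k' K * ksgn k (insert k' K) * M k k' (insert k' K - {k}))"
      using k' fK by (subst sum.insert) (auto simp: i)
    also have "(\<Sum>k\<in>K. ksgn k' K * ksgn k (insert k' K) * M k k' (insert k' K - {k})) =
      (\<Sum>k\<in>K. ksgn k' K * ksgn k (insert k' K) * M k k' (insert k' (K - {k})))"
    proof (rule sum.cong[OF refl])
      fix k assume "k \<in> K"
      then have "insert k' K - {k} = insert k' (K - {k})" using k' by auto
      then show "ksgn k' K * ksgn k (insert k' K) * M k k' (insert k' K - {k}) = ksgn k' K * ksgn k (insert k' K) * M k k' (insert k' (K - {k}))"
        by simp
    qed
    finally show "(\<Sum>k\<in>insert k' K. ksgn k' K * ksgn k (insert k' K) * M k k' (insert k' K - {k}))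
      = M k' k' K + (\<Sum>k\<in>K. ksgn k' K * ksgn k (insert k' K) * M k k' (insert k' (K - {k})))" .
  qed
  have cancel: "(\<Sum>k\<in>K. \<Sum>k'\<in>N - K. ksgn k K * ksgn k' (K - {k}) * M k k' (insert k' (K - {k}))) +
     (\<Sum>k'\<in>N - K. \<Sum>k\<in>K. ksgn k' K * ksgn k (insert k' K) * M k k' (insert k' (K - {k}))) = 0"
  proof -
    have "(\<Sum>k\<in>K. \<Sum>k'\<in>N - K. ksgn k K * ksgn k' (K - {k}) * M k k' (insert k' (K - {k}))) =
      (\<Sum>k\<in>K. \<Sum>k'\<in>N - K. - (ksgn k' K * ksgn k (insert k' K) * M k k' (insert k' (K - {k}))))"
      by (intro sum.cong refl) (use ksgn_anticommute[OF fK] in auto)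
    also have "\<dots> = - (\<Sum>k'\<in>N - K. \<Sum>k\<in>K. ksgn k' K * ksgn k (insert k' K) * M k k' (insert k' (K - {k})))"
      by (subst sum.swap) (simp add: sum_negf)
    finally show ?thesis by simp
  qed
  have "?S + ?T = (\<Sum>k\<in>K. M k k K) + (\<Sum>k\<in>N - K. M k k K) - of_nat (card K) * V K"
    unfolding S' T' sum.distrib using cancel by (simp add: sum_subtractf algebra_simps)
  also have "(\<Sum>k\<in>K. M k k K) + (\<Sum>k\<in>N - K. M k k K) = (\<Sum>k\<in>N. M k k K)"
    using sum.subset_diff[OF K fN, of "\<lambda>k. M k k K"] by (simp add: add.commute)
  also have "\<dots> = (\<Sum>l\<in>C. \<Sum>l'\<in>C. \<Sum>k\<in>N. B l' k * A k l * (a l' * Y l l' K))"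
  proof -
    have "(\<Sum>k\<in>N. M k k K) = (\<Sum>l\<in>C. \<Sum>k\<in>N. \<Sum>l'\<in>C. A k l * B l' k * a l' * Y l l' K)"
      unfolding M_def by (rule sum.swap)
    also have "\<dots> = (\<Sum>l\<in>C. \<Sum>l'\<in>C. \<Sum>k\<in>N. A k l * B l' k * a l' * Y l l' K)"
      by (rule sum.cong[OF refl], rule sum.swap)
    finally show ?thesis by (simp add: mult_ac)
  qed
  also have "\<dots> = (\<Sum>l\<in>C. \<Sum>l'\<in>C. if l' = l then a l * V K else 0)"
    by (intro sum.cong refl) (auto simp: sum_distrib_right[symmetric] BA Y)
  also have "\<dots> = (\<Sum>l\<in>C. a l) * V K" using fC by (simp add: sum_distrib_right)
  finally show ?thesis by (simp add: algebra_simps)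
qed

text \<open>
  \<open>J\<close> is the set of exponents that vanish over the base \<open>\<S>\<^sub>k\<close>, \<open>term_expo l\<close> are the exponents of the terms
  of \<open>F\<close>, and \<open>dlog_coeff k\<close> is the pairing with \<open>e\<^sup>k\<close>. Each exponent \<open>x\<close> lies over a maximal cone with
  rays \<open>cone x\<close>; \<open>alpha x\<close> are its coordinates there, relative to the basis monomial of the block
  of \<open>x\<close>, and \<open>dual_coord x\<close> is the inverse of the matrix of the rays. Multiplication by a term of \<open>F\<close> preserves
  the block and the rank \<open>rk\<close> if the term belongs to \<open>cone x\<close>, and raises \<open>rk\<close> otherwise.
\<close>

locale koszul_data = height_monoid Q H \<Gamma> for Q :: "'m::cancel_comm_monoid_add set" and H \<Gamma> +
  fixes J :: "'m set" and n :: nat and \<Lambda> :: "nat set" and term_expo :: "nat \<Rightarrow> 'm" and dlog_coeff :: "nat \<Rightarrow> 'm \<Rightarrow> int"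
    and rk :: "'m \<Rightarrow> nat" and cone :: "'m \<Rightarrow> nat set" and alpha :: "'m \<Rightarrow> nat \<Rightarrow> nat"
    and dual_coord :: "'m \<Rightarrow> nat \<Rightarrow> nat \<Rightarrow> int" and rank_bound :: nat and coord_bound :: int
  assumes J_add: "x \<in> J \<Longrightarrow> y \<in> Q \<Longrightarrow> x + y \<in> J"
    and dlog_coeff_add: "k \<in> {1..n} \<Longrightarrow> dlog_coeff k (x + y) = dlog_coeff k x + dlog_coeff k y"
    and fin_L: "finite \<Lambda>" and term_expo_mem: "l \<in> \<Lambda> \<Longrightarrow> term_expo l \<in> Q"
    and cone_sub: "x \<in> Q \<Longrightarrow> cone x \<subseteq> \<Lambda>" and card_cone: "x \<in> Q \<Longrightarrow> card (cone x) = n"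
    and cone_step: "x \<in> Q \<Longrightarrow> l \<in> cone x \<Longrightarrow> rk (x + term_expo l) = rk x \<and> cone (x + term_expo l) = cone x \<and>
        dual_coord (x + term_expo l) = dual_coord x \<and> alpha (x + term_expo l) = (alpha x)(l := Suc (alpha x l))"
    and cone_step_J: "x \<in> Q \<Longrightarrow> l \<in> cone x \<Longrightarrow> x + term_expo l \<in> J \<Longrightarrow> x \<in> J"
    and rk_gt: "x \<in> Q \<Longrightarrow> l \<in> \<Lambda> - cone x \<Longrightarrow> rk x < rk (x + term_expo l)"
    and alpha_pos: "x \<in> Q \<Longrightarrow> 0 < alpha x l \<Longrightarrow> \<exists>z\<in>Q. x = z + term_expo l \<and> l \<in> cone z"
    and AB: "x \<in> Q \<Longrightarrow> k \<in> {1..n} \<Longrightarrow> k' \<in> {1..n} \<Longrightarrow> (\<Sum>l\<in>cone x. dlog_coeff k (term_expo l) * dual_coord x l k') = (if k = k' then 1 else 0)"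
    and BA: "x \<in> Q \<Longrightarrow> l \<in> cone x \<Longrightarrow> l' \<in> cone x \<Longrightarrow> (\<Sum>k\<in>{1..n}. dual_coord x l' k * dlog_coeff k (term_expo l)) = (if l' = l then 1 else 0)"
    and rk_bd: "x \<in> Q - J \<Longrightarrow> rk x < rank_bound" and dual_coord_bd: "\<bar>dual_coord x l k\<bar> \<le> coord_bound"
begin

section \<open>Shifts by the terms of F and the twisted differential\<close>

abbreviation S where "S \<equiv> Q - J"
abbreviation d where "d k l \<equiv> complex_of_int (dlog_coeff k (term_expo l))"
abbreviation sh where "sh l w \<equiv> conv Q (mono1 (term_expo l)) w"

lemma sh_at: "l \<in> \<Lambda> \<Longrightarrow> z \<in> Q \<Longrightarrow> sh l w (z + term_expo l) = w z"
  using conv_mono1[OF term_expo_mem, of l z w] by (simp add: add.commute)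

lemma sh_out: "\<nexists>z. z \<in> Q \<and> x = z + term_expo l \<Longrightarrow> sh l w x = 0"
  by (rule conv_mono1_out) (simp add: add.commute)

lemma sh_cases:
  obtains z where "z \<in> Q" "x = z + term_expo l" | "\<And>w. sh l w x = 0"
  using sh_out by metis

lemma sh_sum: "l \<in> \<Lambda> \<Longrightarrow> sh l (\<lambda>x. \<Sum>a\<in>I. c a * f a x) x = (\<Sum>a\<in>I. c a * sh l (f a) x)"
  by (rule sh_cases[of x l]) (auto simp: sh_at)

lemma sh_diff: "l \<in> \<Lambda> \<Longrightarrow> sh l (\<lambda>x. f x - g x) x = sh l f x - sh l g x"
  by (rule sh_cases[of x l]) (auto simp: sh_at)

lemma sh_comm: "sh l (sh l' w) = sh l' (sh l w)"
  by (metis conv_assoc conv_comm)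

text \<open>The u^j-coefficient of the operator \<open>\<partial>_k F + u \<partial>_k\<close>; the
  twisted differential is the Koszul complex of these n commuting operators.\<close>

definition tpartial :: "nat \<Rightarrow> (nat \<Rightarrow> 'm \<Rightarrow> complex) \<Rightarrow> nat \<Rightarrow> 'm \<Rightarrow> complex" where
  "tpartial k w j x = (\<Sum>l\<in>\<Lambda>. d k l * sh l (w j) x) + (if j = 0 then 0 else of_int (dlog_coeff k x) * w (j - 1) x)"

definition twisted_D :: "(nat \<Rightarrow> nat set \<Rightarrow> 'm \<Rightarrow> complex) \<Rightarrow> nat \<Rightarrow> nat set \<Rightarrow> 'm \<Rightarrow> complex" where
  "twisted_D w j K x = (\<Sum>k\<in>K. ksgn k K * tpartial k (\<lambda>i. w i (K - {k})) j x)"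

lemma tpartial_sum: "tpartial k (\<lambda>i x. \<Sum>a\<in>I. c a * f a i x) j x = (\<Sum>a\<in>I. c a * tpartial k (f a) j x)"
proof -
  have "(\<Sum>l\<in>\<Lambda>. d k l * sh l (\<lambda>x. \<Sum>a\<in>I. c a * f a j x) x) = (\<Sum>l\<in>\<Lambda>. \<Sum>a\<in>I. c a * (d k l * sh l (f a j) x))"
    by (rule sum.cong[OF refl]) (simp add: sh_sum sum_distrib_left algebra_simps)
  also have "\<dots> = (\<Sum>a\<in>I. c a * (\<Sum>l\<in>\<Lambda>. d k l * sh l (f a j) x))"
    by (subst sum.swap) (simp add: sum_distrib_left)
  finally show ?thesis
    by (simp add: tpartial_def algebra_simps sum.distrib sum_distrib_left)
qed

lemma tpartial_diff: "tpartial k (\<lambda>i x. f i x - g i x) j x = tpartial k f j x - tpartial k g j x"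
  by (simp add: tpartial_def sh_diff algebra_simps sum_subtractf)

lemma tpartial_zero: "tpartial k (\<lambda>i x. 0) j x = 0"
  using tpartial_sum[where k = k and I = "{}"] by simp

lemma twisted_D_sum: "twisted_D (\<lambda>i K x. \<Sum>a\<in>I. f a i K x) j K x = (\<Sum>a\<in>I. twisted_D (f a) j K x)"
proof -
  have "tpartial k (\<lambda>i x. \<Sum>a\<in>I. f a i (K - {k}) x) j x = (\<Sum>a\<in>I. tpartial k (\<lambda>i. f a i (K - {k})) j x)" for k
    using tpartial_sum[where k = k and I = I and c = "\<lambda>_. 1" and f = "\<lambda>a i. f a i (K - {k})"] by simp
  then show ?thesis unfolding twisted_D_def by (simp add: sum_distrib_left) (rule sum.swap)
qed

lemma twisted_D_diff: "twisted_D (\<lambda>i K x. f i K x - g i K x) j K x = twisted_D f j K x - twisted_D g j K x"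
  by (simp add: twisted_D_def tpartial_diff algebra_simps sum_subtractf)

lemma sh_tpartial:
  assumes l: "l \<in> \<Lambda>" and k: "k \<in> {1..n}"
  shows "sh l (tpartial k w j) x = (\<Sum>l'\<in>\<Lambda>. d k l' * sh l (sh l' (w j)) x) +
     (if j = 0 then 0 else (of_int (dlog_coeff k x) - d k l) * sh l (w (j - 1)) x)"
  by (rule sh_cases[of x l]) (auto simp: sh_at[OF l] tpartial_def dlog_coeff_add[OF k])

text \<open>The commutator would be u times the difference of mixed second derivatives of F.
  Concretely, the expansion \<open>e\<close> is symmetric in k and k' up to exchanging two
  shifts.\<close>

lemma tpartial_comm:
  assumes k: "k \<in> {1..n}" and k': "k' \<in> {1..n}"
  shows "tpartial k (tpartial k' w) j x = tpartial k' (tpartial k w) j x"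
proof -
  have e: "tpartial k (tpartial k' w) j x = (\<Sum>l\<in>\<Lambda>. \<Sum>l'\<in>\<Lambda>. d k l * d k' l' * sh l (sh l' (w j)) x) +
     (if j = 0 then 0 else (\<Sum>l\<in>\<Lambda>. (d k l * of_int (dlog_coeff k' x) + d k' l * of_int (dlog_coeff k x) - d k l * d k' l) * sh l (w (j - 1)) x)) +
     (if j = 0 \<or> j = 1 then 0 else of_int (dlog_coeff k x) * of_int (dlog_coeff k' x) * w (j - 2) x)"
    if k: "k \<in> {1..n}" and k': "k' \<in> {1..n}" for k k'
  proof -
    have 1: "(\<Sum>l\<in>\<Lambda>. d k l * sh l (tpartial k' w j) x) = (\<Sum>l\<in>\<Lambda>. \<Sum>l'\<in>\<Lambda>. d k l * d k' l' * sh l (sh l' (w j)) x) +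
      (if j = 0 then 0 else (\<Sum>l\<in>\<Lambda>. d k l * (of_int (dlog_coeff k' x) - d k' l) * sh l (w (j - 1)) x))"
    proof -
      have "(\<Sum>l\<in>\<Lambda>. d k l * sh l (tpartial k' w j) x) = (\<Sum>l\<in>\<Lambda>. (\<Sum>l'\<in>\<Lambda>. d k l * d k' l' * sh l (sh l' (w j)) x) +
          (if j = 0 then 0 else d k l * (of_int (dlog_coeff k' x) - d k' l) * sh l (w (j - 1)) x))"
        by (intro sum.cong refl) (simp add: sh_tpartial[OF _ k'] distrib_left sum_distrib_left mult.assoc)
      then show ?thesis by (simp add: sum.distrib)
    qed
    have 2: "of_int (dlog_coeff k x) * tpartial k' w (j - 1) x = (\<Sum>l\<in>\<Lambda>. d k' l * of_int (dlog_coeff k x) * sh l (w (j - 1)) x) +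
       (if j - 1 = 0 then 0 else of_int (dlog_coeff k x) * of_int (dlog_coeff k' x) * w (j - 1 - 1) x)"
      by (simp add: tpartial_def algebra_simps sum_distrib_left)
    show ?thesis
    proof (cases "j = 0")
      case True
      then show ?thesis using 1 by (simp add: tpartial_def[of k "tpartial k' w"])
    next
      case False
      have s: "(\<Sum>l\<in>\<Lambda>. (d k l * of_int (dlog_coeff k' x) + d k' l * of_int (dlog_coeff k x) - d k l * d k' l) * sh l (w (j - 1)) x) =
        (\<Sum>l\<in>\<Lambda>. d k l * (of_int (dlog_coeff k' x) - d k' l) * sh l (w (j - 1)) x) + (\<Sum>l\<in>\<Lambda>. d k' l * of_int (dlog_coeff k x) * sh l (w (j - 1)) x)"
        unfolding sum.distrib[symmetric] by (intro sum.cong refl) (simp add: algebra_simps)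
      have "j - 1 = 0 \<longleftrightarrow> j = 0 \<or> j = 1" "j - 1 - 1 = j - 2" using False by auto
      then show ?thesis unfolding tpartial_def[of k "tpartial k' w"] 1 2 s using False by simp
    qed
  qed
  have "(\<Sum>l\<in>\<Lambda>. \<Sum>l'\<in>\<Lambda>. d k l * d k' l' * sh l (sh l' (w j)) x) = (\<Sum>l\<in>\<Lambda>. \<Sum>l'\<in>\<Lambda>. d k' l * d k l' * sh l (sh l' (w j)) x)"
    by (subst sum.swap, intro sum.cong refl) (simp add: sh_comm[of _ _ "w j"] mult.commute)
  then show ?thesis unfolding e[OF k k'] e[OF k' k] by (simp add: algebra_simps)
qed

text \<open>Exchanging the two removed indices turns the double sum into its negative: the operators
  commute and the signs anticommute.\<close>

lemma twisted_D_twisted_D: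
  assumes K: "K \<subseteq> {1..n}"
  shows "twisted_D (twisted_D w) j K x = 0"
proof -
  have fK: "finite K" using K finite_subset by blast
  define g where "g k k' = ksgn k K * ksgn k' (K - {k}) * tpartial k (tpartial k' (\<lambda>i. w i (K - {k} - {k'}))) j x" for k k'
  have "twisted_D (twisted_D w) j K x = (\<Sum>k\<in>K. \<Sum>k'\<in>K - {k}. g k k')"
    unfolding twisted_D_def[of "twisted_D w"]
  proof (rule sum.cong[OF refl])
    fix k assume "k \<in> K"
    have "tpartial k (\<lambda>i. twisted_D w i (K - {k})) j x = tpartial k (\<lambda>i x. \<Sum>k'\<in>K - {k}. ksgn k' (K - {k}) * tpartial k' (\<lambda>i. w i (K - {k} - {k'})) i x) j x"
      by (simp add: twisted_D_def[abs_def])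
    also have "\<dots> = (\<Sum>k'\<in>K - {k}. ksgn k' (K - {k}) * tpartial k (tpartial k' (\<lambda>i. w i (K - {k} - {k'}))) j x)"
      by (rule tpartial_sum)
    finally show "ksgn k K * tpartial k (\<lambda>i. twisted_D w i (K - {k})) j x = (\<Sum>k'\<in>K - {k}. g k k')"
      by (simp add: g_def sum_distrib_left mult.assoc)
  qed
  also have "\<dots> = (\<Sum>(k, k')\<in>Sigma K (\<lambda>k. K - {k}). g k k')"
    using fK by (intro sum.Sigma) auto
  finally have 1: "twisted_D (twisted_D w) j K x = (\<Sum>(k, k')\<in>Sigma K (\<lambda>k. K - {k}). g k k')" .
  also have "\<dots> = (\<Sum>(k, k')\<in>Sigma K (\<lambda>k. K - {k}). g k' k)"
    by (rule sum.reindex_bij_witness[of _ "\<lambda>(a, b). (b, a)" "\<lambda>(a, b). (b, a)"]) auto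
  also have "\<dots> = (\<Sum>(k, k')\<in>Sigma K (\<lambda>k. K - {k}). - g k k')"
  proof (rule sum.cong[OF refl])
    fix p assume "p \<in> Sigma K (\<lambda>k. K - {k})"
    then obtain k k' where p: "p = (k, k')" and kk: "k \<in> K" "k' \<in> K" "k' \<noteq> k" by auto
    have e: "K - {k} - {k'} = K - {k'} - {k}" by auto
    have "tpartial k (tpartial k' (\<lambda>i. w i (K - {k} - {k'}))) j x = tpartial k' (tpartial k (\<lambda>i. w i (K - {k'} - {k}))) j x"
      unfolding e by (rule tpartial_comm) (use kk K in auto)
    then have "g k' k = - g k k'"
      unfolding g_def using ksgn_anticommute2[OF fK kk(2,1)] kk(3) by simp
    then show "(case p of (k, k') \<Rightarrow> g k' k) = (case p of (k, k') \<Rightarrow> - g k k')" by (simp add: p)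
  qed
  also have "\<dots> = - twisted_D (twisted_D w) j K x" unfolding 1 by (simp add: case_prod_unfold sum_negf)
  finally show ?thesis by simp
qed

lemma dlog_coeff_bound:
  assumes k: "k \<in> {1..n}"
  shows "\<exists>C\<ge>0. \<forall>x\<in>Q. real_of_int \<bar>dlog_coeff k x\<bar> \<le> C * real (H x)"
proof (intro exI conjI ballI)
  let ?C = "\<Sum>g\<in>\<Gamma>. real_of_int \<bar>dlog_coeff k g\<bar>"
  show C0: "0 \<le> ?C" by (intro sum_nonneg) auto
  have d0: "dlog_coeff k 0 = 0" using dlog_coeff_add[OF k, of 0 0] by simp
  have "H x = N \<longrightarrow> x \<in> Q \<longrightarrow> real_of_int \<bar>dlog_coeff k x\<bar> \<le> ?C * real (H x)" for N x
  proof (induction N arbitrary: x rule: less_induct)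
    case (less N)
    show ?case
    proof (intro impI)
      assume N: "H x = N" and x: "x \<in> Q"
      show "real_of_int \<bar>dlog_coeff k x\<bar> \<le> ?C * real (H x)"
      proof (cases "x = 0")
        case False
        then obtain g y where g: "g \<in> \<Gamma>" "y \<in> Q" "x = g + y" using gen x by blast
        have Hx: "H x = H g + H y" using g gen_sub H_add by blast
        then have "H y < N" using N H_gen[OF g(1)] by simp
        then have "real_of_int \<bar>dlog_coeff k y\<bar> \<le> ?C * real (H y)" using less g by blast
        moreover have "real_of_int \<bar>dlog_coeff k g\<bar> \<le> ?C" using g fin_gen by (intro member_le_sum) auto
        moreover have "?C \<le> ?C * real (H g)" 
          using mult_left_mono[OF _ C0, of 1 "real (H g)"] H_gen[OF g(1)] by simp
        moreover have "real_of_int \<bar>dlog_coeff k x\<bar> \<le> real_of_int \<bar>dlog_coeff k g\<bar> + real_of_int \<bar>dlog_coeff k y\<bar>"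
          unfolding g(3) dlog_coeff_add[OF k] by simp
        ultimately show ?thesis unfolding Hx by (simp add: algebra_simps)
      qed (simp add: d0)
    qed
  qed
  then show "real_of_int \<bar>dlog_coeff k x\<bar> \<le> ?C * real (H x)" if "x \<in> Q" for x using that by blast
qed

text \<open>The logarithmic derivative multiplies a coefficient by at most a constant times the
  height, and the height is below \<open>2 ^ H x\<close>, which doubling the radius absorbs.\<close>

lemma growth_dlog_coeff:
  assumes k: "k \<in> {1..n}" and c: "growth Q H c"
  shows "growth Q H (\<lambda>x. of_int (dlog_coeff k x) * c x)"
proof (rule growthI)
  show "of_int (dlog_coeff k x) * c x = 0" if "x \<notin> Q" for x using growth_out[OF c that] by simp
  fix R :: nat
  obtain C where C: "C \<ge> 0" "\<forall>x\<in>Q. real_of_int \<bar>dlog_coeff k x\<bar> \<le> C * real (H x)" using dlog_coeff_bound[OF k] by blast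
  obtain M where M: "M \<ge> 0" "\<forall>x\<in>Q. norm (c x) * real (2 * R) ^ H x \<le> M" using growth_bound[OF c] by metis
  have "norm (of_int (dlog_coeff k x) * c x) * real R ^ H x \<le> C * M" if x: "x \<in> Q" for x
  proof -
    have "real_of_int \<bar>dlog_coeff k x\<bar> \<le> C * 2 ^ H x"
    proof -
      have "real (H x) \<le> 2 ^ H x" using less_exp[of "H x"] by (metis less_imp_le of_nat_le_iff of_nat_numeral of_nat_power)
      then have "C * real (H x) \<le> C * 2 ^ H x" using C(1) by (rule mult_left_mono)
      then show ?thesis using C(2) x by fastforce
    qed
    then have "norm (of_int (dlog_coeff k x) * c x) * real R ^ H x \<le> (C * 2 ^ H x) * norm (c x) * real R ^ H x"
      unfolding norm_mult by (intro mult_right_mono) (auto simp: norm_of_int)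
    also have "\<dots> = C * (norm (c x) * real (2 * R) ^ H x)" by (simp add: power_mult_distrib)
    also have "\<dots> \<le> C * M" using M x C by (intro mult_left_mono) auto
    finally show ?thesis .
  qed
  then show "\<exists>M. \<forall>x\<in>Q. norm (of_int (dlog_coeff k x) * c x) * real R ^ H x \<le> M" by blast
qed

lemma growth_tpartial:
  assumes k: "k \<in> {1..n}" and w: "\<And>i. growth Q H (w i)"
  shows "growth Q H (tpartial k w j)"
proof -
  have "growth Q H (\<lambda>x. \<Sum>l\<in>\<Lambda>. d k l * sh l (w j) x)"
    by (intro growth_sum growth_scale growth_conv growth_mono1 term_expo_mem w)
  moreover have "growth Q H (\<lambda>x. if j = 0 then 0 else of_int (dlog_coeff k x) * w (j - 1) x)"
    using growth_dlog_coeff[OF k w] by (cases "j = 0") (auto simp: growth_zero)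
  ultimately show ?thesis unfolding tpartial_def[abs_def] by (rule growth_add)
qed

section \<open>Forms and the filtration by level\<close>

definition is_form :: "(nat \<Rightarrow> nat set \<Rightarrow> 'm \<Rightarrow> complex) \<Rightarrow> bool" where
  "is_form w \<longleftrightarrow> (\<forall>j. \<forall>K\<subseteq>{1..n}. growth Q H (w j K))"

lemma is_form_twisted_D: "is_form w \<Longrightarrow> is_form (twisted_D w)"
  unfolding is_form_def
proof (intro allI impI)
  fix j K assume w: "\<forall>j. \<forall>K\<subseteq>{1..n}. growth Q H (w j K)" and K: "K \<subseteq> {1..n}"
  have "growth Q H (\<lambda>x. \<Sum>k\<in>K. ksgn k K * tpartial k (\<lambda>i. w i (K - {k})) j x)"
  proof (intro growth_sum growth_scale growth_tpartial)
    fix k i assume k: "k \<in> K"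
    then show "k \<in> {1..n}" using K by blast
    have "K - {k} \<subseteq> {1..n}" using K by blast
    then show "growth Q H (w i (K - {k}))" using w by blast
  qed
  then show "growth Q H (twisted_D w j K)" by (simp add: twisted_D_def[abs_def])
qed

lemma is_form_diff: "is_form w \<Longrightarrow> is_form v \<Longrightarrow> is_form (\<lambda>j K x. w j K x - v j K x)"
  unfolding is_form_def
proof (intro allI impI)
  fix j K
  assume w: "\<forall>j. \<forall>K\<subseteq>{1..n}. growth Q H (w j K)" "\<forall>j. \<forall>K\<subseteq>{1..n}. growth Q H (v j K)" and K: "K \<subseteq> {1..n}"
  have "growth Q H (\<lambda>x. w j K x + - v j K x)"
    by (intro growth_add growth_uminus) (use w K in blast)+
  then show "growth Q H (\<lambda>x. w j K x - v j K x)" by simp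
qed

text \<open>Encodes the lexicographic order of the power of u and the rank, since ranks on
  \<open>S\<close> are below \<open>rank_bound\<close>. The derivative part takes its input from the
  preceding power of u, hence from a level lower by \<open>rank_bound\<close>.\<close>

definition L :: "nat \<Rightarrow> 'm \<Rightarrow> nat" where "L j x = j * rank_bound + rk x"

definition vanishes_below :: "nat \<Rightarrow> (nat \<Rightarrow> nat set \<Rightarrow> 'm \<Rightarrow> complex) \<Rightarrow> bool" where
  "vanishes_below r w \<longleftrightarrow> (\<forall>j. \<forall>K\<subseteq>{1..n}. \<forall>x\<in>S. L j x < r \<longrightarrow> w j K x = 0)"

lemma rk_le: "x \<in> Q \<Longrightarrow> l \<in> \<Lambda> \<Longrightarrow> rk x \<le> rk (x + term_expo l)"
  using cone_step[of x l] rk_gt[of x l] by (cases "l \<in> cone x") auto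

lemma S_pred: "z \<in> Q \<Longrightarrow> l \<in> \<Lambda> \<Longrightarrow> z + term_expo l \<in> S \<Longrightarrow> z \<in> S"
  using J_add term_expo_mem by blast

lemma cone_pred:
  assumes "x \<in> Q" "z \<in> Q" "x = z + term_expo l" "l \<in> \<Lambda>" "l \<in> cone z"
  shows "0 < alpha x l" "l \<in> cone x" "x - term_expo l = z"
  using cone_step[OF assms(2,5)] assms by auto

text \<open>
  On an element vanishing below level \<open>r\<close>, the terms of \<open>F\<close> outside the cone and the derivative part
  \<open>u \<partial>\<close> only contribute above level \<open>r\<close>.
\<close>

definition leading :: "(nat set \<Rightarrow> 'm \<Rightarrow> complex) \<Rightarrow> nat set \<Rightarrow> 'm \<Rightarrow> complex" where
  "leading v K x = (\<Sum>k\<in>K. ksgn k K * (\<Sum>l\<in>{l\<in>cone x. 0 < alpha x l}. d k l * v (K - {k}) (x - term_expo l)))"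

lemma twisted_D_leading:
  assumes v: "vanishes_below r v" and x: "x \<in> S" and r: "L j x \<le> r" and K: "K \<subseteq> {1..n}"
  shows "twisted_D v j K x = leading (v j) K x"
proof -
  have "tpartial k (\<lambda>i. v i (K - {k})) j x = (\<Sum>l\<in>{l\<in>cone x. 0 < alpha x l}. d k l * v j (K - {k}) (x - term_expo l))"
    if k: "k \<in> K" for k
  proof -
    have K': "K - {k} \<subseteq> {1..n}" using K by auto
    \<comment> \<open>The input comes from the power j - 1 at the same exponent, which is strictly
      below level r because \<open>rank_bound\<close> is positive as soon as \<open>S\<close> has an
      element.\<close>
    have z: "(if j = 0 then 0 else of_int (dlog_coeff k x) * v (j - 1) (K - {k}) x) = 0"
    proof (cases "j = 0")
      case False
      have "0 < rank_bound" using rk_bd[OF x] by simp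
      then have "L (j - 1) x < r" using r False unfolding L_def by (cases j) auto
      then show ?thesis using v x K' unfolding vanishes_below_def by auto
    qed simp
    have xQ: "x \<in> Q" using x by simp
    have sub: "{l\<in>cone x. 0 < alpha x l} \<subseteq> \<Lambda>" using cone_sub[OF xQ] by auto
    have "(\<Sum>l\<in>\<Lambda>. d k l * sh l (v j (K - {k})) x) = (\<Sum>l\<in>{l\<in>cone x. 0 < alpha x l}. d k l * sh l (v j (K - {k})) x)"
    proof (rule sum.mono_neutral_right[OF fin_L sub], rule ballI)
      fix l assume l: "l \<in> \<Lambda> - {l\<in>cone x. 0 < alpha x l}"
      show "d k l * sh l (v j (K - {k})) x = 0"
      proof (rule sh_cases[of x l])
        fix z assume z: "z \<in> Q" "x = z + term_expo l"
        \<comment> \<open>Otherwise \<open>l\<close> would lie in the cone of \<open>x\<close> with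
          positive coordinate and be one of the retained terms.\<close>
        have "l \<notin> cone z" using cone_pred[OF xQ z _, of] l by auto
        then have "rk z < rk x" using rk_gt[OF z(1), of l] l z by auto
        then have "L j z < r" using r by (simp add: L_def)
        moreover have "z \<in> S" using S_pred[OF z(1)] l x z by auto
        ultimately have "v j (K - {k}) z = 0" using v K' unfolding vanishes_below_def by blast
        then show ?thesis using sh_at[of l z] l z by auto
      qed auto
    qed
    also have "\<dots> = (\<Sum>l\<in>{l\<in>cone x. 0 < alpha x l}. d k l * v j (K - {k}) (x - term_expo l))"
    proof (rule sum.cong[OF refl])
      fix l assume l: "l \<in> {l\<in>cone x. 0 < alpha x l}"
      then obtain z where z: "z \<in> Q" "x = z + term_expo l" "l \<in> cone z" using alpha_pos[OF xQ] by blast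
      have "l \<in> \<Lambda>" using l sub by blast
      then show "d k l * sh l (v j (K - {k})) x = d k l * v j (K - {k}) (x - term_expo l)"
        using sh_at[of l z] z cone_pred[OF xQ z(1,2)] by simp
    qed
    finally show ?thesis using z by (simp add: tpartial_def)
  qed
  then show ?thesis unfolding twisted_D_def leading_def by (intro sum.cong refl) simp
qed

lemma vanishes_below_twisted_D:
  assumes v: "vanishes_below r v" shows "vanishes_below r (twisted_D v)"
  unfolding vanishes_below_def
proof (intro allI ballI impI)
  fix j K x assume K: "K \<subseteq> {1..n}" and x: "x \<in> S" and r: "L j x < r"
  have "v j (K - {k}) (x - term_expo l) = 0" if l: "l \<in> {l\<in>cone x. 0 < alpha x l}" for k l
  proof -
    have xQ: "x \<in> Q" using x by simp
    obtain z where z: "z \<in> Q" "x = z + term_expo l" "l \<in> cone z" using alpha_pos[OF xQ] l by blast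
    have lL: "l \<in> \<Lambda>" using l cone_sub[OF xQ] by auto
    have "L j z < r" using rk_le[OF z(1) lL] r z by (simp add: L_def)
    moreover have "z \<in> S" using S_pred[OF z(1) lL] x z by auto
    ultimately have "v j (K - {k}) z = 0" using v K unfolding vanishes_below_def by blast
    then show ?thesis using cone_pred(3)[OF xQ z(1,2) lL z(3)] by simp
  qed
  then show "twisted_D v j K x = 0" using twisted_D_leading[OF v x _ K, of j] r by (simp add: leading_def)
qed

text \<open>The degree of an exponent relative to the basis monomial of its block.\<close>

definition excess :: "'m \<Rightarrow> nat" where "excess x = (\<Sum>l\<in>cone x. alpha x l)"

text \<open>
  The sum over \<open>l\<close> of \<open>\<partial>/\<partial>z\<^sub>l\<close> composed with the contraction in the direction dual to \<open>\<rho>\<^sub>l\<close>;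
  its anticommutator with the Koszul differential is an Euler operator, diagonal on monomials.
\<close>

definition homotopy_op :: "(nat set \<Rightarrow> 'm \<Rightarrow> complex) \<Rightarrow> nat set \<Rightarrow> 'm \<Rightarrow> complex" where
  "homotopy_op v K x = (\<Sum>l\<in>cone x. \<Sum>k\<in>{1..n} - K. ksgn k K * of_int (dual_coord x l k) * of_nat (Suc (alpha x l)) * v (insert k K) (x + term_expo l))"

lemma finite_cone: "x \<in> Q \<Longrightarrow> finite (cone x)"
  using cone_sub fin_L finite_subset by blast

lemma homotopy:
  assumes x: "x \<in> Q" and K: "K \<subseteq> {1..n}"
  shows "leading (homotopy_op v) K x + homotopy_op (leading v) K x = of_int (int (excess x) + int n - int (card K)) * v K x"
proof -
  let ?C = "cone x"
  define P where "P = {l\<in>cone x. 0 < alpha x l}"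
  define a where "a l = (of_nat (Suc (alpha x l)) :: complex)" for l
  \<comment> \<open>The case l = l' is kept apart: lowering and raising the same variable returns to
    \<open>x\<close> even when \<open>x\<close> is not divisible by it. For l \<noteq> l' and
    \<open>l\<close> not dividing within the block, the value is 0.\<close>
  define Y where "Y l l' W = (if l = l' then v W x else if l \<in> P then v W (x - term_expo l + term_expo l') else 0)" for l l' W
  have pr: "x - term_expo l \<in> Q" "x = (x - term_expo l) + term_expo l" "cone (x - term_expo l) = cone x" "dual_coord (x - term_expo l) = dual_coord x"
    "alpha x = (alpha (x - term_expo l))(l := Suc (alpha (x - term_expo l) l))" "l \<in> \<Lambda>" if l: "l \<in> P" for l
  proof -
    obtain z where z: "z \<in> Q" "x = z + term_expo l" "l \<in> cone z" using alpha_pos[OF x] l by (auto simp: P_def)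
    then have "x - term_expo l = z" by simp
    then show "x - term_expo l \<in> Q" "x = (x - term_expo l) + term_expo l" "cone (x - term_expo l) = cone x" "dual_coord (x - term_expo l) = dual_coord x"
      "alpha x = (alpha (x - term_expo l))(l := Suc (alpha (x - term_expo l) l))"
      using z cone_step[OF z(1,3)] by simp_all
    show "l \<in> \<Lambda>" using l cone_sub[OF x] by (auto simp: P_def)
  qed
  have fC: "finite ?C" by (rule finite_cone[OF x])
  have PC: "P \<subseteq> ?C" by (auto simp: P_def)
  have first: "leading (homotopy_op v) K x = (\<Sum>k\<in>K. ksgn k K * (\<Sum>l\<in>?C. d k l * (\<Sum>l'\<in>?C. \<Sum>k'\<in>{1..n} - (K - {k}).
            ksgn k' (K - {k}) * of_int (dual_coord x l' k') * (a l' - (if l = l' then 1 else 0)) * Y l l' (insert k' (K - {k})))))"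
    unfolding leading_def P_def[symmetric]
  proof (rule sum.cong[OF refl])
    fix k
    let ?G = "\<lambda>l. d k l * (\<Sum>l'\<in>?C. \<Sum>k'\<in>{1..n} - (K - {k}).
            ksgn k' (K - {k}) * of_int (dual_coord x l' k') * (a l' - (if l = l' then 1 else 0)) * Y l l' (insert k' (K - {k})))"
    have "(\<Sum>l\<in>P. d k l * homotopy_op v (K - {k}) (x - term_expo l)) = (\<Sum>l\<in>P. ?G l)"
    proof (intro sum.cong refl arg_cong2[where f = "(*)"])
      fix l assume l: "l \<in> P"
      show "homotopy_op v (K - {k}) (x - term_expo l) = (\<Sum>l'\<in>?C. \<Sum>k'\<in>{1..n} - (K - {k}).
            ksgn k' (K - {k}) * of_int (dual_coord x l' k') * (a l' - (if l = l' then 1 else 0)) * Y l l' (insert k' (K - {k})))"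
        unfolding homotopy_op_def pr(3,4)[OF l]
      proof (intro sum.cong refl)
        fix l' k'
        have "alpha x l' = (if l = l' then Suc (alpha (x - term_expo l) l') else alpha (x - term_expo l) l')"
          using fun_cong[OF pr(5)[OF l], of l'] by auto
        then have "(of_nat (Suc (alpha (x - term_expo l) l')) :: complex) = a l' - (if l = l' then 1 else 0)"
          unfolding a_def by simp
        moreover have "v (insert k' (K - {k})) (x - term_expo l + term_expo l') = Y l l' (insert k' (K - {k}))"
          unfolding Y_def using l pr(2)[OF l] by auto
        ultimately show "ksgn k' (K - {k}) * of_int (dual_coord x l' k') * of_nat (Suc (alpha (x - term_expo l) l')) * v (insert k' (K - {k})) (x - term_expo l + term_expo l')
          = ksgn k' (K - {k}) * of_int (dual_coord x l' k') * (a l' - (if l = l' then 1 else 0)) * Y l l' (insert k' (K - {k}))"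
          by simp
      qed
    qed
    also have "\<dots> = (\<Sum>l\<in>?C. ?G l)"
    proof (rule sum.mono_neutral_left[OF fC PC], rule ballI)
      fix l assume l: "l \<in> ?C - P"
      then have "alpha x l = 0" by (simp add: P_def)
      \<comment> \<open>Extending the sum from \<open>P\<close> to the whole cone adds nothing:
        \<open>alpha x l = 0\<close> gives \<open>a l = 1\<close>, so the diagonal factor vanishes,
        and off the diagonal \<open>Y\<close> does.\<close>
      have z: "c * (a l' - (if l = l' then 1 else 0)) * Y l l' W = 0" for c l' W
        using l \<open>alpha x l = 0\<close> by (auto simp: Y_def a_def)
      show "?G l = 0" by (simp only: z sum.neutral_const mult_zero_right)
    qed
    finally show "ksgn k K * (\<Sum>l\<in>P. d k l * homotopy_op v (K - {k}) (x - term_expo l)) = ksgn k K * (\<Sum>l\<in>?C. ?G l)"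
      by (rule arg_cong)
  qed
  have second: "homotopy_op (leading v) K x = (\<Sum>l'\<in>?C. \<Sum>k'\<in>{1..n} - K. ksgn k' K * of_int (dual_coord x l' k') * a l' * (\<Sum>k\<in>insert k' K.
            ksgn k (insert k' K) * (\<Sum>l\<in>?C. d k l * Y l l' (insert k' K - {k}))))"
    unfolding homotopy_op_def
  proof (intro sum.cong refl)
    fix l' k' assume l': "l' \<in> ?C"
    have st: "cone (x + term_expo l') = ?C" "alpha (x + term_expo l') = (alpha x)(l' := Suc (alpha x l'))"
      using cone_step[OF x l'] by simp_all
    have P': "{l\<in>cone (x + term_expo l'). 0 < alpha (x + term_expo l') l} = insert l' P" using l' by (auto simp: st P_def)
    have "leading v W (x + term_expo l') = (\<Sum>k\<in>W. ksgn k W * (\<Sum>l\<in>?C. d k l * Y l l' (W - {k})))" for W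
      unfolding leading_def P'
    proof (rule sum.cong[OF refl])
      fix k
      have "(\<Sum>l\<in>insert l' P. d k l * v (W - {k}) (x + term_expo l' - term_expo l)) = (\<Sum>l\<in>insert l' P. d k l * Y l l' (W - {k}))"
      proof (intro sum.cong refl arg_cong2[where f = "(*)"])
        fix l assume l: "l \<in> insert l' P"
        show "v (W - {k}) (x + term_expo l' - term_expo l) = Y l l' (W - {k})"
        proof (cases "l = l'")
          case False
          then have lP: "l \<in> P" using l by simp
          have "x + term_expo l' = (x - term_expo l + term_expo l') + term_expo l" using pr(2)[OF lP] by (metis add.assoc add.commute)
          then have "x + term_expo l' - term_expo l = x - term_expo l + term_expo l'" by simp
          then show ?thesis using False lP by (simp add: Y_def)
        qed (simp add: Y_def)
      qed
      also have "\<dots> = (\<Sum>l\<in>?C. d k l * Y l l' (W - {k}))"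
        by (rule sum.mono_neutral_left[OF fC]) (use PC l' in \<open>auto simp: Y_def\<close>)
      finally show "ksgn k W * (\<Sum>l\<in>insert l' P. d k l * v (W - {k}) (x + term_expo l' - term_expo l)) = ksgn k W * (\<Sum>l\<in>?C. d k l * Y l l' (W - {k}))"
        by (rule arg_cong)
    qed
    then show "ksgn k' K * of_int (dual_coord x l' k') * of_nat (Suc (alpha x l')) * leading v (insert k' K) (x + term_expo l') =
      ksgn k' K * of_int (dual_coord x l' k') * a l' * (\<Sum>k\<in>insert k' K.
            ksgn k (insert k' K) * (\<Sum>l\<in>?C. d k l * Y l l' (insert k' K - {k})))"
      by (simp add: a_def)
  qed
  have AB': "(\<Sum>l\<in>?C. d k l * complex_of_int (dual_coord x l k')) = (if k = k' then 1 else 0)"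
    if "k \<in> {1..n}" "k' \<in> {1..n}" for k k'
    using arg_cong[OF AB[OF x that], of complex_of_int] by simp
  have BA': "(\<Sum>k\<in>{1..n}. complex_of_int (dual_coord x l' k) * d k l) = (if l' = l then 1 else 0)"
    if "l \<in> ?C" "l' \<in> ?C" for l l'
    using arg_cong[OF BA[OF x that], of complex_of_int] by simp
  have "leading (homotopy_op v) K x + homotopy_op (leading v) K x = ((\<Sum>l\<in>?C. a l) - of_nat (card K)) * v K x"
    unfolding first second
    by (rule koszul_identity[OF fC _ K AB' BA']) (auto simp: Y_def)
  also have "(\<Sum>l\<in>?C. a l) = of_nat (excess x) + of_nat n"
    by (simp add: a_def excess_def sum.distrib card_cone[OF x])
  finally show ?thesis by simp
qed

end

section \<open>Successive elimination of levels\<close>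

context koszul_data begin

text \<open>Eigenvalue of the Euler operator. For \<open>K\<close> inside \<open>{1..n}\<close> it
  vanishes only in top degree at exponents without excess, and this is where cohomology
  remains.\<close>

definition eigenvalue :: "nat set \<Rightarrow> 'm \<Rightarrow> int" where "eigenvalue K x = int (excess x) + int n - int (card K)"

definition step_y :: "nat \<Rightarrow> (nat \<Rightarrow> nat set \<Rightarrow> 'm \<Rightarrow> complex) \<Rightarrow> nat \<Rightarrow> nat set \<Rightarrow> 'm \<Rightarrow> complex" where
  "step_y r w j K x = (if K \<subseteq> {1..n} \<and> x \<in> S \<and> L j x = r then homotopy_op (w j) K x / of_int (eigenvalue K x) else 0)"

definition step_c :: "nat \<Rightarrow> (nat \<Rightarrow> nat set \<Rightarrow> 'm \<Rightarrow> complex) \<Rightarrow> nat \<Rightarrow> 'm \<Rightarrow> complex" where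
  "step_c r w j x = (if x \<in> S \<and> L j x = r \<and> excess x = 0 then w j {1..n} x else 0)"

definition top_form :: "(nat \<Rightarrow> 'm \<Rightarrow> complex) \<Rightarrow> nat \<Rightarrow> nat set \<Rightarrow> 'm \<Rightarrow> complex" where
  "top_form c j K x = (if K = {1..n} then c j x else 0)"

lemma coord_bound_nonneg: "0 \<le> coord_bound"
  using dual_coord_bd[of undefined undefined undefined] by linarith

lemma alpha_le_excess: "x \<in> Q \<Longrightarrow> l \<in> cone x \<Longrightarrow> alpha x l \<le> excess x"
  unfolding excess_def using finite_cone by (intro member_le_sum) auto

text \<open>A term with \<open>k\<close> outside \<open>K\<close> occurs only for proper
  \<open>K\<close>, and then \<alpha> + 1 is at most the eigenvalue. After division the coefficients
  are bounded by \<open>coord_bound\<close> times values of finitely many shifts of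
  \<open>w\<close>.\<close>

lemma is_form_step_y:
  assumes w: "is_form w" shows "is_form (step_y r w)"
  unfolding is_form_def
proof (intro allI impI)
  fix j K assume K: "K \<subseteq> {1..n}"
  define h where "h l k x = (if x \<in> Q then w j (insert k K) (term_expo l + x) else 0)" for l k x
  \<comment> \<open>Summing absolute values excludes cancellation, so the norm of \<open>g\<close>
    dominates every single shift.\<close>
  define g where "g x = (\<Sum>l\<in>\<Lambda>. \<Sum>k\<in>{1..n}. complex_of_real (norm (h l k x)))" for x
  have gh: "growth Q H (h l k)" if l: "l \<in> \<Lambda>" and k: "k \<in> {1..n}" for l k
  proof -
    have "insert k K \<subseteq> {1..n}" using K k by blast
    then have "growth Q H (w j (insert k K))" using w unfolding is_form_def by blast
    then show ?thesis unfolding h_def by (rule growth_shift) (rule term_expo_mem[OF l])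
  qed
  have gg: "growth Q H g" unfolding g_def[abs_def]
  proof (intro growth_sum)
    fix l k assume "l \<in> \<Lambda>" "k \<in> {1..n}"
    from gh[OF this] show "growth Q H (\<lambda>x. complex_of_real (norm (h l k x)))"
      by (rule growth_dominated[where B = 1]) (auto simp: h_def)
  qed
  show "growth Q H (step_y r w j K)"
  proof (rule growth_dominated[OF gg, where B = "of_int coord_bound"])
    show "step_y r w j K x = 0" if "x \<notin> Q" for x using that by (simp add: step_y_def)
    show "0 \<le> real_of_int coord_bound" using coord_bound_nonneg by simp
    fix x assume x: "x \<in> Q"
    have ng: "norm (g x) = (\<Sum>l\<in>\<Lambda>. \<Sum>k\<in>{1..n}. norm (h l k x))"
    proof -
      have "g x = complex_of_real (\<Sum>l\<in>\<Lambda>. \<Sum>k\<in>{1..n}. norm (h l k x))" by (simp add: g_def)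
      moreover have "0 \<le> (\<Sum>l\<in>\<Lambda>. \<Sum>k\<in>{1..n}. norm (h l k x))" by (intro sum_nonneg) auto
      ultimately show ?thesis by (simp only: norm_of_real abs_of_nonneg)
    qed
    have bnd: "norm (ksgn k K * of_int (dual_coord x l k) * of_nat (Suc (alpha x l)) * w j (insert k K) (x + term_expo l) / of_int (eigenvalue K x))
        \<le> of_int coord_bound * norm (h l k x)" if l: "l \<in> cone x" and k: "k \<in> {1..n} - K" for l k
    proof -
      have "K \<subset> {1..n}" using K k by blast
      then have "card K < n" using psubset_card_mono[of "{1..n}" K] by simp
      then have dn: "int (Suc (alpha x l)) \<le> eigenvalue K x" using alpha_le_excess[OF x l] by (simp add: eigenvalue_def)
      then have dp: "0 < real_of_int (eigenvalue K x)" by simp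
      have f: "real (Suc (alpha x l)) / real_of_int (eigenvalue K x) \<le> 1"
        using dn dp by (simp add: divide_le_eq_1)
      have "norm (ksgn k K * of_int (dual_coord x l k) * of_nat (Suc (alpha x l)) * w j (insert k K) (x + term_expo l) / of_int (eigenvalue K x))
        = real_of_int \<bar>dual_coord x l k\<bar> * (real (Suc (alpha x l)) / real_of_int (eigenvalue K x)) * norm (h l k x)"
        using dp x by (simp add: norm_mult norm_divide ksgn_def h_def add.commute norm_of_int del: of_nat_Suc)
      also have "\<dots> \<le> (of_int coord_bound * 1) * norm (h l k x)"
        using f dual_coord_bd[of x l k] coord_bound_nonneg dp by (intro mult_right_mono mult_mono) auto
      finally show ?thesis by simp
    qed
    have "norm (step_y r w j K x) \<le> norm (homotopy_op (w j) K x / of_int (eigenvalue K x))"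
      by (simp add: step_y_def)
    also have "\<dots> = norm (\<Sum>l\<in>cone x. \<Sum>k\<in>{1..n} - K. ksgn k K * of_int (dual_coord x l k) * of_nat (Suc (alpha x l)) * w j (insert k K) (x + term_expo l) / of_int (eigenvalue K x))"
      by (simp add: homotopy_op_def sum_divide_distrib)
    also have "\<dots> \<le> (\<Sum>l\<in>cone x. \<Sum>k\<in>{1..n} - K. of_int coord_bound * norm (h l k x))"
      by (intro sum_norm_le bnd)
    also have "\<dots> \<le> (\<Sum>l\<in>\<Lambda>. \<Sum>k\<in>{1..n} - K. of_int coord_bound * norm (h l k x))"
      using cone_sub[OF x] fin_L coord_bound_nonneg by (intro sum_mono2 sum_nonneg) auto
    also have "\<dots> \<le> (\<Sum>l\<in>\<Lambda>. \<Sum>k\<in>{1..n}. of_int coord_bound * norm (h l k x))"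
      using coord_bound_nonneg by (intro sum_mono sum_mono2) auto
    also have "\<dots> = of_int coord_bound * norm (g x)" by (simp add: ng sum_distrib_left)
    finally show "norm (step_y r w j K x) \<le> of_int coord_bound * norm (g x)" .
  qed
qed

lemma is_form_top_form: "(\<And>j. growth Q H (c j)) \<Longrightarrow> is_form (top_form c)"
  unfolding is_form_def
proof (intro allI impI)
  fix j K assume c: "\<And>j. growth Q H (c j)"
  have "growth Q H (\<lambda>x. if K = {1..n} then c j x else 0)" using growth_restrict[OF c, of "\<lambda>_. K = {1..n}" j] .
  then show "growth Q H (top_form c j K)" by (simp add: top_form_def[abs_def])
qed

lemma growth_step_c: "is_form w \<Longrightarrow> growth Q H (step_c r w j)"
proof -
  assume w: "is_form w"
  have "growth Q H (w j {1..n})" using w unfolding is_form_def by blast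
  from growth_restrict[OF this, of "\<lambda>x. x \<in> S \<and> L j x = r \<and> excess x = 0"]
  show ?thesis by (simp add: step_c_def[abs_def])
qed

text \<open>The differential at \<open>K\<close> only reads components \<open>K - {k}\<close>, which
  never exhaust \<open>{1..n}\<close>.\<close>

lemma twisted_D_top_form:
  assumes K: "K \<subseteq> {1..n}" shows "twisted_D (top_form c) j K x = 0"
proof -
  have "(\<lambda>i. top_form c i (K - {k})) = (\<lambda>i x. 0)" if "k \<in> K" for k
  proof -
    have "K - {k} \<noteq> {1..n}" using K that by blast
    then show ?thesis by (auto simp: top_form_def fun_eq_iff)
  qed
  then show ?thesis unfolding twisted_D_def by (intro sum.neutral ballI) (simp add: tpartial_zero)
qed

lemma excess_step: "x \<in> Q \<Longrightarrow> l \<in> cone x \<Longrightarrow> excess (x + term_expo l) = Suc (excess x)"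
proof -
  assume x: "x \<in> Q" and l: "l \<in> cone x"
  have c: "cone (x + term_expo l) = cone x" "alpha (x + term_expo l) = (alpha x)(l := Suc (alpha x l))" using cone_step[OF x l] by simp_all
  have "excess (x + term_expo l) = (\<Sum>i\<in>cone x. alpha x i + (if i = l then 1 else 0))"
    unfolding excess_def c by (rule sum.cong) auto
  then show ?thesis using l finite_cone[OF x] by (simp add: sum.distrib excess_def)
qed

lemma vanishes_below_step_y: "vanishes_below r (step_y r w)"
  by (auto simp: vanishes_below_def step_y_def)

text \<open>On level r the leading part of the differential of \<open>w\<close> vanishes, so the
  homotopy identity exhibits \<open>w\<close> times the eigenvalue as a leading part. Where the
  eigenvalue is nonzero one divides; where it is zero, \<open>step_c\<close> removes the value. The
  cocycle condition is asked on level r alone, so that it also applies to the primitives in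
  \<open>independence\<close>.\<close>

lemma step_V:
  assumes w: "vanishes_below r w" and z: "\<And>j K x. K \<subseteq> {1..n} \<Longrightarrow> x \<in> S \<Longrightarrow> L j x = r \<Longrightarrow> twisted_D w j K x = 0"
  shows "vanishes_below (Suc r) (\<lambda>j K x. w j K x - top_form (step_c r w) j K x - twisted_D (step_y r w) j K x)"
  unfolding vanishes_below_def
proof (intro allI ballI impI)
  fix j K x assume K: "K \<subseteq> {1..n}" and x: "x \<in> S" and lt: "L j x < Suc r"
  have xQ: "x \<in> Q" using x by simp
  show "w j K x - top_form (step_c r w) j K x - twisted_D (step_y r w) j K x = 0"
  proof (cases "L j x < r")
    case True
    then show ?thesis using w vanishes_below_twisted_D[OF vanishes_below_step_y] K x unfolding vanishes_below_def by (auto simp: top_form_def step_c_def)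
  next
    case False
    then have r: "L j x = r" using lt by simp
    let ?P = "{l\<in>cone x. 0 < alpha x l}"
    have 1: "twisted_D (step_y r w) j K x = leading (step_y r w j) K x"
      by (rule twisted_D_leading[OF vanishes_below_step_y x _ K]) (simp add: r)
    have 2: "leading (step_y r w j) K x = leading (homotopy_op (w j)) K x / of_int (eigenvalue K x)"
    proof -
      have "step_y r w j (K - {k}) (x - term_expo l) = homotopy_op (w j) (K - {k}) (x - term_expo l) / of_int (eigenvalue K x)"
        if k: "k \<in> K" and l: "l \<in> ?P" for k l
      proof -
        obtain y where y: "y \<in> Q" "x = y + term_expo l" "l \<in> cone y" using alpha_pos[OF xQ] l by blast
        have lL: "l \<in> \<Lambda>" using cone_sub[OF y(1)] y(3) by blast
        have yS: "y \<in> S" using S_pred[OF y(1) lL] x y(2) by simp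
        have "rk x = rk y" using cone_step[OF y(1,3)] y(2) by simp
        then have Ly: "L j y = r" using r by (simp add: L_def)
        \<comment> \<open>Lowering the variable \<open>l\<close> reduces the excess by one and
          removing \<open>k\<close> the cardinality by one; the eigenvalue stays the same and can be
          pulled out of \<open>leading\<close>.\<close>
        have "card K = Suc (card (K - {k}))" using k K finite_subset by (metis card.remove finite_atLeastAtMost)
        then have "eigenvalue (K - {k}) y = eigenvalue K x" using excess_step[OF y(1,3)] y(2) by (simp add: eigenvalue_def)
        moreover have "x - term_expo l = y" using y by simp
        moreover have "K - {k} \<subseteq> {1..n}" using K by blast
        ultimately show ?thesis using yS Ly by (simp add: step_y_def)
      qed
      then have "leading (step_y r w j) K x = (\<Sum>k\<in>K. ksgn k K * (\<Sum>l\<in>?P. d k l * (homotopy_op (w j) (K - {k}) (x - term_expo l) / of_int (eigenvalue K x))))"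
        unfolding leading_def by (intro sum.cong refl arg_cong2[where f = "(*)"]) auto
      then show ?thesis by (simp only: leading_def sum_divide_distrib[symmetric] times_divide_eq_right)
    qed
    have 3: "homotopy_op (leading (w j)) K x = 0"
      unfolding homotopy_op_def
    proof (intro sum.neutral ballI)
      fix l k assume l: "l \<in> cone x" and k: "k \<in> {1..n} - K"
      \<comment> \<open>Multiplication by a ray of the cone of \<open>x\<close> leaves the base part
        alone in the intended data, and so cannot enter \<open>J\<close>.\<close>
      have "x + term_expo l \<in> S" using cone_step_J[OF xQ l] x add_mem[OF xQ term_expo_mem] cone_sub[OF xQ] l by blast
      moreover have "L j (x + term_expo l) = r" using cone_step[OF xQ l] r by (simp add: L_def)
      moreover have iK: "insert k K \<subseteq> {1..n}" using k K by blast
      ultimately have "leading (w j) (insert k K) (x + term_expo l) = 0"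
        using twisted_D_leading[OF w, of "x + term_expo l" j "insert k K"] z[OF iK] by simp
      then show "ksgn k K * of_int (dual_coord x l k) * of_nat (Suc (alpha x l)) * leading (w j) (insert k K) (x + term_expo l) = 0" by simp
    qed
    have 4: "leading (homotopy_op (w j)) K x = of_int (eigenvalue K x) * w j K x"
      using homotopy[OF xQ K, of "w j"] 3 by (simp add: eigenvalue_def)
    have cK: "card K \<le> n" using card_mono[of "{1..n}" K] K by simp
    show ?thesis
    proof (cases "eigenvalue K x = 0")
      case True
      then have e: "excess x = 0" "card K = n" using cK by (auto simp: eigenvalue_def)
      then have "K = {1..n}" using card_subset_eq[of "{1..n}" K] K by simp
      moreover have "twisted_D (step_y r w) j K x = 0" using True by (simp add: 1 2)
      ultimately show ?thesis using e x r by (simp add: top_form_def step_c_def)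
    next
      case False
      then have "top_form (step_c r w) j K x = 0" by (auto simp: top_form_def step_c_def eigenvalue_def)
      then show ?thesis using False by (simp add: 1 2 4)
    qed
  qed
qed

primrec reduct :: "(nat \<Rightarrow> nat set \<Rightarrow> 'm \<Rightarrow> complex) \<Rightarrow> nat \<Rightarrow> nat \<Rightarrow> nat set \<Rightarrow> 'm \<Rightarrow> complex" where
  "reduct w 0 = w"
| "reduct w (Suc r) = (\<lambda>j K x. reduct w r j K x - top_form (step_c r (reduct w r)) j K x - twisted_D (step_y r (reduct w r)) j K x)"

lemma twisted_D_step:
  assumes K: "K \<subseteq> {1..n}"
  shows "twisted_D (\<lambda>j K x. w j K x - top_form c j K x - twisted_D y j K x) j K x = twisted_D w j K x"
proof -
  have "twisted_D (\<lambda>j K x. w j K x - top_form c j K x - twisted_D y j K x) j K x = twisted_D w j K x - twisted_D (top_form c) j K x - twisted_D (twisted_D y) j K x"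
    using twisted_D_diff[of "\<lambda>j K x. w j K x - top_form c j K x" "twisted_D y" j K x] twisted_D_diff[of w "top_form c" j K x] by simp
  then show ?thesis using twisted_D_top_form[OF K] twisted_D_twisted_D[OF K] by simp
qed

lemma reduct_inv:
  assumes w: "is_form w" and z: "\<And>j K x. K \<subseteq> {1..n} \<Longrightarrow> x \<in> S \<Longrightarrow> twisted_D w j K x = 0"
  shows "is_form (reduct w r) \<and> vanishes_below r (reduct w r) \<and> (\<forall>j K x. K \<subseteq> {1..n} \<longrightarrow> x \<in> S \<longrightarrow> twisted_D (reduct w r) j K x = 0)"
proof (induction r)
  case 0
  then show ?case using w z by (auto simp: vanishes_below_def)
next
  case (Suc r)
  show ?case
  proof (intro conjI allI impI)
    show "is_form (reduct w (Suc r))"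
      unfolding reduct.simps using Suc by (intro is_form_diff is_form_top_form is_form_twisted_D is_form_step_y growth_step_c) auto
    show "vanishes_below (Suc r) (reduct w (Suc r))"
      unfolding reduct.simps using Suc by (intro step_V) auto
    fix j K x assume "K \<subseteq> {1..n}" "x \<in> S"
    then show "twisted_D (reduct w (Suc r)) j K x = 0" unfolding reduct.simps using Suc by (simp add: twisted_D_step)
  qed
qed

lemma twisted_D_cong:
  assumes "\<And>i K x. i \<le> j \<Longrightarrow> w i K x = v i K x"
  shows "twisted_D w j K x = twisted_D v j K x"
proof -
  have e: "w j = v j" "w (j - 1) = v (j - 1)" using assms by (auto simp: fun_eq_iff)
  show ?thesis by (simp only: twisted_D_def tpartial_def e)
qed

text \<open>Clears the levels one after another. All levels occurring at u^j are below
  \<open>Suc j * rank_bound\<close>, so the remainder at u^j is zero after that many steps.\<close>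

theorem exactness:
  assumes w: "is_form w" and z: "\<And>j K x. K \<subseteq> {1..n} \<Longrightarrow> x \<in> S \<Longrightarrow> twisted_D w j K x = 0"
  obtains c y where "is_form y" "\<And>j x. c j x \<noteq> 0 \<Longrightarrow> x \<in> S \<and> excess x = 0"
    "\<And>j K x. K \<subseteq> {1..n} \<Longrightarrow> x \<in> S \<Longrightarrow> w j K x = top_form c j K x + twisted_D y j K x"
proof -
  note inv = reduct_inv[OF w z]
  define Y where "Y r = step_y r (reduct w r)" for r
  define C where "C r = step_c r (reduct w r)" for r
  \<comment> \<open>The number of summands depends on j: corrections at higher levels have no
    coefficient at u^j. The total is a formal series in u with convergent coefficients.\<close>
  define y where "y j K x = (\<Sum>r<Suc j * rank_bound. Y r j K x)" for j K x
  define c where "c j x = (\<Sum>r<Suc j * rank_bound. C r j x)" for j x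
  have LM: "L j x < Suc j * rank_bound" if "x \<in> S" for j x
    using rk_bd[OF that] by (simp add: L_def)
  have Y0: "Y r j K x = 0" if "Suc j * rank_bound \<le> r" for r j K x
    using LM[of x j] that by (auto simp: Y_def step_y_def)
  have ym: "y i K x = (\<Sum>r<M. Y r i K x)" if "Suc i * rank_bound \<le> M" for i K x M
    unfolding y_def using that Y0 by (intro sum.mono_neutral_left) auto
  have tele: "reduct w M j K x = w j K x - (\<Sum>r<M. top_form (C r) j K x) - (\<Sum>r<M. twisted_D (Y r) j K x)" for M j K x
    by (induction M) (simp_all add: C_def Y_def)
  show thesis
  proof (rule that[of y c])
    show "is_form y" unfolding is_form_def
    proof (intro allI impI)
      fix j K assume K: "K \<subseteq> {1..n}"
      have "growth Q H (Y r j K)" for r using is_form_step_y inv K unfolding Y_def is_form_def by blast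
      then have "growth Q H (\<lambda>x. \<Sum>r<Suc j * rank_bound. Y r j K x)" by (intro growth_sum)
      then show "growth Q H (y j K)" by (simp add: y_def[abs_def])
    qed
    show "x \<in> S \<and> excess x = 0" if nz: "c j x \<noteq> 0" for j x
    proof -
      obtain r where "C r j x \<noteq> 0" using nz unfolding c_def by (meson sum.neutral)
      then show ?thesis by (auto simp: C_def step_c_def split: if_splits)
    qed
    fix j K x assume K: "K \<subseteq> {1..n}" and x: "x \<in> S"
    let ?M = "Suc j * rank_bound"
    \<comment> \<open>The differential at u^j reads powers of u up to j only, so one truncation
      serves all of them.\<close>
    have "twisted_D y j K x = twisted_D (\<lambda>i K x. \<Sum>r<?M. Y r i K x) j K x"
    proof (rule twisted_D_cong, rule ym)
      fix i assume "i \<le> j"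
      then show "Suc i * rank_bound \<le> Suc j * rank_bound" by (intro mult_le_mono1) simp
    qed
    also have "\<dots> = (\<Sum>r<?M. twisted_D (Y r) j K x)" by (rule twisted_D_sum)
    finally have a: "twisted_D y j K x = (\<Sum>r<?M. twisted_D (Y r) j K x)" .
    have b: "top_form c j K x = (\<Sum>r<?M. top_form (C r) j K x)" by (simp add: top_form_def c_def)
    have "reduct w ?M j K x = 0" using inv[of ?M] LM[OF x] K x unfolding vanishes_below_def by blast
    then have "w j K x - top_form c j K x - twisted_D y j K x = 0" unfolding a b by (simp only: tele)
    then show "w j K x = top_form c j K x + twisted_D y j K x" by (simp add: diff_eq_eq add.commute)
  qed
qed

text \<open>Subtracting a top form and a coboundary from \<open>y\<close> does not change its
  differential, so \<open>y\<close> may be assumed to vanish below any level. At an exponent of that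
  level without excess no variable of its cone can be lowered, so the leading part is an empty sum
  and \<open>c\<close> vanishes there.\<close>

theorem independence:
  assumes c: "\<And>j x. c j x \<noteq> 0 \<Longrightarrow> x \<in> S \<and> excess x = 0"
    and e: "\<And>j K x. K \<subseteq> {1..n} \<Longrightarrow> x \<in> S \<Longrightarrow> top_form c j K x = twisted_D y j K x"
  shows "c j x = 0"
proof -
  have zero: "c j x = 0" if v: "vanishes_below r y'" and r: "L j x = r"
    and e': "\<And>j K x. K \<subseteq> {1..n} \<Longrightarrow> x \<in> S \<Longrightarrow> top_form c j K x = twisted_D y' j K x" for r y' j x
  proof (rule ccontr)
    assume nz: "c j x \<noteq> 0"
    then have x: "x \<in> S" "excess x = 0" using c by auto
    have xQ: "x \<in> Q" using x by simp
    have "{l\<in>cone x. 0 < alpha x l} = {}"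
      using x(2) finite_cone[OF xQ] by (auto simp: excess_def sum_eq_0_iff)
    then have "leading (y' j) {1..n} x = 0" by (simp only: leading_def sum.empty mult_zero_right sum.neutral_const)
    then have "twisted_D y' j {1..n} x = 0" using twisted_D_leading[OF v x(1), of j "{1..n}"] r by simp
    then show False using e'[of "{1..n}" x j] x nz by (simp add: top_form_def)
  qed
  have "\<exists>y'. vanishes_below r y' \<and> (\<forall>j K x. K \<subseteq> {1..n} \<longrightarrow> x \<in> S \<longrightarrow> top_form c j K x = twisted_D y' j K x)" for r
  proof (induction r)
    case 0
    then show ?case using e by (intro exI[of _ y]) (auto simp: vanishes_below_def)
  next
    case (Suc r)
    then obtain y' where y0: "vanishes_below r y'" "\<forall>j K x. K \<subseteq> {1..n} \<longrightarrow> x \<in> S \<longrightarrow> top_form c j K x = twisted_D y' j K x" by (elim exE conjE)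
    note y' = y0(1) y0(2)[rule_format]
    \<comment> \<open>The coefficients \<open>c\<close> of level r are already known to be zero,
      which supplies the hypothesis of \<open>step_V\<close> on that level.\<close>
    have z: "twisted_D y' j K x = 0" if "K \<subseteq> {1..n}" "x \<in> S" "L j x = r" for j K x
    proof -
      have "c j x = 0" by (rule zero[OF y'(1) that(3) y'(2)])
      then have "top_form c j K x = 0" by (simp add: top_form_def)
      then show ?thesis by (simp only: y'(2)[OF that(1,2), symmetric])
    qed
    let ?y = "\<lambda>j K x. y' j K x - top_form (step_c r y') j K x - twisted_D (step_y r y') j K x"
    have "vanishes_below (Suc r) ?y" by (rule step_V[OF y'(1) z])
    moreover have "top_form c j K x = twisted_D ?y j K x" if "K \<subseteq> {1..n}" "x \<in> S" for j K x
      by (simp only: y'(2)[OF that] twisted_D_step[OF that(1)])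
    ultimately show ?case by (intro exI[of _ ?y] conjI allI impI)
  qed
  from this[of "L j x"] obtain y' where y': "vanishes_below (L j x) y'"
    "\<forall>j K x. K \<subseteq> {1..n} \<longrightarrow> x \<in> S \<longrightarrow> top_form c j K x = twisted_D y' j K x" by (elim exE conjE)
  show ?thesis by (rule zero[OF y'(1) refl]) (use y'(2) in simp)
qed

end

section \<open>The exponent monoid of the family\<close>

context toric begin

lemma nrays_ge: "CARD('n) \<le> nrays G"
  using first_rays by (simp add: first_rays_basis_def)

lemma first_basis: "lattice_basis (ray G ` {1..CARD('n)})"
  using first_rays unfolding first_rays_basis_def by blast

lemma dual_additive: "k \<in> {1..CARD('n)} \<Longrightarrow> Modules.additive (dualvec G k)"
  using dual by (simp add: dual_basis_def)

lemma dual_ray: "k \<in> {1..CARD('n)} \<Longrightarrow> l \<in> {1..CARD('n)} \<Longrightarrow> dualvec G k (ray G l) = (if k = l then 1 else 0)"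
  using dual by (simp add: dual_basis_def)

lemma dual_expand: "(\<Sum>k\<in>{1..CARD('n)}. dualvec G k m *s ray G k) = m"
proof -
  let ?K = "{1..CARD('n)}"
  have inj: "inj_on (ray G) ?K" using ray_inj nrays_ge inj_on_subset by (metis atLeastatMost_subset_iff order_refl)
  define c where "c = icoord (ray G ` ?K) m"
  have m: "m = (\<Sum>k\<in>?K. c (ray G k) *s ray G k)"
    using icoord_sum[OF first_basis, of m] by (simp only: sum.reindex[OF inj] o_def c_def)
  have "dualvec G k m = c (ray G k)" if k: "k \<in> ?K" for k
  proof -
    have "dualvec G k m = (\<Sum>l\<in>?K. c (ray G l) * dualvec G k (ray G l))"
      by (subst m) (rule additive_sum[OF dual_additive[OF k]])
    also have "\<dots> = (\<Sum>l\<in>?K. if l = k then c (ray G k) else 0)"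
      by (rule sum.cong[OF refl]) (use dual_ray[OF k] in auto)
    finally show ?thesis using k by simp
  qed
  then show ?thesis using m by (metis (no_types, lifting) sum.cong)
qed

lemma split_add: "a \<in> Zd G \<Longrightarrow> b \<in> Zd G \<Longrightarrow> splitting G (a + b) = splitting G a + splitting G b"
  using splitting by (simp add: is_splitting_def)

lemma split_A1: "a \<in> A1 G \<Longrightarrow> splitting G a = a"
  using splitting by (simp add: is_splitting_def)

text \<open>The bending is a relation among the rays, hence a curve class, and the splitting fixes
  curve classes.\<close>

lemma phi_fan_add: "phi_fan G m + phi_fan G m' = phi_fan G (m + m') + cocyc m m'"
proof -
  have c: "cocyc m m' \<in> A1 G" using cocyc_NE NE_A1 by blast
  then have "cocyc m m' \<in> Zd G" by (simp add: A1_def)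
  then have "splitting G (pl_lift G (m + m') + cocyc m m') = phi_fan G (m + m') + cocyc m m'"
    by (simp add: split_add pl_lift_Zd split_A1[OF c] phi_fan_def)
  moreover have "pl_lift G (m + m') + cocyc m m' = pl_lift G m + pl_lift G m'" by (simp add: cocyc_def)
  ultimately show ?thesis by (simp add: split_add pl_lift_Zd phi_fan_def)
qed

lemma A1_zero: "0 \<in> A1 G"
  by (auto simp: A1_def Zd_iff)

lemma phi_fan_zero [simp]: "phi_fan G 0 = 0"
  by (simp add: phi_fan_def split_A1[OF A1_zero])

lemma cocyc_zero [simp]: "cocyc 0 m = 0" "cocyc m 0 = 0"
  by (simp_all add: cocyc_def)

abbreviation Q where "Q \<equiv> family_monoid G"
abbreviation Bs where "Bs \<equiv> base_monoid G"

lemma mem_Q: "(m, q, a) \<in> Q \<longleftrightarrow> q - phi_fan G m \<in> NE G \<and> a \<in> t_expos G"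
  by (auto simp: family_monoid_def P_phi_def) (metis add_diff_cancel_left' diff_add_cancel add.commute)

lemma mem_Bs: "(m, q, a) \<in> Bs \<longleftrightarrow> m = 0 \<and> q \<in> NE G \<and> a \<in> t_expos G"
  by (auto simp: base_monoid_def)

text \<open>What remains of an exponent after dividing by the monomial of (m, \<phi>(m)). It is
  additive only up to the bending.\<close>

definition base_part :: "'n expo \<Rightarrow> 'n expo" where
  "base_part = (\<lambda>(m, q, a). (0, q - phi_fan G m, a))"

lemma base_part_add: "base_part (x + y) = base_part x + base_part y + (0, cocyc (fst x) (fst y), 0)"
proof -
  obtain m q a m' q' a' where xy: "x = (m, q, a)" "y = (m', q', a')" by (metis prod_cases3)
  have "phi_fan G (m + m') = phi_fan G m + phi_fan G m' - cocyc m m'" using phi_fan_add[of m m'] by simp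
  then show ?thesis by (simp add: xy base_part_def)
qed

lemma base_part_Bs: "x \<in> Q \<Longrightarrow> base_part x \<in> Bs"
  by (cases x) (auto simp: base_part_def mem_Q mem_Bs)

lemma Q_iff_base_part: "x \<in> Q \<longleftrightarrow> base_part x \<in> Bs"
  by (cases x) (auto simp: base_part_def mem_Q mem_Bs)

lemma t_add: "a \<in> t_expos G \<Longrightarrow> b \<in> t_expos G \<Longrightarrow> a + b \<in> t_expos G"
  using Poly_Mapping.keys_add[of a b] by (auto simp: t_expos_def)

lemma t_zero: "0 \<in> t_expos G" by (simp add: t_expos_def)

lemma Bs_add: "x \<in> Bs \<Longrightarrow> y \<in> Bs \<Longrightarrow> x + y \<in> Bs"
  by (cases x; cases y) (auto simp: mem_Bs NE_add t_add)

lemma cocyc_Bs: "(0, cocyc m m', 0) \<in> Bs"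
  by (simp add: mem_Bs cocyc_NE t_zero)

lemma Q_add: "x \<in> Q \<Longrightarrow> y \<in> Q \<Longrightarrow> x + y \<in> Q"
  unfolding Q_iff_base_part base_part_add by (intro Bs_add cocyc_Bs)

lemma zero_prod: "(0 :: 'n expo) = (0, 0, 0)" by (simp add: zero_prod_def)

lemma Bs_zero: "0 \<in> Bs" by (simp add: zero_prod mem_Bs t_zero)

lemma base_part_base: "x \<in> Bs \<Longrightarrow> base_part x = x"
  by (cases x) (auto simp: mem_Bs base_part_def)

lemma Bs_Q: "Bs \<subseteq> Q"
  by (auto simp: Q_iff_base_part base_part_base)

definition tdeg :: "(nat \<Rightarrow>\<^sub>0 nat) \<Rightarrow> nat" where
  "tdeg a = (\<Sum>i\<in>{1..sdim G}. lk a i)"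

lemma tdeg_add: "tdeg (a + b) = tdeg a + tdeg b"
  by (simp add: tdeg_def lookup_add sum.distrib)

lemma tdeg_zero: "a \<in> t_expos G \<Longrightarrow> tdeg a = 0 \<Longrightarrow> a = 0"
proof (rule poly_mapping_eqI)
  fix i assume a: "a \<in> t_expos G" "tdeg a = 0"
  show "lk a i = lk 0 i"
  proof (cases "i \<in> {1..sdim G}")
    case True
    then show ?thesis using a(2) by (simp add: tdeg_def sum_eq_0_iff)
  next
    case False
    then have "i \<notin> Poly_Mapping.keys a" using a(1) unfolding t_expos_def by blast
    then show ?thesis by (simp add: in_keys_iff)
  qed
qed

text \<open>The ample degree of the product of the z_i and z^p, plus the degree in t. The bending
  enters the two summands with opposite signs, so their sum is additive; on exponents of the family
  it is nonnegative, so \<open>nat\<close> cuts nothing off.\<close>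

definition ht :: "'n expo \<Rightarrow> nat" where
  "ht = (\<lambda>(m, q, a). nat (pair ample_wt (pl_lift G m + (q - phi_fan G m))) + tdeg a)"

lemma pair_pl: "0 \<le> pair ample_wt (pl_lift G m)"
  unfolding pair_def using ample_wt_pos pl_lift_nonneg by (intro sum_nonneg mult_nonneg_nonneg) (auto intro: less_imp_le)

lemma pair_pl_zero: "pair ample_wt (pl_lift G m) = 0 \<Longrightarrow> m = 0"
proof -
  assume z: "pair ample_wt (pl_lift G m) = 0"
  have "\<forall>i\<in>{1..nrays G}. ample_wt i * lk (pl_lift G m) i = 0"
    using z ample_wt_pos pl_lift_nonneg unfolding pair_def
    by (subst (asm) sum_nonneg_eq_0_iff) (auto intro!: mult_nonneg_nonneg simp: less_imp_le)
  then have "lk (pl_lift G m) i = 0" for i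
    using ample_wt_pos pl_lift_Zd[of m] by (cases "i \<in> {1..nrays G}") (fastforce simp: Zd_iff)+
  then have "pl_lift G m = 0" by (intro poly_mapping_eqI) simp
  then show "m = 0" using ray_map_pl_lift[of m] by simp
qed

lemma ht_add:
  assumes x: "x \<in> Q" and y: "y \<in> Q" shows "ht (x + y) = ht x + ht y"
proof -
  obtain m q a m' q' a' where xy: "x = (m, q, a)" "y = (m', q', a')" by (metis prod_cases3)
  have n: "0 \<le> pair ample_wt (pl_lift G m + (q - phi_fan G m))" if "(m, q, a) \<in> Q" for m q a
    using that pair_pl[of m] pair_NE(1) by (auto simp: pair_add mem_Q)
  have "phi_fan G (m + m') = phi_fan G m + phi_fan G m' - cocyc m m'" using phi_fan_add[of m m'] by simp
  then have e: "pl_lift G (m + m') + (q + q' - phi_fan G (m + m')) =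
      (pl_lift G m + (q - phi_fan G m)) + (pl_lift G m' + (q' - phi_fan G m'))"
    by (simp add: cocyc_def)
  have "ht (x + y) = nat (pair ample_wt (pl_lift G m + (q - phi_fan G m)) + pair ample_wt (pl_lift G m' + (q' - phi_fan G m'))) + tdeg (a + a')"
    by (simp only: xy ht_def add_Pair prod.case e pair_add[of ample_wt "pl_lift G m + (q - phi_fan G m)"])
  then show ?thesis using n[of m q a] n[of m' q' a'] x y
    by (simp only: xy ht_def prod.case nat_add_distrib tdeg_add)
qed

lemma ht_zero: "x \<in> Q \<Longrightarrow> ht x = 0 \<Longrightarrow> x = 0"
proof -
  assume x: "x \<in> Q" "ht x = 0"
  obtain m q a where xy: "x = (m, q, a)" by (metis prod_cases3)
  have "q - phi_fan G m \<in> NE G" "a \<in> t_expos G" using x by (auto simp: xy mem_Q)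
  moreover from this have "pair ample_wt (pl_lift G m) = 0" "pair ample_wt (q - phi_fan G m) = 0" "tdeg a = 0"
    using x(2) pair_pl[of m] pair_NE(1)[of "q - phi_fan G m"] by (auto simp: xy ht_def pair_add)
  moreover from this have "m = 0" using pair_pl_zero by blast
  ultimately show "x = 0" using pair_NE(2)[of "q - phi_fan G m"] tdeg_zero by (simp add: xy zero_prod)
qed

definition NEgen where
  "NEgen = (SOME \<Gamma>. finite \<Gamma> \<and> \<Gamma> \<subseteq> NE G - {0} \<and> (\<forall>p\<in>NE G - {0}. \<exists>g\<in>\<Gamma>. \<exists>p'\<in>NE G. p = g + p'))"

lemma NEgen_prop: "finite NEgen \<and> NEgen \<subseteq> NE G - {0} \<and> (\<forall>p\<in>NE G - {0}. \<exists>g\<in>NEgen. \<exists>p'\<in>NE G. p = g + p')"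
  unfolding NEgen_def by (rule someI_ex[OF NE_generators])

lemma NEgen: "finite NEgen" "NEgen \<subseteq> NE G - {0}" "p \<in> NE G - {0} \<Longrightarrow> \<exists>g\<in>NEgen. \<exists>p'\<in>NE G. p = g + p'"
  using NEgen_prop by blast+

definition Bgen :: "'n expo set" where
  "Bgen = (\<lambda>g. (0, g, 0)) ` NEgen \<union> texp ` {1..sdim G}"

definition Qgen :: "'n expo set" where
  "Qgen = zexp G ` {1..nrays G} \<union> Bgen"

lemma texp_t: "i \<in> {1..sdim G} \<Longrightarrow> Poly_Mapping.single i 1 \<in> t_expos G"
  by (simp add: t_expos_def)

lemma Bgen_sub: "Bgen \<subseteq> Bs - {0}"
proof -
  have 1: "texp i \<in> Bs - {0}" if "i \<in> {1..sdim G}" for i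
  proof -
    have "Poly_Mapping.single i (1::nat) \<noteq> 0" by (metis lookup_single_eq lookup_zero zero_neq_one)
    then show ?thesis using texp_t[OF that] by (auto simp: texp_def mem_Bs zero_prod)
  qed
  have 2: "(0, g, 0) \<in> Bs - {0}" if "g \<in> NEgen" for g
    using NEgen(2) that by (auto simp: mem_Bs t_zero zero_prod)
  show ?thesis unfolding Bgen_def
  proof (intro Un_least image_subsetI)
    show "g \<in> NEgen \<Longrightarrow> (0, g, 0) \<in> Bs - {0}" for g by (rule 2)
    show "i \<in> {1..sdim G} \<Longrightarrow> texp i \<in> Bs - {0}" for i by (rule 1)
  qed
qed

lemma Bs_split:
  assumes x: "x \<in> Bs" "x \<noteq> 0"
  shows "(\<exists>p a. x = (0, p, a) \<and> p \<in> NE G - {0} \<and> a \<in> t_expos G) \<or> (\<exists>i\<in>{1..sdim G}. \<exists>y\<in>Bs. x = texp i + y)"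
proof -
  obtain p a where xy: "x = (0, p, a)" "p \<in> NE G" "a \<in> t_expos G"
    using x by (auto simp: base_monoid_def)
  show ?thesis
  proof (cases "p = 0")
    case True
    then have "a \<noteq> 0" using x xy by (auto simp: zero_prod)
    then obtain i where i: "i \<in> Poly_Mapping.keys a" by (metis ex_in_conv keys_eq_empty)
    define b where "b = a - Poly_Mapping.single i 1"
    have l: "lk b j = lk a j - (if j = i then 1 else 0)" for j
      by (simp add: b_def lookup_minus lookup_single when_def)
    have "a = Poly_Mapping.single i 1 + b"
      using i by (intro poly_mapping_eqI) (auto simp: lookup_add l lookup_single when_def in_keys_iff)
    moreover have "b \<in> t_expos G" using xy(3) l by (auto simp: t_expos_def in_keys_iff subset_iff)
    ultimately have "x = texp i + (0, p, b)" "(0, p, b) \<in> Bs" "i \<in> {1..sdim G}"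
      using xy i by (auto simp: texp_def mem_Bs t_expos_def)
    then show ?thesis by blast
  qed (use xy in auto)
qed

lemma Bs_gen:
  assumes x: "x \<in> Bs" "x \<noteq> 0" shows "\<exists>g\<in>Bgen. \<exists>y\<in>Bs. x = g + y"
  using Bs_split[OF x]
proof
  assume "\<exists>p a. x = (0, p, a) \<and> p \<in> NE G - {0} \<and> a \<in> t_expos G"
  then obtain p a where p: "x = (0, p, a)" "p \<in> NE G - {0}" "a \<in> t_expos G" by blast
  obtain g p' where g: "g \<in> NEgen" "p' \<in> NE G" "p = g + p'" using NEgen(3)[OF p(2)] by blast
  have "x = (0, g, 0) + (0, p', a)" "(0, p', a) \<in> Bs" "(0, g, 0) \<in> Bgen"
    using p g by (auto simp: mem_Bs Bgen_def)
  then show ?thesis by blast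
qed (auto simp: Bgen_def)

lemma zexp_Q: "l \<in> {1..nrays G} \<Longrightarrow> zexp G l \<in> Q"
  by (simp add: zexp_def mem_Q t_zero)

lemma ray_pl: "l \<in> {1..nrays G} \<Longrightarrow> pl_lift G (ray G l) = Poly_Mapping.single l 1"
proof -
  assume l: "l \<in> {1..nrays G}"
  obtain \<sigma> where s: "\<sigma> \<in> maxc" "rvec (ray G l) \<in> \<sigma>" using cover by blast
  then have "l \<in> gens G \<sigma>" using l by (simp add: gens_def)
  then show ?thesis using l s(1)
    by (intro pl_lift_eqI) (auto simp: lookup_single when_def ray_map_single)
qed

lemma ray_nonzero: "l \<in> {1..nrays G} \<Longrightarrow> ray G l \<noteq> 0"
  using primitive_nonzero ray_primitive by blast

lemma pl_remove:
  assumes "0 < lk (pl_lift G m) l"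
  shows "l \<in> {1..nrays G}" "pl_lift G (m - ray G l) = pl_lift G m - Poly_Mapping.single l 1" "cocyc (m - ray G l) (ray G l) = 0"
proof -
  show l: "l \<in> {1..nrays G}" using assms pl_lift_Zd[of m] by (force simp: Zd_iff)
  obtain \<sigma> where s: "\<sigma> \<in> maxc" "Poly_Mapping.keys (pl_lift G m) \<subseteq> gens G \<sigma>" using pl_lift_cone by blast
  show e: "pl_lift G (m - ray G l) = pl_lift G m - Poly_Mapping.single l 1"
  proof (rule pl_lift_eqI[OF s(1)])
    show "Poly_Mapping.keys (pl_lift G m - Poly_Mapping.single l 1) \<subseteq> gens G \<sigma>"
      using s(2) assms by (auto simp: keys_sub_iff lookup_single when_def) 
    show "0 \<le> lk (pl_lift G m - Poly_Mapping.single l 1) i" for i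
      using assms pl_lift_nonneg[of m i] by (auto simp: lookup_single when_def)
    show "ray_map G (pl_lift G m - Poly_Mapping.single l 1) = m - ray G l"
      by (simp add: ray_map_diff ray_map_pl_lift ray_map_single[OF l])
  qed
  show "cocyc (m - ray G l) (ray G l) = 0"
    by (simp add: cocyc_def e ray_pl[OF l])
qed

lemma remove_ray:
  assumes x: "x \<in> Q" and l: "0 < lk (pl_lift G (fst x)) l"
  obtains z where "z \<in> Q" "x = z + zexp G l" "base_part z = base_part x" "fst z = fst x - ray G l"
proof -
  obtain m q a where xe: "x = (m, q, a)" by (metis prod_cases3)
  have l': "0 < lk (pl_lift G m) l" using l by (simp add: xe)
  define z where "z = (m - ray G l, q - phi_fan G (ray G l), a)"
  have ph: "phi_fan G (m - ray G l) + phi_fan G (ray G l) = phi_fan G m"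
    using phi_fan_add[of "m - ray G l" "ray G l"] pl_remove(3)[OF l'] by simp
  have "q - phi_fan G (ray G l) - phi_fan G (m - ray G l) = q - phi_fan G m" using ph by (simp add: algebra_simps)
  then have b: "base_part z = base_part x" by (simp add: z_def base_part_def xe)
  moreover have "x = z + zexp G l" by (simp add: z_def zexp_def xe)
  moreover have "z \<in> Q" using x b by (simp add: Q_iff_base_part)
  moreover have "fst z = fst x - ray G l" by (simp add: z_def xe)
  ultimately show thesis using that[of z] by blast
qed

text \<open>A ray in the support of the lift can be divided out without bending. If the support is
  empty then m = 0 and the exponent belongs to the base.\<close>

lemma Q_gen:
  assumes x: "x \<in> Q" "x \<noteq> 0" shows "\<exists>g\<in>Qgen. \<exists>y\<in>Q. x = g + y"
proof (cases "\<exists>l. 0 < lk (pl_lift G (fst x)) l")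
  case True
  then obtain l where l: "0 < lk (pl_lift G (fst x)) l" by blast
  obtain z where "z \<in> Q" "x = z + zexp G l" using remove_ray[OF x(1) l] by metis
  then have "x = zexp G l + z" "z \<in> Q" by (simp_all add: add.commute)
  moreover have "zexp G l \<in> Qgen" using pl_remove(1)[OF l] by (simp add: Qgen_def)
  ultimately show ?thesis by blast
next
  case False
  then have "pl_lift G (fst x) = 0" using pl_lift_nonneg[of "fst x"]
    by (intro poly_mapping_eqI) (auto simp: not_less intro: antisym)
  then have "fst x = 0" using ray_map_pl_lift[of "fst x"] by simp
  then have "x \<in> Bs" using x(1) by (cases x) (auto simp: mem_Q mem_Bs)
  then show ?thesis using Bs_gen[OF _ x(2)] Bs_Q by (auto simp: Qgen_def)
qed

definition Bgens0 :: "'n expo set" where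
  "Bgens0 = {(0, p, 0) | p. p \<in> NE G - {0}} \<union> texp ` {1..sdim G}"

sublocale series_base Q ht Qgen Bs Bgen Bgens0
proof
  show "0 \<in> Q" using Bs_zero Bs_Q by blast
  show "finite Qgen" using NEgen(1) by (simp add: Qgen_def Bgen_def)
  show "Qgen \<subseteq> Q" using zexp_Q Bgen_sub Bs_Q by (auto simp: Qgen_def)
  have nz: "g \<noteq> 0" if "g \<in> Qgen" for g
    using that Bgen_sub ray_nonzero by (auto simp: Qgen_def zexp_def zero_prod)
  show "0 < ht g" if "g \<in> Qgen" for g
    using ht_zero[of g] nz[OF that] that \<open>Qgen \<subseteq> Q\<close> by auto
  show "finite Bgen" using NEgen(1) by (simp add: Bgen_def)
  show "Bgens0 \<subseteq> Bs - {0}"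
    using Bgen_sub by (auto simp: Bgens0_def Bgen_def mem_Bs t_zero zero_prod)
  show "\<exists>g\<in>Bgens0. \<exists>y\<in>Bs. x = g + y" if x: "x \<in> Bs" "x \<noteq> 0" for x
    using Bs_split[OF x]
  proof
    assume "\<exists>p a. x = (0, p, a) \<and> p \<in> NE G - {0} \<and> a \<in> t_expos G"
    then obtain p a where p: "x = (0, p, a)" "p \<in> NE G - {0}" "a \<in> t_expos G" by blast
    have "x = (0, p, 0) + (0, 0, a)" "(0, 0, a) \<in> Bs" "(0, p, 0) \<in> Bgens0"
      using p by (auto simp: mem_Bs Bgens0_def)
    then show ?thesis by blast
  qed (auto simp: Bgens0_def)
qed (use Q_add ht_add Q_gen Bs_Q Bs_zero Bs_add Bgen_sub Bs_gen in auto)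

end

section \<open>Blocks, ranks and the Koszul data of the family\<close>

context toric begin

definition cone_index :: "int^'n \<Rightarrow> nat" where
  "cone_index m = (LEAST i. i \<in> {1..mu G} \<and> Poly_Mapping.keys (pl_lift G m) \<subseteq> sigma_gens i)"

abbreviation supp :: "int^'n \<Rightarrow> nat set" where "supp m \<equiv> Poly_Mapping.keys (pl_lift G m)"

lemma cone_index: "cone_index m \<in> {1..mu G} \<and> supp m \<subseteq> sigma_gens (cone_index m)"
proof -
  obtain \<sigma> where s: "\<sigma> \<in> maxc" "supp m \<subseteq> gens G \<sigma>" using pl_lift_cone by blast
  then obtain i where "i \<in> {1..mu G} \<and> supp m \<subseteq> sigma_gens i" using max_cone_seq by blast
  then show ?thesis unfolding cone_index_def by (rule LeastI)
qed

lemma cone_index_le: "i \<in> {1..mu G} \<Longrightarrow> supp m \<subseteq> sigma_gens i \<Longrightarrow> cone_index m \<le> i"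
  unfolding cone_index_def by (rule Least_le) simp

text \<open>If a ray \<open>j\<close> of \<tau>_i were missing from the support, the neighbour
  across the wall opposite \<open>j\<close> would still contain the support. Minimality of i makes
  this neighbour later, and then \<open>j\<close> cannot belong to \<tau>_i.\<close>

lemma tau_gens_supp: "tau_gens (cone_index m) \<subseteq> supp m"
proof (rule subsetI, rule ccontr)
  fix j assume j: "j \<in> tau_gens (cone_index m)" "j \<notin> supp m"
  have i: "cone_index m \<in> {1..mu G}" using cone_index by blast
  have jg: "j \<in> sigma_gens (cone_index m)" using j tau_gens_subset by blast
  obtain i' where i': "i' \<in> {1..mu G}" "i' \<noteq> cone_index m" "sigma_gens (cone_index m) - {j} \<subseteq> sigma_gens i'" "cone_index m < i' \<Longrightarrow> j \<notin> tau_gens (cone_index m)"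
    using tau_gens_wall[OF i jg] by blast
  have "supp m \<subseteq> sigma_gens i'" using cone_index[of m] j i'(3) by blast
  then have "cone_index m \<le> i'" by (rule cone_index_le[OF i'(1)])
  then show False using i'(2,4) j by simp
qed

text \<open>With the preceding lemma, block i is exactly the set of \<open>m\<close> whose support
  lies between \<tau>_i and \<sigma>_i; the shelling condition makes these intervals
  disjoint.\<close>

lemma cone_index_eqI:
  assumes i: "i \<in> {1..mu G}" and "tau_gens i \<subseteq> supp m" "supp m \<subseteq> sigma_gens i"
  shows "cone_index m = i"
proof (rule antisym)
  show "cone_index m \<le> i" using cone_index_le[OF i] assms by blast
  have "tau_gens i \<subseteq> sigma_gens (cone_index m)" using assms cone_index[of m] by blast
  then show "i \<le> cone_index m" using shelling[OF i] cone_index[of m] by blast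
qed

definition base_height :: "'n expo \<Rightarrow> nat" where "base_height x = ht (base_part x)"
text \<open>Lexicographic order of base height and index: indices are at most \<open>mu G\<close>,
  so the radix \<open>Suc (mu G)\<close> avoids a carry.\<close>

definition rk :: "'n expo \<Rightarrow> nat" where "rk x = base_height x * Suc (mu G) + cone_index (fst x)"
definition cone :: "'n expo \<Rightarrow> nat set" where "cone x = sigma_gens (cone_index (fst x))"
text \<open>
  The truncation by \<open>nat\<close> is harmless: by the shelling condition the rays of \<open>\<tau>\<^sub>i\<close> lie in the support of
  every exponent assigned to \<open>\<sigma>\<^sub>i\<close>.
\<close>

definition alpha :: "'n expo \<Rightarrow> nat \<Rightarrow> nat" where
  "alpha x l = nat (lk (pl_lift G (fst x)) l - (if l \<in> tau_gens (cone_index (fst x)) then 1 else 0))"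
text \<open>Set to 0 for \<open>k\<close> outside the frame, so that \<open>coord_bound\<close>
  bounds it for all arguments.\<close>

definition dual_coord :: "'n expo \<Rightarrow> nat \<Rightarrow> nat \<Rightarrow> int" where
  "dual_coord x l k = (if k \<in> {1..CARD('n)} then lk (lift (cone_seq G (cone_index (fst x))) (ray G k)) l else 0)"
definition dlog_coeff :: "nat \<Rightarrow> 'n expo \<Rightarrow> int" where "dlog_coeff k x = dualvec G k (fst x)"
definition \<Lambda> :: "nat set" where "\<Lambda> = {1..nrays G + sdim G}"
text \<open>The terms \<open>z\<^sub>1, \<dots>, z\<^sub>d\<close> of \<open>F\<close> come first, followed by \<open>t\<^sub>1\<close> and the \<open>t\<^sub>i \<phi>\<^bsub>\<nu>+i-1\<^esub>\<close>.\<close>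

definition term_expo :: "nat \<Rightarrow> 'n expo" where
  "term_expo l = (if l \<le> nrays G then zexp G l else if l = Suc (nrays G) then texp 1
     else texp (l - nrays G) + phi_exp G (nu G + (l - nrays G) - 1))"

text \<open>The surplus is the height of the bending, an effective class, and only the zero exponent
  has height 0.\<close>

lemma base_height_add:
  assumes x: "x \<in> Q" and y: "y \<in> Q"
  shows "base_height x + base_height y \<le> base_height (x + y)" "base_height (x + y) = base_height x + base_height y \<Longrightarrow> cocyc (fst x) (fst y) = 0"
proof -
  have b: "base_part x \<in> Q" "base_part y \<in> Q" "(0, cocyc (fst x) (fst y), 0) \<in> Q"
    using base_part_Bs[OF x] base_part_Bs[OF y] cocyc_Bs Bs_Q by blast+
  have e: "base_height (x + y) = base_height x + base_height y + ht (0, cocyc (fst x) (fst y), 0)"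
    unfolding base_height_def base_part_add using b by (simp only: ht_add add_mem)
  then show "base_height x + base_height y \<le> base_height (x + y)" by simp
  assume "base_height (x + y) = base_height x + base_height y"
  then have "ht (0, cocyc (fst x) (fst y), 0) = 0" using e by simp
  then have "(0, cocyc (fst x) (fst y), 0) = (0 :: 'n expo)" by (rule ht_zero[OF b(3)])
  then show "cocyc (fst x) (fst y) = 0" by (simp add: zero_prod)
qed

lemma cone_index_bounds: "1 \<le> cone_index m" "cone_index m \<le> mu G"
  using cone_index[of m] by auto

lemma phi_exp_Q: "phi_exp G i \<in> Q"
proof -
  have "finite A \<Longrightarrow> A \<subseteq> {1..nrays G} \<Longrightarrow> (\<Sum>l\<in>A. zexp G l) \<in> Q" for A
    by (induction A rule: finite_induct) (auto simp: zero_mem intro!: add_mem zexp_Q)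
  then show ?thesis unfolding phi_exp_def phi_gens_def using finite_gens gens_subset by blast
qed

lemma texp_Bs: "i \<in> {1..sdim G} \<Longrightarrow> texp i \<in> Bs - {0}"
  using subsetD[OF Bgen_sub, of "texp i"] by (simp add: Bgen_def)

lemma term_expo_t: "l \<in> \<Lambda> - {1..nrays G} \<Longrightarrow> \<exists>i\<in>{1..sdim G}. \<exists>y\<in>Q. term_expo l = texp i + y"
proof -
  assume l: "l \<in> \<Lambda> - {1..nrays G}"
  then have i: "l - nrays G \<in> {1..sdim G}" "\<not> l \<le> nrays G" by (auto simp: \<Lambda>_def)
  show ?thesis
  proof (cases "l = Suc (nrays G)")
    case True
    then have "term_expo l = texp (l - nrays G) + 0" by (simp add: term_expo_def)
    then show ?thesis using i(1) zero_mem by blast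
  next
    case False
    then have "term_expo l = texp (l - nrays G) + phi_exp G (nu G + (l - nrays G) - 1)" using i by (simp add: term_expo_def)
    then show ?thesis using i(1) phi_exp_Q by blast
  qed
qed

lemma term_expo_z: "l \<in> {1..nrays G} \<Longrightarrow> term_expo l = zexp G l"
  by (simp add: term_expo_def)

lemma term_expo_Q: "l \<in> \<Lambda> \<Longrightarrow> term_expo l \<in> Q"
proof (cases "l \<in> {1..nrays G}")
  case False
  assume "l \<in> \<Lambda>"
  then obtain i y where "i \<in> {1..sdim G}" "y \<in> Q" "term_expo l = texp i + y" using term_expo_t False by blast
  moreover from this have "texp i \<in> Q" using texp_Bs Bs_Q by blast
  ultimately show ?thesis by (simp only: add_mem)
qed (simp add: term_expo_z zexp_Q)

lemma base_part_zexp: "base_part (zexp G l) = 0"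
  by (simp add: base_part_def zexp_def zero_prod)

lemma fst_zexp: "fst (zexp G l) = ray G l"
  by (simp add: zexp_def)

lemma base_height_zexp: "base_height (zexp G l) = 0"
  by (simp add: base_height_def base_part_zexp H_zero)

lemma keys_add_single:
  assumes "\<And>i. 0 \<le> lk a i" shows "Poly_Mapping.keys (a + Poly_Mapping.single l (1::int)) = insert l (Poly_Mapping.keys a)"
proof (rule Set.set_eqI)
  fix i show "i \<in> Poly_Mapping.keys (a + Poly_Mapping.single l 1) \<longleftrightarrow> i \<in> insert l (Poly_Mapping.keys a)"
    using assms[of i] by (auto simp: in_keys_iff lookup_add lookup_single when_def)
qed

text \<open>Inside one cone the lift is additive, so nothing bends. The support gains a ray of
  \<sigma>_i and stays between \<tau>_i and \<sigma>_i, hence in the same block.\<close>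

lemma cone_step_facts:
  assumes x: "x \<in> Q" and l: "l \<in> cone x"
  shows "l \<in> {1..nrays G}" "pl_lift G (fst (x + zexp G l)) = pl_lift G (fst x) + Poly_Mapping.single l 1"
    "cone_index (fst (x + zexp G l)) = cone_index (fst x)" "base_part (x + zexp G l) = base_part x"
proof -
  let ?m = "fst x" let ?i = "cone_index ?m"
  show lr: "l \<in> {1..nrays G}" using l gens_subset unfolding cone_def by blast
  have i: "?i \<in> {1..mu G}" using cone_index by blast
  have k: "supp ?m \<subseteq> sigma_gens ?i" using cone_index by blast
  have kl: "supp (ray G l) \<subseteq> sigma_gens ?i" using l by (simp add: ray_pl[OF lr] cone_def)
  have p: "pl_lift G (?m + ray G l) = pl_lift G ?m + pl_lift G (ray G l)"
    by (rule pl_lift_add[OF cone_seq_max[OF i] k kl])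
  then show pp: "pl_lift G (fst (x + zexp G l)) = pl_lift G (fst x) + Poly_Mapping.single l 1"
    by (simp add: fst_zexp ray_pl[OF lr])
  have c: "cocyc ?m (ray G l) = 0" by (simp add: cocyc_def p)
  show "base_part (x + zexp G l) = base_part x" by (simp add: base_part_add base_part_zexp fst_zexp c zero_prod[symmetric])
  have s: "supp (fst (x + zexp G l)) = insert l (supp ?m)"
    unfolding pp by (rule keys_add_single) (rule pl_lift_nonneg)
  show "cone_index (fst (x + zexp G l)) = cone_index (fst x)"
    by (rule cone_index_eqI[OF i]) (use s tau_gens_supp[of ?m] k l in \<open>auto simp: cone_def\<close>)
qed

lemma rk_gt_aux: "x \<in> Q \<Longrightarrow> y \<in> Q \<Longrightarrow> base_height x < base_height (x + y) \<Longrightarrow> rk x < rk (x + y)"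
proof -
  assume h: "base_height x < base_height (x + y)"
  have "rk x \<le> base_height x * Suc (mu G) + mu G" using cone_index_bounds(2) by (simp add: rk_def)
  also have "\<dots> < Suc (base_height x) * Suc (mu G)" by simp
  also have "\<dots> \<le> base_height (x + y) * Suc (mu G)" using h by (intro mult_le_mono1) simp
  also have "\<dots> \<le> rk (x + y)" by (simp add: rk_def)
  finally show ?thesis .
qed

text \<open>A term containing some t_i raises the base height. For z_l, if the base height does not
  rise then nothing bends and the support just gains \<open>l\<close>. Any cone containing the new
  support contains the old one, and the old minimal cone misses \<open>l\<close>, so the least index
  rises.\<close>

lemma rk_gt:
  assumes x: "x \<in> Q" and l: "l \<in> \<Lambda> - cone x" shows "rk x < rk (x + term_expo l)"
proof (cases "l \<in> {1..nrays G}")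
  case True
  have y: "zexp G l \<in> Q" by (rule zexp_Q[OF True])
  show ?thesis
  proof (cases "base_height x < base_height (x + term_expo l)")
    case True
    then show ?thesis using rk_gt_aux[OF x] term_expo_Q l by blast
  next
    case False
    then have h: "base_height (x + zexp G l) = base_height x" using base_height_add(1)[OF x y] True by (simp add: term_expo_z)
    then have c: "cocyc (fst x) (ray G l) = 0" using base_height_add(2)[OF x y] by (simp add: base_height_zexp fst_zexp)
    let ?m = "fst x"
    have p: "pl_lift G (?m + ray G l) = pl_lift G ?m + Poly_Mapping.single l 1"
      using c by (simp add: cocyc_def ray_pl[OF True])
    have sub: "supp ?m \<subseteq> supp (?m + ray G l)" "l \<in> supp (?m + ray G l)"
      unfolding p using keys_add_single[of "pl_lift G ?m" l, OF pl_lift_nonneg] by auto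
    let ?i = "cone_index (?m + ray G l)"
    have "cone_index ?m \<le> ?i" by (rule cone_index_le) (use cone_index[of "?m + ray G l"] sub in blast)+
    moreover have "cone_index ?m \<noteq> ?i" using l sub cone_index[of "?m + ray G l"] by (auto simp: cone_def)
    ultimately show ?thesis by (simp add: rk_def h term_expo_z[OF True] fst_zexp)
  qed
next
  case False
  then obtain i y where y: "i \<in> {1..sdim G}" "y \<in> Q" "term_expo l = texp i + y" using term_expo_t l by blast
  have t: "texp i \<in> Q" "texp i \<in> Bs" "texp i \<noteq> (0 :: 'n expo)" using texp_Bs[OF y(1)] Bs_Q by auto
  have "0 < base_height (texp i)" using ht_zero[OF t(1)] t(3) by (auto simp: base_height_def base_part_base[OF t(2)])
  also have "base_height (texp i) \<le> base_height (term_expo l)" using base_height_add(1)[OF t(1) y(2)] y(3) by simp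
  finally have "base_height x < base_height (x + term_expo l)" using base_height_add(1)[OF x term_expo_Q, of l] l by simp
  then show ?thesis using rk_gt_aux[OF x] term_expo_Q l by blast
qed

text \<open>This and the next lemma say that the change of basis between the first n rays and the
  rays of \<sigma>_i is inverted by expanding either basis in the other.\<close>

lemma AB_aux:
  assumes i: "i \<in> {1..mu G}" and k: "k \<in> {1..CARD('n)}" and k': "k' \<in> {1..CARD('n)}"
  shows "(\<Sum>l\<in>sigma_gens i. dualvec G k (ray G l) * lk (lift (cone_seq G i) (ray G k')) l) = (if k = k' then 1 else 0)"
proof -
  have s: "cone_seq G i \<in> maxc" by (rule cone_seq_max[OF i])
  have "ray G k' = (\<Sum>l\<in>sigma_gens i. lk (lift (cone_seq G i) (ray G k')) l *s ray G l)"
    using ray_map_lift[OF s, of "ray G k'"] ray_map_restrict[OF keys_lift gens_subset] by metis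
  then have "dualvec G k (ray G k') = dualvec G k (\<Sum>l\<in>sigma_gens i. lk (lift (cone_seq G i) (ray G k')) l *s ray G l)"
    by (rule arg_cong)
  also have "\<dots> = (\<Sum>l\<in>sigma_gens i. lk (lift (cone_seq G i) (ray G k')) l * dualvec G k (ray G l))"
    by (rule additive_sum[OF dual_additive[OF k]])
  finally show ?thesis using dual_ray[OF k k'] by (simp add: mult.commute)
qed

lemma BA_aux:
  assumes i: "i \<in> {1..mu G}" and l: "l \<in> sigma_gens i" and l': "l' \<in> sigma_gens i"
  shows "(\<Sum>k\<in>{1..CARD('n)}. lk (lift (cone_seq G i) (ray G k)) l' * dualvec G k (ray G l)) = (if l' = l then 1 else 0)"
proof -
  have s: "cone_seq G i \<in> maxc" by (rule cone_seq_max[OF i])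
  have add: "Modules.additive (\<lambda>m. lk (lift (cone_seq G i) m) l')"
    by (rule additive.intro) (simp add: lift_add[OF s] lookup_add)
  have lr: "l \<in> {1..nrays G}" using l gens_subset by blast
  have "lk (lift (cone_seq G i) (ray G l)) l' = (\<Sum>k\<in>{1..CARD('n)}. dualvec G k (ray G l) * lk (lift (cone_seq G i) (ray G k)) l')"
    by (subst dual_expand[of "ray G l", symmetric]) (rule additive_sum[OF add])
  moreover have "lift (cone_seq G i) (ray G l) = Poly_Mapping.single l 1"
    by (rule lift_eqI[OF s]) (use l in \<open>auto simp: ray_map_single[OF lr]\<close>)
  ultimately show ?thesis by (simp add: lookup_single when_def mult.commute)
qed

definition nn :: nat where "nn = CARD('n)"

text \<open>Largest height of a surviving base exponent, followed by the largest possible index. The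
  inserted 0 makes \<open>Max\<close> meaningful without a nonemptiness argument.\<close>

definition rank_bound :: "nat \<Rightarrow> nat" where
  "rank_bound k = Suc (Max (insert 0 (ht ` (Bs - power_expos (Suc k)))) * Suc (mu G) + mu G)"

definition coord_bound :: int where
  "coord_bound = (\<Sum>i\<in>{1..mu G}. \<Sum>l\<in>{1..nrays G}. \<Sum>k\<in>{1..CARD('n)}. \<bar>lk (lift (cone_seq G i) (ray G k)) l\<bar>)"

text \<open>Flatness of the family in terms of exponents: the exponents (m, \<phi>(m)) are a basis
  over the base monoid, and adding a base exponent merely translates the base part.\<close>

lemma ext_base_part: "x \<in> Q \<Longrightarrow> x \<in> ext j \<longleftrightarrow> base_part x \<in> power_expos j"
proof
  assume x: "x \<in> Q" and "x \<in> ext j"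
  then obtain b y where b: "x = b + y" "b \<in> power_expos j" "y \<in> Q" by (auto simp: ext_def)
  have bB: "b \<in> Bs" using b(2) power_expos_sub by blast
  then have "fst b = 0" by (auto simp: base_monoid_def)
  then have "base_part x = b + base_part y" by (simp add: b(1) base_part_add base_part_base[OF bB] zero_prod[symmetric])
  then show "base_part x \<in> power_expos j" using power_expos_add[OF b(2) base_part_Bs[OF b(3)]] by simp
next
  assume x: "x \<in> Q" and b: "base_part x \<in> power_expos j"
  have "(fst x, phi_fan G (fst x), 0) \<in> Q" by (simp add: mem_Q t_zero)
  moreover have "x = base_part x + (fst x, phi_fan G (fst x), 0)" by (cases x) (simp add: base_part_def)
  ultimately show "x \<in> ext j" using b unfolding ext_def by blast
qed

lemma dual_coord_bound: "\<bar>dual_coord x l k\<bar> \<le> coord_bound"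
proof (cases "k \<in> {1..CARD('n)} \<and> l \<in> {1..nrays G}")
  case True
  let ?f = "\<lambda>i l k. \<bar>lk (lift (cone_seq G i) (ray G k)) l\<bar>"
  have "\<bar>dual_coord x l k\<bar> = ?f (cone_index (fst x)) l k" using True by (simp add: dual_coord_def)
  also have "\<dots> \<le> (\<Sum>k\<in>{1..CARD('n)}. ?f (cone_index (fst x)) l k)" using True by (intro member_le_sum) auto
  also have "\<dots> \<le> (\<Sum>l\<in>{1..nrays G}. \<Sum>k\<in>{1..CARD('n)}. ?f (cone_index (fst x)) l k)"
    using True by (intro member_le_sum[of l]) (auto intro: sum_nonneg)
  also have "\<dots> \<le> coord_bound" unfolding coord_bound_def
    using cone_index[of "fst x"] by (intro member_le_sum[of "cone_index (fst x)"]) (auto intro: sum_nonneg)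
  finally show ?thesis .
next
  case False
  have "dual_coord x l k = 0"
  proof (cases "k \<in> {1..CARD('n)}")
    case True
    then have "l \<notin> sigma_gens (cone_index (fst x))" using False gens_subset by blast
    then show ?thesis by (simp add: dual_coord_def lookup_lift)
  next
    case False
    then show ?thesis by (simp only: dual_coord_def if_False)
  qed
  moreover have "0 \<le> coord_bound" unfolding coord_bound_def by (intro sum_nonneg) auto
  ultimately show ?thesis by simp
qed

lemma koszul: "koszul_data Q ht Qgen (ext (Suc k)) nn \<Lambda> term_expo dlog_coeff rk cone alpha dual_coord (rank_bound k) coord_bound"
proof (unfold_locales, goal_cases)
  case (1 x y)
  then show ?case by (rule ext_add)
next
  case (2 k x y)
  then show ?case using dual_additive[of k] by (simp add: dlog_coeff_def nn_def additive.add)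
next
  case 3
  show ?case by (simp add: \<Lambda>_def)
next
  case (4 l)
  then show ?case by (rule term_expo_Q)
next
  case (5 x)
  have "sigma_gens (cone_index (fst x)) \<subseteq> {1..nrays G}" by (rule gens_subset)
  then show ?case by (force simp: cone_def \<Lambda>_def)
next
  case (6 x)
  show ?case using card_gens_max[OF cone_seq_max] cone_index[of "fst x"] by (simp add: cone_def nn_def)
next
  case (7 x l)
  note f = cone_step_facts[OF 7]
  have y: "term_expo l = zexp G l" by (rule term_expo_z[OF f(1)])
  have "alpha (x + zexp G l) i = (if i = l then Suc (alpha x l) else alpha x i)" for i
  proof -
    have "(if l \<in> tau_gens (cone_index (fst x)) then 1 else 0) \<le> lk (pl_lift G (fst x)) l"
      using tau_gens_supp[of "fst x"] pl_lift_nonneg[of "fst x" l] by (auto simp: in_keys_iff subset_iff)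
    then show ?thesis unfolding alpha_def f(2,3)
      by (auto simp: lookup_add lookup_single when_def)
  qed
  moreover have "cone_index (fst x + fst (zexp G l)) = cone_index (fst x)" using f(3) by simp
  ultimately show ?case unfolding y by (auto simp: rk_def cone_def dual_coord_def fun_eq_iff f base_height_def)
next
  case (8 x l)
  note f = cone_step_facts[OF 8(1,2)]
  have "x + zexp G l \<in> ext (Suc k)" using 8(3) by (simp only: term_expo_z[OF f(1)])
  then have "base_part (x + zexp G l) \<in> power_expos (Suc k)" using ext_base_part subsetD[OF ext_sub] by blast
  then show ?case by (simp only: f(4) ext_base_part[OF 8(1)])
next
  case (9 x l)
  then show ?case by (rule rk_gt)
next
  case (10 x l)
  let ?m = "fst x"
  \<comment> \<open>On rays of \<tau>_i one has been subtracted in \<open>alpha\<close>, so a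
    positive value there means that the lift is at least 2, and dividing by z_l keeps \<tau>_i
    inside the support.\<close>
  have p: "0 < lk (pl_lift G ?m) l" and p2: "l \<in> tau_gens (cone_index ?m) \<Longrightarrow> 1 < lk (pl_lift G ?m) l"
    using 10(2) by (auto simp: alpha_def split: if_splits)
  obtain z where z: "z \<in> Q" "x = z + zexp G l" "base_part z = base_part x" "fst z = ?m - ray G l"
    by (rule remove_ray[OF 10(1) p])
  have lr: "l \<in> {1..nrays G}" by (rule pl_remove(1)[OF p])
  have pz: "pl_lift G (fst z) = pl_lift G ?m - Poly_Mapping.single l 1" unfolding z(4) by (rule pl_remove(2)[OF p])
  have "cone_index (fst z) = cone_index ?m"
  proof (rule cone_index_eqI)
    show "cone_index ?m \<in> {1..mu G}" using cone_index by blast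
    show "tau_gens (cone_index ?m) \<subseteq> supp (fst z)"
    proof
      fix i assume i: "i \<in> tau_gens (cone_index ?m)"
      then have "lk (pl_lift G ?m) i \<noteq> 0" using tau_gens_supp[of ?m] by (auto simp: in_keys_iff)
      then show "i \<in> supp (fst z)" using p2 i unfolding pz
        by (auto simp: in_keys_iff lookup_single when_def)
    qed
    show "supp (fst z) \<subseteq> sigma_gens (cone_index ?m)"
    proof
      fix i assume "i \<in> supp (fst z)"
      then have "i \<in> supp ?m" using p unfolding pz by (auto simp: in_keys_iff lookup_single when_def split: if_splits)
      then show "i \<in> sigma_gens (cone_index ?m)" using cone_index[of ?m] by blast
    qed
  qed
  moreover have "l \<in> supp ?m" using p by (simp add: in_keys_iff)
  ultimately have "l \<in> cone z" using cone_index[of ?m] by (auto simp: cone_def)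
  then show ?case using z(1,2) term_expo_z[OF lr] by auto
next
  case (11 x k k')
  have i: "cone_index (fst x) \<in> {1..mu G}" using cone_index by blast
  have "(\<Sum>l\<in>cone x. dlog_coeff k (term_expo l) * dual_coord x l k') = (\<Sum>l\<in>sigma_gens (cone_index (fst x)). dualvec G k (ray G l) * lk (lift (cone_seq G (cone_index (fst x))) (ray G k')) l)"
    unfolding cone_def
  proof (rule sum.cong[OF refl])
    fix l assume "l \<in> sigma_gens (cone_index (fst x))"
    then have "l \<in> {1..nrays G}" using gens_subset by blast
    then show "dlog_coeff k (term_expo l) * dual_coord x l k' = dualvec G k (ray G l) * lk (lift (cone_seq G (cone_index (fst x))) (ray G k')) l"
      using 11(3) by (simp add: dlog_coeff_def term_expo_z fst_zexp dual_coord_def nn_def)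
  qed
  then show ?case using AB_aux[OF i, of k k'] 11 by (simp add: nn_def)
next
  case (12 x l l')
  have i: "cone_index (fst x) \<in> {1..mu G}" using cone_index by blast
  have lr: "l \<in> {1..nrays G}" using 12(2) gens_subset unfolding cone_def by blast
  have "(\<Sum>k\<in>{1..nn}. dual_coord x l' k * dlog_coeff k (term_expo l)) = (\<Sum>k\<in>{1..CARD('n)}. lk (lift (cone_seq G (cone_index (fst x))) (ray G k)) l' * dualvec G k (ray G l))"
    unfolding nn_def by (rule sum.cong[OF refl]) (simp add: dual_coord_def dlog_coeff_def term_expo_z[OF lr] fst_zexp)
  then show ?case using BA_aux[OF i, of l l'] 12 by (simp add: cone_def)
next
  case (13 x)
  have "base_part x \<in> Bs - power_expos (Suc k)" using 13 ext_base_part[of x "Suc k"] base_part_Bs[of x] by auto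
  then have "base_height x \<le> Max (insert 0 (ht ` (Bs - power_expos (Suc k))))"
    unfolding base_height_def using finite_power_expos_compl[of "Suc k"] by (intro Max_ge) auto
  then have "base_height x * Suc (mu G) \<le> Max (insert 0 (ht ` (Bs - power_expos (Suc k)))) * Suc (mu G)" by (rule mult_le_mono1)
  then show ?case using cone_index_bounds(2)[of "fst x"] unfolding rk_def rank_bound_def by linarith
next
  case (14 x l k)
  show ?case by (rule dual_coord_bound)
qed

end

section \<open>Power series and cohomology modules\<close>

context cring begin

lemma cauchy_comm:
  assumes "a \<in> UNIV \<rightarrow> carrier R" "b \<in> UNIV \<rightarrow> carrier R"
  shows "(\<Oplus>i\<in>{..n::nat}. a i \<otimes> b (n - i)) = (\<Oplus>i\<in>{..n}. b i \<otimes> a (n - i))"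
proof -
  have "(\<Oplus>i\<in>{..n}. a i \<otimes> b (n - i)) = (\<Oplus>i\<in>(\<lambda>i. n - i) ` {..n}. a i \<otimes> b (n - i))"
  proof -
    have "(\<lambda>i. n - i) ` {..n} = {..n}"
    proof (intro equalityI subsetI)
      fix x assume "x \<in> {..n}"
      then show "x \<in> (\<lambda>i. n - i) ` {..n}" by (intro image_eqI[of _ _ "n - x"]) auto
    qed auto
    then show ?thesis by simp
  qed
  also have "\<dots> = (\<Oplus>i\<in>{..n}. a (n - i) \<otimes> b (n - (n - i)))"
    by (rule finsum_reindex) (use assms in \<open>auto simp: inj_on_def Pi_def\<close>)
  also have "\<dots> = (\<Oplus>i\<in>{..n}. b i \<otimes> a (n - i))"
    by (rule finsum_cong') (use assms in \<open>auto simp: Pi_def m_comm\<close>)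
  finally show ?thesis .
qed

text \<open>The summation bound \<open>k\<close> is separated from the total degree \<open>n\<close>
  to make the induction possible; associativity is the case k = n.\<close>

lemma cauchy_assoc:
  assumes R: "a \<in> UNIV \<rightarrow> carrier R" "b \<in> UNIV \<rightarrow> carrier R" "c \<in> UNIV \<rightarrow> carrier R" and "k \<le> n"
  shows "(\<Oplus>j\<in>{..k::nat}. (\<Oplus>i\<in>{..j}. a i \<otimes> b (j - i)) \<otimes> c (n - j)) =
    (\<Oplus>j\<in>{..k}. a j \<otimes> (\<Oplus>i\<in>{..k - j}. b i \<otimes> c (n - j - i)))"
  using \<open>k \<le> n\<close>
proof (induction k)
  case 0
  then show ?case using R by (simp add: Pi_def m_assoc)
next
  case (Suc k)
  have cl: "a i \<in> carrier R" "b i \<in> carrier R" "c i \<in> carrier R" for i using R by auto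
  define T where "T j = (\<Oplus>i\<in>{..k - j}. b i \<otimes> c (n - j - i))" for j
  have T: "T j \<in> carrier R" for j unfolding T_def using cl by (intro finsum_closed) auto
  have e: "(\<Oplus>i\<in>{..Suc k - j}. b i \<otimes> c (n - j - i)) = b (Suc k - j) \<otimes> c (n - Suc k) \<oplus> T j" if "j \<le> k" for j
  proof -
    have "Suc k - j = Suc (k - j)" "n - j - Suc (k - j) = n - Suc k" using that Suc by auto
    then show ?thesis unfolding T_def using cl by (simp add: finsum_Suc Pi_def)
  qed
  have "(\<Oplus>j\<in>{..Suc k}. a j \<otimes> (\<Oplus>i\<in>{..Suc k - j}. b i \<otimes> c (n - j - i)))
    = a (Suc k) \<otimes> (\<Oplus>i\<in>{..0}. b i \<otimes> c (n - Suc k - i)) \<oplus> (\<Oplus>j\<in>{..k}. a j \<otimes> (\<Oplus>i\<in>{..Suc k - j}. b i \<otimes> c (n - j - i)))"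
    by (subst finsum_Suc) (use cl in \<open>auto simp: Pi_def intro!: finsum_closed m_closed\<close>)
  also have "(\<Oplus>j\<in>{..k}. a j \<otimes> (\<Oplus>i\<in>{..Suc k - j}. b i \<otimes> c (n - j - i)))
    = (\<Oplus>j\<in>{..k}. (a j \<otimes> b (Suc k - j)) \<otimes> c (n - Suc k) \<oplus> a j \<otimes> T j)"
    by (rule finsum_cong') (use cl T e in \<open>auto simp: r_distr m_assoc\<close>)
  also have "\<dots> = (\<Oplus>j\<in>{..k}. (a j \<otimes> b (Suc k - j)) \<otimes> c (n - Suc k)) \<oplus> (\<Oplus>j\<in>{..k}. a j \<otimes> T j)"
    by (rule finsum_addf) (use cl T in auto)
  also have "(\<Oplus>j\<in>{..k}. (a j \<otimes> b (Suc k - j)) \<otimes> c (n - Suc k)) = (\<Oplus>j\<in>{..k}. a j \<otimes> b (Suc k - j)) \<otimes> c (n - Suc k)"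
    by (rule finsum_ldistr[symmetric]) (use cl in auto)
  also have "(\<Oplus>j\<in>{..k}. a j \<otimes> T j) = (\<Oplus>j\<in>{..k}. (\<Oplus>i\<in>{..j}. a i \<otimes> b (j - i)) \<otimes> c (n - j))"
    using Suc by (simp add: T_def)
  also have "a (Suc k) \<otimes> (\<Oplus>i\<in>{..0}. b i \<otimes> c (n - Suc k - i)) = a (Suc k) \<otimes> b 0 \<otimes> c (n - Suc k)"
    using cl by (simp add: m_assoc)
  finally have r: "(\<Oplus>j\<in>{..Suc k}. a j \<otimes> (\<Oplus>i\<in>{..Suc k - j}. b i \<otimes> c (n - j - i))) =
     a (Suc k) \<otimes> b 0 \<otimes> c (n - Suc k) \<oplus> ((\<Oplus>j\<in>{..k}. a j \<otimes> b (Suc k - j)) \<otimes> c (n - Suc k) \<oplus>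
      (\<Oplus>j\<in>{..k}. (\<Oplus>i\<in>{..j}. a i \<otimes> b (j - i)) \<otimes> c (n - j)))" .
  have s1: "(\<Oplus>j\<in>{..k}. (\<Oplus>i\<in>{..j}. a i \<otimes> b (j - i)) \<otimes> c (n - j)) \<in> carrier R"
    and s2: "(\<Oplus>j\<in>{..k}. a j \<otimes> b (Suc k - j)) \<in> carrier R"
    using cl by (auto intro!: finsum_closed m_closed)
  have "(\<Oplus>j\<in>{..Suc k}. (\<Oplus>i\<in>{..j}. a i \<otimes> b (j - i)) \<otimes> c (n - j)) =
    (\<Oplus>i\<in>{..Suc k}. a i \<otimes> b (Suc k - i)) \<otimes> c (n - Suc k) \<oplus> (\<Oplus>j\<in>{..k}. (\<Oplus>i\<in>{..j}. a i \<otimes> b (j - i)) \<otimes> c (n - j))"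
    by (subst finsum_Suc) (use cl in \<open>auto simp: Pi_def intro!: finsum_closed m_closed\<close>)
  also have "(\<Oplus>i\<in>{..Suc k}. a i \<otimes> b (Suc k - i)) = a (Suc k) \<otimes> b 0 \<oplus> (\<Oplus>i\<in>{..k}. a i \<otimes> b (Suc k - i))"
    by (subst finsum_Suc) (use cl in \<open>auto simp: Pi_def\<close>)
  finally show ?case unfolding r using cl s1 s2 by (simp add: l_distr a_assoc)
qed

lemma cring_power_series: "cring (power_series_ring R)"
proof (rule cringI)
  show "abelian_group (power_series_ring R)"
  proof (rule abelian_groupI)
    fix x assume "x \<in> carrier (power_series_ring R)"
    then show "\<exists>y\<in>carrier (power_series_ring R). y \<oplus>\<^bsub>power_series_ring R\<^esub> x = \<zero>\<^bsub>power_series_ring R\<^esub>"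
      by (intro bexI[of _ "\<lambda>j. \<ominus> x j"]) (auto simp: power_series_ring_def Pi_def l_neg)
  qed (auto simp: power_series_ring_def Pi_def a_ac)
  show "comm_monoid (power_series_ring R)"
  proof (rule comm_monoidI)
    fix x y z assume x: "x \<in> carrier (power_series_ring R)" and y: "y \<in> carrier (power_series_ring R)"
    show "x \<otimes>\<^bsub>power_series_ring R\<^esub> y \<in> carrier (power_series_ring R)"
      using x y by (auto simp: power_series_ring_def Pi_def intro!: finsum_closed)
    show "x \<otimes>\<^bsub>power_series_ring R\<^esub> y = y \<otimes>\<^bsub>power_series_ring R\<^esub> x"
      using x y cauchy_comm by (auto simp: power_series_ring_def)
    assume z: "z \<in> carrier (power_series_ring R)"
    show "x \<otimes>\<^bsub>power_series_ring R\<^esub> y \<otimes>\<^bsub>power_series_ring R\<^esub> z = x \<otimes>\<^bsub>power_series_ring R\<^esub> (y \<otimes>\<^bsub>power_series_ring R\<^esub> z)"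
      using x y z cauchy_assoc[of x y z _ _, OF _ _ _ order_refl] by (auto simp: power_series_ring_def)
  next
    fix x assume x: "x \<in> carrier (power_series_ring R)"
    have cl: "x i \<in> carrier R" for i using x by (auto simp: power_series_ring_def)
    have "(\<Oplus>i\<in>{..j}. (if i = 0 then \<one> else \<zero>) \<otimes> x (j - i)) = x j" for j
    proof -
      have "(\<Oplus>i\<in>{..j}. (if i = 0 then \<one> else \<zero>) \<otimes> x (j - i)) = (\<Oplus>i\<in>{..j}. if i = 0 then x (j - i) else \<zero>)"
        by (rule finsum_cong') (use cl in auto)
      also have "\<dots> = x (j - 0)" by (rule add.finprod_singleton_swap) (use cl in auto)
      finally show ?thesis by simp
    qed
    then show "\<one>\<^bsub>power_series_ring R\<^esub> \<otimes>\<^bsub>power_series_ring R\<^esub> x = x"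
      by (auto simp: power_series_ring_def)
  qed (auto simp: power_series_ring_def)
  fix x y z assume "x \<in> carrier (power_series_ring R)" "y \<in> carrier (power_series_ring R)" "z \<in> carrier (power_series_ring R)"
  then have cl: "x i \<in> carrier R" "y i \<in> carrier R" "z i \<in> carrier R" for i by (auto simp: power_series_ring_def)
  have "(\<Oplus>i\<in>{..j}. (x i \<oplus> y i) \<otimes> z (j - i)) = (\<Oplus>i\<in>{..j}. x i \<otimes> z (j - i)) \<oplus> (\<Oplus>i\<in>{..j}. y i \<otimes> z (j - i))" for j
  proof -
    have "(\<Oplus>i\<in>{..j}. (x i \<oplus> y i) \<otimes> z (j - i)) = (\<Oplus>i\<in>{..j}. x i \<otimes> z (j - i) \<oplus> y i \<otimes> z (j - i))"
      by (rule finsum_cong') (use cl in \<open>auto simp: l_distr\<close>)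
    also have "\<dots> = (\<Oplus>i\<in>{..j}. x i \<otimes> z (j - i)) \<oplus> (\<Oplus>i\<in>{..j}. y i \<otimes> z (j - i))"
      by (rule finsum_addf) (use cl in auto)
    finally show ?thesis .
  qed
  then show "(x \<oplus>\<^bsub>power_series_ring R\<^esub> y) \<otimes>\<^bsub>power_series_ring R\<^esub> z =
     x \<otimes>\<^bsub>power_series_ring R\<^esub> z \<oplus>\<^bsub>power_series_ring R\<^esub> y \<otimes>\<^bsub>power_series_ring R\<^esub> z"
    by (auto simp: power_series_ring_def)
qed

end

lemma ps_simps:
  "x \<in> carrier (power_series_ring R) \<longleftrightarrow> (\<forall>j. x j \<in> carrier R)"
  "(x \<oplus>\<^bsub>power_series_ring R\<^esub> y) j = x j \<oplus>\<^bsub>R\<^esub> y j"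
  "(x \<otimes>\<^bsub>power_series_ring R\<^esub> y) j = (\<Oplus>\<^bsub>R\<^esub>i\<in>{..j}. x i \<otimes>\<^bsub>R\<^esub> y (j - i))"
  "\<one>\<^bsub>power_series_ring R\<^esub> j = (if j = 0 then \<one>\<^bsub>R\<^esub> else \<zero>\<^bsub>R\<^esub>)"
  "\<zero>\<^bsub>power_series_ring R\<^esub> j = \<zero>\<^bsub>R\<^esub>"
  by (auto simp: power_series_ring_def)

text \<open>For each fixed index \<open>K\<close> a form is a power series over \<open>B\<close>, on
  which \<open>c\<close> acts as multiplication by its image under \<open>h\<close>. The module laws
  thus hold slice by slice by the ring laws of B[[u]].\<close>

lemma module_ps_forms:
  fixes A :: "('a, 'd) ring_scheme" (structure) and B :: "('b, 'e) ring_scheme" and P :: "'p set"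
  assumes A: "cring A" and B: "cring B" and h: "h \<in> ring_hom A B"
  shows "Module.module (power_series_ring A)
     \<lparr>carrier = UNIV \<rightarrow> (P \<rightarrow>\<^sub>E carrier B),
      mult = u1, one = u2,
      zero = (\<lambda>j. \<lambda>K\<in>P. \<zero>\<^bsub>B\<^esub>),
      add = (\<lambda>\<omega> \<eta> j. \<lambda>K\<in>P. \<omega> j K \<oplus>\<^bsub>B\<^esub> \<eta> j K),
      smult = (\<lambda>c \<omega> j. \<lambda>K\<in>P. \<Oplus>\<^bsub>B\<^esub>i\<in>{..j}. h (c i) \<otimes>\<^bsub>B\<^esub> \<omega> (j - i) K)\<rparr>"
    (is "Module.module _ ?M")
proof -
  interpret A: cring A by (rule A)
  interpret B: cring B by (rule B)
  interpret h: ring_hom_cring A B h by (intro ring_hom_cring.intro ring_hom_cring_axioms.intro A B h)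
  interpret PA: cring "power_series_ring A" by (rule A.cring_power_series)
  interpret PB: cring "power_series_ring B" by (rule B.cring_power_series)
  define sl where "sl \<omega> K = (\<lambda>j. \<omega> j K)" for \<omega> :: "nat \<Rightarrow> 'p \<Rightarrow> 'b" and K
  define ph where "ph c = (\<lambda>j. h (c j))" for c :: "nat \<Rightarrow> 'a"
  have carr: "\<omega> \<in> carrier ?M \<longleftrightarrow> (\<forall>j. \<omega> j \<in> P \<rightarrow>\<^sub>E carrier B)" for \<omega> by auto
  have slc: "sl \<omega> K \<in> carrier (power_series_ring B)" if "\<omega> \<in> carrier ?M" "K \<in> P" for \<omega> K
    using that by (auto simp: ps_simps sl_def Pi_def PiE_def)
  have phc: "ph c \<in> carrier (power_series_ring B)" if "c \<in> carrier (power_series_ring A)" for c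
    using that by (auto simp: ps_simps ph_def)
  have ext: "\<omega> = \<eta>" if "\<And>j. \<omega> j \<in> extensional P" "\<And>j. \<eta> j \<in> extensional P" "\<And>K. K \<in> P \<Longrightarrow> sl \<omega> K = sl \<eta> K" for \<omega> \<eta>
  proof
    fix j show "\<omega> j = \<eta> j"
      by (rule extensionalityI[OF that(1,2)]) (use that(3) in \<open>auto simp: sl_def fun_eq_iff\<close>)
  qed
  have ex: "\<omega> j \<in> extensional P" if "\<omega> \<in> carrier ?M" for \<omega> j using that by (auto simp: PiE_def)
  have exo: "(\<omega> \<oplus>\<^bsub>?M\<^esub> \<eta>) j \<in> extensional P" "(c \<odot>\<^bsub>?M\<^esub> \<omega>) j \<in> extensional P" "\<zero>\<^bsub>?M\<^esub> j \<in> extensional P" for \<omega> \<eta> c j by auto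
  have sla: "sl (\<omega> \<oplus>\<^bsub>?M\<^esub> \<eta>) K = sl \<omega> K \<oplus>\<^bsub>power_series_ring B\<^esub> sl \<eta> K" if "K \<in> P" for \<omega> \<eta> K
    using that by (auto simp: sl_def ps_simps fun_eq_iff)
  have sls: "sl (c \<odot>\<^bsub>?M\<^esub> \<omega>) K = ph c \<otimes>\<^bsub>power_series_ring B\<^esub> sl \<omega> K" if "K \<in> P" for c \<omega> K
    using that by (auto simp: sl_def ps_simps fun_eq_iff ph_def)
  have slz: "sl \<zero>\<^bsub>?M\<^esub> K = \<zero>\<^bsub>power_series_ring B\<^esub>" if "K \<in> P" for K
    using that by (auto simp: sl_def ps_simps fun_eq_iff)
  have pha: "ph (c \<oplus>\<^bsub>power_series_ring A\<^esub> c') = ph c \<oplus>\<^bsub>power_series_ring B\<^esub> ph c'"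
    if "c \<in> carrier (power_series_ring A)" "c' \<in> carrier (power_series_ring A)" for c c'
    using that by (auto simp: ps_simps ph_def fun_eq_iff)
  have phm: "ph (c \<otimes>\<^bsub>power_series_ring A\<^esub> c') = ph c \<otimes>\<^bsub>power_series_ring B\<^esub> ph c'"
    if "c \<in> carrier (power_series_ring A)" "c' \<in> carrier (power_series_ring A)" for c c'
  proof
    fix j
    have cl: "c i \<in> carrier A" "c' i \<in> carrier A" for i using that by (auto simp: ps_simps)
    have "h (\<Oplus>\<^bsub>A\<^esub>i\<in>{..j}. c i \<otimes>\<^bsub>A\<^esub> c' (j - i)) = (\<Oplus>\<^bsub>B\<^esub>i\<in>{..j}. (h \<circ> (\<lambda>i. c i \<otimes>\<^bsub>A\<^esub> c' (j - i))) i)"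
      by (rule h.hom_finsum) (use cl in auto)
    also have "\<dots> = (\<Oplus>\<^bsub>B\<^esub>i\<in>{..j}. h (c i) \<otimes>\<^bsub>B\<^esub> h (c' (j - i)))"
      by (rule B.finsum_cong') (use cl in auto)
    finally show "ph (c \<otimes>\<^bsub>power_series_ring A\<^esub> c') j = (ph c \<otimes>\<^bsub>power_series_ring B\<^esub> ph c') j"
      by (simp add: ph_def ps_simps)
  qed
  have pho: "ph \<one>\<^bsub>power_series_ring A\<^esub> = \<one>\<^bsub>power_series_ring B\<^esub>"
    by (auto simp: ph_def ps_simps fun_eq_iff)
  have addc: "\<omega> \<oplus>\<^bsub>?M\<^esub> \<eta> \<in> carrier ?M" if "\<omega> \<in> carrier ?M" "\<eta> \<in> carrier ?M" for \<omega> \<eta>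
    using that by (auto simp: Pi_def PiE_def)
  have smc: "c \<odot>\<^bsub>?M\<^esub> \<omega> \<in> carrier ?M" if "c \<in> carrier (power_series_ring A)" "\<omega> \<in> carrier ?M" for c \<omega>
    using that by (auto simp: Pi_def PiE_def ps_simps intro!: B.finsum_closed)
  show ?thesis
  proof (rule moduleI)
    show "cring (power_series_ring A)" by (rule PA.cring_axioms)
    show "abelian_group ?M"
    proof (rule abelian_groupI)
      fix x y z assume x: "x \<in> carrier ?M" and y: "y \<in> carrier ?M"
      show "x \<oplus>\<^bsub>?M\<^esub> y \<in> carrier ?M" by (rule addc[OF x y])
      show "x \<oplus>\<^bsub>?M\<^esub> y = y \<oplus>\<^bsub>?M\<^esub> x"
        by (rule ext) (simp_all only: exo sla slc x y PB.a_comm)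
      assume z: "z \<in> carrier ?M"
      show "x \<oplus>\<^bsub>?M\<^esub> y \<oplus>\<^bsub>?M\<^esub> z = x \<oplus>\<^bsub>?M\<^esub> (y \<oplus>\<^bsub>?M\<^esub> z)"
        by (rule ext) (simp_all only: exo sla slc x y z PB.a_assoc)
    next
      show "\<zero>\<^bsub>?M\<^esub> \<in> carrier ?M" by auto
      fix x assume x: "x \<in> carrier ?M"
      show "\<zero>\<^bsub>?M\<^esub> \<oplus>\<^bsub>?M\<^esub> x = x"
        by (rule ext) (simp_all only: exo ex sla slc slz x PB.l_zero)
      define y where "y = (\<lambda>j. \<lambda>K\<in>P. \<ominus>\<^bsub>B\<^esub> x j K)"
      have y: "y \<in> carrier ?M" using x by (auto simp: y_def Pi_def PiE_def)
      have "y \<oplus>\<^bsub>?M\<^esub> x = \<zero>\<^bsub>?M\<^esub>"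
        using x by (auto simp: y_def fun_eq_iff restrict_def B.l_neg Pi_def PiE_def)
      then show "\<exists>y\<in>carrier ?M. y \<oplus>\<^bsub>?M\<^esub> x = \<zero>\<^bsub>?M\<^esub>" using y by blast
    qed
    fix c x assume c: "c \<in> carrier (power_series_ring A)" and x: "x \<in> carrier ?M"
    show "c \<odot>\<^bsub>?M\<^esub> x \<in> carrier ?M" by (rule smc[OF c x])
    fix c' assume c': "c' \<in> carrier (power_series_ring A)"
    show "(c \<oplus>\<^bsub>power_series_ring A\<^esub> c') \<odot>\<^bsub>?M\<^esub> x = c \<odot>\<^bsub>?M\<^esub> x \<oplus>\<^bsub>?M\<^esub> c' \<odot>\<^bsub>?M\<^esub> x"
      by (rule ext) (simp_all only: exo sla sls slc x c c' pha phc PB.l_distr)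
    show "(c \<otimes>\<^bsub>power_series_ring A\<^esub> c') \<odot>\<^bsub>?M\<^esub> x = c \<odot>\<^bsub>?M\<^esub> (c' \<odot>\<^bsub>?M\<^esub> x)"
      by (rule ext) (simp_all only: exo sla sls slc x c c' phm phc PB.m_assoc)
  next
    fix c x y assume c: "c \<in> carrier (power_series_ring A)" and x: "x \<in> carrier ?M" and y: "y \<in> carrier ?M"
    show "c \<odot>\<^bsub>?M\<^esub> (x \<oplus>\<^bsub>?M\<^esub> y) = c \<odot>\<^bsub>?M\<^esub> x \<oplus>\<^bsub>?M\<^esub> c \<odot>\<^bsub>?M\<^esub> y"
      by (rule ext) (simp_all only: exo sla sls slc x y c phc PB.r_distr)
  next
    fix x assume x: "x \<in> carrier ?M"
    show "\<one>\<^bsub>power_series_ring A\<^esub> \<odot>\<^bsub>?M\<^esub> x = x"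
      by (rule ext) (simp_all only: exo ex sls slc x pho PB.l_one)
  qed
qed

section \<open>Cohomology of a module endomorphism\<close>

locale module_endo = module R M for R (structure) and M (structure) +
  fixes D
  assumes D_closed: "x \<in> carrier M \<Longrightarrow> D x \<in> carrier M"
    and D_add: "x \<in> carrier M \<Longrightarrow> y \<in> carrier M \<Longrightarrow> D (x \<oplus>\<^bsub>M\<^esub> y) = D x \<oplus>\<^bsub>M\<^esub> D y"
    and D_smult: "c \<in> carrier R \<Longrightarrow> x \<in> carrier M \<Longrightarrow> D (c \<odot>\<^bsub>M\<^esub> x) = c \<odot>\<^bsub>M\<^esub> D x"
begin

abbreviation HH where "HH \<equiv> cohomology M D"
definition ZZ where "ZZ = {x\<in>carrier M. D x = \<zero>\<^bsub>M\<^esub>}"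
definition BB where "BB = D ` carrier M"
definition cls where "cls x = BB +>\<^bsub>M\<^esub> x"

lemma D_zero: "D \<zero>\<^bsub>M\<^esub> = \<zero>\<^bsub>M\<^esub>"
  using D_add[of "\<zero>\<^bsub>M\<^esub>" "\<zero>\<^bsub>M\<^esub>"] D_closed[of "\<zero>\<^bsub>M\<^esub>"] M.add.l_cancel_one'[of "D \<zero>\<^bsub>M\<^esub>" "D \<zero>\<^bsub>M\<^esub>"] by auto

lemma D_neg: "x \<in> carrier M \<Longrightarrow> D (\<ominus>\<^bsub>M\<^esub> x) = \<ominus>\<^bsub>M\<^esub> D x"
proof -
  assume x: "x \<in> carrier M"
  have "D (\<ominus>\<^bsub>M\<^esub> x) \<oplus>\<^bsub>M\<^esub> D x = \<zero>\<^bsub>M\<^esub>"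
    using D_add[of "\<ominus>\<^bsub>M\<^esub> x" x] x by (simp add: M.l_neg D_zero)
  then show ?thesis using M.minus_equality[of "D (\<ominus>\<^bsub>M\<^esub> x)" "D x"] D_closed x by simp
qed

lemma BB_sub: "BB \<subseteq> carrier M"
  using D_closed by (auto simp: BB_def)

lemma BB_subgroup: "subgroup BB (add_monoid M)"
proof (rule M.add.subgroupI)
  show "BB \<subseteq> carrier M" by (rule BB_sub)
  show "BB \<noteq> {}" by (auto simp: BB_def)
  fix a assume "a \<in> BB"
  then obtain x where x: "x \<in> carrier M" "a = D x" by (auto simp: BB_def)
  then show "\<ominus>\<^bsub>M\<^esub> a \<in> BB" using D_neg[OF x(1)] by (auto simp: BB_def intro!: image_eqI[of _ _ "\<ominus>\<^bsub>M\<^esub> x"])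
  fix b assume "b \<in> BB"
  then obtain y where y: "y \<in> carrier M" "b = D y" by (auto simp: BB_def)
  show "a \<oplus>\<^bsub>M\<^esub> b \<in> BB" using x y D_add by (auto simp: BB_def intro!: image_eqI[of _ _ "x \<oplus>\<^bsub>M\<^esub> y"])
qed

sublocale BB: abelian_subgroup BB M
  by (rule abelian_subgroupI3) (auto simp: additive_subgroup_def BB_subgroup M.abelian_group_axioms)

lemma BB_smult: "c \<in> carrier R \<Longrightarrow> b \<in> BB \<Longrightarrow> c \<odot>\<^bsub>M\<^esub> b \<in> BB"
  using D_smult by (auto simp: BB_def intro!: image_eqI[of _ _ "c \<odot>\<^bsub>M\<^esub> _"])

lemma cls_eq: "x \<in> carrier M \<Longrightarrow> y \<in> carrier M \<Longrightarrow> cls x = cls y \<longleftrightarrow> x \<oplus>\<^bsub>M\<^esub> \<ominus>\<^bsub>M\<^esub> y \<in> BB"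
  unfolding cls_def
  using BB.a_rcos_module[of y x] BB.a_repr_independence'[of x y] BB.a_rcos_self[of x] by metis

lemma cls_self: "x \<in> carrier M \<Longrightarrow> x \<in> cls x"
  unfolding cls_def by (rule BB.a_rcos_self)

lemma cls_shift: "x \<in> carrier M \<Longrightarrow> y \<in> carrier M \<Longrightarrow> cls (x \<oplus>\<^bsub>M\<^esub> D y) = cls x"
  by (subst cls_eq) (auto simp: D_closed BB_def M.a_ac M.r_neg intro!: image_eqI[of _ _ y],
      metis D_closed M.a_comm M.a_inv_closed M.a_lcomm M.r_neg M.r_zero)

lemma ZZ_sub: "ZZ \<subseteq> carrier M" by (auto simp: ZZ_def)

lemma ZZ_add: "x \<in> ZZ \<Longrightarrow> y \<in> ZZ \<Longrightarrow> x \<oplus>\<^bsub>M\<^esub> y \<in> ZZ"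
  by (auto simp: ZZ_def D_add)

lemma ZZ_smult: "c \<in> carrier R \<Longrightarrow> x \<in> ZZ \<Longrightarrow> c \<odot>\<^bsub>M\<^esub> x \<in> ZZ"
  by (auto simp: ZZ_def D_smult)

lemma ZZ_zero: "\<zero>\<^bsub>M\<^esub> \<in> ZZ"
  by (simp add: ZZ_def D_zero)

lemma ZZ_neg: "x \<in> ZZ \<Longrightarrow> \<ominus>\<^bsub>M\<^esub> x \<in> ZZ"
  by (auto simp: ZZ_def D_neg)

lemma HH_carrier: "carrier HH = cls ` ZZ"
  by (auto simp: cohomology_def Let_def cls_def[abs_def] BB_def ZZ_def)

lemma HH_zero: "\<zero>\<^bsub>HH\<^esub> = cls \<zero>\<^bsub>M\<^esub>"
  using BB_sub by (simp add: cohomology_def Let_def cls_def BB_def)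

lemma HH_add: "x \<in> carrier M \<Longrightarrow> y \<in> carrier M \<Longrightarrow> cls x \<oplus>\<^bsub>HH\<^esub> cls y = cls (x \<oplus>\<^bsub>M\<^esub> y)"
  using BB.a_rcos_sum[of x y] by (simp add: cohomology_def Let_def cls_def)

text \<open>The union over representatives in \<open>cohomology\<close> collapses to one coset,
  since linearity of \<open>D\<close> makes scalars preserve its image.\<close>

lemma HH_smult:
  assumes c: "c \<in> carrier R" and x: "x \<in> carrier M"
  shows "c \<odot>\<^bsub>HH\<^esub> cls x = cls (c \<odot>\<^bsub>M\<^esub> x)"
proof -
  have "cls (c \<odot>\<^bsub>M\<^esub> y) = cls (c \<odot>\<^bsub>M\<^esub> x)" if y: "y \<in> cls x" for y
  proof -
    have yM: "y \<in> carrier M" using y BB.a_elemrcos_carrier[of x y] x by (simp add: cls_def)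
    have "y \<oplus>\<^bsub>M\<^esub> \<ominus>\<^bsub>M\<^esub> x \<in> BB" using BB.a_rcos_module[OF x yM] y by (simp add: cls_def)
    then have "c \<odot>\<^bsub>M\<^esub> (y \<oplus>\<^bsub>M\<^esub> \<ominus>\<^bsub>M\<^esub> x) \<in> BB" by (rule BB_smult[OF c])
    then show ?thesis using c x yM by (subst cls_eq) (auto simp: smult_r_distr smult_r_minus)
  qed
  then have "(\<Union>y\<in>cls x. cls (c \<odot>\<^bsub>M\<^esub> y)) = cls (c \<odot>\<^bsub>M\<^esub> x)" using cls_self[OF x] by blast
  then show ?thesis by (simp add: cohomology_def Let_def cls_def BB_def)
qed

lemma module_HH: "Module.module R HH"
proof (rule moduleI)
  show "cring R" by (rule R.cring_axioms)
  note Zc = subsetD[OF ZZ_sub]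
  show "abelian_group HH"
  proof (rule abelian_groupI)
    fix x y z assume "x \<in> carrier HH" "y \<in> carrier HH"
    then obtain a b where ab: "a \<in> ZZ" "b \<in> ZZ" "x = cls a" "y = cls b" by (auto simp: HH_carrier)
    show "x \<oplus>\<^bsub>HH\<^esub> y \<in> carrier HH" using ab by (simp add: HH_add Zc HH_carrier ZZ_add)
    show "x \<oplus>\<^bsub>HH\<^esub> y = y \<oplus>\<^bsub>HH\<^esub> x" using ab by (simp add: HH_add Zc M.a_comm)
    assume "z \<in> carrier HH"
    then obtain c where c: "c \<in> ZZ" "z = cls c" by (auto simp: HH_carrier)
    show "x \<oplus>\<^bsub>HH\<^esub> y \<oplus>\<^bsub>HH\<^esub> z = x \<oplus>\<^bsub>HH\<^esub> (y \<oplus>\<^bsub>HH\<^esub> z)" using ab c by (simp add: HH_add Zc M.a_assoc)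
  next
    show "\<zero>\<^bsub>HH\<^esub> \<in> carrier HH" by (simp add: HH_zero HH_carrier ZZ_zero)
    fix x assume "x \<in> carrier HH"
    then obtain a where a: "a \<in> ZZ" "x = cls a" by (auto simp: HH_carrier)
    show "\<zero>\<^bsub>HH\<^esub> \<oplus>\<^bsub>HH\<^esub> x = x" using a by (simp add: HH_zero HH_add Zc)
    have "cls (\<ominus>\<^bsub>M\<^esub> a) \<oplus>\<^bsub>HH\<^esub> x = \<zero>\<^bsub>HH\<^esub>" using a by (simp add: HH_zero HH_add Zc M.l_neg)
    then show "\<exists>y\<in>carrier HH. y \<oplus>\<^bsub>HH\<^esub> x = \<zero>\<^bsub>HH\<^esub>" using ZZ_neg a by (auto simp: HH_carrier)
  qed
  fix c x assume c: "c \<in> carrier R" and "x \<in> carrier HH"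
  then obtain a where a: "a \<in> ZZ" "x = cls a" by (auto simp: HH_carrier)
  show "c \<odot>\<^bsub>HH\<^esub> x \<in> carrier HH" using a c by (simp add: HH_smult Zc HH_carrier ZZ_smult)
  fix c' assume c': "c' \<in> carrier R"
  show "(c \<oplus> c') \<odot>\<^bsub>HH\<^esub> x = c \<odot>\<^bsub>HH\<^esub> x \<oplus>\<^bsub>HH\<^esub> c' \<odot>\<^bsub>HH\<^esub> x"
    using a c c' by (simp add: HH_smult HH_add Zc smult_l_distr)
  show "(c \<otimes> c') \<odot>\<^bsub>HH\<^esub> x = c \<odot>\<^bsub>HH\<^esub> (c' \<odot>\<^bsub>HH\<^esub> x)"
    using a c c' by (simp add: HH_smult Zc smult_assoc1)
next
  fix x assume "x \<in> carrier HH"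
  then obtain a where a: "a \<in> ZZ" "x = cls a" by (auto simp: HH_carrier)
  then show "\<one> \<odot>\<^bsub>HH\<^esub> x = x" using ZZ_sub by (simp add: HH_smult subset_iff)
next
  fix c x y assume c: "c \<in> carrier R" and "x \<in> carrier HH" "y \<in> carrier HH"
  then obtain a b where ab: "a \<in> ZZ" "b \<in> ZZ" "x = cls a" "y = cls b" by (auto simp: HH_carrier)
  then show "c \<odot>\<^bsub>HH\<^esub> (x \<oplus>\<^bsub>HH\<^esub> y) = c \<odot>\<^bsub>HH\<^esub> x \<oplus>\<^bsub>HH\<^esub> c \<odot>\<^bsub>HH\<^esub> y"
    using c subsetD[OF ZZ_sub] by (simp add: HH_smult HH_add smult_r_distr)
qed

lemma HH_finsum:
  assumes "f \<in> I \<rightarrow> ZZ"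
  shows "(\<Oplus>\<^bsub>HH\<^esub>i\<in>I. cls (f i)) = cls (\<Oplus>\<^bsub>M\<^esub>i\<in>I. f i)"
proof -
  interpret H: module R HH by (rule module_HH)
  show ?thesis using assms
  proof (induction I rule: infinite_finite_induct)
    case (insert i I)
    then have f: "f \<in> I \<rightarrow> ZZ" "f i \<in> ZZ" by auto
    then have "f \<in> I \<rightarrow> carrier M" "f i \<in> carrier M" "(\<lambda>i. cls (f i)) \<in> I \<rightarrow> carrier HH" "cls (f i) \<in> carrier HH"
      using ZZ_sub by (auto simp: HH_carrier)
    then show ?case using insert f by (simp add: HH_add)
  qed (simp_all add: HH_zero)
qed

text \<open>A basis is a set of classes, whereas \<open>w\<close> is an indexed family, so distinct
  indices must give distinct classes. This follows by comparing the coefficients of two indicator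
  families, which differ because 1 \<noteq> 0.\<close>

theorem cohomology_basis:
  assumes fin: "finite I" and w: "w \<in> I \<rightarrow> ZZ" and one: "\<one> \<noteq> \<zero>"
    and span: "\<And>z. z \<in> ZZ \<Longrightarrow> \<exists>c\<in>I \<rightarrow> carrier R. cls z = cls (\<Oplus>\<^bsub>M\<^esub>i\<in>I. c i \<odot>\<^bsub>M\<^esub> w i)"
    and indep: "\<And>c i. c \<in> I \<rightarrow> carrier R \<Longrightarrow> (\<Oplus>\<^bsub>M\<^esub>i\<in>I. c i \<odot>\<^bsub>M\<^esub> w i) \<in> BB \<Longrightarrow> i \<in> I \<Longrightarrow> c i = \<zero>"
  shows "module_basis R HH ((\<lambda>i. cls (w i)) ` I)"
proof -
  interpret H: module R HH by (rule module_HH)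
  let ?b = "\<lambda>i. cls (w i)" and ?B = "(\<lambda>i. cls (w i)) ` I"
  have wM: "w i \<in> carrier M" if "i \<in> I" for i using w that ZZ_sub by auto
  let ?s = "\<lambda>c. \<Oplus>\<^bsub>M\<^esub>i\<in>I. c i \<odot>\<^bsub>M\<^esub> w i"
  have sM: "?s c \<in> carrier M" if "c \<in> I \<rightarrow> carrier R" for c
    using that wM by (intro M.finsum_closed) auto
  have diff: "c i = c' i" if c: "c \<in> I \<rightarrow> carrier R" and c': "c' \<in> I \<rightarrow> carrier R" and e: "cls (?s c) = cls (?s c')" and i: "i \<in> I" for c c' i
  proof -
    let ?d = "\<lambda>i. c i \<oplus> \<ominus> c' i"
    have d: "?d \<in> I \<rightarrow> carrier R" using c c' by auto
    have "(\<Oplus>\<^bsub>M\<^esub>i\<in>I. c i \<odot>\<^bsub>M\<^esub> w i) = (\<Oplus>\<^bsub>M\<^esub>i\<in>I. ?d i \<odot>\<^bsub>M\<^esub> w i \<oplus>\<^bsub>M\<^esub> c' i \<odot>\<^bsub>M\<^esub> w i)"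
    proof (rule M.finsum_cong')
      fix i assume i: "i \<in> I"
      then have cl: "c i \<in> carrier R" "c' i \<in> carrier R" "w i \<in> carrier M" using c c' wM by auto
      then have "c i = ?d i \<oplus> c' i" by (simp add: R.a_assoc R.l_neg)
      then show "c i \<odot>\<^bsub>M\<^esub> w i = ?d i \<odot>\<^bsub>M\<^esub> w i \<oplus>\<^bsub>M\<^esub> c' i \<odot>\<^bsub>M\<^esub> w i"
        using cl smult_l_distr[of "?d i" "c' i" "w i"] by simp
    qed (use c c' wM in \<open>auto simp: Pi_iff\<close>)
    also have "\<dots> = ?s ?d \<oplus>\<^bsub>M\<^esub> ?s c'" by (rule M.finsum_addf) (use c c' wM in \<open>auto simp: Pi_iff\<close>)
    finally have s: "?s c = ?s ?d \<oplus>\<^bsub>M\<^esub> ?s c'" .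
    have "?s c \<oplus>\<^bsub>M\<^esub> \<ominus>\<^bsub>M\<^esub> ?s c' \<in> BB" using e cls_eq sM c c' by blast
    then have "?s ?d \<in> BB" unfolding s using sM[OF d] sM[OF c'] by (simp add: M.a_assoc M.r_neg)
    then have "?d i = \<zero>" by (rule indep[OF d _ i])
    then show ?thesis using c c' i R.add.inv_equality R.minus_minus by (metis PiE R.a_inv_closed R.minus_equality)
  qed
  have inj: "inj_on ?b I"
  proof (rule inj_onI)
    fix i i' assume i: "i \<in> I" "i' \<in> I" and e: "?b i = ?b i'"
    have d: "?s (\<lambda>j. if j = i0 then \<one> else \<zero>) = w i0" if "i0 \<in> I" for i0
    proof -
      have "?s (\<lambda>j. if j = i0 then \<one> else \<zero>) = (\<Oplus>\<^bsub>M\<^esub>j\<in>I. if j = i0 then w j else \<zero>\<^bsub>M\<^esub>)"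
        by (rule M.finsum_cong') (use wM in auto)
      also have "\<dots> = w i0" by (rule M.add.finprod_singleton_swap) (use that fin wM in auto)
      finally show ?thesis .
    qed
    have "(if i = i then \<one> else \<zero>) = (if i = i' then \<one> else \<zero>)"
      by (rule diff[of "\<lambda>j. if j = i then \<one> else \<zero>" "\<lambda>j. if j = i' then \<one> else \<zero>" i]) (use d i e in auto)
    then show "i = i'" using one by (auto split: if_splits)
  qed
  have sum: "(\<Oplus>\<^bsub>HH\<^esub>b\<in>{b\<in>?B. c b \<noteq> \<zero>}. c b \<odot>\<^bsub>HH\<^esub> b) = cls (?s (\<lambda>i. c (?b i)))" if c: "c \<in> ?B \<rightarrow> carrier R" for c
  proof -
    have bH: "?b i \<in> carrier HH" if "i \<in> I" for i using that w by (auto simp: HH_carrier)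
    have "(\<Oplus>\<^bsub>HH\<^esub>b\<in>{b\<in>?B. c b \<noteq> \<zero>}. c b \<odot>\<^bsub>HH\<^esub> b) = (\<Oplus>\<^bsub>HH\<^esub>b\<in>?B. c b \<odot>\<^bsub>HH\<^esub> b)"
      by (rule H.M.add.finprod_mono_neutral_cong_left) (use fin c bH in auto)
    also have "\<dots> = (\<Oplus>\<^bsub>HH\<^esub>i\<in>I. c (?b i) \<odot>\<^bsub>HH\<^esub> ?b i)"
      by (rule H.M.finsum_reindex[OF _ inj]) (use c bH in auto)
    also have "\<dots> = (\<Oplus>\<^bsub>HH\<^esub>i\<in>I. cls (c (?b i) \<odot>\<^bsub>M\<^esub> w i))"
    proof (rule H.M.finsum_cong'[OF refl])
      show "(\<lambda>i. cls (c (?b i) \<odot>\<^bsub>M\<^esub> w i)) \<in> I \<rightarrow> carrier HH"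
        using c w by (auto simp: HH_carrier intro!: imageI ZZ_smult)
      show "c (?b i) \<odot>\<^bsub>HH\<^esub> ?b i = cls (c (?b i) \<odot>\<^bsub>M\<^esub> w i)" if "i \<in> I" for i
        by (rule HH_smult) (use c wM that in auto)
    qed
    also have "\<dots> = cls (?s (\<lambda>i. c (?b i)))"
      by (rule HH_finsum) (use c w in \<open>auto intro!: ZZ_smult\<close>)
    finally show ?thesis .
  qed
  show ?thesis unfolding module_basis_def
  proof (intro conjI ballI)
    show "?B \<subseteq> carrier HH" using w by (auto simp: HH_carrier)
    fix x assume "x \<in> carrier HH"
    then obtain z where z: "z \<in> ZZ" "x = cls z" by (auto simp: HH_carrier)
    obtain c where c: "c \<in> I \<rightarrow> carrier R" "cls z = cls (?s c)" using span[OF z(1)] by blast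
    \<comment> \<open>Transports the coefficients from indices to classes; \<open>restrict\<close>
      makes the coefficient function unique off the basis.\<close>
    define e where "e = (\<lambda>b\<in>?B. c (the_inv_into I ?b b))"
    have eb: "e (?b i) = c i" if "i \<in> I" for i using that by (simp add: e_def the_inv_into_f_f[OF inj])
    have e: "e \<in> ?B \<rightarrow>\<^sub>E carrier R"
    proof (rule PiE_I)
      fix b assume "b \<in> ?B"
      then show "e b \<in> carrier R" using eb c(1) by auto
    qed (simp add: e_def)
    show "\<exists>!c. c \<in> ?B \<rightarrow>\<^sub>E carrier R \<and> finite {b\<in>?B. c b \<noteq> \<zero>} \<and>
        x = (\<Oplus>\<^bsub>HH\<^esub>b\<in>{b\<in>?B. c b \<noteq> \<zero>}. c b \<odot>\<^bsub>HH\<^esub> b)"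
    proof (rule ex1I[of _ e], intro conjI)
      show "e \<in> ?B \<rightarrow>\<^sub>E carrier R" by (rule e)
      show "finite {b\<in>?B. e b \<noteq> \<zero>}" using fin by simp
      have "?s (\<lambda>i. e (?b i)) = ?s c"
        by (rule M.finsum_cong') (use c wM eb in auto)
      then show "x = (\<Oplus>\<^bsub>HH\<^esub>b\<in>{b\<in>?B. e b \<noteq> \<zero>}. e b \<odot>\<^bsub>HH\<^esub> b)"
        using sum[of e] e c(2) z(2) by (auto simp: PiE_def)
    next
      fix g assume g: "g \<in> ?B \<rightarrow>\<^sub>E carrier R \<and> finite {b\<in>?B. g b \<noteq> \<zero>} \<and>
        x = (\<Oplus>\<^bsub>HH\<^esub>b\<in>{b\<in>?B. g b \<noteq> \<zero>}. g b \<odot>\<^bsub>HH\<^esub> b)"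
      then have gP: "g \<in> ?B \<rightarrow> carrier R" by (auto simp: PiE_def)
      have "cls (?s (\<lambda>i. g (?b i))) = cls (?s c)" using sum[OF gP] g c(2) z(2) by metis
      then have "g (?b i) = c i" if "i \<in> I" for i
        using diff[of "\<lambda>i. g (?b i)" c i] gP c(1) that by auto
      then have "g b = e b" if "b \<in> ?B" for b using that eb by auto
      then show "g = e" using g e by (intro PiE_ext[of g ?B "\<lambda>_. carrier R" e]) auto
    qed
  qed
qed

end

text \<open>At height N there are at most K^N elements, with K one more than the number of
  generators, so at radius 1/(2K) the levels are dominated by a geometric series of ratio
  1/2.\<close>

lemma (in height_monoid) geometric_sum_bound:
  assumes F: "finite F" "F \<subseteq> Q"
  shows "(\<Sum>x\<in>F. (1 / real (2 * Suc (card \<Gamma>))) ^ H x) \<le> 2"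
proof -
  define K where "K = Suc (card \<Gamma>)"
  have Kp: "0 < real K" by (simp add: K_def)
  define m where "m = Suc (Max (insert 0 (H ` F)))"
  have Hm: "H ` F \<subseteq> {..<m}" using F by (auto simp: m_def less_Suc_eq_le)
  have "(\<Sum>x\<in>F. (1 / real (2 * K)) ^ H x) = (\<Sum>N<m. \<Sum>x\<in>{x\<in>F. H x = N}. (1 / real (2 * K)) ^ H x)"
    by (rule sum.group[symmetric]) (use F Hm in auto)
  also have "\<dots> \<le> (\<Sum>N<m. (1/2) ^ N)"
  proof (rule sum_mono)
    fix N
    have "(\<Sum>x\<in>{x\<in>F. H x = N}. (1 / real (2 * K)) ^ H x) = real (card {x\<in>F. H x = N}) * (1 / real (2 * K)) ^ N"
      by simp
    also have "\<dots> \<le> real (K ^ N) * (1 / real (2 * K)) ^ N"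
    proof (rule mult_right_mono)
      have "card {x\<in>F. H x = N} \<le> card {x\<in>Q. H x \<le> N}" using F level[of N] by (intro card_mono) auto
      then show "real (card {x\<in>F. H x = N}) \<le> real (K ^ N)" using level[of N] unfolding K_def by linarith
    qed simp
    also have "\<dots> = (1/2) ^ N"
      using Kp by (simp add: power_divide power_mult_distrib)
    finally show "(\<Sum>x\<in>{x\<in>F. H x = N}. (1 / real (2 * K)) ^ H x) \<le> (1/2) ^ N" .
  qed
  also have "\<dots> \<le> 2"
    by (simp add: sum_gp_strict)
  finally show ?thesis by (simp only: K_def)
qed

section \<open>The hypercohomology of the family\<close>

locale expo_monoid = height_monoid Q H \<Gamma> for Q :: "('n::finite) expo set" and H \<Gamma>
begin

text \<open>A point is multiplicative, so its values on generators control it. Taking P at least 1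
  lets the bound persist for generators of height above 1.\<close>

lemma point_bound:
  assumes xi: "\<xi> \<in> points Q"
  obtains P :: nat where "\<And>x. x \<in> Q \<Longrightarrow> norm (\<xi> x) \<le> real P ^ H x"
proof -
  obtain P :: nat where P: "1 + (\<Sum>g\<in>\<Gamma>. norm (\<xi> g)) \<le> real P" using real_arch_simple by blast
  have P1: "1 \<le> real P" using P sum_nonneg[of \<Gamma> "\<lambda>g. norm (\<xi> g)"] by simp
  have "H x = N \<longrightarrow> x \<in> Q \<longrightarrow> norm (\<xi> x) \<le> real P ^ H x" for N x
  proof (induction N arbitrary: x rule: less_induct)
    case (less N)
    show ?case
    proof (intro impI)
      assume N: "H x = N" and x: "x \<in> Q"
      show "norm (\<xi> x) \<le> real P ^ H x"
      proof (cases "x = 0")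
        case True
        then show ?thesis using xi by (simp add: points_def H_zero)
      next
        case False
        then obtain g y where g: "g \<in> \<Gamma>" "y \<in> Q" "x = g + y" using gen x by blast
        have gQ: "g \<in> Q" using g gen_sub by blast
        have Hx: "H x = H g + H y" using g gQ H_add by blast
        then have "H y < N" using N H_gen[OF g(1)] by simp
        then have y: "norm (\<xi> y) \<le> real P ^ H y" using less g by blast
        have "norm (\<xi> g) \<le> (\<Sum>g\<in>\<Gamma>. norm (\<xi> g))" using g fin_gen by (intro member_le_sum) auto
        then have "norm (\<xi> g) \<le> real P ^ 1" using P by simp
        also have "\<dots> \<le> real P ^ H g" using H_gen[OF g(1)] P1 by (intro power_increasing) auto
        finally have gP: "norm (\<xi> g) \<le> real P ^ H g" .
        have "\<xi> x = \<xi> g * \<xi> y" using xi g gQ by (auto simp: points_def)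
        then have "norm (\<xi> x) = norm (\<xi> g) * norm (\<xi> y)" by (simp add: norm_mult)
        also have "\<dots> \<le> real P ^ H g * real P ^ H y" using gP y by (intro mult_mono) auto
        finally show ?thesis by (simp add: Hx power_add)
      qed
    qed
  qed
  then show thesis using that by blast
qed

text \<open>Connects the growth bounds with absolute convergence at all points. In one direction a
  larger radius leaves a geometric series; in the other, single terms are bounded by the sum at
  suitable points.\<close>

lemma growth_iff_summable:
  assumes supp: "\<And>x. x \<notin> Q \<Longrightarrow> c x = 0"
  shows "growth Q H c \<longleftrightarrow> (\<forall>\<xi>\<in>points Q. (\<lambda>x. norm (c x * \<xi> x)) summable_on Q)"
proof
  assume g: "growth Q H c"
  show "\<forall>\<xi>\<in>points Q. (\<lambda>x. norm (c x * \<xi> x)) summable_on Q"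
  proof
    fix \<xi> assume "\<xi> \<in> points Q"
    then obtain P :: nat where P: "\<And>x. x \<in> Q \<Longrightarrow> norm (\<xi> x) \<le> real P ^ H x" using point_bound by blast
    define K where "K = 2 * Suc (card \<Gamma>)"
    have Kp: "0 < real K" by (simp add: K_def)
    obtain M where M: "0 \<le> M" "\<forall>x\<in>Q. norm (c x) * real (K * P) ^ H x \<le> M" using growth_bound[OF g] by blast
    have t: "norm (c x * \<xi> x) \<le> M * (1 / real K) ^ H x" if x: "x \<in> Q" for x
    proof -
      have "norm (c x * \<xi> x) \<le> norm (c x) * real P ^ H x"
        unfolding norm_mult using P[OF x] by (intro mult_left_mono) auto
      also have "\<dots> = (norm (c x) * real (K * P) ^ H x) * (1 / real K) ^ H x"
        using Kp by (simp add: power_mult_distrib power_divide)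
      also have "\<dots> \<le> M * (1 / real K) ^ H x" using M x by (intro mult_right_mono) auto
      finally show ?thesis .
    qed
    show "(\<lambda>x. norm (c x * \<xi> x)) summable_on Q"
    proof (rule nonneg_bdd_above_summable_on)
      show "bdd_above (sum (\<lambda>x. norm (c x * \<xi> x)) ` {F. F \<subseteq> Q \<and> finite F})"
      proof (rule bdd_aboveI2)
        fix F assume F: "F \<in> {F. F \<subseteq> Q \<and> finite F}"
        have "(\<Sum>x\<in>F. norm (c x * \<xi> x)) \<le> (\<Sum>x\<in>F. M * (1 / real K) ^ H x)"
          using F t by (intro sum_mono) auto
        also have "\<dots> = M * (\<Sum>x\<in>F. (1 / real K) ^ H x)" by (simp add: sum_distrib_left)
        also have "\<dots> \<le> M * 2" using geometric_sum_bound[of F] F M(1) unfolding K_def by (intro mult_left_mono) auto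
        finally show "(\<Sum>x\<in>F. norm (c x * \<xi> x)) \<le> M * 2" .
      qed
    qed simp
  qed
next
  assume s: "\<forall>\<xi>\<in>points Q. (\<lambda>x. norm (c x * \<xi> x)) summable_on Q"
  show "growth Q H c"
  proof (rule growthI[OF supp])
    fix R :: nat
    let ?x = "\<lambda>x. complex_of_real (real R ^ H x)"
    \<comment> \<open>Additivity of the height makes \<open>x\<close> to R^(H x) a monoid
      homomorphism, hence a point to evaluate at.\<close>
    have "?x \<in> points Q" by (auto simp: points_def H_zero H_add power_add)
    from bspec[OF s this] have S: "(\<lambda>x. norm (c x * ?x x)) summable_on Q" .
    have "norm (c x) * real R ^ H x \<le> infsum (\<lambda>x. norm (c x * ?x x)) Q" if x: "x \<in> Q" for x
    proof -
      have "(\<Sum>x\<in>{x}. norm (c x * ?x x)) \<le> infsum (\<lambda>x. norm (c x * ?x x)) Q"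
        by (rule finite_sum_le_infsum[OF S]) (use x in auto)
      then show ?thesis by (simp add: norm_mult norm_power)
    qed
    then show "\<exists>M. \<forall>x\<in>Q. norm (c x) * real R ^ H x \<le> M" by blast
  qed
qed

end

section \<open>The rings of the family as rings of series\<close>

context toric begin

sublocale expo_monoid Q ht Qgen by unfold_locales

lemma zmon_eq: "zmon = mono1"
  by (simp add: zmon_def mono1_def fun_eq_iff)

lemma total_ring_eq: "total_ring G = R"
proof -
  have "{c. (\<forall>x. x \<notin> Q \<longrightarrow> c x = 0) \<and> (\<forall>\<xi>\<in>points Q. (\<lambda>x. norm (c x * \<xi> x)) summable_on Q)} = {c. growth Q ht c}"
  proof (rule Collect_cong)
    fix c :: "'n expo \<Rightarrow> complex"
    show "((\<forall>x. x \<notin> Q \<longrightarrow> c x = 0) \<and> (\<forall>\<xi>\<in>points Q. (\<lambda>x. norm (c x * \<xi> x)) summable_on Q)) = growth Q ht c"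
    proof (cases "\<forall>x. x \<notin> Q \<longrightarrow> c x = 0")
      case True
      then have e: "growth Q ht c \<longleftrightarrow> (\<forall>\<xi>\<in>points Q. (\<lambda>x. norm (c x * \<xi> x)) summable_on Q)"
        by (intro growth_iff_summable) blast
      show ?thesis unfolding e using True by (intro iffI conjI) (elim conjE, assumption+)
    next
      case False
      then have "\<not> growth Q ht c" using growth_out by metis
      with False show ?thesis by (intro iffI) (elim conjE, iprover+)
    qed
  qed
  then show ?thesis unfolding total_ring_def series_ring_def conv_def zmon_eq by simp
qed

lemma base_ring_eq: "base_ring G = base"
  unfolding base_ring_def base_def total_ring_eq by simp

lemma max_ideal_eq: "max_ideal G = power_ideal 1"
proof -
  have "({zmon (0, p, 0) | p. p \<in> NE G - {0}} \<union> {zmon (texp i) | i. i \<in> {1..sdim G}}) = mono1 ` Bgens0"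
    unfolding Bgens0_def zmon_eq by (simp only: image_Un image_image setcompr_eq_image Collect_mem_eq)
  then show ?thesis unfolding max_ideal_def base_ring_eq by (simp only: genideal_power_ideal)
qed

lemma ideal_k_eq: "ideal_k G k = power_ideal (Suc k)"
  unfolding ideal_k_def max_ideal_eq base_ring_eq by (rule ideal_pow_power_ideal)

lemma extended_ideal_eq: "extended_ideal_k G k = ext_ideal (Suc k)"
  unfolding extended_ideal_k_def total_ring_eq ideal_k_eq by (rule genideal_ext_ideal)

lemma fun_k_eq: "fun_k G k = R Quot ext_ideal (Suc k)"
  by (simp add: fun_k_def total_ring_eq extended_ideal_eq)

lemma base_k_eq: "base_k G k = base Quot power_ideal (Suc k)"
  by (simp add: base_k_def base_ring_eq ideal_k_eq)

lemma cring_fun_k: "cring (fun_k G k)"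
  unfolding fun_k_eq by (rule ideal.quotient_is_cring[OF ideal_ext_ideal cring_R])

lemma cring_base_k: "cring (base_k G k)"
  unfolding base_k_eq by (rule ideal.quotient_is_cring[OF ideal_power_ideal cring_base])

definition fun_class :: "nat \<Rightarrow> ('n expo \<Rightarrow> complex) \<Rightarrow> ('n expo \<Rightarrow> complex) set" where
  "fun_class k c = ext_ideal (Suc k) +>\<^bsub>R\<^esub> c"

definition base_class :: "nat \<Rightarrow> ('n expo \<Rightarrow> complex) \<Rightarrow> ('n expo \<Rightarrow> complex) set" where
  "base_class k c = power_ideal (Suc k) +>\<^bsub>base\<^esub> c"

lemma fun_class_hom: "fun_class k \<in> ring_hom R (fun_k G k)"
  unfolding fun_k_eq using ideal.rcos_ring_hom[OF ideal_ext_ideal] by (simp add: fun_class_def[abs_def])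

lemma base_class_hom: "base_class k \<in> ring_hom base (base_k G k)"
  unfolding base_k_eq using ideal.rcos_ring_hom[OF ideal_power_ideal] by (simp add: base_class_def[abs_def])

lemma fun_k_carrier: "carrier (fun_k G k) = fun_class k ` {c. growth Q ht c}"
  unfolding fun_k_eq FactRing_def A_RCOSETS_def' by (auto simp: fun_class_def[abs_def] R_ops)

lemma base_k_carrier: "carrier (base_k G k) = base_class k ` carrier base"
  unfolding base_k_eq FactRing_def A_RCOSETS_def' by (auto simp: base_class_def[abs_def])

text \<open>The extended ideal consists of all convergent series supported on \<open>ext\<close>, so
  a coset is a prescription of the coefficients at the surviving exponents. Computations in the
  quotient can be made there.\<close>

lemma fun_class_mem:
  assumes c: "growth Q ht c"
  shows "d \<in> fun_class k c \<longleftrightarrow> growth Q ht d \<and> (\<forall>x\<in>Q - ext (Suc k). d x = c x)"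
proof -
  interpret R: cring R by (rule cring_R)
  interpret E: ideal "ext_ideal (Suc k)" R by (rule ideal_ext_ideal)
  interpret E: abelian_subgroup "ext_ideal (Suc k)" R
    by (rule abelian_subgroupI3) (rule E.additive_subgroup_axioms, rule R.abelian_group_axioms)
  have cR: "c \<in> carrier R" using c by (simp add: R_ops)
  have m: "d \<in> fun_class k c \<longleftrightarrow> (\<lambda>x. d x + - c x) \<in> ext_ideal (Suc k)" if d: "d \<in> carrier R"
    unfolding fun_class_def using E.a_rcos_module[OF cR d] by (simp add: a_inv_R[OF cR] R_ops)
  have e: "(\<lambda>x. d x + - c x) \<in> ext_ideal (Suc k) \<longleftrightarrow> (\<forall>x\<in>Q - ext (Suc k). d x = c x)" if d: "growth Q ht d"
  proof -
    have "growth Q ht (\<lambda>x. d x + - c x)" by (intro growth_add growth_uminus c d)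
    moreover have "d x = c x" if "x \<notin> Q" for x using that growth_out[OF c] growth_out[OF d] by simp
    ultimately show ?thesis by (auto simp: ext_ideal_def)
  qed
  have "d \<in> carrier R" if "d \<in> fun_class k c"
    using that E.a_elemrcos_carrier[OF cR] unfolding fun_class_def by blast
  then show ?thesis using m e by (auto simp: R_ops)
qed

lemma fun_class_eq_iff:
  assumes c: "growth Q ht c" and d: "growth Q ht d"
  shows "fun_class k c = fun_class k d \<longleftrightarrow> (\<forall>x\<in>Q - ext (Suc k). c x = d x)"
proof
  assume "fun_class k c = fun_class k d"
  then have "c \<in> fun_class k d" using fun_class_mem[OF c, of c k] c by auto
  then show "\<forall>x\<in>Q - ext (Suc k). c x = d x" using fun_class_mem[OF d] by blast
next
  assume e: "\<forall>x\<in>Q - ext (Suc k). c x = d x"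
  show "fun_class k c = fun_class k d"
  proof (rule Set.set_eqI)
    fix a show "a \<in> fun_class k c \<longleftrightarrow> a \<in> fun_class k d" using e unfolding fun_class_mem[OF c] fun_class_mem[OF d] by auto
  qed
qed

lemma base_class_eq_zero:
  assumes c: "c \<in> carrier base"
  shows "base_class k c = \<zero>\<^bsub>base_k G k\<^esub> \<longleftrightarrow> (\<forall>x\<in>Bs - power_expos (Suc k). c x = 0)"
proof -
  interpret B: cring base by (rule cring_base)
  interpret E: ideal "power_ideal (Suc k)" base by (rule ideal_power_ideal)
  have z: "\<zero>\<^bsub>base_k G k\<^esub> = power_ideal (Suc k)" by (simp add: base_k_eq FactRing_def)
  have "base_class k c = power_ideal (Suc k) \<longleftrightarrow> c \<in> power_ideal (Suc k)"
  proof
    assume "base_class k c = power_ideal (Suc k)"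
    then show "c \<in> power_ideal (Suc k)" using E.a_rcos_self[OF c] by (simp add: base_class_def)
  qed (simp add: base_class_def E.a_rcos_const)
  moreover have "c \<in> power_ideal (Suc k) \<longleftrightarrow> (\<forall>x\<in>Bs - power_expos (Suc k). c x = 0)"
    using c by (auto simp: power_ideal_def base_carrier)
  ultimately show ?thesis by (simp add: z)
qed

lemma base_growth: "c \<in> carrier base \<Longrightarrow> growth Q ht c"
  using base_sub_R by (auto simp: R_ops)

lemma base_class_mem:
  assumes c: "c \<in> carrier base" and d: "d \<in> base_class k c"
  shows "d \<in> carrier base" "\<And>x. x \<notin> power_expos (Suc k) \<Longrightarrow> d x = c x"
proof -
  interpret B: cring base by (rule cring_base)
  interpret E: ideal "power_ideal (Suc k)" base by (rule ideal_power_ideal)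
  interpret E: abelian_subgroup "power_ideal (Suc k)" base
    by (rule abelian_subgroupI3) (rule E.additive_subgroup_axioms, rule B.abelian_group_axioms)
  show dB: "d \<in> carrier base" using E.a_elemrcos_carrier[OF c] d unfolding base_class_def by blast
  have "(\<lambda>x. d x + - c x) \<in> power_ideal (Suc k)"
    using E.a_rcos_module[OF c dB] d by (simp add: base_class_def a_inv_base[OF c] base_ops)
  then show "d x = c x" if "x \<notin> power_expos (Suc k)" for x using that by (auto simp: power_ideal_def)
qed

text \<open>Representatives of one base class differ only on \<open>power_expos\<close>, which is
  contained in \<open>ext\<close>, so all cosets in the union coincide.\<close>

lemma base_to_fun_base_class:
  assumes c: "c \<in> carrier base" shows "base_to_fun G k (base_class k c) = fun_class k c"
proof -
  interpret B: cring base by (rule cring_base)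
  interpret E: ideal "power_ideal (Suc k)" base by (rule ideal_power_ideal)
  have e: "fun_class k d = fun_class k c" if d: "d \<in> base_class k c" for d
  proof -
    have "d x = c x" if x: "x \<in> Q - ext (Suc k)" for x
    proof (rule base_class_mem(2)[OF c d])
      show "x \<notin> power_expos (Suc k)" using x subsetD[OF power_expos_ext] by blast
    qed
    then show ?thesis using fun_class_eq_iff[OF base_growth[OF base_class_mem(1)[OF c d]] base_growth[OF c]] by blast
  qed
  have "c \<in> base_class k c" unfolding base_class_def by (rule E.a_rcos_self[OF c])
  then show ?thesis unfolding base_to_fun_def total_ring_eq extended_ideal_eq fun_class_def[symmetric]
    using e by blast
qed

lemma base_to_fun_hom: "base_to_fun G k \<in> ring_hom (base_k G k) (fun_k G k)"
proof (rule ring_hom_memI)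
  interpret b: ring_hom_cring base "base_k G k" "base_class k"
    by (intro ring_hom_cring.intro ring_hom_cring_axioms.intro cring_base cring_base_k base_class_hom)
  interpret f: ring_hom_cring R "fun_k G k" "fun_class k"
    by (intro ring_hom_cring.intro ring_hom_cring_axioms.intro cring_R cring_fun_k fun_class_hom)
  have bR: "c \<in> carrier R" if "c \<in> carrier base" for c using that base_sub_R by blast
  fix x assume "x \<in> carrier (base_k G k)"
  then obtain c where c: "c \<in> carrier base" "x = base_class k c" by (auto simp: base_k_carrier)
  show "base_to_fun G k x \<in> carrier (fun_k G k)" using c bR by (simp add: base_to_fun_base_class)
  fix y assume "y \<in> carrier (base_k G k)"
  then obtain d where d: "d \<in> carrier base" "y = base_class k d" by (auto simp: base_k_carrier)
  have m: "c \<otimes>\<^bsub>base\<^esub> d = c \<otimes>\<^bsub>R\<^esub> d" "c \<oplus>\<^bsub>base\<^esub> d = c \<oplus>\<^bsub>R\<^esub> d" by (simp_all add: base_ops R_ops)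
  have "x \<otimes>\<^bsub>base_k G k\<^esub> y = base_class k (c \<otimes>\<^bsub>base\<^esub> d)" using c d by simp
  then show "base_to_fun G k (x \<otimes>\<^bsub>base_k G k\<^esub> y) = base_to_fun G k x \<otimes>\<^bsub>fun_k G k\<^esub> base_to_fun G k y"
    using c d bR base_to_fun_base_class[of "c \<otimes>\<^bsub>base\<^esub> d" k] by (simp add: base_to_fun_base_class) (simp add: m bR)
  have "x \<oplus>\<^bsub>base_k G k\<^esub> y = base_class k (c \<oplus>\<^bsub>base\<^esub> d)" using c d by simp
  then show "base_to_fun G k (x \<oplus>\<^bsub>base_k G k\<^esub> y) = base_to_fun G k x \<oplus>\<^bsub>fun_k G k\<^esub> base_to_fun G k y"
    using c d bR base_to_fun_base_class[of "c \<oplus>\<^bsub>base\<^esub> d" k] by (simp add: base_to_fun_base_class) (simp add: m bR)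
next
  interpret b: ring_hom_cring base "base_k G k" "base_class k"
    by (intro ring_hom_cring.intro ring_hom_cring_axioms.intro cring_base cring_base_k base_class_hom)
  interpret f: ring_hom_cring R "fun_k G k" "fun_class k"
    by (intro ring_hom_cring.intro ring_hom_cring_axioms.intro cring_R cring_fun_k fun_class_hom)
  have "\<one>\<^bsub>base_k G k\<^esub> = base_class k \<one>\<^bsub>base\<^esub>" by simp
  moreover have "\<one>\<^bsub>base\<^esub> = \<one>\<^bsub>R\<^esub>" by (simp add: base_ops R_ops)
  moreover have "fun_class k \<one>\<^bsub>R\<^esub> = \<one>\<^bsub>fun_k G k\<^esub>" by simp
  moreover have "base_to_fun G k (base_class k \<one>\<^bsub>base\<^esub>) = fun_class k \<one>\<^bsub>base\<^esub>"
    by (rule base_to_fun_base_class[OF cring.cring_simprules(6)[OF cring_base]])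
  ultimately show "base_to_fun G k \<one>\<^bsub>base_k G k\<^esub> = \<one>\<^bsub>fun_k G k\<^esub>" by (simp only:)
qed

lemma log_deriv_eq: "log_deriv G i c = (\<lambda>x. of_int (dlog_coeff i x) * c x)"
  by (auto simp: log_deriv_def dlog_coeff_def fun_eq_iff)

lemma one_ne_zero: "\<one>\<^bsub>base_k_u G k\<^esub> \<noteq> \<zero>\<^bsub>base_k_u G k\<^esub>"
proof
  interpret b: ring_hom_cring base "base_k G k" "base_class k"
    by (intro ring_hom_cring.intro ring_hom_cring_axioms.intro cring_base cring_base_k base_class_hom)
  assume "\<one>\<^bsub>base_k_u G k\<^esub> = \<zero>\<^bsub>base_k_u G k\<^esub>"
  then have "\<one>\<^bsub>base_k_u G k\<^esub> 0 = \<zero>\<^bsub>base_k_u G k\<^esub> 0" by simp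
  then have "base_class k \<one>\<^bsub>base\<^esub> = \<zero>\<^bsub>base_k G k\<^esub>" by (simp add: ps_simps)
  then have "\<one>\<^bsub>base\<^esub> 0 = 0" using base_class_eq_zero[of "\<one>\<^bsub>base\<^esub>" k] Bs_zero zero_notin_power_expos[of k] by auto
  then show False by (simp add: base_ops mono1_def)
qed

end

section \<open>Forms over the truncated base, represented by series\<close>

locale toric_k = toric G for G :: "('n::finite) lg_data" + fixes k :: nat
begin

sublocale kz: koszul_data Q ht Qgen "ext (Suc k)" nn \<Lambda> term_expo dlog_coeff rk cone alpha dual_coord "rank_bound k" coord_bound
  by (rule koszul)

abbreviation Fk where "Fk \<equiv> fun_k G k"

lemma hom_fun_class: "ring_hom_cring R Fk (fun_class k)"
  by (intro ring_hom_cring.intro ring_hom_cring_axioms.intro cring_R cring_fun_k fun_class_hom)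

lemma fun_class_closed: "growth Q ht c \<Longrightarrow> fun_class k c \<in> carrier Fk"
  by (auto simp: fun_k_carrier)

lemma fun_class_add: "growth Q ht c \<Longrightarrow> growth Q ht d \<Longrightarrow> fun_class k c \<oplus>\<^bsub>Fk\<^esub> fun_class k d = fun_class k (\<lambda>x. c x + d x)"
  using ring_hom_add[OF fun_class_hom, of c d k] by (simp add: R_ops)

lemma fun_class_mult: "growth Q ht c \<Longrightarrow> growth Q ht d \<Longrightarrow> fun_class k c \<otimes>\<^bsub>Fk\<^esub> fun_class k d = fun_class k (conv Q c d)"
  using ring_hom_mult[OF fun_class_hom, of c d k] by (simp add: R_ops)

lemma fun_class_zero: "\<zero>\<^bsub>Fk\<^esub> = fun_class k (\<lambda>x. 0)"
  using ring_hom_cring.hom_zero[OF hom_fun_class] by (simp add: R_ops)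

lemma fun_class_neg: "growth Q ht c \<Longrightarrow> \<ominus>\<^bsub>Fk\<^esub> fun_class k c = fun_class k (\<lambda>x. - c x)"
  using ring_hom_cring.hom_a_inv[OF hom_fun_class, of c] a_inv_R[of c] by (simp add: R_ops)

lemma fun_class_finsum:
  assumes "finite I" "\<And>i. i \<in> I \<Longrightarrow> growth Q ht (f i)"
  shows "(\<Oplus>\<^bsub>Fk\<^esub>i\<in>I. fun_class k (f i)) = fun_class k (\<lambda>x. \<Sum>i\<in>I. f i x)"
proof -
  interpret Fk: cring Fk by (rule cring_fun_k)
  show ?thesis using assms
  proof (induction I rule: finite_induct)
    case (insert i I)
    have "(\<lambda>i. fun_class k (f i)) \<in> I \<rightarrow> carrier Fk" "fun_class k (f i) \<in> carrier Fk" using insert fun_class_closed by auto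
    then show ?case using insert by (simp add: fun_class_add growth_sum)
  qed (simp add: fun_class_zero)
qed

definition form_of :: "(nat \<Rightarrow> nat set \<Rightarrow> 'n expo \<Rightarrow> complex) \<Rightarrow> 'n form" where
  "form_of w = (\<lambda>j. \<lambda>K\<in>Pow {1..nn}. fun_class k (w j K))"

lemma forms_eq: "forms G k =
     \<lparr>carrier = UNIV \<rightarrow> (Pow {1..nn} \<rightarrow>\<^sub>E carrier Fk),
      mult = undefined, one = undefined,
      zero = (\<lambda>j. \<lambda>K\<in>Pow {1..nn}. \<zero>\<^bsub>Fk\<^esub>),
      add = (\<lambda>\<omega> \<eta> j. \<lambda>K\<in>Pow {1..nn}. \<omega> j K \<oplus>\<^bsub>Fk\<^esub> \<eta> j K),
      smult = (\<lambda>c \<omega> j. \<lambda>K\<in>Pow {1..nn}.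
        \<Oplus>\<^bsub>Fk\<^esub>i\<in>{..j}. base_to_fun G k (c i) \<otimes>\<^bsub>Fk\<^esub> \<omega> (j - i) K)\<rparr>"
  by (simp only: forms_def nn_def)

lemma module_forms: "Module.module (base_k_u G k) (forms G k)"
  unfolding forms_eq by (rule module_ps_forms[OF cring_base_k cring_fun_k base_to_fun_hom])

lemma is_form_growth: "kz.is_form w \<Longrightarrow> K \<subseteq> {1..nn} \<Longrightarrow> growth Q ht (w j K)"
  by (simp only: kz.is_form_def)

lemma form_of_carrier: "kz.is_form w \<Longrightarrow> form_of w \<in> carrier (forms G k)"
  using is_form_growth fun_class_closed by (auto simp: forms_eq form_of_def)

lemma form_of_surj:
  assumes "\<omega> \<in> carrier (forms G k)"
  obtains w where "kz.is_form w" "\<omega> = form_of w"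
proof -
  define w where "w j K = (SOME c. growth Q ht c \<and> \<omega> j K = fun_class k c)" for j K
  have w: "growth Q ht (w j K) \<and> \<omega> j K = fun_class k (w j K)" if K: "K \<subseteq> {1..nn}" for j K
  proof -
    have "\<omega> j K \<in> carrier Fk" using assms K by (auto simp: forms_eq Pi_def PiE_def)
    then have "\<exists>c. growth Q ht c \<and> \<omega> j K = fun_class k c" by (auto simp: fun_k_carrier)
    then show ?thesis unfolding w_def by (rule someI_ex)
  qed
  have "\<omega> j = form_of w j" for j
  proof (rule extensionalityI[of _ "Pow {1..nn}"])
    show "\<omega> j \<in> extensional (Pow {1..nn})" using assms by (auto simp: forms_eq Pi_def PiE_def)
    show "form_of w j \<in> extensional (Pow {1..nn})" by (simp add: form_of_def)
    show "\<omega> j K = form_of w j K" if "K \<in> Pow {1..nn}" for K using w that by (simp add: form_of_def)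
  qed
  then show thesis using that[of w] w by (auto simp: kz.is_form_def)
qed

lemma form_of_eq_iff:
  assumes w: "kz.is_form w" and v: "kz.is_form v"
  shows "form_of w = form_of v \<longleftrightarrow> (\<forall>j K x. K \<subseteq> {1..nn} \<longrightarrow> x \<in> Q - ext (Suc k) \<longrightarrow> w j K x = v j K x)"
proof
  assume e: "form_of w = form_of v"
  show "\<forall>j K x. K \<subseteq> {1..nn} \<longrightarrow> x \<in> Q - ext (Suc k) \<longrightarrow> w j K x = v j K x"
  proof (intro allI impI)
    fix j K x assume K: "K \<subseteq> {1..nn}" and x: "x \<in> Q - ext (Suc k)"
    have "form_of w j K = form_of v j K" using e by simp
    then have "fun_class k (w j K) = fun_class k (v j K)" using K by (simp add: form_of_def)
    then show "w j K x = v j K x" using fun_class_eq_iff[OF is_form_growth[OF w K] is_form_growth[OF v K]] x by blast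
  qed
next
  assume e: "\<forall>j K x. K \<subseteq> {1..nn} \<longrightarrow> x \<in> Q - ext (Suc k) \<longrightarrow> w j K x = v j K x"
  have "fun_class k (w j K) = fun_class k (v j K)" if K: "K \<subseteq> {1..nn}" for j K
    using fun_class_eq_iff[OF is_form_growth[OF w K] is_form_growth[OF v K]] e K by blast
  then show "form_of w = form_of v" unfolding form_of_def by (intro ext restrict_ext) auto
qed

lemma is_form_add: "kz.is_form w \<Longrightarrow> kz.is_form v \<Longrightarrow> kz.is_form (\<lambda>j K x. w j K x + v j K x)"
  unfolding kz.is_form_def using growth_add by blast

lemma form_of_add: "kz.is_form w \<Longrightarrow> kz.is_form v \<Longrightarrow> form_of w \<oplus>\<^bsub>forms G k\<^esub> form_of v = form_of (\<lambda>j K x. w j K x + v j K x)"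
  using is_form_growth by (auto simp: forms_eq form_of_def fun_eq_iff fun_class_add)

lemma form_of_zero: "\<zero>\<^bsub>forms G k\<^esub> = form_of (\<lambda>j K x. 0)"
  by (simp add: forms_eq form_of_def fun_class_zero)

lemma is_form_zero: "kz.is_form (\<lambda>j K x. 0)"
  by (simp add: kz.is_form_def growth_zero)

lemma is_form_sum: "(\<And>i. i \<in> I \<Longrightarrow> kz.is_form (f i)) \<Longrightarrow> kz.is_form (\<lambda>j K x. \<Sum>i\<in>I. f i j K x)"
  unfolding kz.is_form_def by (intro allI impI growth_sum) blast

lemma form_of_finsum:
  assumes "finite I" "\<And>i. i \<in> I \<Longrightarrow> kz.is_form (f i)"
  shows "(\<Oplus>\<^bsub>forms G k\<^esub>i\<in>I. form_of (f i)) = form_of (\<lambda>j K x. \<Sum>i\<in>I. f i j K x)"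
proof -
  interpret M: module "base_k_u G k" "forms G k" by (rule module_forms)
  show ?thesis using assms
  proof (induction I rule: finite_induct)
    case (insert i I)
    have "(\<lambda>i. form_of (f i)) \<in> I \<rightarrow> carrier (forms G k)" "form_of (f i) \<in> carrier (forms G k)" using insert form_of_carrier by auto
    then show ?case using insert by (simp add: form_of_add is_form_sum)
  qed (simp add: form_of_zero)
qed

definition scalar_act :: "(nat \<Rightarrow> 'n expo \<Rightarrow> complex) \<Rightarrow> (nat \<Rightarrow> nat set \<Rightarrow> 'n expo \<Rightarrow> complex) \<Rightarrow> nat \<Rightarrow> nat set \<Rightarrow> 'n expo \<Rightarrow> complex" where
  "scalar_act \<gamma> w j K x = (\<Sum>i\<le>j. conv Q (\<gamma> i) (w (j - i) K) x)"

lemma scalar_rep: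
  assumes "c \<in> carrier (base_k_u G k)"
  obtains \<gamma> where "\<And>i. \<gamma> i \<in> carrier base" "c = (\<lambda>i. base_class k (\<gamma> i))"
proof -
  have "\<forall>i. \<exists>g. g \<in> carrier base \<and> c i = base_class k g" using assms by (auto simp: ps_simps base_k_carrier)
  then obtain \<gamma> where "\<forall>i. \<gamma> i \<in> carrier base \<and> c i = base_class k (\<gamma> i)" by metis
  then show thesis using that[of \<gamma>] by auto
qed

lemma scalar_mem: "(\<And>i. \<gamma> i \<in> carrier base) \<Longrightarrow> (\<lambda>i. base_class k (\<gamma> i)) \<in> carrier (base_k_u G k)"
  by (auto simp: ps_simps base_k_carrier)

lemma is_form_scalar_act:
  assumes "\<And>i. \<gamma> i \<in> carrier base" "kz.is_form w" shows "kz.is_form (scalar_act \<gamma> w)"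
  unfolding kz.is_form_def
proof (intro allI impI)
  fix j K assume K: "K \<subseteq> {1..nn}"
  have "growth Q ht (\<lambda>x. \<Sum>i\<le>j. conv Q (\<gamma> i) (w (j - i) K) x)"
    by (intro growth_sum growth_conv base_growth assms is_form_growth[OF assms(2) K])
  then show "growth Q ht (scalar_act \<gamma> w j K)" by (simp only: scalar_act_def[abs_def])
qed

lemma form_of_smult:
  assumes g: "\<And>i. \<gamma> i \<in> carrier base" and w: "kz.is_form w"
  shows "(\<lambda>i. base_class k (\<gamma> i)) \<odot>\<^bsub>forms G k\<^esub> form_of w = form_of (scalar_act \<gamma> w)"
proof -
  have "(\<Oplus>\<^bsub>Fk\<^esub>i\<in>{..j}. base_to_fun G k (base_class k (\<gamma> i)) \<otimes>\<^bsub>Fk\<^esub> fun_class k (w (j - i) K)) = fun_class k (scalar_act \<gamma> w j K)"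
    if K: "K \<subseteq> {1..nn}" for j K
  proof -
    interpret Fk: cring Fk by (rule cring_fun_k)
    have gr: "growth Q ht (conv Q (\<gamma> i) (w (j - i) K))" for i
      by (intro growth_conv base_growth g is_form_growth[OF w K])
    have "(\<Oplus>\<^bsub>Fk\<^esub>i\<in>{..j}. base_to_fun G k (base_class k (\<gamma> i)) \<otimes>\<^bsub>Fk\<^esub> fun_class k (w (j - i) K)) = (\<Oplus>\<^bsub>Fk\<^esub>i\<in>{..j}. fun_class k (conv Q (\<gamma> i) (w (j - i) K)))"
      by (simp only: base_to_fun_base_class[OF g] fun_class_mult[OF base_growth[OF g] is_form_growth[OF w K]])
    also have "\<dots> = fun_class k (\<lambda>x. \<Sum>i\<in>{..j}. conv Q (\<gamma> i) (w (j - i) K) x)" by (rule fun_class_finsum) (auto intro: gr)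
    finally show ?thesis by (simp only: scalar_act_def[abs_def])
  qed
  then show ?thesis by (auto simp: forms_eq form_of_def fun_eq_iff)
qed

lemma F_sum: "unfolding_F G = (\<lambda>x. \<Sum>l\<in>\<Lambda>. mono1 (term_expo l) x)"
proof
  fix x
  let ?d = "nrays G" and ?s = "sdim G"
  have "(\<Sum>l\<in>\<Lambda>. mono1 (term_expo l) x) = (\<Sum>l\<in>{1..?d}. mono1 (term_expo l) x) + (\<Sum>l\<in>{?d + 1..?d + ?s}. mono1 (term_expo l) x)"
    unfolding \<Lambda>_def by (rule sum.ub_add_nat) simp
  also have "(\<Sum>l\<in>{1..?d}. mono1 (term_expo l) x) = (\<Sum>l\<in>{1..?d}. zmon (zexp G l) x)"
    by (rule sum.cong) (auto simp: term_expo_z zmon_eq)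
  also have "(\<Sum>l\<in>{?d + 1..?d + ?s}. mono1 (term_expo l) x) = (\<Sum>i\<in>{1..?s}. mono1 (term_expo (i + ?d)) x)"
    using sum.shift_bounds_cl_nat_ivl[of "\<lambda>l. mono1 (term_expo l) x" 1 ?d ?s] by (simp add: add.commute)
  \<comment> \<open>\<open>sdim G\<close> is at least 1 by its definition, so the term t_1 can be
    split off.\<close>
  also have "\<dots> = mono1 (term_expo (1 + ?d)) x + (\<Sum>i\<in>{2..?s}. mono1 (term_expo (i + ?d)) x)"
    using sum.atLeast_Suc_atMost[of 1 ?s "\<lambda>i. mono1 (term_expo (i + ?d)) x"] by (simp add: sdim_def numeral_2_eq_2)
  also have "mono1 (term_expo (1 + ?d)) x = zmon (texp 1) x" by (simp add: term_expo_def zmon_eq)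
  also have "(\<Sum>i\<in>{2..?s}. mono1 (term_expo (i + ?d)) x) = (\<Sum>i\<in>{2..?s}. zmon (texp i + phi_exp G (nu G + i - 1)) x)"
    by (rule sum.cong) (auto simp: term_expo_def zmon_eq)
  finally show "unfolding_F G x = (\<Sum>l\<in>\<Lambda>. mono1 (term_expo l) x)" by (simp add: unfolding_F_def)
qed

lemma growth_F: "growth Q ht (unfolding_F G)"
  unfolding F_sum by (intro growth_sum growth_mono1 term_expo_Q)

lemma F_k_eq: "F_k G k = fun_class k (unfolding_F G)"
  by (simp only: F_k_def extended_ideal_eq total_ring_eq fun_class_def)

lemma log_deriv_fun_class:
  assumes i: "i \<in> {1..nn}" and c: "growth Q ht c"
  shows "log_deriv_k G k i (fun_class k c) = fun_class k (\<lambda>x. of_int (dlog_coeff i x) * c x)"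
proof -
  have "fun_class k (log_deriv G i d) = fun_class k (\<lambda>x. of_int (dlog_coeff i x) * c x)" if d: "d \<in> fun_class k c" for d
  proof -
    have d': "growth Q ht d" "\<forall>x\<in>Q - ext (Suc k). d x = c x" using d fun_class_mem[OF c] by blast+
    show ?thesis unfolding log_deriv_eq
      using fun_class_eq_iff[OF kz.growth_dlog_coeff[OF i d'(1)] kz.growth_dlog_coeff[OF i c]] d'(2) by auto
  qed
  moreover have "c \<in> fun_class k c" using fun_class_mem[OF c, of c k] c by blast
  ultimately show ?thesis unfolding log_deriv_k_def total_ring_eq extended_ideal_eq fun_class_def[symmetric] by blast
qed

lemma conv_dF:
  assumes v: "growth Q ht v"
  shows "conv Q (\<lambda>x. of_int (dlog_coeff i x) * unfolding_F G x) v = (\<lambda>x. \<Sum>l\<in>\<Lambda>. kz.d i l * conv Q (mono1 (term_expo l)) v x)"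
proof -
  have "(\<lambda>x. of_int (dlog_coeff i x) * unfolding_F G x) = (\<lambda>x. \<Sum>l\<in>\<Lambda>. kz.d i l * mono1 (term_expo l) x)"
    unfolding F_sum sum_distrib_left by (intro ext sum.cong refl) (auto simp: mono1_def)
  then show ?thesis by (simp only: conv_sum_left conv_scale_left)
qed

lemma is_form_tpartial: "kz.is_form w \<Longrightarrow> i \<in> {1..nn} \<Longrightarrow> K \<subseteq> {1..nn} \<Longrightarrow> growth Q ht (kz.tpartial i (\<lambda>t. w t K) j)"
  using is_form_growth by (intro kz.growth_tpartial) auto

text \<open>Transfers the differential from cosets to representatives, which makes the exactness and
  independence results applicable.\<close>

lemma twisted_form_of:
  assumes w: "kz.is_form w" shows "twisted_d G k (form_of w) = form_of (kz.twisted_D w)"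
proof -
  interpret Fk: cring Fk by (rule cring_fun_k)
  have main: "(\<Oplus>\<^bsub>Fk\<^esub>i\<in>K. (let b = (log_deriv_k G k i (F_k G k) \<otimes>\<^bsub>Fk\<^esub> form_of w j (K - {i})) \<oplus>\<^bsub>Fk\<^esub>
              (if j = 0 then \<zero>\<^bsub>Fk\<^esub> else log_deriv_k G k i (form_of w (j - 1) (K - {i})))
      in if even (card {l\<in>K. l < i}) then b else \<ominus>\<^bsub>Fk\<^esub> b)) = fun_class k (kz.twisted_D w j K)"
    if K: "K \<subseteq> {1..nn}" for j K
  proof -
    have bterm: "(let b = (log_deriv_k G k i (F_k G k) \<otimes>\<^bsub>Fk\<^esub> form_of w j (K - {i})) \<oplus>\<^bsub>Fk\<^esub>
              (if j = 0 then \<zero>\<^bsub>Fk\<^esub> else log_deriv_k G k i (form_of w (j - 1) (K - {i})))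
      in if even (card {l\<in>K. l < i}) then b else \<ominus>\<^bsub>Fk\<^esub> b) = fun_class k (\<lambda>x. ksgn i K * kz.tpartial i (\<lambda>t. w t (K - {i})) j x)"
      if i: "i \<in> K" for i
    proof -
      let ?K = "K - {i}"
      have K': "?K \<subseteq> {1..nn}" and i': "i \<in> {1..nn}" using K i by auto
      have g: "growth Q ht (w t ?K)" for t by (rule is_form_growth[OF w K'])
      have gF: "growth Q ht (\<lambda>x. of_int (dlog_coeff i x) * unfolding_F G x)" by (rule kz.growth_dlog_coeff[OF i' growth_F])
      have fmK: "form_of w t ?K = fun_class k (w t ?K)" for t using K' by (simp add: form_of_def)
      have 1: "log_deriv_k G k i (F_k G k) \<otimes>\<^bsub>Fk\<^esub> form_of w j ?K = fun_class k (\<lambda>x. \<Sum>l\<in>\<Lambda>. kz.d i l * conv Q (mono1 (term_expo l)) (w j ?K) x)"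
        by (simp only: F_k_eq log_deriv_fun_class[OF i' growth_F] fmK fun_class_mult[OF gF g] conv_dF[OF g])
      have 2: "(if j = 0 then \<zero>\<^bsub>Fk\<^esub> else log_deriv_k G k i (form_of w (j - 1) ?K)) = fun_class k (\<lambda>x. if j = 0 then 0 else of_int (dlog_coeff i x) * w (j - 1) ?K x)"
        by (cases "j = 0") (simp_all add: fun_class_zero fmK log_deriv_fun_class[OF i' g])
      have g1: "growth Q ht (\<lambda>x. \<Sum>l\<in>\<Lambda>. kz.d i l * conv Q (mono1 (term_expo l)) (w j ?K) x)"
        by (intro growth_sum growth_scale growth_conv growth_mono1 term_expo_Q g)
      have g2: "growth Q ht (\<lambda>x. if j = 0 then 0 else of_int (dlog_coeff i x) * w (j - 1) ?K x)"
        using kz.growth_dlog_coeff[OF i' g] by (cases "j = 0") (auto simp: growth_zero)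
      have b: "(log_deriv_k G k i (F_k G k) \<otimes>\<^bsub>Fk\<^esub> form_of w j ?K) \<oplus>\<^bsub>Fk\<^esub>
              (if j = 0 then \<zero>\<^bsub>Fk\<^esub> else log_deriv_k G k i (form_of w (j - 1) ?K)) = fun_class k (kz.tpartial i (\<lambda>t. w t ?K) j)"
        unfolding 1 2 fun_class_add[OF g1 g2] by (simp only: kz.tpartial_def[abs_def])
      have gn: "growth Q ht (kz.tpartial i (\<lambda>t. w t ?K) j)" by (rule is_form_tpartial[OF w i' K'])
      show ?thesis unfolding b Let_def ksgn_def by (simp add: fun_class_neg[OF gn])
    qed
    have gr: "growth Q ht (\<lambda>x. ksgn i K * kz.tpartial i (\<lambda>t. w t (K - {i})) j x)" if "i \<in> K" for i
      by (intro growth_scale is_form_tpartial[OF w]) (use K that in auto)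
    have "(\<Oplus>\<^bsub>Fk\<^esub>i\<in>K. (let b = (log_deriv_k G k i (F_k G k) \<otimes>\<^bsub>Fk\<^esub> form_of w j (K - {i})) \<oplus>\<^bsub>Fk\<^esub>
              (if j = 0 then \<zero>\<^bsub>Fk\<^esub> else log_deriv_k G k i (form_of w (j - 1) (K - {i})))
      in if even (card {l\<in>K. l < i}) then b else \<ominus>\<^bsub>Fk\<^esub> b)) = (\<Oplus>\<^bsub>Fk\<^esub>i\<in>K. fun_class k (\<lambda>x. ksgn i K * kz.tpartial i (\<lambda>t. w t (K - {i})) j x))"
      by (rule Fk.finsum_cong'[OF refl]) (use bterm gr fun_class_closed in auto)
    also have "\<dots> = fun_class k (\<lambda>x. \<Sum>i\<in>K. ksgn i K * kz.tpartial i (\<lambda>t. w t (K - {i})) j x)"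
      by (rule fun_class_finsum) (use gr K finite_subset in auto)
    finally show ?thesis by (simp only: kz.twisted_D_def[abs_def])
  qed
  show ?thesis unfolding twisted_d_def nn_def[symmetric] form_of_def[of "kz.twisted_D w"]
    by (intro ext restrict_ext) (rule main, blast)
qed

lemma dlog_coeff_base: "y \<in> Bs \<Longrightarrow> i \<in> {1..nn} \<Longrightarrow> dlog_coeff i y = 0"
proof -
  assume y: "y \<in> Bs" and i: "i \<in> {1..nn}"
  have "fst y = 0" using y by (auto simp: base_monoid_def)
  then have "fst y = fst (0 :: 'n expo)" by simp
  then have "dlog_coeff i y = dlog_coeff i 0" by (simp only: dlog_coeff_def)
  then show ?thesis using kz.dlog_coeff_add[OF i, of 0 0] by simp
qed

text \<open>Base exponents have m = 0 and so are killed by the logarithmic derivations: the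
  differential is relative to the base.\<close>

lemma conv_dlog_coeff:
  assumes g: "\<gamma> \<in> carrier base" and i: "i \<in> {1..nn}"
  shows "conv Q \<gamma> (\<lambda>x. of_int (dlog_coeff i x) * v x) x = of_int (dlog_coeff i x) * conv Q \<gamma> v x"
  unfolding conv_fib sum_distrib_left
proof (intro sum.cong refl)
  fix p assume p: "p \<in> fib x"
  obtain y z where yz: "p = (y, z)" by (cases p)
  have "\<gamma> y * (of_int (dlog_coeff i z) * v z) = of_int (dlog_coeff i x) * (\<gamma> y * v z)"
  proof (cases "\<gamma> y = 0")
    case False
    then have "y \<in> Bs" using g by (auto simp: base_carrier)
    moreover have "x = y + z" using p by (simp add: yz fib_def)
    ultimately show ?thesis using kz.dlog_coeff_add[OF i] dlog_coeff_base[OF _ i] by simp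
  qed simp
  then show "(case p of (y, z) \<Rightarrow> \<gamma> y * (of_int (dlog_coeff i z) * v z)) = of_int (dlog_coeff i x) * (case p of (y, z) \<Rightarrow> \<gamma> y * v z)"
    by (simp add: yz)
qed

lemma conv_add_right: "conv Q c (\<lambda>x. d x + e x) = (\<lambda>x. conv Q c d x + conv Q c e x)"
  by (simp add: conv_comm[of c] conv_add_left)

lemma conv_scale_right: "conv Q c (\<lambda>x. a * d x) = (\<lambda>x. a * conv Q c d x)"
  by (simp add: conv_comm[of c] conv_scale_left)

lemma conv_sum_right: "conv Q c (\<lambda>x. \<Sum>i\<in>I. d i x) = (\<lambda>x. \<Sum>i\<in>I. conv Q c (d i) x)"
  by (simp add: conv_comm[of c] conv_sum_left)

lemma conv_zero_right: "conv Q c (\<lambda>x. 0) = (\<lambda>x. 0)"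
  by (simp add: conv_comm[of c] conv_zero_left)

lemma tpartial_scalar_act:
  assumes g: "\<And>i. \<gamma> i \<in> carrier base" and i: "i \<in> {1..nn}"
  shows "kz.tpartial i (\<lambda>t. scalar_act \<gamma> w t K) j x = (\<Sum>t\<le>j. conv Q (\<gamma> t) (kz.tpartial i (\<lambda>t. w t K) (j - t)) x)"
proof -
  let ?s = "\<lambda>l v. conv Q (mono1 (term_expo l)) v"
  have sw: "?s l (conv Q c v) = conv Q c (?s l v)" for l c v by (metis conv_assoc conv_comm)
  have 1: "?s l (scalar_act \<gamma> w j K) x = (\<Sum>t\<le>j. conv Q (\<gamma> t) (?s l (w (j - t) K)) x)" for l
    unfolding scalar_act_def[abs_def] by (simp only: conv_sum_right sw)
  have "(\<Sum>l\<in>\<Lambda>. kz.d i l * ?s l (scalar_act \<gamma> w j K) x) = (\<Sum>l\<in>\<Lambda>. \<Sum>t\<le>j. kz.d i l * conv Q (\<gamma> t) (?s l (w (j - t) K)) x)"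
    by (simp only: 1 sum_distrib_left)
  also have "\<dots> = (\<Sum>t\<le>j. \<Sum>l\<in>\<Lambda>. kz.d i l * conv Q (\<gamma> t) (?s l (w (j - t) K)) x)" by (rule sum.swap)
  also have "\<dots> = (\<Sum>t\<le>j. conv Q (\<gamma> t) (\<lambda>x. \<Sum>l\<in>\<Lambda>. kz.d i l * ?s l (w (j - t) K) x) x)"
    by (simp only: conv_sum_right conv_scale_right)
  finally have a: "(\<Sum>l\<in>\<Lambda>. kz.d i l * ?s l (scalar_act \<gamma> w j K) x) = (\<Sum>t\<le>j. conv Q (\<gamma> t) (\<lambda>x. \<Sum>l\<in>\<Lambda>. kz.d i l * ?s l (w (j - t) K) x) x)" .
  \<comment> \<open>The summand t = j would differentiate a coefficient below u^0 and is 0, so the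
    Cauchy sum effectively stops at j - 1.\<close>
  have b: "(if j = 0 then 0 else of_int (dlog_coeff i x) * scalar_act \<gamma> w (j - 1) K x) =
    (\<Sum>t\<le>j. conv Q (\<gamma> t) (\<lambda>x. if j - t = 0 then 0 else of_int (dlog_coeff i x) * w (j - t - 1) K x) x)"
  proof (cases j)
    case 0
    then show ?thesis by (simp add: conv_zero_right)
  next
    case (Suc m)
    have "(\<Sum>t\<le>Suc m. conv Q (\<gamma> t) (\<lambda>x. if Suc m - t = 0 then 0 else of_int (dlog_coeff i x) * w (Suc m - t - 1) K x) x)
      = (\<Sum>t\<le>m. conv Q (\<gamma> t) (\<lambda>x. if Suc m - t = 0 then 0 else of_int (dlog_coeff i x) * w (Suc m - t - 1) K x) x)"
      by (simp add: conv_zero_right)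
    also have "\<dots> = (\<Sum>t\<le>m. of_int (dlog_coeff i x) * conv Q (\<gamma> t) (w (m - t) K) x)"
    proof (rule sum.cong[OF refl])
      fix t assume "t \<in> {..m}"
      then have e: "Suc m - t \<noteq> 0" "Suc m - t - 1 = m - t" by auto
      show "conv Q (\<gamma> t) (\<lambda>x. if Suc m - t = 0 then 0 else of_int (dlog_coeff i x) * w (Suc m - t - 1) K x) x = of_int (dlog_coeff i x) * conv Q (\<gamma> t) (w (m - t) K) x"
        using e(1) unfolding e(2) by (simp only: if_False conv_dlog_coeff[OF g i])
    qed
    finally show ?thesis using Suc by (simp add: scalar_act_def sum_distrib_left)
  qed
  have "kz.tpartial i (\<lambda>t. scalar_act \<gamma> w t K) j x = (\<Sum>t\<le>j. conv Q (\<gamma> t) (\<lambda>x. (\<Sum>l\<in>\<Lambda>. kz.d i l * ?s l (w (j - t) K) x) +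
     (if j - t = 0 then 0 else of_int (dlog_coeff i x) * w (j - t - 1) K x)) x)"
    unfolding kz.tpartial_def a b by (simp only: conv_add_right sum.distrib)
  then show ?thesis by (simp only: kz.tpartial_def[abs_def])
qed

lemma twisted_D_scalar_act:
  assumes g: "\<And>i. \<gamma> i \<in> carrier base" and K: "K \<subseteq> {1..nn}"
  shows "kz.twisted_D (scalar_act \<gamma> w) j K x = scalar_act \<gamma> (kz.twisted_D w) j K x"
proof -
  have "kz.twisted_D (scalar_act \<gamma> w) j K x = (\<Sum>i\<in>K. \<Sum>t\<le>j. ksgn i K * conv Q (\<gamma> t) (kz.tpartial i (\<lambda>t. w t (K - {i})) (j - t)) x)"
    unfolding kz.twisted_D_def
  proof (rule sum.cong[OF refl])
    fix i assume "i \<in> K"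
    then have i: "i \<in> {1..nn}" using K by blast
    show "ksgn i K * kz.tpartial i (\<lambda>t. scalar_act \<gamma> w t (K - {i})) j x = (\<Sum>t\<le>j. ksgn i K * conv Q (\<gamma> t) (kz.tpartial i (\<lambda>t. w t (K - {i})) (j - t)) x)"
      by (simp only: tpartial_scalar_act[OF g i] sum_distrib_left)
  qed
  also have "\<dots> = (\<Sum>t\<le>j. \<Sum>i\<in>K. ksgn i K * conv Q (\<gamma> t) (kz.tpartial i (\<lambda>t. w t (K - {i})) (j - t)) x)" by (rule sum.swap)
  also have "\<dots> = (\<Sum>t\<le>j. conv Q (\<gamma> t) (\<lambda>x. \<Sum>i\<in>K. ksgn i K * kz.tpartial i (\<lambda>t. w t (K - {i})) (j - t) x) x)"
    by (simp only: conv_sum_right conv_scale_right)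
  finally show ?thesis by (simp only: scalar_act_def kz.twisted_D_def[abs_def])
qed

sublocale E: module_endo "base_k_u G k" "forms G k" "twisted_d G k"
proof (intro module_endo.intro module_endo_axioms.intro module_forms)
  fix x assume "x \<in> carrier (forms G k)"
  then obtain w where w: "kz.is_form w" "x = form_of w" by (rule form_of_surj)
  show "twisted_d G k x \<in> carrier (forms G k)" unfolding w(2) twisted_form_of[OF w(1)] by (intro form_of_carrier kz.is_form_twisted_D w(1))
  fix y assume "y \<in> carrier (forms G k)"
  then obtain v where v: "kz.is_form v" "y = form_of v" by (rule form_of_surj)
  have "kz.twisted_D (\<lambda>j K x. w j K x + v j K x) = (\<lambda>j K x. kz.twisted_D w j K x + kz.twisted_D v j K x)"
  proof (intro ext)
    fix j K x
    \<comment> \<open>Additivity is recovered from compatibility with differences.\<close>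
    have "kz.twisted_D (\<lambda>j K x. w j K x + v j K x) j K x = kz.twisted_D (\<lambda>j K x. (w j K x + v j K x) - v j K x) j K x + kz.twisted_D v j K x"
      by (simp only: kz.twisted_D_diff diff_add_cancel)
    then show "kz.twisted_D (\<lambda>j K x. w j K x + v j K x) j K x = kz.twisted_D w j K x + kz.twisted_D v j K x" by simp
  qed
  then show "twisted_d G k (x \<oplus>\<^bsub>forms G k\<^esub> y) = twisted_d G k x \<oplus>\<^bsub>forms G k\<^esub> twisted_d G k y"
    by (simp only: w(2) v(2) form_of_add[OF w(1) v(1)] twisted_form_of[OF w(1)] twisted_form_of[OF v(1)]
        twisted_form_of[OF is_form_add[OF w(1) v(1)]] form_of_add[OF kz.is_form_twisted_D[OF w(1)] kz.is_form_twisted_D[OF v(1)]])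
next
  fix c x assume "c \<in> carrier (base_k_u G k)" "x \<in> carrier (forms G k)"
  obtain \<gamma> where g: "\<And>i. \<gamma> i \<in> carrier base" "c = (\<lambda>i. base_class k (\<gamma> i))"
    using \<open>c \<in> carrier (base_k_u G k)\<close> by (rule scalar_rep) blast
  obtain w where w: "kz.is_form w" "x = form_of w" using \<open>x \<in> carrier (forms G k)\<close> by (rule form_of_surj)
  have "form_of (kz.twisted_D (scalar_act \<gamma> w)) = form_of (scalar_act \<gamma> (kz.twisted_D w))"
    by (subst form_of_eq_iff) (use g w is_form_scalar_act kz.is_form_twisted_D twisted_D_scalar_act in auto)
  then show "twisted_d G k (c \<odot>\<^bsub>forms G k\<^esub> x) = c \<odot>\<^bsub>forms G k\<^esub> twisted_d G k x"
    by (simp only: g(2) w(2) form_of_smult[OF g(1) w(1)] twisted_form_of[OF w(1)] twisted_form_of[OF is_form_scalar_act[OF g(1) w(1)]]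
       form_of_smult[OF g(1) kz.is_form_twisted_D[OF w(1)]])
qed

end

section \<open>The basis given by the monomials of the cones \<open>\<tau>_i\<close>\<close>

context toric_k begin

definition tau_expo :: "nat \<Rightarrow> 'n expo" where "tau_expo i = (\<Sum>l\<in>tau_gens i. zexp G l)"

text \<open>The form P(\<tau>_i) dlog z_1 \<and> ... \<and> dlog z_n, constant in u.\<close>

definition basis_form :: "nat \<Rightarrow> nat \<Rightarrow> nat set \<Rightarrow> 'n expo \<Rightarrow> complex" where
  "basis_form i j K = (if j = 0 \<and> K = {1..nn} then mono1 (tau_expo i) else (\<lambda>x. 0))"

abbreviation S where "S \<equiv> Q - ext (Suc k)"

text \<open>All rays involved belong to \<sigma>_i, where the lift is linear, so their product
  acquires no base factor.\<close>

lemma tau_expo_facts: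
  assumes i: "i \<in> {1..mu G}"
  shows "tau_expo i \<in> Q" "base_part (tau_expo i) = 0" "pl_lift G (fst (tau_expo i)) = (\<Sum>l\<in>tau_gens i. Poly_Mapping.single l 1)"
proof -
  have P: "A \<subseteq> tau_gens i \<Longrightarrow> (\<Sum>l\<in>A. zexp G l) \<in> Q \<and> base_part (\<Sum>l\<in>A. zexp G l) = 0 \<and>
      pl_lift G (fst (\<Sum>l\<in>A. zexp G l)) = (\<Sum>l\<in>A. Poly_Mapping.single l 1)" if "finite A" for A
    using that
  proof (induction A rule: finite_induct)
    case empty
    have b: "base_part 0 = 0" using base_part_base[OF Bs_zero] .
    show ?case by (simp add: zero_mem b)
  next
    case (insert l A)
    let ?x = "\<Sum>l\<in>A. zexp G l"
    have IH: "?x \<in> Q" "base_part ?x = 0" "pl_lift G (fst ?x) = (\<Sum>l\<in>A. Poly_Mapping.single l 1)" using insert by auto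
    have lt: "l \<in> tau_gens i" using insert by auto
    have lr: "l \<in> {1..nrays G}" by (rule subsetD[OF gens_subset lt])
    have sA: "insert l A \<subseteq> sigma_gens i" using insert tau_gens_subset by blast
    have k1: "supp (fst ?x) \<subseteq> sigma_gens i"
      unfolding IH(3) keys_sub_iff using sA insert(1) by (auto simp: lookup_sum lookup_single when_def)
    have k2: "supp (ray G l) \<subseteq> sigma_gens i" using sA by (simp add: ray_pl[OF lr])
    have p: "pl_lift G (fst ?x + ray G l) = pl_lift G (fst ?x) + pl_lift G (ray G l)"
      by (rule pl_lift_add[OF cone_seq_max[OF i] k1 k2])
    have c: "cocyc (fst ?x) (ray G l) = 0" by (simp add: cocyc_def p)
    have c': "cocyc (ray G l) (fst ?x) = 0" using p by (simp add: cocyc_def add.commute)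
    have e: "(\<Sum>l\<in>insert l A. zexp G l) = ?x + zexp G l" using insert by (simp add: add.commute)
    show ?case unfolding e
      using insert(1,2) IH p c c' zexp_Q[OF lr]
      by (simp add: add_mem base_part_add base_part_zexp fst_zexp ray_pl[OF lr] zero_prod[symmetric] add.commute)
  qed
  from P[OF finite_gens order_refl] show "tau_expo i \<in> Q" "base_part (tau_expo i) = 0" "pl_lift G (fst (tau_expo i)) = (\<Sum>l\<in>tau_gens i. Poly_Mapping.single l 1)"
    unfolding tau_expo_def by blast+
qed

lemma base_tau_expo:
  assumes i: "i \<in> {1..mu G}" and b: "b \<in> Bs"
  shows "b + tau_expo i \<in> Q" "base_part (b + tau_expo i) = b" "cone_index (fst (b + tau_expo i)) = i" "alpha (b + tau_expo i) l = 0"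
proof -
  show "b + tau_expo i \<in> Q" using b Bs_Q tau_expo_facts(1)[OF i] add_mem by blast
  have fb: "fst b = 0" using b by (auto simp: base_monoid_def)
  then have f: "fst (b + tau_expo i) = fst (tau_expo i)" by simp
  show "base_part (b + tau_expo i) = b"
    by (simp add: base_part_add tau_expo_facts(2)[OF i] base_part_base[OF b] fb zero_prod[symmetric])
  have lP: "lk (pl_lift G (fst (tau_expo i))) l = (if l \<in> tau_gens i then 1 else 0)" for l
    by (simp add: tau_expo_facts(3)[OF i] lookup_sum lookup_single when_def finite_gens)
  have s: "supp (fst (tau_expo i)) = tau_gens i" using lP by (auto simp: in_keys_iff split: if_splits)
  show id: "cone_index (fst (b + tau_expo i)) = i"
    unfolding f by (rule cone_index_eqI[OF i]) (use s tau_gens_subset in auto)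
  show "alpha (b + tau_expo i) l = 0" unfolding alpha_def id unfolding f lP by simp
qed

text \<open>Without excess the lift is the indicator of \<tau>_i. The lift determines m, and m
  together with the base part determines the exponent.\<close>

lemma excess_zero_decomp:
  assumes x: "x \<in> Q" and e: "kz.excess x = 0"
  shows "x = base_part x + tau_expo (cone_index (fst x))"
proof -
  let ?i = "cone_index (fst x)"
  have i: "?i \<in> {1..mu G}" using cone_index by blast
  have "alpha x l = 0" if "l \<in> sigma_gens ?i" for l
    using e kz.alpha_le_excess[OF x, of l] that by (simp add: cone_def)
  then have "lk (pl_lift G (fst x)) l = (if l \<in> tau_gens ?i then 1 else 0)" for l
  proof (cases "l \<in> sigma_gens ?i")
    case True
    then have "lk (pl_lift G (fst x)) l \<le> (if l \<in> tau_gens ?i then 1 else 0)"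
      using \<open>\<And>l. l \<in> sigma_gens ?i \<Longrightarrow> alpha x l = 0\<close>[of l] by (auto simp: alpha_def split: if_splits)
    moreover have "l \<in> tau_gens ?i \<Longrightarrow> lk (pl_lift G (fst x)) l \<noteq> 0" using tau_gens_supp[of "fst x"] by (auto simp: in_keys_iff)
    ultimately show ?thesis using pl_lift_nonneg[of "fst x" l] by (auto split: if_splits)
  next
    case False
    then have "l \<notin> supp (fst x)" "l \<notin> tau_gens ?i" using cone_index[of "fst x"] tau_gens_subset[of ?i] by blast+
    then show ?thesis by (simp add: in_keys_iff)
  qed
  then have "pl_lift G (fst x) = pl_lift G (fst (tau_expo ?i))"
    by (intro poly_mapping_eqI) (simp add: tau_expo_facts(3)[OF i] lookup_sum lookup_single when_def finite_gens)
  then have f: "fst x = fst (tau_expo ?i)" using ray_map_pl_lift by metis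
  have "fst (base_part x + tau_expo ?i) = fst x" using f by (cases x) (simp add: base_part_def)
  moreover have "base_part (base_part x + tau_expo ?i) = base_part x" by (rule base_tau_expo(2)[OF i base_part_Bs[OF x]])
  moreover have "y = z" if "fst y = fst z" "base_part y = base_part z" for y z :: "'n expo"
    using that by (cases y; cases z) (auto simp: base_part_def)
  ultimately show ?thesis by metis
qed

lemma excess_base_tau_expo: "i \<in> {1..mu G} \<Longrightarrow> b \<in> Bs \<Longrightarrow> kz.excess (b + tau_expo i) = 0"
  by (simp add: kz.excess_def base_tau_expo(4))

lemma is_form_basis_form: "i \<in> {1..mu G} \<Longrightarrow> kz.is_form (basis_form i)"
  unfolding kz.is_form_def basis_form_def using growth_mono1[OF tau_expo_facts(1)] growth_zero by (auto split: if_splits)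

lemma basis_form_top_form: "basis_form i = kz.top_form (\<lambda>j. if j = 0 then mono1 (tau_expo i) else (\<lambda>x. 0))"
  by (auto simp: basis_form_def kz.top_form_def fun_eq_iff)

lemma form_of_basis_form_ZZ: "i \<in> {1..mu G} \<Longrightarrow> form_of (basis_form i) \<in> E.ZZ"
proof -
  assume i: "i \<in> {1..mu G}"
  have "form_of (kz.twisted_D (basis_form i)) = form_of (\<lambda>j K x. 0)"
    by (subst form_of_eq_iff[OF kz.is_form_twisted_D[OF is_form_basis_form[OF i]] is_form_zero]) (auto simp: basis_form_top_form kz.twisted_D_top_form)
  then show ?thesis unfolding E.ZZ_def
    by (simp add: form_of_carrier[OF is_form_basis_form[OF i]] twisted_form_of[OF is_form_basis_form[OF i]] form_of_zero)
qed

definition coef :: "(nat \<Rightarrow> nat \<Rightarrow> 'n expo \<Rightarrow> complex) \<Rightarrow> nat \<Rightarrow> 'n expo \<Rightarrow> complex" where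
  "coef \<gamma> j x = (\<Sum>i\<in>{1..mu G}. conv Q (\<gamma> i j) (mono1 (tau_expo i)) x)"

lemma scalar_act_basis_form: "scalar_act \<gamma> (basis_form i) j K x = (if K = {1..nn} then conv Q (\<gamma> j) (mono1 (tau_expo i)) x else 0)"
proof -
  have "scalar_act \<gamma> (basis_form i) j K x = (\<Sum>t\<in>{..j}. if t = j then (if K = {1..nn} then conv Q (\<gamma> j) (mono1 (tau_expo i)) x else 0) else 0)"
    unfolding scalar_act_def by (rule sum.cong) (auto simp: basis_form_def conv_zero_right)
  then show ?thesis by simp
qed

lemma lincomb:
  assumes g: "\<And>i j. i \<in> {1..mu G} \<Longrightarrow> \<gamma> i j \<in> carrier base"
    and c: "\<And>i. i \<in> {1..mu G} \<Longrightarrow> c i = (\<lambda>j. base_class k (\<gamma> i j))"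
  shows "(\<Oplus>\<^bsub>forms G k\<^esub>i\<in>{1..mu G}. c i \<odot>\<^bsub>forms G k\<^esub> form_of (basis_form i)) = form_of (kz.top_form (coef \<gamma>))"
    and "kz.is_form (kz.top_form (coef \<gamma>))"
proof -
  have F: "kz.is_form (scalar_act (\<gamma> i) (basis_form i))" if "i \<in> {1..mu G}" for i
    using is_form_scalar_act[of "\<gamma> i" "basis_form i"] g[OF that] is_form_basis_form[OF that] by blast
  have "(\<Oplus>\<^bsub>forms G k\<^esub>i\<in>{1..mu G}. c i \<odot>\<^bsub>forms G k\<^esub> form_of (basis_form i)) = (\<Oplus>\<^bsub>forms G k\<^esub>i\<in>{1..mu G}. form_of (scalar_act (\<gamma> i) (basis_form i)))"
  proof (rule E.M.finsum_cong'[OF refl])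
    show "(\<lambda>i. form_of (scalar_act (\<gamma> i) (basis_form i))) \<in> {1..mu G} \<rightarrow> carrier (forms G k)" using F form_of_carrier by blast
    fix i assume i: "i \<in> {1..mu G}"
    show "c i \<odot>\<^bsub>forms G k\<^esub> form_of (basis_form i) = form_of (scalar_act (\<gamma> i) (basis_form i))"
      unfolding c[OF i] by (rule form_of_smult[OF g[OF i] is_form_basis_form[OF i]])
  qed
  also have "\<dots> = form_of (\<lambda>j K x. \<Sum>i\<in>{1..mu G}. scalar_act (\<gamma> i) (basis_form i) j K x)"
    by (rule form_of_finsum) (use F in auto)
  also have e: "(\<lambda>j K x. \<Sum>i\<in>{1..mu G}. scalar_act (\<gamma> i) (basis_form i) j K x) = kz.top_form (coef \<gamma>)"
    by (auto simp: scalar_act_basis_form kz.top_form_def coef_def fun_eq_iff)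
  finally show "(\<Oplus>\<^bsub>forms G k\<^esub>i\<in>{1..mu G}. c i \<odot>\<^bsub>forms G k\<^esub> form_of (basis_form i)) = form_of (kz.top_form (coef \<gamma>))" .
  have "kz.is_form (\<lambda>j K x. \<Sum>i\<in>{1..mu G}. scalar_act (\<gamma> i) (basis_form i) j K x)" by (rule is_form_sum) (rule F)
  then show "kz.is_form (kz.top_form (coef \<gamma>))" unfolding e .
qed

lemma conv_base_tau_expo:
  assumes g: "g \<in> carrier base" and i: "i \<in> {1..mu G}" and x: "x \<in> Q"
  shows "conv Q g (mono1 (tau_expo i)) x = (if cone_index (fst x) = i \<and> kz.excess x = 0 then g (base_part x) else 0)"
proof (cases "cone_index (fst x) = i \<and> kz.excess x = 0")
  case True
  then have d: "x = tau_expo i + base_part x" using excess_zero_decomp[OF x] by (metis add.commute)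
  have "conv Q (mono1 (tau_expo i)) g x = g (base_part x)"
    by (subst d) (rule conv_mono1[OF tau_expo_facts(1)[OF i] subsetD[OF Bs_Q base_part_Bs[OF x]]])
  then show ?thesis using True by (simp add: conv_comm[of g])
next
  case False
  have "conv Q (mono1 (tau_expo i)) g x = 0"
  proof (cases "\<exists>z. z \<in> Q \<and> x = tau_expo i + z")
    case True
    then obtain z where z: "z \<in> Q" "x = tau_expo i + z" by blast
    have "g z = 0"
    proof (rule ccontr)
      assume "g z \<noteq> 0"
      then have zB: "z \<in> Bs" using g by (auto simp: base_carrier)
      have "x = z + tau_expo i" using z(2) by (simp only: add.commute)
      then show False using False base_tau_expo(3)[OF i zB] excess_base_tau_expo[OF i zB] by simp
    qed
    then show ?thesis using conv_mono1[OF tau_expo_facts(1)[OF i] z(1), of g] z(2) by simp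
  qed (rule conv_mono1_out)
  then show ?thesis unfolding conv_comm[of g] using False by (simp only: if_False)
qed

text \<open>Exponents without excess correspond bijectively to pairs of a base exponent and an
  index, so at most one summand contributes at \<open>x\<close>. Scalars and coefficients of top
  forms thereby translate into each other.\<close>

lemma coef_eq:
  assumes g: "\<And>i j. i \<in> {1..mu G} \<Longrightarrow> \<gamma> i j \<in> carrier base" and x: "x \<in> Q"
  shows "coef \<gamma> j x = (if kz.excess x = 0 then \<gamma> (cone_index (fst x)) j (base_part x) else 0)"
proof -
  have "coef \<gamma> j x = (\<Sum>i\<in>{1..mu G}. if i = cone_index (fst x) then (if kz.excess x = 0 then \<gamma> (cone_index (fst x)) j (base_part x) else 0) else 0)"
    unfolding coef_def by (rule sum.cong[OF refl]) (use conv_base_tau_expo[OF g _ x] in auto)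
  then show ?thesis using cone_index[of "fst x"] by simp
qed

lemma in_S: "b \<in> Bs \<Longrightarrow> i \<in> {1..mu G} \<Longrightarrow> b + tau_expo i \<in> S \<longleftrightarrow> b \<notin> power_expos (Suc k)"
  using ext_base_part[OF base_tau_expo(1)] base_tau_expo(1,2) by (auto simp del: power_expos.simps)

lemma span_forms:
  assumes "z \<in> E.ZZ"
  shows "\<exists>c\<in>{1..mu G} \<rightarrow> carrier (base_k_u G k). E.cls z =
     E.cls (\<Oplus>\<^bsub>forms G k\<^esub>i\<in>{1..mu G}. c i \<odot>\<^bsub>forms G k\<^esub> form_of (basis_form i))"
proof -
  obtain w where w: "kz.is_form w" "z = form_of w" using assms form_of_surj unfolding E.ZZ_def by blast
  have "form_of (kz.twisted_D w) = form_of (\<lambda>j K x. 0)" using assms unfolding E.ZZ_def w(2) by (simp add: twisted_form_of[OF w(1)] form_of_zero)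
  then have zero: "kz.twisted_D w j K x = 0" if "K \<subseteq> {1..nn}" "x \<in> S" for j K x
    using form_of_eq_iff[OF kz.is_form_twisted_D[OF w(1)] is_form_zero] that by blast
  obtain c y where y: "kz.is_form y" and c: "\<And>j x. c j x \<noteq> 0 \<Longrightarrow> x \<in> S \<and> kz.excess x = 0"
    and e: "\<And>j K x. K \<subseteq> {1..nn} \<Longrightarrow> x \<in> S \<Longrightarrow> w j K x = kz.top_form c j K x + kz.twisted_D y j K x"
  proof (rule kz.exactness[OF w(1) zero])
    fix y c assume "kz.is_form y" "\<And>j x. c j x \<noteq> 0 \<Longrightarrow> x \<in> S \<and> kz.excess x = 0"
      "\<And>j K x. K \<subseteq> {1..nn} \<Longrightarrow> x \<in> S \<Longrightarrow> w j K x = kz.top_form c j K x + kz.twisted_D y j K x"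
    then show thesis by (rule that)
  qed
  \<comment> \<open>Reads the scalars off along \<open>b + tau_expo i\<close>. Only finitely many
    \<open>b\<close> lie outside the ideal, so the convergent coefficients yield elements of the
    polynomial base ring.\<close>
  define \<gamma> where "\<gamma> i j b = (if b \<in> Bs - power_expos (Suc k) then c j (b + tau_expo i) else 0)" for i j b
  have g: "\<gamma> i j \<in> carrier base" for i j
  proof -
    have sub: "{b. \<gamma> i j b \<noteq> 0} \<subseteq> Bs - power_expos (Suc k)" by (rule subsetI) (simp add: \<gamma>_def split: if_splits)
    then show ?thesis using finite_subset[OF sub finite_power_expos_compl] unfolding base_carrier by blast
  qed
  have co: "coef \<gamma> j x = c j x" if x: "x \<in> S" for j x
  proof (cases "kz.excess x = 0")
    case True
    have xQ: "x \<in> Q" using x by blast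
    have i: "cone_index (fst x) \<in> {1..mu G}" using cone_index by blast
    have "base_part x \<in> Bs - power_expos (Suc k)" using base_part_Bs[OF xQ] ext_base_part[OF xQ] x by blast
    then have "coef \<gamma> j x = c j (base_part x + tau_expo (cone_index (fst x)))" using True by (simp only: coef_eq[where \<gamma>=\<gamma>, OF g xQ] \<gamma>_def if_True refl)
    then show ?thesis using excess_zero_decomp[OF xQ True] by simp
  next
    case False
    then show ?thesis using coef_eq[of \<gamma> x j, OF g] x c[of j x] by auto
  qed
  let ?c = "\<lambda>i j. base_class k (\<gamma> i j)"
  note lc = lincomb[of \<gamma> ?c, OF g refl]
  have "form_of w = form_of (\<lambda>j K x. kz.top_form (coef \<gamma>) j K x + kz.twisted_D y j K x)"
  proof (subst form_of_eq_iff[OF w(1) is_form_add[OF lc(2) kz.is_form_twisted_D[OF y]]], intro allI impI)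
    fix j K x assume "K \<subseteq> {1..nn}" "x \<in> S"
    then show "w j K x = kz.top_form (coef \<gamma>) j K x + kz.twisted_D y j K x" using e co by (simp add: kz.top_form_def)
  qed
  also have "\<dots> = form_of (kz.top_form (coef \<gamma>)) \<oplus>\<^bsub>forms G k\<^esub> twisted_d G k (form_of y)"
    by (simp only: twisted_form_of[OF y] form_of_add[OF lc(2) kz.is_form_twisted_D[OF y]])
  finally have "E.cls z = E.cls (form_of (kz.top_form (coef \<gamma>)))"
    unfolding w(2) using E.cls_shift[OF form_of_carrier[OF lc(2)] form_of_carrier[OF y]] by simp
  moreover have "?c \<in> {1..mu G} \<rightarrow> carrier (base_k_u G k)" by (rule Pi_I, rule scalar_mem, rule g)
  ultimately show ?thesis using lc(1) by (intro bexI[of _ ?c]) simp_all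
qed

lemma indep_forms:
  assumes c: "c \<in> {1..mu G} \<rightarrow> carrier (base_k_u G k)"
    and B: "(\<Oplus>\<^bsub>forms G k\<^esub>i\<in>{1..mu G}. c i \<odot>\<^bsub>forms G k\<^esub> form_of (basis_form i)) \<in> E.BB" and i: "i \<in> {1..mu G}"
  shows "c i = \<zero>\<^bsub>base_k_u G k\<^esub>"
proof -
  have "\<forall>i\<in>{1..mu G}. \<exists>\<gamma>. (\<forall>j. \<gamma> j \<in> carrier base) \<and> c i = (\<lambda>j. base_class k (\<gamma> j))"
  proof
    fix i assume "i \<in> {1..mu G}"
    with c have "c i \<in> carrier (base_k_u G k)" by (rule Pi_mem)
    then obtain \<gamma> where "\<And>j. \<gamma> j \<in> carrier base" "c i = (\<lambda>j. base_class k (\<gamma> j))" by (rule scalar_rep) blast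
    then show "\<exists>\<gamma>. (\<forall>j. \<gamma> j \<in> carrier base) \<and> c i = (\<lambda>j. base_class k (\<gamma> j))" by blast
  qed
  from bchoice[OF this] obtain \<gamma> where \<gamma>: "\<forall>i\<in>{1..mu G}. (\<forall>j. \<gamma> i j \<in> carrier base) \<and> c i = (\<lambda>j. base_class k (\<gamma> i j))"
    by (elim exE)
  have g: "\<gamma> i j \<in> carrier base" if "i \<in> {1..mu G}" for i j by (rule spec[OF conjunct1[OF bspec[OF \<gamma> that]]])
  have cg: "c i = (\<lambda>j. base_class k (\<gamma> i j))" if "i \<in> {1..mu G}" for i by (rule conjunct2[OF bspec[OF \<gamma> that]])
  have lc: "(\<Oplus>\<^bsub>forms G k\<^esub>i\<in>{1..mu G}. c i \<odot>\<^bsub>forms G k\<^esub> form_of (basis_form i)) = form_of (kz.top_form (coef \<gamma>))"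
    by (rule lincomb(1)[OF g cg])
  have lF: "kz.is_form (kz.top_form (coef \<gamma>))" by (rule lincomb(2)[OF g cg])
  obtain y0 where y0: "y0 \<in> carrier (forms G k)" "form_of (kz.top_form (coef \<gamma>)) = twisted_d G k y0"
    using B unfolding lc E.BB_def by (elim imageE) (rule that)
  obtain y where y: "kz.is_form y" "y0 = form_of y" using y0(1) by (rule form_of_surj)
  have eq: "kz.top_form (coef \<gamma>) j K x = kz.twisted_D y j K x" if "K \<subseteq> {1..nn}" "x \<in> S" for j K x
    using y0(2) that form_of_eq_iff[OF lF kz.is_form_twisted_D[OF y(1)]] unfolding y(2) twisted_form_of[OF y(1)] by blast
  \<comment> \<open>\<open>independence\<close> asks for coefficients supported on \<open>S\<close>;
    the values cut off lie in the extended ideal.\<close>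
  define C where "C j x = (if x \<in> S then coef \<gamma> j x else 0)" for j x
  have "C j x = 0" for j x
  proof (rule kz.independence)
    show "x \<in> S \<and> kz.excess x = 0" if "C j x \<noteq> 0" for j x
      using that coef_eq[of \<gamma> x j, OF g] by (auto simp: C_def split: if_splits)
    show "kz.top_form C j K x = kz.twisted_D y j K x" if "K \<subseteq> {1..nn}" "x \<in> S" for j K x
      using eq[OF that, of j] that(2) by (auto simp: kz.top_form_def C_def split: if_splits)
  qed
  have "\<gamma> i j b = 0" if b: "b \<in> Bs - power_expos (Suc k)" for j b
  proof -
    have bB: "b \<in> Bs" and xS: "b + tau_expo i \<in> S" using b in_S[OF _ i] by blast+
    have "coef \<gamma> j (b + tau_expo i) = 0" using \<open>\<And>j x. C j x = 0\<close>[of j "b + tau_expo i"] xS by (simp add: C_def)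
    then show ?thesis
      using coef_eq[where \<gamma>=\<gamma>, OF g base_tau_expo(1)[OF i bB], of j] excess_base_tau_expo[OF i bB] base_tau_expo(2,3)[OF i bB] by simp
  qed
  then have "base_class k (\<gamma> i j) = \<zero>\<^bsub>base_k G k\<^esub>" for j using base_class_eq_zero[OF g[OF i]] by blast
  then show ?thesis unfolding cg[OF i] by (auto simp: ps_simps fun_eq_iff)
qed

text \<open>The only nonzero coefficient is a monomial at u^0 in top degree, where the contributions
  of u and of the form degree vanish; zero coefficients impose no condition.\<close>

lemma homogeneous_basis_form: "i \<in> {1..mu G} \<Longrightarrow> homogeneous_form G (expo_weight G (tau_expo i)) (form_of (basis_form i))"
  unfolding homogeneous_form_def nn_def[symmetric]
proof (intro allI impI)
  fix j K assume i: "i \<in> {1..mu G}" and K: "K \<subseteq> {1..nn}"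
  have "basis_form i j K \<in> form_of (basis_form i) j K"
    using K fun_class_mem[OF is_form_growth[OF is_form_basis_form[OF i] K], of "basis_form i j K" k j] is_form_growth[OF is_form_basis_form[OF i] K, of j] by (simp add: form_of_def)
  moreover have "\<forall>x. basis_form i j K x \<noteq> 0 \<longrightarrow> expo_weight G x + 2 * int j + 2 * (int nn - int (card K)) = expo_weight G (tau_expo i)"
    by (auto simp: basis_form_def mono1_def)
  ultimately show "\<exists>c\<in>form_of (basis_form i) j K. \<forall>x. c x \<noteq> 0 \<longrightarrow> expo_weight G x + 2 * int j + 2 * (int nn - int (card K)) = expo_weight G (tau_expo i)"
    by blast
qed

theorem graded_free_hypercohomology:
  "graded_free (base_k_u G k) (hypercohomology G k) (homogeneous_classes G k)"
  unfolding graded_free_def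
proof (intro conjI exI)
  show "Module.module (base_k_u G k) (hypercohomology G k)"
    unfolding hypercohomology_def by (rule E.module_HH)
  let ?B = "(\<lambda>i. E.cls (form_of (basis_form i))) ` {1..mu G}"
  show "module_basis (base_k_u G k) (hypercohomology G k) ?B"
    unfolding hypercohomology_def
  proof (rule E.cohomology_basis[where w = "\<lambda>i. form_of (basis_form i)" and I = "{1..mu G}"])
    show "(\<lambda>i. form_of (basis_form i)) \<in> {1..mu G} \<rightarrow> E.ZZ" using form_of_basis_form_ZZ by blast
  qed (rule finite_atLeastAtMost one_ne_zero span_forms indep_forms; assumption?)+
  show "?B \<subseteq> homogeneous_classes G k"
  proof (rule image_subsetI)
    fix i assume i: "i \<in> {1..mu G}"
    have "E.cls (form_of (basis_form i)) \<in> carrier (hypercohomology G k)"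
      unfolding hypercohomology_def E.HH_carrier using form_of_basis_form_ZZ[OF i] by blast
    moreover have "form_of (basis_form i) \<in> E.cls (form_of (basis_form i))" by (rule E.cls_self[OF form_of_carrier[OF is_form_basis_form[OF i]]])
    ultimately show "E.cls (form_of (basis_form i)) \<in> homogeneous_classes G k"
      unfolding homogeneous_classes_def using homogeneous_basis_form[OF i] by blast
  qed
qed

end

theorem theorem3p1:
  fixes G :: "('n::finite) lg_data" and k :: nat
  assumes "smooth_fan (fan G)" and "complete_fan (fan G)"
    and "ray_generators G" and "projective_fan G"
    and "first_rays_basis G" and "dual_basis G"
    and "cone_ordering G" and "monomial_numbering G"
    and "is_splitting G"
  shows "graded_free (base_k_u G k) (hypercohomology G k) (homogeneous_classes G k)"
proof -
  interpret toric_k G k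
    by (intro toric_k.intro toric.intro assms(1-7,9))
  show ?thesis by (rule graded_free_hypercohomology)
qed

end
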